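(* Let $\Omega=(0,1)^3$, let $s\in(0,1)$, let $\sigma\in(0,1)$, and let $f$ be analytic in $\overline{\Omega}$. Let $u\in\widetilde H^s(\Omega)$ be the weak solution of the Dirichlet integral fractional Laplace problem, i.e. $a(u,v)=\langle f,v\rangle_{L^2(\Omega)}$ for all $v\in\widetilde H^s(\Omega)$. For $L\in\mathbb{N}$ and a polynomial degree $q\in\mathbb{N}$ with $q\sim L$ (i.e. $c_1L\le q\le c_2 L$ for fixed constants $0<c_1\le c_2$), let $V_N:=W^L_q=\mathcal{S}^q_0(\Omega,\mathcal{T}^L_{\mathrm{geo},\sigma})$, $N:=\dim W^L_q$ (so that $L\sim q\sim N^{1/6}$), and let $u_N\in V_N$ be the Galerkin approximation, $a(u_N,v)=\langle f,v\rangle_{L^2(\Omega)}$ for all $v\in V_N$. Then there exist constants $b,C>0$ (depending on $\Omega$, $f$, $s$, and the fixed parameters $\sigma,c_1,c_2$, but not on $L$ or $N$) such that $$\|u-u_N\|_{\widetilde H^s(\Omega)}\le C\exp(-b\sqrt[6]{N}).$$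
   Context: For $t\in(0,1)$ and open $\omega\subset\mathbb{R}^3$: $|v|_{H^t(\omega)}^2=\int_\omega\int_\omega \frac{|v(x)-v(z)|^2}{|x-z|^{3+2t}}\,dz\,dx$, $\|v\|_{H^t(\omega)}^2=\|v\|_{L^2(\omega)}^2+|v|_{H^t(\omega)}^2$. $\widetilde H^t(\Omega)=\{u\in H^t(\mathbb{R}^3): u\equiv 0 \text{ on }\mathbb{R}^3\setminus\overline\Omega\}$ with norm $\|v\|_{\widetilde H^t(\Omega)}^2=\|v\|_{H^t(\Omega)}^2+\|v/r_{\partial\Omega}^t\|_{L^2(\Omega)}^2$, where $r_{\partial\Omega}(x)=\operatorname{dist}(x,\partial\Omega)$. The bilinear form is $a(u,v)=\frac{C(s)}{2}\int_{\mathbb{R}^3}\int_{\mathbb{R}^3}\frac{(u(x)-u(z))(v(x)-v(z))}{|x-z|^{3+2s}}\,dz\,dx$ with $C(s)=-2^{2s}\frac{\Gamma(s+3/2)}{\pi^{3/2}\Gamma(-s)}$; it is continuous and coercive on $\widetilde H^s(\Omega)$. Geometric mesh: for $L\ge1$ define nodes in $[0,1]$: $x_0=0$, $x_i=\sigma^{L-i}/2$ for $i=1,\dots,L$, $x_i=1-\sigma^{i-L}/2$ for $i=L+1,\dots,2L$, $x_{2L+1}=1$; $\mathcal{T}^L_{\mathrm{geo},\sigma}$ is the tensor-product mesh of $(0,1)^3$ into axis-parallel boxes $K=(x_i,x_{i+1})\times(x_j,x_{j+1})\times(x_k,x_{k+1})$, each the image of the reference cube $\widehat K=(0,1)^3$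 under an affine map $F_K$ with diagonal Jacobian. $\mathcal{S}^q_0(\Omega,\mathcal{T}^L_{\mathrm{geo},\sigma})=\{v\in C(\overline\Omega): v|_K\circ F_K\in\mathbb{Q}_q(\widehat K)\ \forall K,\ v|_{\partial\Omega}=0\}$, where $\mathbb{Q}_q=\mathbb{P}_q^{\otimes 3}$ is the space of polynomials of degree $\le q$ in each variable; $\dim W^L_q=O(q^3L^3)$. *)

theory Defs
  imports "HOL-Analysis.Analysis" "HOL-Library.Function_Algebras"
begin

type_synonym R3 = "real ^ 3"

definition Omega :: "R3 set" where
  "Omega = {x. \<forall>i. 0 < x $ i \<and> x $ i < 1}"

definition gagliardo_sq :: "real \<Rightarrow> R3 set \<Rightarrow> (R3 \<Rightarrow> real) \<Rightarrow> ennreal" where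
  "gagliardo_sq t \<omega> v =
     (\<integral>\<^sup>+ x. indicator \<omega> x * (\<integral>\<^sup>+ z. indicator \<omega> z *
        ennreal ((v x - v z)\<^sup>2 / norm (x - z) powr (3 + 2 * t)) \<partial>lborel) \<partial>lborel)"

definition L2_sq :: "R3 set \<Rightarrow> (R3 \<Rightarrow> real) \<Rightarrow> ennreal" where
  "L2_sq \<omega> v = (\<integral>\<^sup>+ x. indicator \<omega> x * ennreal ((v x)\<^sup>2) \<partial>lborel)"

definition Htilde :: "real \<Rightarrow> R3 set \<Rightarrow> (R3 \<Rightarrow> real) set" where
  "Htilde t \<Omega> = {u. u \<in> borel_measurable lborel
                     \<and> L2_sq UNIV u < \<infinity> \<and> gagliardo_sq t UNIV u < \<infinity>
                     \<and> (\<forall>x. x \<notin> closure \<Omega> \<longrightarrow> u x = 0)}"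

definition Htilde_norm_sq :: "real \<Rightarrow> R3 set \<Rightarrow> (R3 \<Rightarrow> real) \<Rightarrow> ennreal" where
  "Htilde_norm_sq t \<Omega> v =
     L2_sq \<Omega> v + gagliardo_sq t \<Omega> v
     + L2_sq \<Omega> (\<lambda>x. v x / infdist x (frontier \<Omega>) powr t)"

definition Cconst :: "real \<Rightarrow> real" where
  "Cconst s = - (2 powr (2 * s)) * Gamma (s + 3 / 2) / (pi powr (3 / 2) * Gamma (- s))"

definition bform :: "real \<Rightarrow> (R3 \<Rightarrow> real) \<Rightarrow> (R3 \<Rightarrow> real) \<Rightarrow> real" where
  "bform s u v = Cconst s / 2 *
     (\<integral>x. (\<integral>z. (u x - u z) * (v x - v z) / norm (x - z) powr (3 + 2 * s) \<partial>lborel) \<partial>lborel)"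

definition L2_inner :: "R3 set \<Rightarrow> (R3 \<Rightarrow> real) \<Rightarrow> (R3 \<Rightarrow> real) \<Rightarrow> real" where
  "L2_inner \<Omega> f v = (LINT x:\<Omega>|lborel. f x * v x)"

definition real_analytic_on :: "(R3 \<Rightarrow> real) \<Rightarrow> R3 set \<Rightarrow> bool" where
  "real_analytic_on f S \<longleftrightarrow> (\<forall>x\<in>S. \<exists>r>0. \<exists>c :: nat \<Rightarrow> nat \<Rightarrow> nat \<Rightarrow> real.
      \<forall>y\<in>ball x r. ((\<lambda>(a, b, k). c a b k * (y $ 1 - x $ 1) ^ a * (y $ 2 - x $ 2) ^ b
                                  * (y $ 3 - x $ 3) ^ k) has_sum f y) UNIV)"

definition analytic_on_closure :: "(R3 \<Rightarrow> real) \<Rightarrow> R3 set \<Rightarrow> bool" where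
  "analytic_on_closure f \<Omega> \<longleftrightarrow> (\<exists>U. open U \<and> closure \<Omega> \<subseteq> U \<and> real_analytic_on f U)"

text \<open>Geometric mesh nodes x_0,...,x_{2L+1} in [0,1].\<close>
definition geo_node :: "real \<Rightarrow> nat \<Rightarrow> nat \<Rightarrow> real" where
  "geo_node \<sigma> L i =
     (if i = 0 then 0
      else if i \<le> L then \<sigma> ^ (L - i) / 2
      else if i \<le> 2 * L then 1 - \<sigma> ^ (i - L) / 2
      else 1)"

text \<open>Element K of the tensor mesh indexed by idx (idx d < 2L+1 for each direction d).\<close>
definition geo_elem :: "real \<Rightarrow> nat \<Rightarrow> (3 \<Rightarrow> nat) \<Rightarrow> R3 set" where
  "geo_elem \<sigma> L idx = {x. \<forall>d. geo_node \<sigma> L (idx d) < x $ d \<and> x $ d < geo_node \<sigma> L (Suc (idx d))}"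

definition geo_map :: "real \<Rightarrow> nat \<Rightarrow> (3 \<Rightarrow> nat) \<Rightarrow> R3 \<Rightarrow> R3" where
  "geo_map \<sigma> L idx \<xi> = (\<chi> d. geo_node \<sigma> L (idx d)
       + (geo_node \<sigma> L (Suc (idx d)) - geo_node \<sigma> L (idx d)) * \<xi> $ d)"

definition ref_cube :: "R3 set" where
  "ref_cube = {\<xi>. \<forall>d. 0 < \<xi> $ d \<and> \<xi> $ d < 1}"

definition in_Qq :: "nat \<Rightarrow> (R3 \<Rightarrow> real) \<Rightarrow> bool" where
  "in_Qq q p \<longleftrightarrow> (\<exists>c :: nat \<Rightarrow> nat \<Rightarrow> nat \<Rightarrow> real. \<forall>\<xi>\<in>ref_cube.
      p \<xi> = (\<Sum>a\<le>q. \<Sum>b\<le>q. \<Sum>k\<le>q. c a b k * (\<xi> $ 1) ^ a * (\<xi> $ 2) ^ b * (\<xi> $ 3) ^ k))"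

definition Sq0 :: "real \<Rightarrow> nat \<Rightarrow> nat \<Rightarrow> (R3 \<Rightarrow> real) set" where
  "Sq0 \<sigma> L q = {v. continuous_on (closure Omega) v
       \<and> (\<forall>x\<in>frontier Omega. v x = 0)
       \<and> (\<forall>x. x \<notin> closure Omega \<longrightarrow> v x = 0)
       \<and> (\<forall>idx. (\<forall>d. idx d < 2 * L + 1) \<longrightarrow> in_Qq q (v \<circ> geo_map \<sigma> L idx))}"

definition fun_dim :: "(R3 \<Rightarrow> real) set \<Rightarrow> nat" where
  "fun_dim V = vector_space.dim (\<lambda>c (v :: R3 \<Rightarrow> real) x. c * v x) V"

end

theory Submission
  imports Defs "HOL-Complex_Analysis.Complex_Analysis"
begin

text \<open>
By quasi-optimality (Cea) it suffices to construct one exponentially accurate function of the discrete space,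
and no weighted regularity theory is needed for this. Three facts about the solution are used.

\<^item> Boundary layer: the rescaling of the solution to the cube shrunk by \<open>h\<close> towards the centre has no larger
 energy, so testing the weak form shows that it differs from the solution by \<open>O(sqrt h)\<close> in energy. With a
 cut-off (a multiplier of the energy space by Hardy's inequality) the layer of width \<open>h\<close> costs only \<open>O(sqrt h)\<close>.

\<^item> Analyticity along a flow: the flow of the fields \<open>x_i (1 - x_i) d/dx_i\<close> maps the cube onto itself, hence acts
 on the energy space, and transports the bilinear form and the right-hand side analytically in the flow
 parameter. Testing the equation of the \<open>k\<close>-th finite difference with itself bounds it by \<open>C A^k k! h^k\<close>.

\<^item> Gaussian mollification in the flow parameter with width \<open>k\<close> changes the solution by \<open>O(k)\<close> in energy and makes it
 entire in each variable \<open>ln (x_i / (1 - x_i))\<close>, with bounds on a fixed strip that are polynomial in \<open>1 / k\<close> and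
 in the inverse of the distance to the boundary.

A cell of the geometric mesh away from the boundary has a complex neighbourhood of size comparable to its own that
is mapped into this strip, so tensorised Chebyshev interpolation, corrected to be exact at the end points,
converges exponentially there. Cutting off at the mesh line at distance \<open>sigma^p / 2\<close> with \<open>p\<close> a small
multiple of \<open>L\<close> balances all contributions.
\<close>


text \<open>The obstacle is a gap between norms: analyticity along the flow is available only in
  energy, while interpolation needs point values on complex neighbourhoods of cells. The Gaussian
  supplies point values, but a complex shift of height y costs exp (const * y^2 / k^2) if the shift
  is charged to the Gaussian, which is useless since k is a power of sigma^p. In
  \<open>uk_ext_bound\<close> the differences in the flow parameter therefore fall on the solution:
  they fix a strip whose height does not depend on k, and the Gaussian costs only powers of 1 / k.
  Forward differences stand in for derivatives along the flow, because flowing the solution always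
  stays in the energy space whereas its differentiability is not known beforehand. The interpolation
  error is never differentiated. A sup bound S and a Lipschitz bound M give energy of order S^(1-s)
  M^s, so an M that grows algebraically in the cell sizes is harmless once S is exponentially
  small.\<close>

section \<open>Cauchy-Schwarz and the mass of the truncated kernel\<close>

lemma integral_Cauchy_Schwarz:
 fixes f g :: "'a => real"
 assumes [measurable]: "f \<in> borel_measurable M" "g \<in> borel_measurable M"
  and f2: "integrable M (%x. (f x)\<^sup>2)" and g2: "integrable M (%x. (g x)\<^sup>2)"
 shows "integrable M (%x. f x * g x)"
  and "\<bar>\<integral>x. f x * g x \<partial>M\<bar> <= sqrt (\<integral>x. (f x)\<^sup>2 \<partial>M) * sqrt (\<integral>x. (g x)\<^sup>2 \<partial>M)"
proof -
 have ineq: "\<bar>a * b\<bar> <= a\<^sup>2 + b\<^sup>2" for a b :: real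
 proof -
  have "2 * (\<bar>a\<bar> * \<bar>b\<bar>) <= a\<^sup>2 + b\<^sup>2" using sum_squares_bound[of "\<bar>a\<bar>" "\<bar>b\<bar>"] by (simp add: mult.assoc)
  moreover have "0 <= \<bar>a\<bar> * \<bar>b\<bar>" by simp
  ultimately show ?thesis unfolding abs_mult by linarith
 qed
 show int: "integrable M (%x. f x * g x)"
  by (rule Bochner_Integration.integrable_bound[OF Bochner_Integration.integrable_add[OF f2 g2]])
    (auto intro!: AE_I2 simp: ineq)
 define A B C where "A = (\<integral>x. (f x)\<^sup>2 \<partial>M)" and "B = (\<integral>x. (g x)\<^sup>2 \<partial>M)" and "C = (\<integral>x. f x * g x \<partial>M)"
 have A0: "A \<ge> 0" and B0: "B \<ge> 0" by (auto simp: A_def B_def)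
 have q: "0 <= A + 2 * t * C + t\<^sup>2 * B" for t
 proof -
  have "0 <= (\<integral>x. (f x + t * g x)\<^sup>2 \<partial>M)" by simp
  also have "(%x. (f x + t * g x)\<^sup>2) = (%x. (f x)\<^sup>2 + 2 * t * (f x * g x) + t\<^sup>2 * (g x)\<^sup>2)"
   by (auto simp: fun_eq_iff power2_eq_square algebra_simps)
  also have "(\<integral>x. ((f x)\<^sup>2 + 2 * t * (f x * g x) + t\<^sup>2 * (g x)\<^sup>2) \<partial>M) = A + 2 * t * C + t\<^sup>2 * B"
   using int f2 g2 by (simp add: A_def B_def C_def)
  finally show ?thesis .
 qed
 have "C\<^sup>2 <= A * B"
 proof (cases "B = 0")
  case True
  have "C = 0"
  proof (rule ccontr)
   assume "C \<noteq> 0"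
   then show False using q[of "- (A + 1) / (2 * C)"] True by (simp add: field_simps)
  qed
  then show ?thesis using True by simp
 next
  case False
  then have "B > 0" using B0 by simp
  then show ?thesis using q[of "- C / B"] by (simp add: field_simps power2_eq_square)
 qed
 then have "sqrt (C\<^sup>2) <= sqrt (A * B)" by (rule real_sqrt_le_mono)
 then show "\<bar>\<integral>x. f x * g x \<partial>M\<bar> <= sqrt (\<integral>x. (f x)\<^sup>2 \<partial>M) * sqrt (\<integral>x. (g x)\<^sup>2 \<partial>M)"
  by (simp add: A_def B_def C_def real_sqrt_mult)
qed

definition kern :: "real => R3 => R3 => real" where
 "kern s x z = 1 / norm (x - z) powr (3 + 2 * s)"

lemma kern_nonneg [simp]: "0 <= kern s x z"
 by (simp add: kern_def)

lemma kern_commute: "kern s x z = kern s z x"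
 by (simp add: kern_def norm_minus_commute)

lemma measurable_kern [measurable (raw)]:
 assumes [measurable]: "f \<in> M \<rightarrow>\<^sub>M borel" "g \<in> M \<rightarrow>\<^sub>M borel"
 shows "(%p. kern s (f p) (g p)) \<in> borel_measurable M"
 unfolding kern_def by measurable

text \<open>A function with sup norm and Lipschitz constant of order 1 has squared increments of
  order \<open>min 1 ((norm y)^2)\<close>. The mass of the kernel against this profile is the
  constant behind \<open>gagliardo_multiplier\<close> and \<open>gagliardo_Lipschitz\<close>, and
  its integrand serves again as an integrable majorant in \<open>gauss_nn_finite\<close>.\<close>

definition kern_const :: "real => ennreal" where
 "kern_const s = (\<integral>\<^sup>+y. ennreal (min 1 ((norm (y::R3))\<^sup>2) / norm y powr (3 + 2 * s)) \<partial>lborel)"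

lemma nn_integral_affine_R3:
 fixes t :: R3 and c :: real
 assumes c: "c \<noteq> 0" and [measurable]: "F \<in> borel_measurable borel"
 shows "(\<integral>\<^sup>+x. F x \<partial>lborel) = (\<integral>\<^sup>+x. ennreal (\<bar>c\<bar>^3) * F (t + c *\<^sub>R x) \<partial>lborel)"
 by (subst lborel_affine[OF c, of t]) (simp add: nn_integral_density nn_integral_distr ennreal_power)

text \<open>Dyadic balls replace polar coordinates. The contributions at radius 2^n have ratio
  2^(-2s), summable because s > 0; those at radius 2^(-n) have ratio 2^(-(2-2s)), summable because s
  < 1.\<close>

lemma kern_const_finite:
 assumes s: "0 < s" "s < 1"
 shows "kern_const s < \<infinity>"
proof -
 define v where "v = unit_ball_vol (real DIM(R3))"
 have v0: "v \<ge> 0" by (simp add: v_def)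
 define a where "a n = v * (2 ^ Suc n)^3 * (2 ^ n) powr (-(3 + 2 * s))" for n :: nat
 define b where "b n = v * ((1/2) ^ n)^3 * ((1/2) ^ Suc n) powr (-(1 + 2 * s))" for n :: nat
 have p2: "(2::real) ^ n = 2 powr n" for n by (simp add: powr_realpow)
 have p3: "(1/2::real) ^ n = 2 powr (-real n)" for n
  by (simp add: powr_minus powr_realpow power_one_over field_simps)
 have a_eq: "a n = v * 8 * (2 powr (- 2 * s)) ^ n" for n
 proof -
  have "(2 ^ Suc n)^3 = (8::real) * 2 powr (3 * real n)"
   by (simp add: power_mult_distrib powr_realpow[symmetric] powr_powr power_mult[symmetric] mult.commute)
  moreover have "(2 ^ n) powr (-(3 + 2 * s)) = 2 powr (- (3 + 2 * s) * real n)"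
   by (simp add: p2 powr_powr mult.commute)
  moreover have "(2 powr (- 2 * s)) ^ n = 2 powr (- 2 * s * real n)"
   by (simp add: powr_realpow[symmetric] powr_powr)
  moreover have "2 powr (3 * real n) * 2 powr (- (3 + 2 * s) * real n) = 2 powr (- 2 * s * real n)"
   unfolding powr_add[symmetric] by (rule arg_cong[where f = "%x. 2 powr x"]) (simp add: algebra_simps)
  ultimately show ?thesis unfolding a_def by (metis mult.assoc)
 qed
 have b_eq: "b n = v * 2 powr (1 + 2 * s) * (2 powr (- (2 - 2 * s))) ^ n" for n
 proof -
  have "((1/2) ^ n)^3 = 2 powr (- 3 * real n)"
   by (simp add: p3 powr_realpow[symmetric] powr_powr mult.commute del: powr_numeral)
  moreover have "((1/2) ^ Suc n) powr (-(1 + 2 * s)) = 2 powr ((1 + 2 * s) * (1 + real n))"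
   unfolding p3 powr_powr by (rule arg_cong[where f = "%x. 2 powr x"]) (simp add: algebra_simps)
  moreover have "(2 powr (- (2 - 2 * s))) ^ n = 2 powr (- (2 - 2 * s) * real n)"
   by (simp add: powr_realpow[symmetric] powr_powr)
  moreover have "2 powr (- 3 * real n) * 2 powr ((1 + 2 * s) * (1 + real n)) = 2 powr (1 + 2 * s) * 2 powr (- (2 - 2 * s) * real n)"
   unfolding powr_add[symmetric] by (rule arg_cong[where f = "%x. 2 powr x"]) (simp add: algebra_simps)
  ultimately show ?thesis unfolding b_def by (metis mult.assoc)
 qed
 have "summable a" unfolding a_eq[abs_def]
  by (intro summable_mult summable_geometric) (use s in \<open>auto simp: powr_less_one\<close>)
 moreover have "summable b" unfolding b_eq[abs_def]
  by (intro summable_mult summable_geometric) (use s in \<open>auto simp: powr_less_one\<close>)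
 moreover have "a n \<ge> 0" "b n \<ge> 0" for n using v0 by (auto simp: a_def b_def)
 ultimately have fin: "(\<Sum>n. ennreal (a n)) < \<infinity>" "(\<Sum>n. ennreal (b n)) < \<infinity>"
  by (auto simp: suminf_ennreal2 less_top[symmetric])
 define fa where "fa n y = ennreal ((2 ^ n) powr (-(3 + 2 * s))) * indicator (ball (0::R3) (2 ^ Suc n)) y" for n :: nat and y
 define fb where "fb n y = ennreal (((1/2) ^ Suc n) powr (-(1 + 2 * s))) * indicator (ball (0::R3) ((1/2) ^ n)) y" for n :: nat and y
 have le: "ennreal (min 1 ((norm y)\<^sup>2) / norm y powr (3 + 2 * s)) <= (\<Sum>n. fa n y) + (\<Sum>n. fb n y)" for y
 proof (cases "norm y \<ge> 1")
  case True
  define n where "n = nat \<lfloor>log 2 (norm y)\<rfloor>"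
  have l0: "log 2 (norm y) \<ge> 0" using True by (subst zero_le_log_cancel_iff) auto
  have n1: "real n <= log 2 (norm y)" "log 2 (norm y) < real n + 1"
   using l0 unfolding n_def by linarith+
  have "2 powr real n <= norm y" "norm y < 2 powr (real n + 1)"
   using n1 less_le_trans[OF zero_less_one True] by (simp_all add: le_log_iff log_less_iff)
  then have n2: "2 ^ n <= norm y" "norm y < 2 ^ Suc n"
   by (simp_all add: powr_realpow powr_add mult.commute)
  have "min 1 ((norm y)\<^sup>2) / norm y powr (3 + 2 * s) <= norm y powr (-(3 + 2 * s))"
   unfolding powr_minus_divide by (intro divide_right_mono) auto
  also have "... <= (2 ^ n) powr (-(3 + 2 * s))"
   using n2 s by (intro powr_mono2') auto
  finally have "ennreal (min 1 ((norm y)\<^sup>2) / norm y powr (3 + 2 * s)) <= fa n y"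
   using n2 by (simp add: fa_def ennreal_leI)
  also have "... <= (\<Sum>n. fa n y)"
   using sum_le_suminf[of "%n. fa n y" "{n}"] by simp
  also have "... <= (\<Sum>n. fa n y) + (\<Sum>n. fb n y)" by simp
  finally show ?thesis .
 next
  case False
  show ?thesis
  proof (cases "y = 0")
   case False
   then have y0: "norm y > 0" by simp
   define n where "n = nat \<lfloor>- log 2 (norm y)\<rfloor>"
   have l0: "- log 2 (norm y) \<ge> 0" using \<open>\<not> 1 <= norm y\<close> y0 by simp
   have n1: "real n <= - log 2 (norm y)" "- log 2 (norm y) < real n + 1"
    using l0 unfolding n_def by linarith+
   have "norm y <= 2 powr (- real n)" "2 powr (- (real n + 1)) < norm y"
    using n1 y0 by (simp_all add: log_le_iff[symmetric] less_log_iff[symmetric])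
   then have n2: "norm y <= (1/2) ^ n" "(1/2) ^ Suc n < norm y"
    unfolding p3 by (simp_all add: algebra_simps)
   \<comment> \<open>The floor gives a shell closed at its outer radius, but the balls in
     \<open>fb\<close> are open: a norm equal to \<open>(1/2)^n\<close> belongs to the previous
     index.\<close>
   have "\<exists>k. (1/2)^Suc k <= norm y \<and> norm y < (1/2)^k"
   proof (cases "norm y = (1/2)^n")
    case True
    have "n \<noteq> 0" using True \<open>\<not> 1 <= norm y\<close> by (cases n) auto
    then obtain k where "n = Suc k" by (cases n) auto
    then have "norm y = (1/2)^k / 2" "(1/2)^Suc k = norm y" using True by simp_all
    moreover have "(0::real) < (1/2)^k" by simp
    ultimately show ?thesis by (intro exI[of _ k]) linarith
   next
    case False
    then show ?thesis using n2 by (intro exI[of _ n]) auto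
   qed
   then obtain k where k: "(1/2)^Suc k <= norm y" "norm y < (1/2)^k" by blast
   have "min 1 ((norm y)\<^sup>2) / norm y powr (3 + 2 * s) <= norm y powr 2 / norm y powr (3 + 2 * s)"
    using y0 by (intro divide_right_mono) (auto simp: powr_numeral)
   also have "... = norm y powr (-(1 + 2 * s))"
    unfolding powr_diff[symmetric] by simp
   also have "... <= ((1/2) ^ Suc k) powr (-(1 + 2 * s))"
    using k s by (intro powr_mono2') auto
   finally have "ennreal (min 1 ((norm y)\<^sup>2) / norm y powr (3 + 2 * s)) <= fb k y"
    using k by (simp add: fb_def ennreal_leI)
   also have "... <= (\<Sum>n. fb n y)"
    using sum_le_suminf[of "%n. fb n y" "{k}"] by simp
   also have "... <= (\<Sum>n. fa n y) + (\<Sum>n. fb n y)" by simp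
   finally show ?thesis .
  qed simp
 qed
 have [measurable]: "fa n \<in> borel_measurable lborel" "fb n \<in> borel_measurable lborel" for n
  unfolding fa_def[abs_def] fb_def[abs_def]
  by (intro borel_measurable_times_ennreal borel_measurable_indicator borel_measurable_const; simp)+
 have "kern_const s <= (\<integral>\<^sup>+y. (\<Sum>n. fa n y) + (\<Sum>n. fb n y) \<partial>lborel)"
  unfolding kern_const_def by (intro nn_integral_mono le)
 also have "... = (\<Sum>n. \<integral>\<^sup>+y. fa n y \<partial>lborel) + (\<Sum>n. \<integral>\<^sup>+y. fb n y \<partial>lborel)"
  by (subst nn_integral_add, measurable) (subst nn_integral_suminf, measurable)+
 also have "(%n. \<integral>\<^sup>+y. fa n y \<partial>lborel) = (%n. ennreal (a n))"
 proof
  fix n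
  have "(\<integral>\<^sup>+y. fa n y \<partial>lborel) = ennreal ((2 ^ n) powr (-(3 + 2 * s))) * ennreal (v * (2 ^ Suc n)^3)"
   unfolding fa_def by (subst nn_integral_cmult_indicator) (simp_all add: emeasure_ball v_def)
  also have "... = ennreal (((2 ^ n) powr (-(3 + 2 * s))) * (v * (2 ^ Suc n)^3))"
   by (rule ennreal_mult'[symmetric]) simp
  also have "((2 ^ n) powr (-(3 + 2 * s))) * (v * (2 ^ Suc n)^3) = a n"
   unfolding a_def by (simp only: mult_ac)
  finally show "(\<integral>\<^sup>+y. fa n y \<partial>lborel) = ennreal (a n)" .
 qed
 also have "(%n. \<integral>\<^sup>+y. fb n y \<partial>lborel) = (%n. ennreal (b n))"
 proof
  fix n
  have "(\<integral>\<^sup>+y. fb n y \<partial>lborel) = ennreal (((1/2) ^ Suc n) powr (-(1 + 2 * s))) * ennreal (v * ((1/2) ^ n)^3)"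
   unfolding fb_def by (subst nn_integral_cmult_indicator) (simp_all add: emeasure_ball v_def)
  also have "... = ennreal ((((1/2) ^ Suc n) powr (-(1 + 2 * s))) * (v * ((1/2) ^ n)^3))"
   by (rule ennreal_mult'[symmetric]) simp
  also have "(((1/2) ^ Suc n) powr (-(1 + 2 * s))) * (v * ((1/2) ^ n)^3) = b n"
   unfolding b_def by (simp only: mult_ac)
  finally show "(\<integral>\<^sup>+y. fb n y \<partial>lborel) = ennreal (b n)" .
 qed
 also have "(\<Sum>n. ennreal (a n)) + (\<Sum>n. ennreal (b n)) < \<infinity>"
  using fin by simp
 finally show ?thesis .
qed

text \<open>Scaling z = x + r y: volume r^3 against the kernel's degree -(3 + 2s) leaves r^(-2s).
  With r the distance of x to the boundary this power is exactly the Hardy weight.\<close>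

lemma nn_integral_truncated_kern:
 assumes r: "r > 0"
 shows "(\<integral>\<^sup>+z. ennreal (min 1 ((norm (x - z) / r)\<^sup>2) * kern s x z) \<partial>lborel) = ennreal (r powr (- 2 * s)) * kern_const s"
proof -
 have "(\<integral>\<^sup>+z. ennreal (min 1 ((norm (x - z) / r)\<^sup>2) * kern s x z) \<partial>lborel)
   = (\<integral>\<^sup>+y. ennreal (\<bar>r\<bar>^3) * ennreal (min 1 ((norm (x - (x + r *\<^sub>R y)) / r)\<^sup>2) * kern s x (x + r *\<^sub>R y)) \<partial>lborel)"
  by (rule nn_integral_affine_R3) (use r in auto)
 also have "... = (\<integral>\<^sup>+y. ennreal (r powr (- 2 * s)) * ennreal (min 1 ((norm (y::R3))\<^sup>2) / norm y powr (3 + 2 * s)) \<partial>lborel)"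
 proof (rule nn_integral_cong)
  fix y :: R3
  have "r ^ 3 / r powr (3 + 2 * s) = r powr (- 2 * s)"
   using r by (simp add: powr_add powr_minus divide_simps)
  then have "\<bar>r\<bar>^3 * (min 1 ((norm (x - (x + r *\<^sub>R y)) / r)\<^sup>2) * kern s x (x + r *\<^sub>R y))
    = r powr (- 2 * s) * (min 1 ((norm y)\<^sup>2) / norm y powr (3 + 2 * s))"
   using r by (simp add: kern_def powr_mult) (simp add: field_simps)
  then show "ennreal (\<bar>r\<bar>^3) * ennreal (min 1 ((norm (x - (x + r *\<^sub>R y)) / r)\<^sup>2) * kern s x (x + r *\<^sub>R y))
    = ennreal (r powr (- 2 * s)) * ennreal (min 1 ((norm y)\<^sup>2) / norm y powr (3 + 2 * s))"
   using r by (simp add: ennreal_mult'[symmetric])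
 qed
 also have "... = ennreal (r powr (- 2 * s)) * kern_const s"
  unfolding kern_const_def by (rule nn_integral_cmult) simp
 finally show ?thesis .
qed

section \<open>The cube, Hardy's inequality, multipliers and Lipschitz functions\<close>

lemma Omega_box: "Omega = box 0 1"
 by (auto simp: Omega_def mem_box_cart)

lemma open_Omega: "open Omega"
 by (simp add: Omega_box open_box)

lemma closure_Omega: "closure Omega = {x. \<forall>i. 0 <= x $ i \<and> x $ i <= 1}"
proof -
 have "box (0::R3) 1 \<noteq> {}"
  by (auto simp: box_ne_empty Basis_vec_def inner_axis)
 then show ?thesis
  unfolding Omega_box by (subst closure_box) (auto simp: mem_box_cart)
qed

lemma measurable_Omega [measurable]: "Omega \<in> sets borel" "closure Omega \<in> sets borel"
 by (auto intro: borel_open open_Omega)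

text \<open>Members of \<open>Htilde\<close> are constrained only off the closed cube, so nothing is
  known pointwise on its faces; this removes the faces from pointwise estimates.\<close>

lemma AE_not_frontier_Omega: "AE x in lborel. x \<notin> closure Omega \<or> x \<in> Omega"
proof -
 have "negligible (frontier Omega)"
  by (rule negligible_convex_frontier) (simp add: Omega_box convex_box)
 then have "frontier Omega \<in> null_sets lebesgue" by (simp add: negligible_iff_null_sets)
 then have "frontier Omega \<in> null_sets lborel"
  by (simp add: null_sets_completion_iff)
 then have "AE x in lborel. x \<notin> frontier Omega" by (rule AE_not_in)
 then show ?thesis
  by eventually_elim (auto simp: frontier_def interior_open open_Omega)
qed

lemma emeasure_closure_Omega: "emeasure lborel (closure Omega) = 1"
proof -
 have "closure Omega = cbox 0 (1::R3)"
  by (auto simp: closure_Omega mem_box_cart)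
 moreover have "emeasure lborel (cbox 0 (1::R3)) = 1"
  by (subst emeasure_lborel_cbox) (auto simp: Basis_vec_def inner_axis intro!: prod.neutral)
 ultimately show ?thesis by simp
qed

text \<open>Inside the cube this is the distance to the boundary; elsewhere it is at most 0, so that
  its sign characterises the open cube.\<close>

definition bd :: "R3 => real" where
 "bd x = Min (range (%i. min (x $ i) (1 - x $ i)))"

lemma bd_le: "bd x <= x $ i" "bd x <= 1 - x $ i"
proof -
 have "bd x <= min (x $ i) (1 - x $ i)"
  unfolding bd_def by (rule Min_le) auto
 then show "bd x <= x $ i" "bd x <= 1 - x $ i" by auto
qed

lemma bd_cases: obtains i where "bd x = x $ i" | i where "bd x = 1 - x $ i"
proof -
 have "bd x \<in> range (%i. min (x $ i) (1 - x $ i))"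
  unfolding bd_def by (rule Min_in) auto
 then show ?thesis using that by (auto simp: min_def split: if_splits)
qed

lemma bd_pos_iff: "0 < bd x \<longleftrightarrow> x \<in> Omega"
 by (auto simp: bd_def Omega_def Min_gr_iff)

lemma measurable_bd [measurable]: "bd \<in> borel_measurable borel"
proof -
 have "bd = (%x. min (min (x $ 1) (1 - x $ 1)) (min (min (x $ 2) (1 - x $ 2)) (min (x $ 3) (1 - x $ 3))))"
  unfolding bd_def by (auto simp: UNIV_3 fun_eq_iff)
 moreover have "... \<in> borel_measurable borel"
  by (intro borel_measurable_continuous_onI continuous_intros)
 ultimately show ?thesis by simp
qed

text \<open>A ball of radius d/2 has volume pi/6 d^3, and the kernel at distance 2d is
  (2d)^(-(3+2s)); the product is this constant times d^(-2s).\<close>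

definition hardy_const :: "real => real" where
 "hardy_const s = pi / 6 * 2 powr (- (3 + 2 * s))"

lemma hardy_const_pos: "hardy_const s > 0"
 by (simp add: hardy_const_def)

text \<open>Beyond the nearest face, at distance d = \<open>bd x\<close>, lies an exterior ball of
  radius d/2 centred at distance 3d/2 from x. All its points are within 2d of x, which bounds the
  kernel from below there.\<close>

lemma nn_integral_kern_outside_ge:
 assumes x: "x \<in> Omega" and s: "0 < s"
 shows "ennreal (hardy_const s * bd x powr (- 2 * s)) <= (\<integral>\<^sup>+z. indicator (- closure Omega) z * ennreal (kern s x z) \<partial>lborel)"
proof -
 have d0: "bd x > 0" using x bd_pos_iff by blast
 define d where "d = bd x"
 have "\<exists>c. norm (x - c) = 3/2 * d \<and> ball c (d/2) \<subseteq> - closure Omega"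
 proof (rule bd_cases[of x])
  fix i assume i: "bd x = x $ i"
  define c where "c = x - (3/2 * d) *\<^sub>R axis i 1"
  have "norm (x - c) = 3/2 * d" using d0 by (simp add: c_def d_def norm_axis_1)
  moreover have "z \<notin> closure Omega" if "dist c z < d/2" for z
  proof -
   have "\<bar>(c - z) $ i\<bar> < d/2"
    using that component_le_norm_cart[of "c - z" i] by (simp add: dist_norm)
   moreover have "c $ i = - d/2" using i by (simp add: c_def d_def axis_def)
   ultimately have "z $ i < 0" unfolding vector_minus_component by linarith
   then show ?thesis unfolding closure_Omega by (auto simp: not_le)
  qed
  ultimately show ?thesis by (intro exI[of _ c]) auto
 next
  fix i assume i: "bd x = 1 - x $ i"
  define c where "c = x + (3/2 * d) *\<^sub>R axis i 1"
  have "norm (x - c) = 3/2 * d" using d0 by (simp add: c_def d_def norm_axis_1)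
  moreover have "z \<notin> closure Omega" if "dist c z < d/2" for z
  proof -
   have "\<bar>(c - z) $ i\<bar> < d/2"
    using that component_le_norm_cart[of "c - z" i] by (simp add: dist_norm)
   moreover have "c $ i = 1 + d/2" using i by (simp add: c_def d_def axis_def field_simps)
   ultimately have "z $ i > 1" unfolding vector_minus_component by linarith
   then show ?thesis unfolding closure_Omega by (auto simp: not_le)
  qed
  ultimately show ?thesis by (intro exI[of _ c]) auto
 qed
 then obtain c where c: "norm (x - c) = 3/2 * d" "ball c (d/2) \<subseteq> - closure Omega" by blast
 have dp: "d > 0" using d0 by (simp add: d_def)
 have "hardy_const s * bd x powr (- 2 * s) = (2 * d) powr (- (3 + 2 * s)) * (4/3 * pi * (d/2)^3)"
 proof -
  have "d powr (- 2 * s) = d powr (- (3 + 2 * s)) * d ^ 3"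
   using dp by (simp add: powr_realpow[symmetric] powr_add[symmetric] del: powr_numeral)
  then show ?thesis
   using dp by (simp add: hardy_const_def d_def[symmetric] powr_mult power_divide)
 qed
 also have "ennreal ... = ennreal ((2 * d) powr (- (3 + 2 * s))) * emeasure lborel (ball c (d/2))"
  using dp by (subst emeasure_ball) (auto simp: unit_ball_vol_3 ennreal_mult'[symmetric] mult_ac)
 also have "... = (\<integral>\<^sup>+z. ennreal ((2 * d) powr (- (3 + 2 * s))) * indicator (ball c (d/2)) z \<partial>lborel)"
  by (rule nn_integral_cmult_indicator[symmetric]) simp
 also have "... <= (\<integral>\<^sup>+z. indicator (- closure Omega) z * ennreal (kern s x z) \<partial>lborel)"
 proof (rule nn_integral_mono)
  fix z :: R3
  show "ennreal ((2 * d) powr (- (3 + 2 * s))) * indicator (ball c (d/2)) z <= indicator (- closure Omega) z * ennreal (kern s x z)"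
  proof (cases "z \<in> ball c (d/2)")
   case True
   then have z: "z \<in> - closure Omega" using c by blast
   have "norm (x - z) <= norm (x - c) + norm (c - z)"
    using norm_triangle_ineq[of "x - c" "c - z"] by simp
   also have "... <= 2 * d" using c(1) True by (simp add: dist_norm)
   finally have le: "norm (x - z) <= 2 * d" .
   have "x \<noteq> z" using z x closure_subset[of Omega] by auto
   then have "(2 * d) powr (- (3 + 2 * s)) <= norm (x - z) powr (- (3 + 2 * s))"
    using le s by (intro powr_mono2') auto
   then have "(2 * d) powr (- (3 + 2 * s)) <= kern s x z"
    unfolding kern_def powr_minus_divide[of "norm (x - z)"] .
   then show ?thesis using True z by (auto intro!: ennreal_leI)
  qed simp
 qed
 finally show ?thesis .
qed

lemma gagliardo_UNIV:
 "gagliardo_sq s UNIV w = (\<integral>\<^sup>+x. \<integral>\<^sup>+z. ennreal ((w x - w z)\<^sup>2 * kern s x z) \<partial>lborel \<partial>lborel)"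
 by (simp add: gagliardo_sq_def kern_def)

text \<open>The seminorm is taken over the whole space: restricting the inner integral to the
  exterior, where w vanishes, leaves (w x)^2 times the exterior mass of the kernel. For this reason
  s = 1/2 is no exceptional value.\<close>

lemma hardy:
 assumes [measurable]: "w \<in> borel_measurable borel" and w0: "!!x. x \<notin> closure Omega ==> w x = 0" and s: "0 < s"
 shows "(\<integral>\<^sup>+x. indicator Omega x * ennreal ((w x)\<^sup>2 * bd x powr (- 2 * s)) \<partial>lborel)
   <= ennreal (1 / hardy_const s) * gagliardo_sq s UNIV w"
proof -
 have "indicator Omega x * ennreal ((w x)\<^sup>2 * bd x powr (- 2 * s))
   <= ennreal (1 / hardy_const s) * (\<integral>\<^sup>+z. ennreal ((w x - w z)\<^sup>2 * kern s x z) \<partial>lborel)" for x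
 proof (cases "x \<in> Omega")
  case True
  have "ennreal ((w x)\<^sup>2 * bd x powr (- 2 * s))
    = ennreal (1 / hardy_const s) * (ennreal ((w x)\<^sup>2) * ennreal (hardy_const s * bd x powr (- 2 * s)))"
   using hardy_const_pos[of s] by (simp add: ennreal_mult'[symmetric])
  also have "... <= ennreal (1 / hardy_const s) * (ennreal ((w x)\<^sup>2) * (\<integral>\<^sup>+z. indicator (- closure Omega) z * ennreal (kern s x z) \<partial>lborel))"
   by (intro mult_left_mono nn_integral_kern_outside_ge True s) auto
  also have "ennreal ((w x)\<^sup>2) * (\<integral>\<^sup>+z. indicator (- closure Omega) z * ennreal (kern s x z) \<partial>lborel)
   = (\<integral>\<^sup>+z. ennreal ((w x)\<^sup>2) * (indicator (- closure Omega) z * ennreal (kern s x z)) \<partial>lborel)"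
   by (rule nn_integral_cmult[symmetric]) measurable
  also have "... <= (\<integral>\<^sup>+z. ennreal ((w x - w z)\<^sup>2 * kern s x z) \<partial>lborel)"
   by (intro nn_integral_mono) (auto split: split_indicator simp: w0 ennreal_mult'[symmetric])
  finally show ?thesis using True by (simp add: mult_left_mono)
 qed simp
 then have "(\<integral>\<^sup>+x. indicator Omega x * ennreal ((w x)\<^sup>2 * bd x powr (- 2 * s)) \<partial>lborel)
   <= (\<integral>\<^sup>+x. ennreal (1 / hardy_const s) * (\<integral>\<^sup>+z. ennreal ((w x - w z)\<^sup>2 * kern s x z) \<partial>lborel) \<partial>lborel)"
  by (intro nn_integral_mono)
 also have "... = ennreal (1 / hardy_const s) * gagliardo_sq s UNIV w"
  unfolding gagliardo_UNIV by (rule nn_integral_cmult) measurable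
 finally show ?thesis .
qed

text \<open>In the product increment the term with the increment of the multiplier is integrated
  first over z, by \<open>nn_integral_truncated_kern\<close> at scale r = \<open>bd x\<close>, and
  then over x by Hardy. The Lipschitz hypothesis is relative to the distance to the boundary, so the
  constant is the same for cut-offs of every width.\<close>

lemma gagliardo_multiplier:
 assumes [measurable]: "w \<in> borel_measurable borel" "\<phi> \<in> borel_measurable borel"
  and w0: "!!x. x \<notin> closure Omega ==> w x = 0" and s: "0 < s"
  and bound: "!!x. \<bar>\<phi> x\<bar> <= 1"
  and lip: "!!x z. x \<in> Omega ==> \<bar>\<phi> x - \<phi> z\<bar> <= C * norm (x - z) / bd x" and C: "C \<ge> 1"
 shows "gagliardo_sq s UNIV (%x. \<phi> x * w x)
   <= (2 + 8 * ennreal (C\<^sup>2 / hardy_const s) * kern_const s) * gagliardo_sq s UNIV w"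
proof -
 have cut: "(\<phi> x - \<phi> z)\<^sup>2 <= 4 * C\<^sup>2 * min 1 ((norm (x - z) / bd x)\<^sup>2)" if "x \<in> Omega" for x z
 proof -
  have "\<bar>\<phi> x - \<phi> z\<bar> <= 2 * C" using bound[of x] bound[of z] C by linarith
  then have "\<bar>\<phi> x - \<phi> z\<bar>\<^sup>2 <= (2 * C)\<^sup>2" by (intro power_mono) auto
  moreover have "\<bar>\<phi> x - \<phi> z\<bar>\<^sup>2 <= (C * (norm (x - z) / bd x))\<^sup>2"
   using lip[OF that, of z] by (intro power_mono) auto
  moreover have "C\<^sup>2 * (norm (x - z) / bd x)\<^sup>2 <= 4 * C\<^sup>2 * (norm (x - z) / bd x)\<^sup>2"
   by (intro mult_right_mono) auto
  ultimately show ?thesis by (auto simp: min_def power_mult_distrib power_divide)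
 qed
 have pt: "((\<phi> x * w x) - (\<phi> z * w z))\<^sup>2 <= 2 * (w x - w z)\<^sup>2 + 2 * ((\<phi> x - \<phi> z)\<^sup>2 * (w x)\<^sup>2)" for x z
 proof -
  have "(\<phi> x * w x) - (\<phi> z * w z) = \<phi> z * (w x - w z) + (\<phi> x - \<phi> z) * w x" by algebra
  then have "((\<phi> x * w x) - (\<phi> z * w z))\<^sup>2 <= 2 * (\<phi> z * (w x - w z))\<^sup>2 + 2 * ((\<phi> x - \<phi> z) * w x)\<^sup>2"
   using sum_squares_bound[of "\<phi> z * (w x - w z)" "(\<phi> x - \<phi> z) * w x"] by (simp add: power2_sum)
  moreover have "(\<phi> z)\<^sup>2 <= 1" using bound[of z] by (simp add: abs_square_le_1)
  then have "(\<phi> z * (w x - w z))\<^sup>2 <= (w x - w z)\<^sup>2"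
   unfolding power_mult_distrib by (intro mult_left_le_one_le) auto
  ultimately show ?thesis by (simp add: power_mult_distrib)
 qed
 have inner: "(\<integral>\<^sup>+z. ennreal (((\<phi> x * w x) - (\<phi> z * w z))\<^sup>2 * kern s x z) \<partial>lborel)
  <= 2 * (\<integral>\<^sup>+z. ennreal ((w x - w z)\<^sup>2 * kern s x z) \<partial>lborel)
   + 8 * ennreal (C\<^sup>2) * kern_const s * (indicator Omega x * ennreal ((w x)\<^sup>2 * bd x powr (- 2 * s)))"
  if x: "x \<notin> closure Omega \<or> x \<in> Omega" for x
 proof (cases "x \<in> Omega")
  case True
  have d0: "bd x > 0" using True bd_pos_iff by blast
  have "(\<integral>\<^sup>+z. ennreal (((\<phi> x * w x) - (\<phi> z * w z))\<^sup>2 * kern s x z) \<partial>lborel)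
   <= (\<integral>\<^sup>+z. 2 * ennreal ((w x - w z)\<^sup>2 * kern s x z)
      + ennreal (8 * C\<^sup>2 * (w x)\<^sup>2) * ennreal (min 1 ((norm (x - z) / bd x)\<^sup>2) * kern s x z) \<partial>lborel)"
  proof (rule nn_integral_mono)
   fix z
   have "((\<phi> x * w x) - (\<phi> z * w z))\<^sup>2 <= 2 * (w x - w z)\<^sup>2 + 2 * ((4 * C\<^sup>2 * min 1 ((norm (x - z) / bd x)\<^sup>2)) * (w x)\<^sup>2)"
    using pt[of x z] mult_right_mono[OF cut[OF True, of z], of "(w x)\<^sup>2"] by simp
   then have "((\<phi> x * w x) - (\<phi> z * w z))\<^sup>2 * kern s x z
     <= (2 * (w x - w z)\<^sup>2 + 2 * ((4 * C\<^sup>2 * min 1 ((norm (x - z) / bd x)\<^sup>2)) * (w x)\<^sup>2)) * kern s x z"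
    by (intro mult_right_mono) auto
   also have "... = 2 * ((w x - w z)\<^sup>2 * kern s x z) + 8 * C\<^sup>2 * (w x)\<^sup>2 * (min 1 ((norm (x - z) / bd x)\<^sup>2) * kern s x z)"
    by (simp add: algebra_simps)
   finally have "ennreal (((\<phi> x * w x) - (\<phi> z * w z))\<^sup>2 * kern s x z) <= ennreal ..." by (rule ennreal_leI)
   then show "ennreal (((\<phi> x * w x) - (\<phi> z * w z))\<^sup>2 * kern s x z) <= 2 * ennreal ((w x - w z)\<^sup>2 * kern s x z)
      + ennreal (8 * C\<^sup>2 * (w x)\<^sup>2) * ennreal (min 1 ((norm (x - z) / bd x)\<^sup>2) * kern s x z)"
    by (subst (asm) ennreal_plus) (auto simp: ennreal_mult' zero_le_mult_iff intro!: mult_nonneg_nonneg)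
  qed
  also have "... = 2 * (\<integral>\<^sup>+z. ennreal ((w x - w z)\<^sup>2 * kern s x z) \<partial>lborel)
    + ennreal (8 * C\<^sup>2 * (w x)\<^sup>2) * (ennreal (bd x powr (- 2 * s)) * kern_const s)"
   by (subst nn_integral_add) (auto simp: nn_integral_cmult nn_integral_truncated_kern[OF d0])
  also have "ennreal (8 * C\<^sup>2 * (w x)\<^sup>2) * (ennreal (bd x powr (- 2 * s)) * kern_const s)
    = 8 * ennreal (C\<^sup>2) * kern_const s * (indicator Omega x * ennreal ((w x)\<^sup>2 * bd x powr (- 2 * s)))"
   using True by (simp add: ennreal_mult' mult_ac)
  finally show ?thesis .
 next
  case False
  then have wx: "w x = 0" using x w0 by blast
  have "(\<integral>\<^sup>+z. ennreal (((\<phi> x * w x) - (\<phi> z * w z))\<^sup>2 * kern s x z) \<partial>lborel)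
   <= (\<integral>\<^sup>+z. 2 * ennreal ((w x - w z)\<^sup>2 * kern s x z) \<partial>lborel)"
  proof (rule nn_integral_mono)
   fix z
   have "((\<phi> x * w x) - (\<phi> z * w z))\<^sup>2 * kern s x z <= (2 * (w x - w z)\<^sup>2) * kern s x z"
    using pt[of x z] wx by (intro mult_right_mono) auto
   from ennreal_leI[OF this]
   show "ennreal (((\<phi> x * w x) - (\<phi> z * w z))\<^sup>2 * kern s x z) <= 2 * ennreal ((w x - w z)\<^sup>2 * kern s x z)"
    by (simp add: ennreal_mult' mult.assoc)
  qed
  also have "... = 2 * (\<integral>\<^sup>+z. ennreal ((w x - w z)\<^sup>2 * kern s x z) \<partial>lborel)"
   by (simp add: nn_integral_cmult)
  finally show ?thesis using False by simp
 qed
 have "gagliardo_sq s UNIV (%x. \<phi> x * w x)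
   <= (\<integral>\<^sup>+x. 2 * (\<integral>\<^sup>+z. ennreal ((w x - w z)\<^sup>2 * kern s x z) \<partial>lborel)
   + 8 * ennreal (C\<^sup>2) * kern_const s * (indicator Omega x * ennreal ((w x)\<^sup>2 * bd x powr (- 2 * s))) \<partial>lborel)"
  unfolding gagliardo_UNIV 
  by (rule nn_integral_mono_AE, rule eventually_mono[OF AE_not_frontier_Omega], rule inner)
 also have "... = 2 * gagliardo_sq s UNIV w
   + 8 * ennreal (C\<^sup>2) * kern_const s * (\<integral>\<^sup>+x. indicator Omega x * ennreal ((w x)\<^sup>2 * bd x powr (- 2 * s)) \<partial>lborel)"
  unfolding gagliardo_UNIV by (subst nn_integral_add) (auto simp: nn_integral_cmult)
 also have "... <= 2 * gagliardo_sq s UNIV w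
   + 8 * ennreal (C\<^sup>2) * kern_const s * (ennreal (1 / hardy_const s) * gagliardo_sq s UNIV w)"
  by (intro add_left_mono mult_left_mono hardy w0 s) auto
 also have "... = (2 + 8 * (ennreal (C\<^sup>2) * ennreal (1 / hardy_const s)) * kern_const s) * gagliardo_sq s UNIV w"
  by (simp add: ring_distribs mult_ac)
 also have "ennreal (C\<^sup>2) * ennreal (1 / hardy_const s) = ennreal (C\<^sup>2 / hardy_const s)"
  by (simp add: ennreal_mult'[symmetric])
 finally show ?thesis .
qed

text \<open>Interpolation between sup norm and Lipschitz norm: at the length r = 2 S / M the
  Lipschitz bound hands over to the sup bound, and the squared seminorm is of order S^(2-2s) M^(2s).
  This converts exponentially small sup errors into exponentially small energy.\<close>

lemma gagliardo_Lipschitz: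
 assumes [measurable]: "e \<in> borel_measurable borel"
  and e0: "!!x. x \<notin> closure Omega ==> e x = 0" and S: "S > 0" and M: "M > 0"
  and bound: "!!x. \<bar>e x\<bar> <= S" and lip: "!!x z. \<bar>e x - e z\<bar> <= M * norm (x - z)"
 shows "gagliardo_sq s UNIV e <= ennreal (8 * S\<^sup>2 * (2 * S / M) powr (- 2 * s)) * kern_const s"
proof -
 define r where "r = 2 * S / M"
 have r: "r > 0" using S M by (simp add: r_def)
 define g where "g x z = ennreal (4 * S\<^sup>2) * ennreal (min 1 ((norm (x - z) / r)\<^sup>2) * kern s x z)" for x z
 have [measurable]: "(%p. g (fst p) (snd p)) \<in> borel_measurable (borel \<Otimes>\<^sub>M borel)"
  "(%p. g (snd p) (fst p)) \<in> borel_measurable (borel \<Otimes>\<^sub>M borel)"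
  unfolding g_def by measurable
 have [measurable]: "g x \<in> borel_measurable borel" for x
  unfolding g_def by measurable
 have gi: "(\<integral>\<^sup>+z. g x z \<partial>lborel) = ennreal (4 * S\<^sup>2) * (ennreal (r powr (- 2 * s)) * kern_const s)" for x
  unfolding g_def by (simp add: nn_integral_cmult nn_integral_truncated_kern[OF r])
 have gs: "g x z = g z x" for x z unfolding g_def by (simp add: kern_commute norm_minus_commute)
 \<comment> \<open>An increment is nonzero only if one of the two points lies in the closed cube;
   charging both cases makes the two resulting double integrals equal by symmetry of
   \<open>g\<close>.\<close>
 have le: "ennreal ((e x - e z)\<^sup>2 * kern s x z) <= indicator (closure Omega) x * g x z + indicator (closure Omega) z * g x z" for x z
 proof (cases "x \<in> closure Omega \<or> z \<in> closure Omega")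
  case True
  have "\<bar>e x - e z\<bar> <= 2 * S" using bound[of x] bound[of z] by linarith
  then have "\<bar>e x - e z\<bar>\<^sup>2 <= (2 * S)\<^sup>2" by (intro power_mono) auto
  moreover have "\<bar>e x - e z\<bar>\<^sup>2 <= (2 * S * (norm (x - z) / r))\<^sup>2"
   using lip[of x z] S M by (intro power_mono) (auto simp: r_def field_simps)
  ultimately have "(e x - e z)\<^sup>2 <= 4 * S\<^sup>2 * min 1 ((norm (x - z) / r)\<^sup>2)"
   by (auto simp: min_def power_mult_distrib power_divide)
  then have "(e x - e z)\<^sup>2 * kern s x z <= 4 * S\<^sup>2 * min 1 ((norm (x - z) / r)\<^sup>2) * kern s x z"
   by (intro mult_right_mono) auto
  then have "ennreal ((e x - e z)\<^sup>2 * kern s x z) <= g x z"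
   unfolding g_def by (simp add: ennreal_mult'[symmetric] mult.assoc ennreal_leI)
  also have "g x z <= indicator (closure Omega) x * g x z + indicator (closure Omega) z * g x z"
   using True by (auto simp: add_increasing split: split_indicator)
  finally show ?thesis .
 qed (simp add: e0)
 have "gagliardo_sq s UNIV e
  <= (\<integral>\<^sup>+x. \<integral>\<^sup>+z. indicator (closure Omega) x * g x z + indicator (closure Omega) z * g x z \<partial>lborel \<partial>lborel)"
  unfolding gagliardo_UNIV by (intro nn_integral_mono le)
 also have "... = (\<integral>\<^sup>+x. \<integral>\<^sup>+z. indicator (closure Omega) x * g x z \<partial>lborel \<partial>lborel)
   + (\<integral>\<^sup>+x. \<integral>\<^sup>+z. indicator (closure Omega) z * g x z \<partial>lborel \<partial>lborel)"
  by (subst nn_integral_add[symmetric]) (auto intro!: nn_integral_cong nn_integral_add)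
 also have "(\<integral>\<^sup>+x. \<integral>\<^sup>+z. indicator (closure Omega) z * g x z \<partial>lborel \<partial>lborel)
  = (\<integral>\<^sup>+z. \<integral>\<^sup>+x. indicator (closure Omega) z * g x z \<partial>lborel \<partial>lborel)"
  by (rule lborel_pair.Fubini') measurable
 also have "... = (\<integral>\<^sup>+x. \<integral>\<^sup>+z. indicator (closure Omega) x * g x z \<partial>lborel \<partial>lborel)"
  by (simp add: gs)
 also have "(\<integral>\<^sup>+x. \<integral>\<^sup>+z. indicator (closure Omega) x * g x z \<partial>lborel \<partial>lborel)
  = ennreal (4 * S\<^sup>2) * (ennreal (r powr (- 2 * s)) * kern_const s)"
  by (simp add: nn_integral_cmult gi nn_integral_multc emeasure_closure_Omega)
 also have "... + ... = ennreal (8 * S\<^sup>2 * r powr (- 2 * s)) * kern_const s"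
  using S by (simp add: ennreal_mult' mult.assoc[symmetric] distrib_right[symmetric] ennreal_plus[symmetric] del: ennreal_plus)
 finally show ?thesis by (simp add: r_def)
qed

section \<open>Comparison of the norm of the energy space with the full-space seminorm\<close>

lemma infdist_frontier_Omega_ge:
 assumes x: "x \<in> Omega"
 shows "bd x <= infdist x (frontier Omega)"
proof -
 have fr: "frontier Omega = closure Omega - Omega"
  by (simp add: frontier_def interior_open open_Omega)
 have "(0::R3) \<in> frontier Omega" unfolding fr closure_Omega by (simp add: Omega_def)
 then have ne: "frontier Omega \<noteq> {}" by blast
 have "bd x <= dist x y" if y: "y \<in> frontier Omega" for y
 proof -
  have "y \<in> closure Omega" "y \<notin> Omega" using y fr by auto
  obtain i where "\<not> (0 < y $ i \<and> y $ i < 1)" using \<open>y \<notin> Omega\<close> by (auto simp: Omega_def)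
  moreover have "0 <= y $ i \<and> y $ i <= 1" using \<open>y \<in> closure Omega\<close> by (simp add: closure_Omega)
  ultimately have "y $ i = 0 \<or> y $ i = 1" by linarith
  then have "bd x <= \<bar>(x - y) $ i\<bar>"
   using bd_le[of x i] by auto
  also have "... <= dist x y" unfolding dist_norm by (rule component_le_norm_cart)
  finally show ?thesis .
 qed
 then show ?thesis unfolding infdist_notempty[OF ne] by (intro cINF_greatest ne)
qed

lemma bd_less_1: "bd x < 1"
 using bd_le[of x 1] by linarith

lemma bd_powr_ge_1: assumes "x \<in> Omega" "0 <= s" shows "1 <= bd x powr (- 2 * s)"
proof -
 have "bd x > 0" using assms bd_pos_iff by blast
 then have "1 powr (- 2 * s) <= bd x powr (- 2 * s)"
  using bd_less_1[of x] assms by (intro powr_mono2') auto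
 then show ?thesis by simp
qed

text \<open>Poincare's inequality as a case of Hardy's: on the unit cube the weight
  \<open>bd x powr (- 2 * s)\<close> is at least 1.\<close>

lemma L2_le_gagliardo:
 assumes [measurable]: "w \<in> borel_measurable borel" and w0: "!!x. x \<notin> closure Omega ==> w x = 0" and s: "0 < s"
 shows "L2_sq UNIV w <= ennreal (1 / hardy_const s) * gagliardo_sq s UNIV w"
proof -
 have "L2_sq UNIV w <= (\<integral>\<^sup>+x. indicator Omega x * ennreal ((w x)\<^sup>2 * bd x powr (- 2 * s)) \<partial>lborel)"
  unfolding L2_sq_def
 proof (rule nn_integral_mono_AE, rule eventually_mono[OF AE_not_frontier_Omega])
  fix x :: R3 assume "x \<notin> closure Omega \<or> x \<in> Omega"
  then consider "x \<notin> closure Omega" | "x \<in> Omega" by blast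
  then show "indicator UNIV x * ennreal ((w x)\<^sup>2) <= indicator Omega x * ennreal ((w x)\<^sup>2 * bd x powr (- 2 * s))"
  proof cases
   case 2
   then show ?thesis using mult_left_mono[OF bd_powr_ge_1[OF 2, of s], of "(w x)\<^sup>2"] s
    by (auto intro!: ennreal_leI)
  qed (simp add: w0)
 qed
 also have "... <= ennreal (1 / hardy_const s) * gagliardo_sq s UNIV w"
  by (intro hardy w0 s) auto
 finally show ?thesis .
qed

lemma Htilde_iff:
 assumes "0 < s"
 shows "w \<in> Htilde s Omega \<longleftrightarrow> w \<in> borel_measurable borel \<and> gagliardo_sq s UNIV w < \<infinity>
   \<and> (\<forall>x. x \<notin> closure Omega --> w x = 0)"
proof
 assume "w \<in> borel_measurable borel \<and> gagliardo_sq s UNIV w < \<infinity> \<and> (\<forall>x. x \<notin> closure Omega --> w x = 0)"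
 moreover from this have "L2_sq UNIV w <= ennreal (1 / hardy_const s) * gagliardo_sq s UNIV w"
  by (intro L2_le_gagliardo assms) auto
 moreover have "... < \<infinity>" using calculation(1) by (simp add: ennreal_mult_less_top)
 ultimately show "w \<in> Htilde s Omega" unfolding Htilde_def by (auto intro: le_less_trans)
qed (auto simp: Htilde_def)

text \<open>From here on errors are measured in the full-space seminorm. The weighted part of the
  norm is Hardy's inequality once more, as \<open>bd\<close> does not exceed the distance to the
  frontier.\<close>

lemma Htilde_norm_le:
 assumes [measurable]: "w \<in> borel_measurable borel" and w0: "!!x. x \<notin> closure Omega ==> w x = 0" and s: "0 < s"
 shows "Htilde_norm_sq s Omega w <= ennreal (1 + 2 / hardy_const s) * gagliardo_sq s UNIV w"
proof -
 have "L2_sq Omega w <= L2_sq UNIV w"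
  unfolding L2_sq_def by (intro nn_integral_mono) (auto split: split_indicator)
 also have "... <= ennreal (1 / hardy_const s) * gagliardo_sq s UNIV w"
  by (intro L2_le_gagliardo w0 s) auto
 finally have 1: "L2_sq Omega w <= ennreal (1 / hardy_const s) * gagliardo_sq s UNIV w" .
 have 2: "gagliardo_sq s Omega w <= gagliardo_sq s UNIV w"
  unfolding gagliardo_sq_def by (intro nn_integral_mono mult_mono) (auto split: split_indicator)
 have "L2_sq Omega (%x. w x / infdist x (frontier Omega) powr s)
   <= (\<integral>\<^sup>+x. indicator Omega x * ennreal ((w x)\<^sup>2 * bd x powr (- 2 * s)) \<partial>lborel)"
  unfolding L2_sq_def
 proof (rule nn_integral_mono)
  fix x :: R3
  show "indicator Omega x * ennreal ((w x / infdist x (frontier Omega) powr s)\<^sup>2)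
   <= indicator Omega x * ennreal ((w x)\<^sup>2 * bd x powr (- 2 * s))"
  proof (cases "x \<in> Omega")
   case True
   have b: "0 < bd x" using True bd_pos_iff by blast
   have "(w x / infdist x (frontier Omega) powr s)\<^sup>2 <= (w x)\<^sup>2 / (bd x powr s)\<^sup>2"
    unfolding power_divide using b infdist_frontier_Omega_ge[OF True] s
    by (intro divide_left_mono power_mono powr_mono2 mult_pos_pos zero_less_power) auto
   also have "(bd x powr s)\<^sup>2 = bd x powr (2 * s)"
    by (simp add: power2_eq_square powr_add[symmetric])
   also have "(w x)\<^sup>2 / bd x powr (2 * s) = (w x)\<^sup>2 * bd x powr (- 2 * s)"
    by (simp add: powr_minus_divide)
   finally show ?thesis using True by (simp add: ennreal_leI)
  qed simp
 qed
 also have "... <= ennreal (1 / hardy_const s) * gagliardo_sq s UNIV w"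
  by (intro hardy w0 s) auto
 finally have "Htilde_norm_sq s Omega w <= (ennreal (1 / hardy_const s) * gagliardo_sq s UNIV w + gagliardo_sq s UNIV w)
   + ennreal (1 / hardy_const s) * gagliardo_sq s UNIV w"
  unfolding Htilde_norm_sq_def by (intro add_mono 1 2)
 also have "... = (ennreal (1 / hardy_const s) + ennreal 1 + ennreal (1 / hardy_const s)) * gagliardo_sq s UNIV w"
  by (simp add: ring_distribs)
 also have "ennreal (1 / hardy_const s) + ennreal 1 + ennreal (1 / hardy_const s) = ennreal (1 + 2 / hardy_const s)"
  using hardy_const_pos[of s] by (subst ennreal_plus[symmetric], simp, simp)+ (simp add: field_simps)
 finally show ?thesis .
qed

section \<open>The bilinear form on the product space, the energy norm and quasi-optimality\<close>

definition incr :: "(R3 => real) => R3 \<times> R3 => real" where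
 "incr w p = w (fst p) - w (snd p)"

definition kern2 :: "real => R3 \<times> R3 => real" where
 "kern2 s p = kern s (fst p) (snd p)"

abbreviation lborel2 :: "(R3 \<times> R3) measure" where
 "lborel2 \<equiv> lborel \<Otimes>\<^sub>M lborel"

text \<open>The kernel is a parameter because the flow transports the form into other kernels, and
  differences in the flow time produce forms whose kernels change sign.\<close>

definition kform :: "(R3 \<times> R3 => real) => (R3 => real) => (R3 => real) => real" where
 "kform K w v = (\<integral>p. incr w p * incr v p * K p \<partial>lborel2)"

definition enorm :: "real => (R3 => real) => real" where
 "enorm s w = sqrt (kform (kern2 s) w w)"

lemma kern2_nonneg [simp]: "0 <= kern2 s p"
 by (simp add: kern2_def)

lemma measurable_incr [measurable]: 
 assumes [measurable]: "w \<in> borel_measurable borel"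
 shows "incr w \<in> borel_measurable (borel \<Otimes>\<^sub>M borel)"
 unfolding incr_def by measurable

lemma measurable_kern2 [measurable]: "kern2 s \<in> borel_measurable (borel \<Otimes>\<^sub>M borel)"
 unfolding kern2_def by measurable

lemma gagliardo_prod:
 assumes [measurable]: "w \<in> borel_measurable borel"
 shows "gagliardo_sq s UNIV w = (\<integral>\<^sup>+p. ennreal ((incr w p)\<^sup>2 * kern2 s p) \<partial>lborel2)"
 unfolding gagliardo_UNIV
 by (subst lborel.nn_integral_fst[symmetric]) (auto simp: incr_def kern2_def)

lemma HtildeD:
 assumes "w \<in> Htilde s Omega"
 shows "w \<in> borel_measurable borel" "gagliardo_sq s UNIV w < \<infinity>" "!!x. x \<notin> closure Omega ==> w x = 0"
 using assms by (auto simp: Htilde_def)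

lemma integrable_incr_sq:
 assumes w: "w \<in> Htilde s Omega"
 shows "integrable lborel2 (%p. (incr w p)\<^sup>2 * kern2 s p)"
proof -
 note HtildeD(1)[OF w, measurable]
 show ?thesis
  by (rule integrableI_nonneg) (use HtildeD(2)[OF w] in \<open>auto simp: gagliardo_prod\<close>)
qed

lemma gagliardo_eq_kform:
 assumes w: "w \<in> Htilde s Omega"
 shows "gagliardo_sq s UNIV w = ennreal (kform (kern2 s) w w)"
proof -
 note HtildeD(1)[OF w, measurable]
 have "(\<integral>\<^sup>+p. ennreal ((incr w p)\<^sup>2 * kern2 s p) \<partial>lborel2) = ennreal (\<integral>p. (incr w p)\<^sup>2 * kern2 s p \<partial>lborel2)"
  by (intro nn_integral_eq_integral integrable_incr_sq w) auto
 then show ?thesis by (simp add: gagliardo_prod kform_def power2_eq_square)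
qed

lemma kform_self_nonneg: "0 <= kform (kern2 s) w w"
 unfolding kform_def by (intro integral_nonneg_AE) (auto simp: zero_le_square)

lemma enorm_nonneg [simp]: "0 <= enorm s w"
 by (simp add: enorm_def kform_self_nonneg)

lemma gagliardo_eq_enorm:
 assumes "w \<in> Htilde s Omega"
 shows "gagliardo_sq s UNIV w = ennreal ((enorm s w)\<^sup>2)"
 by (simp add: gagliardo_eq_kform[OF assms] enorm_def kform_self_nonneg)

text \<open>Cauchy-Schwarz with weight \<open>kern2 s\<close>. A kernel of any sign that is
  dominated pointwise by a multiple of the fractional one gives a form bounded by the same
  multiple.\<close>

lemma kform_bound:
 assumes w: "w \<in> Htilde s Omega" and v: "v \<in> Htilde s Omega"
  and K [measurable]: "K \<in> borel_measurable (borel \<Otimes>\<^sub>M borel)" and M: "!!p. \<bar>K p\<bar> <= M * kern2 s p" "0 <= M"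
 shows "integrable lborel2 (%p. incr w p * incr v p * K p)"
  and "\<bar>kform K w v\<bar> <= M * enorm s w * enorm s v"
proof -
 note HtildeD(1)[OF w, measurable] HtildeD(1)[OF v, measurable]
 define f g where "f p = \<bar>incr w p\<bar> * sqrt (kern2 s p)" and "g p = \<bar>incr v p\<bar> * sqrt (kern2 s p)" for p
 have [measurable]: "f \<in> borel_measurable (borel \<Otimes>\<^sub>M borel)" "g \<in> borel_measurable (borel \<Otimes>\<^sub>M borel)"
  unfolding f_def g_def by measurable
 have f2: "(%p. (f p)\<^sup>2) = (%p. (incr w p)\<^sup>2 * kern2 s p)" and g2: "(%p. (g p)\<^sup>2) = (%p. (incr v p)\<^sup>2 * kern2 s p)"
  by (auto simp: f_def g_def power_mult_distrib)
 have i: "integrable lborel2 (%p. f p * g p)" "\<bar>\<integral>p. f p * g p \<partial>lborel2\<bar> <= enorm s w * enorm s v"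
  using integral_Cauchy_Schwarz[of f lborel2 g] integrable_incr_sq[OF w] integrable_incr_sq[OF v]
  unfolding f2 g2 enorm_def kform_def by (auto simp: power2_eq_square)
 have le: "\<bar>incr w p * incr v p * K p\<bar> <= M * (f p * g p)" for p
 proof -
  have "\<bar>incr w p * incr v p * K p\<bar> <= \<bar>incr w p * incr v p\<bar> * (M * kern2 s p)"
   unfolding abs_mult[of "incr w p * incr v p"] by (intro mult_left_mono M) auto
  also have "... = M * (f p * g p)"
   by (simp add: f_def g_def abs_mult)
  finally show ?thesis .
 qed
 have iM: "integrable lborel2 (%p. M * (f p * g p))" using i(1) by simp
 show int: "integrable lborel2 (%p. incr w p * incr v p * K p)"
  by (rule Bochner_Integration.integrable_bound[OF iM])
   (use le in \<open>auto intro!: AE_I2 order_trans[OF le abs_ge_self]\<close>)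
 have "\<bar>kform K w v\<bar> <= (\<integral>p. \<bar>incr w p * incr v p * K p\<bar> \<partial>lborel2)"
  unfolding kform_def by (rule integral_abs_bound)
 also have "... <= (\<integral>p. M * (f p * g p) \<partial>lborel2)"
  by (intro integral_mono le iM integrable_abs int)
 also have "... = M * (\<integral>p. f p * g p \<partial>lborel2)" by simp
 also have "... <= M * (enorm s w * enorm s v)" using i(2) M(2) by (intro mult_left_mono) auto
 finally show "\<bar>kform K w v\<bar> <= M * enorm s w * enorm s v" by (simp add: mult.assoc)
qed

lemma kform_CS:
 assumes w: "w \<in> Htilde s Omega" and v: "v \<in> Htilde s Omega"
 shows "integrable lborel2 (%p. incr w p * incr v p * kern2 s p)"
  and "\<bar>kform (kern2 s) w v\<bar> <= enorm s w * enorm s v"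
 using kform_bound[OF w v, of "kern2 s" 1] by auto

text \<open>The iterated Bochner integral in \<open>bform\<close> agrees with the product integral
  by Fubini, which requires the integrability that \<open>kform_CS\<close> provides on the energy
  space.\<close>

lemma bform_eq_kform:
 assumes w: "w \<in> Htilde s Omega" and v: "v \<in> Htilde s Omega"
 shows "bform s w v = Cconst s / 2 * kform (kern2 s) w v"
 unfolding bform_def kform_def
 by (subst lborel_pair.integral_fst'[OF kform_CS(1)[OF w v], symmetric])
  (simp add: incr_def kern2_def kern_def)

text \<open>Gamma (1 - s) = - s * Gamma (- s) is positive, hence Gamma (- s) is negative and cancels
  the leading sign.\<close>

lemma Cconst_pos:
 assumes "0 < s" "s < 1"
 shows "Cconst s > 0"
proof -
 have "Gamma (- s + 1) = - s * Gamma (- s)"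
 proof (rule Gamma_plus1)
  show "- s \<notin> \<int>\<^sub>\<le>\<^sub>0"
  proof
   assume "- s \<in> \<int>\<^sub>\<le>\<^sub>0"
   then obtain n :: int where n: "- s = of_int n" by (auto elim: nonpos_Ints_cases)
   then have "real_of_int n < 0" "real_of_int n > - 1" using assms by linarith+
   then have "n < 0" "n > - 1" by linarith+
   then show False by simp
  qed
 qed
 moreover have "Gamma (- s + 1) > 0" using assms by (intro Gamma_real_pos) auto
 ultimately have "s * Gamma (- s) < 0" by simp
 then have "Gamma (- s) < 0" using assms by (simp add: mult_less_0_iff)
 moreover have "Gamma (s + 3/2) > 0" using assms by (intro Gamma_real_pos) auto
 ultimately show ?thesis
  unfolding Cconst_def by (intro divide_neg_neg mult_neg_pos mult_pos_neg) auto
qed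

lemma Htilde_linear:
 assumes s: "0 < s" and w: "w \<in> Htilde s Omega" and v: "v \<in> Htilde s Omega"
 shows "(%x. a * w x + b * v x) \<in> Htilde s Omega"
proof -
 note HtildeD(1)[OF w, measurable] HtildeD(1)[OF v, measurable]
 have le: "(incr (%x. a * w x + b * v x) p)\<^sup>2 * kern2 s p
  <= 2 * a\<^sup>2 * ((incr w p)\<^sup>2 * kern2 s p) + 2 * b\<^sup>2 * ((incr v p)\<^sup>2 * kern2 s p)" for p
 proof -
  have "incr (%x. a * w x + b * v x) p = a * incr w p + b * incr v p"
   by (simp add: incr_def algebra_simps)
  then have "(incr (%x. a * w x + b * v x) p)\<^sup>2 <= 2 * a\<^sup>2 * (incr w p)\<^sup>2 + 2 * b\<^sup>2 * (incr v p)\<^sup>2"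
   using sum_squares_bound[of "a * incr w p" "b * incr v p"] by (simp add: power2_sum power_mult_distrib)
  then have "(incr (%x. a * w x + b * v x) p)\<^sup>2 * kern2 s p <= (2 * a\<^sup>2 * (incr w p)\<^sup>2 + 2 * b\<^sup>2 * (incr v p)\<^sup>2) * kern2 s p"
   by (intro mult_right_mono) auto
  then show ?thesis by (simp add: algebra_simps)
 qed
 have "integrable lborel2 (%p. (incr (%x. a * w x + b * v x) p)\<^sup>2 * kern2 s p)"
  by (rule Bochner_Integration.integrable_bound[of _ "%p. 2 * a\<^sup>2 * ((incr w p)\<^sup>2 * kern2 s p) + 2 * b\<^sup>2 * ((incr v p)\<^sup>2 * kern2 s p)"])
   (auto intro!: AE_I2 integrable_incr_sq w v le Bochner_Integration.integrable_add integrable_mult_right)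
 then have "(\<integral>\<^sup>+p. ennreal ((incr (%x. a * w x + b * v x) p)\<^sup>2 * kern2 s p) \<partial>lborel2) < \<infinity>"
  by (subst nn_integral_eq_integral) auto
 then show ?thesis
  unfolding Htilde_iff[OF s] using HtildeD(3)[OF w] HtildeD(3)[OF v] by (auto simp: gagliardo_prod)
qed

lemma Htilde_add: "0 < s ==> w \<in> Htilde s Omega ==> v \<in> Htilde s Omega ==> (%x. w x + v x) \<in> Htilde s Omega"
 using Htilde_linear[of s w v 1 1] by simp

lemma Htilde_diff: "0 < s ==> w \<in> Htilde s Omega ==> v \<in> Htilde s Omega ==> (%x. w x - v x) \<in> Htilde s Omega"
 using Htilde_linear[of s w v 1 "-1"] by simp

lemma kform_commute: "kform K w v = kform K v w"
 by (simp add: kform_def mult.commute)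

lemma kform_linear_right:
 assumes "integrable lborel2 (%p. incr w p * incr v p * K p)" "integrable lborel2 (%p. incr w p * incr v' p * K p)"
 shows "kform K w (%x. a * v x + b * v' x) = a * kform K w v + b * kform K w v'"
proof -
 have "kform K w (%x. a * v x + b * v' x) = (\<integral>p. a * (incr w p * incr v p * K p) + b * (incr w p * incr v' p * K p) \<partial>lborel2)"
  unfolding kform_def by (rule Bochner_Integration.integral_cong) (auto simp: incr_def algebra_simps)
 then show ?thesis using assms by (simp add: kform_def)
qed

lemma kform_diff_right:
 assumes "w \<in> Htilde s Omega" "v \<in> Htilde s Omega" "v' \<in> Htilde s Omega"
 shows "kform (kern2 s) w (%x. v x - v' x) = kform (kern2 s) w v - kform (kern2 s) w v'"
 using kform_linear_right[of w v "kern2 s" v' 1 "-1"] kform_CS(1) assms by simp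

lemma kform_diff_left:
 assumes "w \<in> Htilde s Omega" "v \<in> Htilde s Omega" "v' \<in> Htilde s Omega"
 shows "kform (kern2 s) (%x. v x - v' x) w = kform (kern2 s) v w - kform (kern2 s) v' w"
 using kform_diff_right[OF assms] kform_commute[of "kern2 s" w] by metis

text \<open>Pythagoras: the Galerkin error is orthogonal to v - uN for the symmetric form, so in the
  energy norm the best-approximation constant is 1.\<close>

lemma cea:
 assumes s: "0 < s" and u: "u \<in> Htilde s Omega" and uN: "uN \<in> Htilde s Omega" and v: "v \<in> Htilde s Omega"
  and orth: "kform (kern2 s) u (%x. v x - uN x) = kform (kern2 s) uN (%x. v x - uN x)"
 shows "enorm s (%x. u x - uN x) <= enorm s (%x. u x - v x)"
proof -
 define d e where "d = (%x. v x - uN x)" and "e = (%x. u x - uN x)"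
 have d: "d \<in> Htilde s Omega" and e: "e \<in> Htilde s Omega"
  unfolding d_def e_def by (auto intro: Htilde_diff s u uN v)
 have 0: "kform (kern2 s) e d = 0"
  unfolding e_def using kform_diff_left[OF d u uN] orth by (simp add: d_def)
 have "(%x. u x - v x) = (%x. e x - d x)" by (auto simp: d_def e_def)
 then have "kform (kern2 s) (%x. u x - v x) (%x. u x - v x) = kform (kern2 s) (%x. e x - d x) (%x. e x - d x)"
  by simp
 also have "... = kform (kern2 s) e e - 2 * kform (kern2 s) e d + kform (kern2 s) d d"
  using kform_diff_left[OF Htilde_diff[OF s e d] e d] kform_diff_right[OF e e d] kform_diff_right[OF d e d]
   kform_commute[of "kern2 s" "%x. e x - d x" e] kform_commute[of "kern2 s" "%x. e x - d x" d] kform_commute[of "kern2 s" d e]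
  kform_diff_right[OF Htilde_diff[OF s e d] e d] by linarith
 finally show ?thesis
  using 0 kform_self_nonneg[of s d] unfolding enorm_def e_def[symmetric] by simp
qed

lemma enorm_triangle:
 assumes s: "0 < s" and w: "w \<in> Htilde s Omega" and v: "v \<in> Htilde s Omega"
 shows "enorm s (%x. w x + v x) <= enorm s w + enorm s v"
proof -
 have eq: "kform (kern2 s) (%x. w x + v x) (%x. w x + v x)
   = kform (kern2 s) w w + 2 * kform (kern2 s) w v + kform (kern2 s) v v"
 proof -
  have lin: "kform (kern2 s) a (%x. w x + v x) = kform (kern2 s) a w + kform (kern2 s) a v" if "a \<in> Htilde s Omega" for a
   using kform_linear_right[of a w "kern2 s" v 1 1] kform_CS(1) w v that by simp
  show ?thesis
   using lin[OF Htilde_add[OF s w v]] lin[OF w] lin[OF v]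
   using kform_commute[of "kern2 s" "%x. w x + v x" w] kform_commute[of "kern2 s" "%x. w x + v x" v]
    kform_commute[of "kern2 s" v w] by linarith
 qed
 have sq: "(enorm s a)\<^sup>2 = kform (kern2 s) a a" for a by (simp add: enorm_def kform_self_nonneg)
 have "(enorm s (%x. w x + v x))\<^sup>2 <= (enorm s w + enorm s v)\<^sup>2"
  using kform_CS(2)[OF w v] unfolding power2_sum sq eq by (auto simp: abs_le_iff)
 then show ?thesis by (rule power2_le_imp_le) simp
qed

lemma enorm_scale: "enorm s (%x. a * w x) = \<bar>a\<bar> * enorm s w"
proof -
 have "kform (kern2 s) (%x. a * w x) (%x. a * w x) = (\<integral>p. a\<^sup>2 * (incr w p * incr w p * kern2 s p) \<partial>lborel2)"
  unfolding kform_def by (rule Bochner_Integration.integral_cong) (auto simp: incr_def algebra_simps power2_eq_square)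
 then show ?thesis by (simp add: enorm_def kform_def real_sqrt_mult)
qed

lemma enorm_minus_commute: "enorm s (%x. w x - v x) = enorm s (%x. v x - w x)"
 using enorm_scale[of s "-1" "%x. w x - v x"] by simp

lemma enorm_diff_triangle:
 assumes s: "0 < s" and w: "w \<in> Htilde s Omega" and v: "v \<in> Htilde s Omega"
 shows "enorm s (%x. w x - v x) <= enorm s w + enorm s v"
 using enorm_triangle[OF s w Htilde_linear[OF s v v, of "-1" 0]] enorm_scale[of s "-1" v] by simp

lemma enorm_le:
 assumes "w \<in> Htilde s Omega" "gagliardo_sq s UNIV w <= ennreal (B\<^sup>2)" "0 <= B"
 shows "enorm s w <= B"
 using assms(2) unfolding gagliardo_eq_enorm[OF assms(1)]
 by (subst (asm) ennreal_le_iff) (auto intro: power2_le_imp_le[OF _ assms(3)])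

text \<open>The closed cube has volume 1, so Cauchy-Schwarz against its indicator bounds the L1 norm
  by the L2 norm. L1 is the norm in which the right-hand side and the pointwise estimate of the
  mollifier see a function.\<close>

lemma L1_le_enorm:
 assumes s: "0 < s" and w: "w \<in> Htilde s Omega"
 shows "integrable lborel w" "(\<integral>x. \<bar>w x\<bar> \<partial>lborel) <= enorm s w / sqrt (hardy_const s)"
proof -
 note HtildeD(1)[OF w, measurable]
 have "L2_sq UNIV w <= ennreal (1 / hardy_const s) * ennreal ((enorm s w)\<^sup>2)"
  unfolding gagliardo_eq_enorm[OF w, symmetric] by (intro L2_le_gagliardo s HtildeD[OF w])
 also have "... = ennreal ((enorm s w)\<^sup>2 / hardy_const s)"
  using hardy_const_pos[of s] by (simp add: ennreal_mult'[symmetric])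
 finally have L2: "(\<integral>\<^sup>+x. ennreal ((w x)\<^sup>2) \<partial>lborel) <= ennreal ((enorm s w)\<^sup>2 / hardy_const s)"
  by (simp add: L2_sq_def)
 have i: "integrable lborel (%x. (w x)\<^sup>2)"
  by (rule integrableI_nonneg) (use L2 in \<open>auto intro: le_less_trans\<close>)
 have le: "(\<integral>x. (w x)\<^sup>2 \<partial>lborel) <= (enorm s w)\<^sup>2 / hardy_const s"
  using L2 i hardy_const_pos[of s] by (subst (asm) nn_integral_eq_integral) (auto simp: ennreal_le_iff)
 define c where "c = (indicator (closure Omega) :: R3 => real)"
 have c2: "(%x. (c x)\<^sup>2) = c" by (auto simp: c_def power2_eq_square split: split_indicator)
 have ci: "integrable lborel c" "(\<integral>x. c x \<partial>lborel) = 1"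
  unfolding c_def using emeasure_closure_Omega by (auto simp: measure_def intro!: integrable_real_indicator)
 have [measurable]: "c \<in> borel_measurable borel" unfolding c_def by measurable
 have wc: "(%x. \<bar>w x\<bar> * c x) = (%x. \<bar>w x\<bar>)"
  using HtildeD(3)[OF w] by (auto simp: c_def split: split_indicator)
 have "integrable lborel (%x. \<bar>w x\<bar> * c x)"
  by (rule integral_Cauchy_Schwarz(1)) (auto simp: c2 ci i)
 then show "integrable lborel w" unfolding wc by (rule integrable_abs_cancel) simp
 have "\<bar>\<integral>x. \<bar>w x\<bar> * c x \<partial>lborel\<bar> <= sqrt (\<integral>x. \<bar>w x\<bar>\<^sup>2 \<partial>lborel) * sqrt (\<integral>x. (c x)\<^sup>2 \<partial>lborel)"
  by (rule integral_Cauchy_Schwarz(2)) (auto simp: c2 ci i)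
 also have "... = sqrt (\<integral>x. (w x)\<^sup>2 \<partial>lborel)" by (simp add: c2 ci)
 also have "... <= sqrt ((enorm s w)\<^sup>2 / hardy_const s)" using le by simp
 finally show "(\<integral>x. \<bar>w x\<bar> \<partial>lborel) <= enorm s w / sqrt (hardy_const s)"
  unfolding wc by (simp add: real_sqrt_divide)
qed

section \<open>Forward differences and Cauchy estimates\<close>

fun fd :: "real => nat => (real => real) => real => real" where
 "fd h 0 f t = f t"
| "fd h (Suc k) f t = fd h k f (t + h) - fd h k f t"

lemma fd_Suc': "fd h (Suc k) f t = fd h k (%t. f (t + h) - f t) t"
proof (induction k arbitrary: t)
 case (Suc k)
 have "fd h (Suc (Suc k)) f t = fd h (Suc k) f (t + h) - fd h (Suc k) f t" by (rule fd.simps(2))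
 also have "... = fd h k (%t. f (t + h) - f t) (t + h) - fd h k (%t. f (t + h) - f t) t"
  unfolding Suc.IH ..
 finally show ?case by simp
qed simp

lemma fd_add: "fd h k (%t. f t + g t) t = fd h k f t + fd h k g t"
 by (induction k arbitrary: t) auto

lemma fd_diff: "fd h k (%t. f t - g t) t = fd h k f t - fd h k g t"
 by (induction k arbitrary: t) auto

lemma fd_cmult: "fd h k (%t. c * f t) t = c * fd h k f t"
 by (induction k arbitrary: t) (auto simp: algebra_simps)

lemma fd_shift: "fd h k (%t. f (t + c)) t = fd h k f (t + c)"
 by (induction k arbitrary: t) (auto simp: algebra_simps)

lemma fd_cong:
 assumes "!!j. j <= k ==> f (t + real j * h) = g (t + real j * h)"
 shows "fd h k f t = fd h k g t"
 using assms
proof (induction k arbitrary: t)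
 case 0
 then show ?case using "0.prems"[of 0] by simp
next
 case (Suc k)
 have "fd h k f (t + h) = fd h k g (t + h)"
 proof (rule Suc.IH)
  fix j assume "j <= k"
  then show "f (t + h + real j * h) = g (t + h + real j * h)"
   using Suc.prems[of "Suc j"] by (simp add: algebra_simps)
 qed
 moreover have "fd h k f t = fd h k g t" by (rule Suc.IH) (use Suc.prems in auto)
 ultimately show ?case by simp
qed

text \<open>The shift is put on the first factor. Applied with the kernel as \<open>a\<close> and
  the solution as \<open>b\<close>, all differences of the solution are then taken at the same time
  \<open>t\<close>, so that testing the equation leads to a closed recursion.\<close>

lemma fd_Leibniz:
 "fd h k (%t. a t * b t) t = (\<Sum>j\<le>k. real (k choose j) * fd h j a (t + real (k - j) * h) * fd h (k - j) b t)"
proof (induction k arbitrary: a b t)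
 case 0
 then show ?case by simp
next
 case (Suc k)
 define G where "G j = fd h j a (t + real (Suc k - j) * h) * fd h (Suc k - j) b t" for j
 have "fd h (Suc k) (%t. a t * b t) t
   = fd h k (%t. a (t + h) * (b (t + h) - b t) + (a (t + h) - a t) * b t) t"
  unfolding fd_Suc' by (rule arg_cong[where f = "%f. fd h k f t"]) (auto simp: algebra_simps)
 also have "... = fd h k (%t. a (t + h) * (b (t + h) - b t)) t + fd h k (%t. (a (t + h) - a t) * b t) t"
  by (rule fd_add)
 also have "fd h k (%t. a (t + h) * (b (t + h) - b t)) t = (\<Sum>j\<le>k. real (k choose j) * G j)"
  unfolding Suc.IH
 proof (rule sum.cong[OF refl])
  fix j assume j: "j \<in> {..k}"
  have 1: "fd h j (%t. a (t + h)) (t + real (k - j) * h) = fd h j a (t + real (Suc k - j) * h)"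
   using j unfolding fd_shift by (simp add: Suc_diff_le algebra_simps)
  have 2: "fd h (k - j) (%t. b (t + h) - b t) t = fd h (Suc k - j) b t"
   using j unfolding fd_Suc'[symmetric] by (simp add: Suc_diff_le)
  show "real (k choose j) * fd h j (%t. a (t + h)) (t + real (k - j) * h) * fd h (k - j) (%t. b (t + h) - b t) t
    = real (k choose j) * G j"
   unfolding 1 2 G_def by simp
 qed
 also have "fd h k (%t. (a (t + h) - a t) * b t) t = (\<Sum>j\<le>k. real (k choose j) * G (Suc j))"
  unfolding Suc.IH by (rule sum.cong) (auto simp: G_def fd_Suc'[symmetric] simp del: fd.simps)
 also have "(\<Sum>j\<le>k. real (k choose j) * G j) + (\<Sum>j\<le>k. real (k choose j) * G (Suc j))
   = (\<Sum>j\<le>Suc k. real (Suc k choose j) * G j)"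
 proof -
  have "(\<Sum>j\<le>k. real (k choose j) * G j) = (\<Sum>j\<le>Suc k. real (k choose j) * G j)" by simp
  also have "... = G 0 + (\<Sum>j\<le>k. real (k choose Suc j) * G (Suc j))"
   by (subst sum.atMost_Suc_shift) simp
  finally have e: "(\<Sum>j\<le>k. real (k choose j) * G j) = G 0 + (\<Sum>j\<le>k. real (k choose Suc j) * G (Suc j))" .
  show ?thesis
   unfolding e by (subst sum.atMost_Suc_shift) (simp add: sum.distrib[symmetric] algebra_simps)
 qed
 finally show ?case by (simp add: G_def mult.assoc)
qed

lemma fd_integral:
 assumes "!!t. integrable M (F t)"
 shows "integrable M (%x. fd h k (%t. F t x) t)" "fd h k (%t. integral\<^sup>L M (F t)) t = (\<integral>x. fd h k (%t. F t x) t \<partial>M)"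
proof -
 have "integrable M (%x. fd h k (%t. F t x) t) \<and> fd h k (%t. integral\<^sup>L M (F t)) t = (\<integral>x. fd h k (%t. F t x) t \<partial>M)"
  by (induction k arbitrary: t) (use assms in auto)
 then show "integrable M (%x. fd h k (%t. F t x) t)" "fd h k (%t. integral\<^sup>L M (F t)) t = (\<integral>x. fd h k (%t. F t x) t \<partial>M)"
  by auto
qed

lemma fd_measurable:
 assumes "!!t. F t \<in> borel_measurable M"
 shows "(%x. fd h k (%t. F t x) t) \<in> borel_measurable M"
 by (induction k arbitrary: t) (use assms in auto)

text \<open>Mean value theorem of order k, with \<open>f j\<close> playing the j-th derivative. The
  induction passes to the increments \<open>g j\<close>, which are differentiable only up to b - h,
  and ends with the ordinary mean value theorem for \<open>f k\<close>.\<close>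

lemma fd_mean_value:
 assumes "!!k x. a < x ==> x < b ==> (f k has_real_derivative f (Suc k) x) (at x)"
  and "h > 0" "a < t" "t + real k * h < b"
 shows "\<exists>\<xi>. t <= \<xi> \<and> \<xi> <= t + real k * h \<and> fd h k (f 0) t = h ^ k * f k \<xi>"
 using assms
proof (induction k arbitrary: f b)
 case 0
 then show ?case by auto
next
 case (Suc k)
 define g where "g j x = f j (x + h) - f j x" for j x
 have "\<exists>\<xi>. t <= \<xi> \<and> \<xi> <= t + real k * h \<and> fd h k (g 0) t = h ^ k * g k \<xi>"
 proof (rule Suc.IH[where b = "b - h"])
  fix j x assume x: "a < x" "x < b - h"
  have "(f j has_real_derivative f (Suc j) (x + h)) (at (x + h))"
   using x Suc.prems(2) by (intro Suc.prems(1)) auto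
  then have "((%x. f j (x + h)) has_real_derivative f (Suc j) (x + h)) (at x)"
   by (simp add: DERIV_shift)
  moreover have "(f j has_real_derivative f (Suc j) x) (at x)"
   using x Suc.prems(2) by (intro Suc.prems(1)) auto
  ultimately show "(g j has_real_derivative g (Suc j) x) (at x)"
   unfolding g_def[abs_def] by (rule DERIV_diff)
 qed (use Suc.prems in \<open>auto simp: algebra_simps\<close>)
 then obtain \<xi> where \<xi>: "t <= \<xi>" "\<xi> <= t + real k * h" "fd h k (g 0) t = h ^ k * g k \<xi>" by blast
 have "\<exists>z. \<xi> < z \<and> z < \<xi> + h \<and> f k (\<xi> + h) - f k \<xi> = (\<xi> + h - \<xi>) * f (Suc k) z"
  by (rule MVT2) (use Suc.prems \<xi> in \<open>auto simp: algebra_simps intro!: Suc.prems(1)\<close>)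
 then obtain z where z: "\<xi> < z" "z < \<xi> + h" "f k (\<xi> + h) - f k \<xi> = h * f (Suc k) z" by auto
 have "fd h (Suc k) (f 0) t = fd h k (g 0) t"
  unfolding fd_Suc' g_def ..
 then have "fd h (Suc k) (f 0) t = h ^ Suc k * f (Suc k) z"
  using \<xi>(3) z(3) by (simp add: g_def)
 then show ?case using z \<xi> by (intro exI[of _ z]) (auto simp: algebra_simps)
qed

lemma holomorphic_higher_deriv_real:
 assumes g: "g holomorphic_on S" "open S" and x: "complex_of_real x \<in> S"
 shows "((%x. Re ((deriv ^^ k) g (of_real x))) has_real_derivative Re ((deriv ^^ Suc k) g (of_real x))) (at x)"
proof -
 have "(deriv ^^ k) g holomorphic_on S" by (intro holomorphic_higher_deriv g)
 then have "((deriv ^^ k) g has_field_derivative deriv ((deriv ^^ k) g) (of_real x)) (at (of_real x))"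
  using g(2) x holomorphic_derivI by blast
 then have "((%x. (deriv ^^ k) g (of_real x)) has_vector_derivative deriv ((deriv ^^ k) g) (of_real x)) (at x)"
  by (rule has_vector_derivative_real_field)
 then have "((%x. Re ((deriv ^^ k) g (of_real x))) has_vector_derivative Re (deriv ((deriv ^^ k) g) (of_real x))) (at x)"
  by (rule bounded_linear.has_vector_derivative[OF bounded_linear_Re])
 then show ?thesis by (simp add: has_real_derivative_iff_has_vector_derivative)
qed

text \<open>The mean value point lies within R/4 of 0, so Cauchy's inequality on a disc of radius
  R/2 around it stays inside the ball of radius R; this gives the factor 2 / R per order.\<close>

lemma fd_holomorphic_bound:
 assumes g: "g holomorphic_on ball 0 R" and M: "!!z. norm z < R ==> norm (g z) <= M"
  and gr: "!!t. \<bar>t\<bar> < R ==> g (of_real t) = of_real (gr t)"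
  and R: "R > 0" and h: "h > 0" and t: "0 <= t" "t + real k * h <= R / 4"
 shows "\<bar>fd h k gr t\<bar> <= M * fact k * (2 * h / R) ^ k"
proof -
 define f where "f k x = Re ((deriv ^^ k) g (of_real x))" for k x
 have "\<exists>\<xi>. t <= \<xi> \<and> \<xi> <= t + real k * h \<and> fd h k (f 0) t = h ^ k * f k \<xi>"
 proof (rule fd_mean_value[where a = "-R" and b = R])
  fix j x assume "- R < x" "x < R"
  then show "(f j has_real_derivative f (Suc j) x) (at x)"
   unfolding f_def[abs_def] by (intro holomorphic_higher_deriv_real[OF g]) auto
 qed (use R h t in auto)
 then obtain \<xi> where \<xi>: "t <= \<xi>" "\<xi> <= t + real k * h" "fd h k (f 0) t = h ^ k * f k \<xi>" by blast
 have "fd h k gr t = fd h k (f 0) t"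
 proof (rule fd_cong)
  fix j assume "j <= k"
  then have "real j * h <= real k * h" using h by (intro mult_right_mono) auto
  moreover have "0 <= real j * h" using h by simp
  ultimately have "\<bar>t + real j * h\<bar> < R" using t R by linarith
  then show "gr (t + real j * h) = f 0 (t + real j * h)"
   using gr[of "t + real j * h"] by (simp add: f_def del: of_real_add)
 qed
 moreover have sub: "cball (of_real \<xi>) (R/2) \<subseteq> ball (0::complex) R"
 proof
  fix z :: complex assume z: "z \<in> cball (of_real \<xi>) (R/2)"
  have "norm z <= norm (of_real \<xi> :: complex) + norm (of_real \<xi> - z)"
   by (metis norm_triangle_sub add.commute norm_minus_commute)
  also have "... <= R/4 + R/2" using z \<xi> t by (intro add_mono) (auto simp: dist_norm)
  also have "... < R" using R by simp
  finally show "z \<in> ball 0 R" by simp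
 qed
 have "norm ((deriv ^^ k) g (of_real \<xi>)) <= fact k * M / (R/2) ^ k"
 proof (rule Cauchy_inequality)
  show "g holomorphic_on ball (of_real \<xi>) (R/2)" 
   by (rule holomorphic_on_subset[OF g]) (use sub ball_subset_cball in blast)
  show "continuous_on (cball (of_real \<xi>) (R/2)) g"
   by (rule continuous_on_subset[OF holomorphic_on_imp_continuous_on[OF g] sub])
  fix x :: complex assume "norm (of_real \<xi> - x) = R/2"
  then have "x \<in> ball 0 R" using sub by (auto simp: dist_norm)
  then show "norm (g x) <= M" using M by simp
 qed (use R in simp)
 then have "\<bar>f k \<xi>\<bar> <= fact k * M / (R/2) ^ k"
  unfolding f_def using abs_Re_le_cmod order_trans by blast
 then have "h ^ k * \<bar>f k \<xi>\<bar> <= h ^ k * (fact k * M / (R/2) ^ k)"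
  using h by (intro mult_left_mono) auto
 ultimately show ?thesis
  using \<xi>(3) h R by (simp add: abs_mult power_mult_distrib power_divide field_simps)
qed

text \<open>Discrete Gronwall: inserting the bound into the sum produces a geometric series with 1 +
  r * (sum of (1+r)^i for i < k) = (1+r)^k.\<close>

lemma recurrence_bound:
 fixes a :: "nat => real"
 assumes "!!k. a k <= r * c * A ^ k + r * (\<Sum>j=1..k. A ^ j * a (k - j))" and "r \<ge> 0" "A > 0"
 shows "a k <= r * c * (A * (1 + r)) ^ k"
proof (induction k rule: less_induct)
 case (less k)
 have "a k <= r * c * A ^ k + r * (\<Sum>j=1..k. A ^ j * a (k - j))" by (rule assms)
 also have "(\<Sum>j=1..k. A ^ j * a (k - j)) <= (\<Sum>j=1..k. A ^ j * (r * c * (A * (1 + r)) ^ (k - j)))"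
  using assms(3) by (intro sum_mono mult_left_mono less.IH) auto
 also have "... = (\<Sum>j=1..k. A ^ k * (r * c * (1 + r) ^ (k - j)))"
 proof (rule sum.cong[OF refl])
  fix j assume "j \<in> {1..k}"
  then have "A ^ k = A ^ j * A ^ (k - j)" by (simp add: power_add[symmetric])
  then show "A ^ j * (r * c * (A * (1 + r)) ^ (k - j)) = A ^ k * (r * c * (1 + r) ^ (k - j))"
   by (simp add: power_mult_distrib)
 qed
 also have "... = A ^ k * (r * c) * (\<Sum>j=1..k. (1 + r) ^ (k - j))"
  by (simp add: sum_distrib_left mult_ac)
 also have "(\<Sum>j=1..k. (1 + r) ^ (k - j)) = (\<Sum>i<k. (1 + r) ^ i)"
  by (rule sum.reindex_bij_witness[of _ "%i. k - i" "%j. k - j"]) auto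
 finally have "a k <= r * c * A ^ k + r * (A ^ k * (r * c) * (\<Sum>i<k. (1 + r) ^ i))"
  using assms(2) by (simp add: mult_left_mono)
 also have "... = r * c * A ^ k * (1 + r * (\<Sum>i<k. (1 + r) ^ i))" by (simp add: algebra_simps)
 also have "r * (\<Sum>i<k. (1 + r) ^ i) = (1 + r) ^ k - 1"
  using one_diff_power_eq[of "1 + r" k] by simp
 finally show ?case by (simp add: power_mult_distrib)
qed

section \<open>The logistic flow with real time: group law, bi-Lipschitz bounds, change of
  variables\<close>

text \<open>In the variable ln (t / (1 - t)) this is translation by \<open>e\<close>, whence the
  group law \<open>Tf_add\<close>. Continuing it by the identity makes it bi-Lipschitz on the whole
  line, as composition in the full-space seminorm requires.\<close>

definition Tf :: "real => real => real" where
 "Tf e t = (if 0 < t \<and> t < 1 then exp e * t / (1 + (exp e - 1) * t) else t)"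

text \<open>At 0 and 1 the one-sided derivatives of \<open>Tf e\<close> differ unless e = 0; the
  value 1 there sits on a null set.\<close>

definition dTf :: "real => real => real" where
 "dTf e t = (if 0 < t \<and> t < 1 then exp e / (1 + (exp e - 1) * t)\<^sup>2 else 1)"

lemma Tf_den_pos:
 assumes "0 <= t" "t <= 1"
 shows "0 < 1 + (exp e - 1) * (t::real)"
proof -
 have "1 + (exp e - 1) * t = (1 - t) + exp e * t" by (simp add: algebra_simps)
 moreover have "0 < (1 - t) + exp e * t"
 proof (cases "t = 0")
  case False
  then have "0 < exp e * t" using assms by simp
  then show ?thesis using assms by linarith
 qed simp
 ultimately show ?thesis by simp
qed

lemma Tf_closed: "0 <= t ==> t <= 1 ==> Tf e t = exp e * t / (1 + (exp e - 1) * t)"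
 by (cases "t = 0"; cases "t = 1") (auto simp: Tf_def)

lemma Tf_in:
 assumes "0 < t" "t < 1"
 shows "0 < Tf e t" "Tf e t < 1"
 using assms Tf_den_pos[of t e] by (auto simp: Tf_def divide_simps algebra_simps)

lemma Tf_outside [simp]: "\<not> (0 < t \<and> t < 1) ==> Tf e t = t"
 by (auto simp: Tf_def)

lemma Tf_in_iff: "0 < Tf e t \<and> Tf e t < 1 \<longleftrightarrow> 0 < t \<and> t < 1"
 using Tf_in[of t e] by (cases "0 < t \<and> t < 1") auto

lemma Tf_in_closed_iff: "0 <= Tf e t \<and> Tf e t <= 1 \<longleftrightarrow> 0 <= t \<and> t <= 1"
 using Tf_in[of t e] by (cases "0 < t \<and> t < 1") auto

lemma Tf_0 [simp]: "Tf 0 t = t"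
 by (simp add: Tf_def)

lemma Tf_add: "Tf (a + b) t = Tf a (Tf b t)"
proof (cases "0 < t \<and> t < 1")
 case True
 have d: "0 < 1 + (exp b - 1) * t" "0 < 1 + (exp (a + b) - 1) * t" "0 < 1 + (exp a - 1) * Tf b t"
  using True Tf_den_pos[of t b] Tf_den_pos[of t "a + b"] Tf_den_pos[of "Tf b t" a] Tf_in[of t b] by auto
 have eq: "Tf b t = exp b * t / (1 + (exp b - 1) * t)" using True by (simp add: Tf_def)
 have "1 + (exp a - 1) * Tf b t = (1 + (exp (a + b) - 1) * t) / (1 + (exp b - 1) * t)"
  unfolding eq using d(1) by (simp add: field_simps exp_add)
 then have "exp a * Tf b t / (1 + (exp a - 1) * Tf b t) = exp (a + b) * t / (1 + (exp (a + b) - 1) * t)"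
  unfolding eq using d by (simp add: exp_add)
 then show ?thesis using True Tf_in[of t b] by (simp add: Tf_def[of a] Tf_def[of "a + b"])
qed (auto simp: Tf_def)

lemma Tf_inverse [simp]: "Tf (- e) (Tf e t) = t" "Tf e (Tf (- e) t) = t"
 using Tf_add[of "- e" e t] Tf_add[of e "- e" t] by auto

text \<open>A Moebius map has an exact difference factor. Bounding it in
  \<open>Tf_factor_bounds\<close> gives the Lipschitz bound on the unit interval and, for t = r,
  both bounds of \<open>dTf\<close>.\<close>

lemma Tf_diff:
 assumes "0 <= t" "t <= 1" "0 <= r" "r <= 1"
 shows "Tf e t - Tf e r = exp e / ((1 + (exp e - 1) * t) * (1 + (exp e - 1) * r)) * (t - r)"
 using assms Tf_den_pos[of t e] Tf_den_pos[of r e] unfolding Tf_closed[OF assms(1,2)] Tf_closed[OF assms(3,4)]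
 by (simp add: diff_frac_eq) (simp add: algebra_simps)

lemma Tf_den_bounds:
 assumes "0 <= t" "t <= 1"
 shows "exp (min 0 e) <= 1 + (exp e - 1) * t" "1 + (exp e - 1) * t <= exp (max 0 (e::real))"
proof -
 have eq: "1 + (exp e - 1) * t = (1 - t) + t * exp e" by (simp add: algebra_simps)
 have "exp (min 0 e) <= 1" "exp (min 0 e) <= exp e" "1 <= exp (max 0 e)" "exp e <= exp (max 0 e)" by auto
 moreover have "(1 - t) * exp (min 0 e) + t * exp (min 0 e) = exp (min 0 e)" 
  "(1 - t) * exp (max 0 e) + t * exp (max 0 e) = exp (max 0 e)" by (simp_all add: algebra_simps)
 ultimately show "exp (min 0 e) <= 1 + (exp e - 1) * t" "1 + (exp e - 1) * t <= exp (max 0 e)"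
  unfolding eq using assms mult_left_mono[of "exp (min 0 e)" 1 "1 - t"] mult_left_mono[of "exp (min 0 e)" "exp e" t]
   mult_left_mono[of 1 "exp (max 0 e)" "1 - t"] mult_left_mono[of "exp e" "exp (max 0 e)" t] by auto
qed

text \<open>Each denominator is a convex combination of 1 and exp e, hence lies between exp (min 0
  e) and exp (max 0 e).\<close>

lemma Tf_factor_bounds:
 fixes t r e :: real
 assumes "0 <= t" "t <= 1" "0 <= r" "r <= 1"
 shows "exp (- \<bar>e\<bar>) <= exp e / ((1 + (exp e - 1) * t) * (1 + (exp e - 1) * r))"
  "exp e / ((1 + (exp e - 1) * t) * (1 + (exp e - 1) * r)) <= exp \<bar>e\<bar>"
proof -
 define a b where "a = 1 + (exp e - 1) * t" and "b = 1 + (exp e - 1) * r"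
 have p: "a > 0" "b > 0" using assms Tf_den_pos[of t e] Tf_den_pos[of r e] by (simp_all add: a_def b_def)
 have "a * b <= exp (max 0 e) * exp (max 0 e)"
  unfolding a_def b_def using assms Tf_den_pos[of t e] Tf_den_pos[of r e] by (intro mult_mono Tf_den_bounds) auto
 then have "exp (- \<bar>e\<bar>) * (a * b) <= exp (- \<bar>e\<bar>) * (exp (max 0 e) * exp (max 0 e))" by (intro mult_left_mono) auto
 also have "... = exp e" by (auto simp: mult_exp_exp max_def)
 finally show "exp (- \<bar>e\<bar>) <= exp e / ((1 + (exp e - 1) * t) * (1 + (exp e - 1) * r))"
  unfolding a_def[symmetric] b_def[symmetric] using p by (simp add: pos_le_divide_eq)
 have "exp (min 0 e) * exp (min 0 e) <= a * b"
  unfolding a_def b_def using assms Tf_den_pos[of t e] Tf_den_pos[of r e] by (intro mult_mono Tf_den_bounds) auto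
 then have "exp \<bar>e\<bar> * (exp (min 0 e) * exp (min 0 e)) <= exp \<bar>e\<bar> * (a * b)" by (intro mult_left_mono) auto
 moreover have "exp \<bar>e\<bar> * (exp (min 0 e) * exp (min 0 e)) = exp e" by (auto simp: mult_exp_exp min_def)
 ultimately show "exp e / ((1 + (exp e - 1) * t) * (1 + (exp e - 1) * r)) <= exp \<bar>e\<bar>"
  unfolding a_def[symmetric] b_def[symmetric] using p by (simp add: pos_divide_le_eq)
qed

lemma dTf_bounds: "exp (- \<bar>e\<bar>) <= dTf e t" "dTf e t <= exp \<bar>e\<bar>"
 using Tf_factor_bounds[of t t e] by (auto simp: dTf_def power2_eq_square)

lemma dTf_pos: "0 < dTf e t"
 using dTf_bounds(1)[of e t] exp_gt_zero less_le_trans by blast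

definition clamp01 :: "real => real" where
 "clamp01 x = max 0 (min 1 x)"

lemma clamp01_in: "0 <= clamp01 x" "clamp01 x <= 1"
 by (auto simp: clamp01_def)

text \<open>Clamping and its remainder are both nondecreasing, so their increments add up without
  cancellation. Since the flow moves the clamped part alone, Lipschitz bounds on the unit interval
  pass to the line with the same constant; the complex flow uses this too.\<close>

lemma clamp01_split: "\<bar>x - y\<bar> = \<bar>clamp01 x - clamp01 y\<bar> + \<bar>(x - clamp01 x) - (y - clamp01 y)\<bar>"
 by (auto simp: clamp01_def max_def min_def)

lemma Tf_clamp01: "Tf e x - x = Tf e (clamp01 x) - clamp01 x"
 by (cases "x <= 0"; cases "1 <= x") (auto simp: clamp01_def Tf_def)

lemma Tf_Lipschitz: "\<bar>Tf e x - Tf e y\<bar> <= exp \<bar>e\<bar> * \<bar>x - y\<bar>"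
proof -
 have "Tf e x - Tf e y = (Tf e (clamp01 x) - Tf e (clamp01 y)) + ((x - clamp01 x) - (y - clamp01 y))"
  using Tf_clamp01[of e x] Tf_clamp01[of e y] by linarith
 also have "\<bar>...\<bar> <= \<bar>Tf e (clamp01 x) - Tf e (clamp01 y)\<bar> + \<bar>(x - clamp01 x) - (y - clamp01 y)\<bar>" by (rule abs_triangle_ineq)
 also have "\<bar>Tf e (clamp01 x) - Tf e (clamp01 y)\<bar> <= exp \<bar>e\<bar> * \<bar>clamp01 x - clamp01 y\<bar>"
 proof -
  have "0 <= exp e / ((1 + (exp e - 1) * clamp01 x) * (1 + (exp e - 1) * clamp01 y))"
   by (intro divide_nonneg_nonneg mult_nonneg_nonneg less_imp_le[OF Tf_den_pos]) (auto simp: clamp01_in)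
  then show ?thesis
   unfolding Tf_diff[OF clamp01_in clamp01_in] abs_mult[of _ "clamp01 x - clamp01 y"]
   using Tf_factor_bounds(2)[OF clamp01_in clamp01_in, of e x y] by (intro mult_right_mono) linarith+
 qed
 also have "\<bar>(x - clamp01 x) - (y - clamp01 y)\<bar> <= exp \<bar>e\<bar> * \<bar>(x - clamp01 x) - (y - clamp01 y)\<bar>"
  by (rule mult_left_le_imp_le[of 1]) (auto simp: mult_right_mono[of 1 "exp \<bar>e\<bar>", simplified])
 finally show ?thesis using clamp01_split[of x y] by (simp add: distrib_left)
qed

lemma Tf_strict_mono: assumes "x < y" shows "Tf e x < Tf e y"
proof -
 consider "y <= 0" | "x <= 0" "0 < y" "y < 1" | "x <= 0" "1 <= y" | "0 < x" "y < 1" | "0 < x" "x < 1" "1 <= y" | "1 <= x"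
  using assms by linarith
 then show ?thesis
 proof cases
  case 4
  have "0 < exp e / ((1 + (exp e - 1) * y) * (1 + (exp e - 1) * x))"
   using 4 assms by (intro divide_pos_pos mult_pos_pos Tf_den_pos) auto
  then have "0 < exp e / ((1 + (exp e - 1) * y) * (1 + (exp e - 1) * x)) * (y - x)"
   using assms by (intro mult_pos_pos) auto
  then have "0 < Tf e y - Tf e x"
   using 4 assms Tf_diff[of y x e] by simp
  then show ?thesis by simp
 qed (use assms Tf_in[of x e] Tf_in[of y e] in auto)
qed

lemma Tf_less_iff: "Tf e x < Tf e y \<longleftrightarrow> x < y"
 using Tf_strict_mono[of x y e] Tf_strict_mono[of y x e] by (metis linorder_neqE_linordered_idom not_less_iff_gr_or_eq)

lemma isCont_Tf: "isCont (Tf e) x"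
proof -
 have "(exp \<bar>e\<bar>)-lipschitz_on UNIV (Tf e)"
  by (rule lipschitz_onI) (auto simp: dist_real_def Tf_Lipschitz)
 then have "continuous_on UNIV (Tf e)" by (rule lipschitz_on_continuous_on)
 then show ?thesis by (simp add: continuous_on_eq_continuous_at)
qed

lemma measurable_Tf [measurable]: "Tf e \<in> borel_measurable borel"
 by (intro borel_measurable_continuous_onI continuous_at_imp_continuous_on) (auto intro: isCont_Tf)

lemma measurable_dTf [measurable]: "dTf e \<in> borel_measurable borel"
 unfolding dTf_def[abs_def] by measurable

lemma Tf_deriv:
 assumes "x \<noteq> 0" "x \<noteq> 1"
 shows "(Tf e has_real_derivative dTf e x) (at x)"
proof -
 consider "x < 0" | "1 < x" | "0 < x" "x < 1" using assms by linarith
 then show ?thesis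
 proof cases
  case 1
  have "((%x. x) has_real_derivative dTf e x) (at x)" using 1 by (auto simp: dTf_def intro!: derivative_eq_intros)
  then show ?thesis
   by (rule has_field_derivative_transform_within_open[where S = "{..<0}"]) (use 1 in \<open>auto simp: Tf_def\<close>)
 next
  case 2
  have "((%x. x) has_real_derivative dTf e x) (at x)" using 2 by (auto simp: dTf_def intro!: derivative_eq_intros)
  then show ?thesis
   by (rule has_field_derivative_transform_within_open[where S = "{1<..}"]) (use 2 in \<open>auto simp: Tf_def\<close>)
 next
  case 3
  have n: "1 + (exp e - 1) * x \<noteq> 0" using Tf_den_pos[of x e] 3 by simp
  have "((%x. exp e * x / (1 + (exp e - 1) * x)) has_real_derivative dTf e x) (at x)"
   using 3 n by (auto simp: dTf_def power2_eq_square intro!: derivative_eq_intros) (simp add: algebra_simps)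
  then show ?thesis
   by (rule has_field_derivative_transform_within_open[where S = "{0<..<1}"]) (use 3 in \<open>auto simp: Tf_def\<close>)
 qed
qed

lemma nn_integral_dTf:
 assumes "a <= b"
 shows "(\<integral>\<^sup>+t. ennreal (dTf e t) * indicator {a<..<b} t \<partial>lborel) = ennreal (Tf e b - Tf e a)"
proof -
 have "(dTf e has_integral (Tf e b - Tf e a)) {a..b}"
 proof (rule fundamental_theorem_of_calculus_interior_strong[of "{0, 1}"])
  fix x assume "x \<in> {a<..<b} - {0, 1}"
  then show "(Tf e has_vector_derivative dTf e x) (at x)"
   using Tf_deriv[of x e] by (simp add: has_real_derivative_iff_has_vector_derivative)
 qed (use assms in \<open>auto intro!: continuous_at_imp_continuous_on isCont_Tf\<close>)
 then have "((%t. if t \<in> {a..b} then dTf e t else 0) has_integral (Tf e b - Tf e a)) UNIV"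
  by (simp only: has_integral_restrict_UNIV)
 then have I: "(\<integral>\<^sup>+t. ennreal (if t \<in> {a..b} then dTf e t else 0) \<partial>lborel) = ennreal (Tf e b - Tf e a)"
  by (intro nn_integral_has_integral_lborel) (auto simp: less_imp_le[OF dTf_pos])
 have "AE t in lborel. t \<noteq> a" "AE t in lborel. t \<noteq> b" by (auto intro: AE_lborel_singleton)
 then have "AE t in lborel. ennreal (dTf e t) * indicator {a<..<b} t = ennreal (if t \<in> {a..b} then dTf e t else 0)"
  by eventually_elim (auto split: split_indicator)
 then show ?thesis using I nn_integral_cong_AE by metis
qed

text \<open>The three coordinate flows commute, so the time is a vector and \<open>Sf\<close> is an
  action of the additive group of R3 (\<open>Sf_add\<close>); mollifying over the time is a
  convolution for this action.\<close>

definition Sf :: "R3 => R3 => R3" where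
 "Sf d x = (\<chi> i. Tf (d $ i) (x $ i))"

definition Jf :: "R3 => R3 => real" where
 "Jf d x = (\<Prod>i\<in>UNIV. dTf (d $ i) (x $ i))"

lemma Sf_nth [simp]: "Sf d x $ i = Tf (d $ i) (x $ i)"
 by (simp add: Sf_def)

lemma Sf_add: "Sf (a + b) x = Sf a (Sf b x)"
 by (simp add: vec_eq_iff Tf_add)

lemma Sf_0 [simp]: "Sf 0 x = x"
 by (simp add: vec_eq_iff)

lemma Sf_inverse [simp]: "Sf (- d) (Sf d x) = x" "Sf d (Sf (- d) x) = x"
 by (simp_all add: vec_eq_iff)

lemma Sf_Omega: "Sf d x \<in> Omega \<longleftrightarrow> x \<in> Omega" "Sf d x \<in> closure Omega \<longleftrightarrow> x \<in> closure Omega"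
 unfolding closure_Omega by (auto simp: Omega_def Tf_in_iff Tf_in_closed_iff)

lemma Jf_pos: "0 < Jf d x"
 unfolding Jf_def by (intro prod_pos) (auto simp: dTf_pos)

lemma Jf_bounds: "exp (- 3 * norm d) <= Jf d x" "Jf d x <= exp (3 * norm d)"
proof -
 have "(\<Prod>i\<in>(UNIV::3 set). exp (- norm d)) <= Jf d x"
  unfolding Jf_def
 proof (rule prod_mono)
  fix i :: 3
  have "exp (- norm d) <= exp (- \<bar>d $ i\<bar>)" using component_le_norm_cart[of d i] by simp
  then show "0 <= exp (- norm d) \<and> exp (- norm d) <= dTf (d $ i) (x $ i)"
   using dTf_bounds(1)[of "d $ i" "x $ i"] order_trans exp_ge_zero by blast
 qed
 then show "exp (- 3 * norm d) <= Jf d x" by (simp add: exp_of_nat_mult[symmetric])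
 have "Jf d x <= (\<Prod>i\<in>(UNIV::3 set). exp (norm d))"
  unfolding Jf_def
 proof (rule prod_mono)
  fix i :: 3
  have "exp \<bar>d $ i\<bar> <= exp (norm d)" using component_le_norm_cart[of d i] by simp
  then show "0 <= dTf (d $ i) (x $ i) \<and> dTf (d $ i) (x $ i) <= exp (norm d)"
   using dTf_bounds(2)[of "d $ i" "x $ i"] less_imp_le[OF dTf_pos[of "d $ i" "x $ i"]] order_trans by blast
 qed
 then show "Jf d x <= exp (3 * norm d)" by (simp add: exp_of_nat_mult[symmetric])
qed

lemma Sf_Lipschitz: "norm (Sf d x - Sf d z) <= exp (norm d) * norm (x - z)"
proof -
 have "norm (Sf d x - Sf d z) <= norm (exp (norm d) *\<^sub>R (x - z))"
 proof (rule norm_le_componentwise_cart)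
  fix i :: 3
  have "\<bar>Tf (d $ i) (x $ i) - Tf (d $ i) (z $ i)\<bar> <= exp \<bar>d $ i\<bar> * \<bar>x $ i - z $ i\<bar>" by (rule Tf_Lipschitz)
  also have "... <= exp (norm d) * \<bar>x $ i - z $ i\<bar>" using component_le_norm_cart[of d i] by (intro mult_right_mono) auto
  finally show "norm ((Sf d x - Sf d z) $ i) <= norm ((exp (norm d) *\<^sub>R (x - z)) $ i)" by (simp add: abs_mult)
 qed
 then show ?thesis by simp
qed

lemma Sf_Lipschitz_below: "norm (x - z) <= exp (norm d) * norm (Sf d x - Sf d z)"
 using Sf_Lipschitz[of "- d" "Sf d x" "Sf d z"] by simp

lemma continuous_Sf: "continuous_on UNIV (Sf d)"
proof -
 have "(exp (norm d))-lipschitz_on UNIV (Sf d)"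
  by (rule lipschitz_onI) (auto simp: dist_norm Sf_Lipschitz)
 then show ?thesis by (rule lipschitz_on_continuous_on)
qed

lemma measurable_Sf [measurable]: "Sf d \<in> borel_measurable borel"
 by (intro borel_measurable_continuous_onI continuous_Sf)

lemma measurable_vec_nth [measurable]: "(%x::R3. x $ i) \<in> borel_measurable borel"
 by (intro borel_measurable_continuous_onI continuous_intros)

lemma measurable_Jf [measurable]: "Jf d \<in> borel_measurable borel"
 unfolding Jf_def[abs_def] by measurable

text \<open>The change of variables is checked on boxes: the map is coordinatewise and strictly
  increasing, so the preimage of a box is a box, the density is a product, and each factor is a
  one-dimensional integral of \<open>dTf\<close>.\<close>

lemma lborel_Sf: "lborel = distr (density lborel (%x. ennreal (Jf d x))) borel (Sf d)"
proof (rule lborel_eqI)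
 fix l u :: R3 assume lu: "!!b. b \<in> Basis ==> l \<bullet> b <= u \<bullet> b"
 have lui: "l $ i <= u $ i" for i proof -
  have "axis i 1 \<in> (Basis :: R3 set)" by (auto simp: Basis_vec_def)
  then show ?thesis using lu[of "axis i 1"] by (simp add: inner_axis)
 qed
 define l' u' where "l' = Sf (- d) l" and "u' = Sf (- d) u"
 have iff: "Sf d x \<in> box l u \<longleftrightarrow> (\<forall>i. l' $ i < x $ i \<and> x $ i < u' $ i)" for x
  unfolding mem_box_cart l'_def u'_def Sf_nth
  by (metis Tf_less_iff Tf_inverse(1) vector_uminus_component)
 \<comment> \<open>\<open>nn_integral_lborel_prod\<close> indexes its factors by basis vectors; the
   choice operator recovers the coordinate from \<open>axis i 1\<close>.\<close>
 define \<phi> where "\<phi> b t = (%i. ennreal (dTf (d $ i) t) * indicator {l' $ i<..<u' $ i} t) (SOME i. b = axis i (1::real))" for b :: R3 and t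
 have axi: "(SOME j. axis i (1::real) = (axis j 1 :: R3)) = i" for i
  by (rule some_equality) (auto simp: axis_eq_axis)
 have BU: "(\<Prod>b\<in>Basis. F b) = (\<Prod>i\<in>(UNIV::3 set). F (axis i (1::real)))" for F :: "R3 => 'b::comm_monoid_mult"
 proof -
  have B: "(Basis :: R3 set) = range (%i. axis i 1)" by (auto simp: Basis_vec_def)
  have i: "inj (%i. axis i 1 :: R3)" by (auto simp: inj_on_def axis_eq_axis)
  show ?thesis unfolding B prod.reindex[OF i] o_def ..
 qed
 have "emeasure (distr (density lborel (%x. ennreal (Jf d x))) borel (Sf d)) (box l u)
   = (\<integral>\<^sup>+x. ennreal (Jf d x) * indicator (Sf d -` box l u) x \<partial>lborel)"
 proof -
  have vs: "Sf d -` box l u \<in> sets borel" by (rule measurable_sets_borel[OF measurable_Sf]) simp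
  have "emeasure (density lborel (%x. ennreal (Jf d x))) (Sf d -` box l u) = (\<integral>\<^sup>+x. ennreal (Jf d x) * indicator (Sf d -` box l u) x \<partial>lborel)"
   by (rule emeasure_density) (use vs in auto)
  then show ?thesis by (subst emeasure_distr) auto
 qed
 also have "... = (\<integral>\<^sup>+x. (\<Prod>b\<in>Basis. \<phi> b (x \<bullet> b)) \<partial>lborel)"
 proof (rule nn_integral_cong)
  fix x :: R3
  have "(\<Prod>b\<in>Basis. \<phi> b (x \<bullet> b)) = (\<Prod>i\<in>UNIV. ennreal (dTf (d $ i) (x $ i)) * indicator {l' $ i<..<u' $ i} (x $ i))"
   unfolding BU by (simp add: \<phi>_def axi inner_axis)
  also have "... = (\<Prod>i\<in>UNIV. ennreal (dTf (d $ i) (x $ i))) * (\<Prod>i\<in>UNIV. indicator {l' $ i<..<u' $ i} (x $ i))"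
   by (rule prod.distrib)
  also have "(\<Prod>i\<in>UNIV. ennreal (dTf (d $ i) (x $ i))) = ennreal (Jf d x)"
   unfolding Jf_def by (rule prod_ennreal) (simp add: less_imp_le[OF dTf_pos])
  also have "(\<Prod>i\<in>UNIV. indicator {l' $ i<..<u' $ i} (x $ i)) = (indicator (Sf d -` box l u) x :: ennreal)"
  proof (cases "Sf d x \<in> box l u")
   case True then show ?thesis by (simp add: iff)
  next
   case False
   then obtain i where "\<not> (l' $ i < x $ i \<and> x $ i < u' $ i)" unfolding iff by blast
   then have "indicator {l' $ i<..<u' $ i} (x $ i) = (0::ennreal)" by auto
   then show ?thesis using False by (auto intro!: prod_zero)
  qed
  finally show "ennreal (Jf d x) * indicator (Sf d -` box l u) x = (\<Prod>b\<in>Basis. \<phi> b (x \<bullet> b))" by simp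
 qed
 also have "... = (\<Prod>b\<in>Basis. \<integral>\<^sup>+t. \<phi> b t \<partial>lborel)"
  by (rule nn_integral_lborel_prod) (auto simp: \<phi>_def[abs_def])
 also have "... = (\<Prod>i\<in>UNIV. ennreal (u $ i - l $ i))"
  unfolding BU
 proof (rule prod.cong[OF refl])
  fix i :: 3
  have le: "l' $ i <= u' $ i" using lui[of i] Tf_less_iff[of "- d $ i" "u $ i" "l $ i"] by (simp add: l'_def u'_def not_less[symmetric])
  have "(\<integral>\<^sup>+t. \<phi> (axis i 1) t \<partial>lborel) = ennreal (Tf (d $ i) (u' $ i) - Tf (d $ i) (l' $ i))"
   unfolding \<phi>_def axi by (rule nn_integral_dTf[OF le])
  then show "(\<integral>\<^sup>+t. \<phi> (axis i 1) t \<partial>lborel) = ennreal (u $ i - l $ i)" by (simp add: l'_def u'_def)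
 qed
 also have "... = (\<Prod>b\<in>Basis. ennreal ((u - l) \<bullet> b))"
  unfolding BU by (simp add: inner_axis)
 also have "... = ennreal (\<Prod>b\<in>Basis. (u - l) \<bullet> b)"
  by (rule prod_ennreal) (use lu in \<open>simp add: inner_diff_left\<close>)
 finally show "emeasure (distr (density lborel (%x. ennreal (Jf d x))) borel (Sf d)) (box l u) = (\<Prod>b\<in>Basis. (u - l) \<bullet> b)" .
qed simp

lemma nn_integral_Sf:
 assumes [measurable]: "F \<in> borel_measurable borel"
 shows "(\<integral>\<^sup>+x. F x \<partial>lborel) = (\<integral>\<^sup>+x. ennreal (Jf d x) * F (Sf d x) \<partial>lborel)"
 by (subst lborel_Sf[of d]) (simp add: nn_integral_distr nn_integral_density)

lemma integral_Sf:
 fixes F :: "R3 => real"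
 assumes [measurable]: "F \<in> borel_measurable borel"
 shows "(\<integral>x. F x \<partial>lborel) = (\<integral>x. Jf d x * F (Sf d x) \<partial>lborel)"
 by (subst lborel_Sf[of d]) (simp add: integral_distr integral_density less_imp_le[OF Jf_pos])

section \<open>Complex extension of the analytic right-hand side\<close>

lemma holomorphic_uniform_limit_open:
 assumes u: "uniform_limit A f g F" and h: "!!n. f n holomorphic_on A" and F: "F \<noteq> bot" and A: "open A"
 shows "g holomorphic_on A"
 unfolding holomorphic_on_open[OF A]
proof
 fix z assume "z \<in> A"
 then obtain r where r: "r > 0" "cball z r \<subseteq> A" using A by (meson open_contains_cball)
 then have r': "ball z r \<subseteq> A" using ball_subset_cball by blast
 have "g holomorphic_on ball z r"
 proof (rule holomorphic_uniform_limit[where f = f and F = F and z = z and r = r and g = g])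
  show "\<forall>\<^sub>F n in F. continuous_on (cball z r) (f n) \<and> f n holomorphic_on ball z r"
   using holomorphic_on_subset[OF h r(2)] holomorphic_on_subset[OF h r']
   by (auto intro!: always_eventually holomorphic_on_imp_continuous_on)
  show "uniform_limit (cball z r) f g F" by (rule uniform_limit_on_subset[OF u r(2)])
 qed (use F in auto)
 then show "\<exists>f'. (g has_field_derivative f') (at z)"
  using r by (auto simp: holomorphic_on_open)
qed

text \<open>A local complex extension of f phrased without holomorphy in several variables: it is
  bounded by M on the polydisc of radius rh, and its composition with three holomorphic functions of
  one variable is holomorphic. Complex lines and complex flow orbits are the compositions that
  occur.\<close>

definition ext_at :: "(R3 => real) => R3 => real => real => bool" where
 "ext_at f x rh M \<longleftrightarrow> (\<exists>F. 
   (\<forall>y. (\<forall>i. \<bar>y $ i - x $ i\<bar> < rh) --> F (complex_of_real (y $ 1)) (complex_of_real (y $ 2)) (complex_of_real (y $ 3)) = complex_of_real (f y))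
  \<and> (\<forall>z1 z2 z3. norm (z1 - of_real (x $ 1)) < rh --> norm (z2 - of_real (x $ 2)) < rh --> norm (z3 - of_real (x $ 3)) < rh
     --> norm (F z1 z2 z3) <= M)
  \<and> (\<forall>S c1 c2 c3. open S --> c1 holomorphic_on S --> c2 holomorphic_on S --> c3 holomorphic_on S -->
     (\<forall>t\<in>S. norm (c1 t - of_real (x $ 1)) < rh \<and> norm (c2 t - of_real (x $ 2)) < rh \<and> norm (c3 t - of_real (x $ 3)) < rh) -->
     (%t. F (c1 t) (c2 t) (c3 t)) holomorphic_on S))"

lemma ext_at_mono:
 fixes x x0 :: R3
 assumes e: "ext_at f x0 rh M" and x: "!!i. \<bar>x $ i - x0 $ i\<bar> <= rh / 2" and "rh' <= rh / 2" "M <= M'"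
 shows "ext_at f x rh' M'"
proof -
 have c: "norm (z - complex_of_real (x0 $ i)) < rh" if "norm (z - complex_of_real (x $ i)) < rh'" for z i
 proof -
  have "norm (z - complex_of_real (x0 $ i)) <= norm (z - complex_of_real (x $ i)) + norm (complex_of_real (x $ i) - complex_of_real (x0 $ i))"
   using norm_triangle_ineq[of "z - complex_of_real (x $ i)" "complex_of_real (x $ i) - complex_of_real (x0 $ i)"] by simp
  also have "norm (complex_of_real (x $ i) - complex_of_real (x0 $ i)) = \<bar>x $ i - x0 $ i\<bar>"
   by (simp flip: of_real_diff)
  finally show ?thesis using that x[of i] assms(3) by linarith
 qed
 have r: "\<bar>y $ i - x0 $ i\<bar> < rh" if "\<bar>y $ i - x $ i\<bar> < rh'" for y :: R3 and i
  using that x[of i] assms(3) by linarith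
 show ?thesis using e assms(4) unfolding ext_at_def
  apply (elim exE conjE)
  subgoal for F
   apply (rule exI[of _ F])
   apply (intro conjI allI impI)
    apply (simp add: r)
    apply (rule order_trans[of _ M]; simp add: c)
   apply (simp add: c)
   done
  done
qed

text \<open>Summability over an unordered index set is absolute summability, so the series at one
  corner of a real cube majorises the complex series on the polydisc, and the Weierstrass test gives
  holomorphy of all compositions.\<close>

lemma power_series_ext_at:
 fixes x0 :: R3 and f :: "R3 => real" and c :: "nat => nat => nat => real"
 assumes r: "r > 0"
  and hs: "!!y. y \<in> ball x0 r ==> ((%(a, b, k). c a b k * (y $ 1 - x0 $ 1) ^ a * (y $ 2 - x0 $ 2) ^ b
                 * (y $ 3 - x0 $ 3) ^ k) has_sum f y) UNIV"
 shows "\<exists>M. ext_at f x0 (r / 4) M"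
proof -
 \<comment> \<open>The corner is at l1 distance 3 rh from the centre, and 3 r / 4 < r keeps it in
   the ball of convergence.\<close>
 define rh where "rh = r / 4"
 have rh: "rh > 0" using r by (simp add: rh_def)
 have inball: "y \<in> ball x0 r" if "!!i. \<bar>y $ i - x0 $ i\<bar> <= rh" for y
 proof -
  have "dist x0 y <= (\<Sum>i\<in>UNIV. \<bar>(x0 - y) $ i\<bar>)" unfolding dist_norm by (rule norm_le_l1_cart)
  also have "... <= (\<Sum>i\<in>(UNIV::3 set). rh)" using that by (intro sum_mono) (auto simp: abs_minus_commute)
  also have "... = 3 * rh" by simp
  also have "... < r" using r by (simp add: rh_def)
  finally show ?thesis by simp
 qed
 define m where "m = (%(a, b, k). \<bar>c a b k\<bar> * rh ^ a * rh ^ b * rh ^ k)"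
 have "(%(a, b, k). c a b k * rh ^ a * rh ^ b * rh ^ k) summable_on UNIV"
  using hs[OF inball, of "x0 + (\<chi> i. rh)"] rh by (auto simp: summable_on_def)
 then have "(%p. norm ((%(a, b, k). c a b k * rh ^ a * rh ^ b * rh ^ k) p)) summable_on UNIV"
  by (rule summable_on_iff_abs_summable_on_real[THEN iffD1])
 moreover have "(%p. norm ((%(a, b, k). c a b k * rh ^ a * rh ^ b * rh ^ k) p)) = m"
  using rh by (auto simp: m_def abs_mult power_abs)
 ultimately have msum: "m summable_on UNIV" by simp
 define T where "T = (%(a, b, k) z1 z2 z3. complex_of_real (c a b k) * (z1 - of_real (x0 $ 1)) ^ a
   * (z2 - of_real (x0 $ 2)) ^ b * (z3 - of_real (x0 $ 3)) ^ k)"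
 define F where "F z1 z2 z3 = (\<Sum>\<^sub>\<infinity>p. T p z1 z2 z3)" for z1 z2 z3
 have Tm: "norm (T p z1 z2 z3) <= m p"
  if "norm (z1 - of_real (x0 $ 1)) < rh" "norm (z2 - of_real (x0 $ 2)) < rh" "norm (z3 - of_real (x0 $ 3)) < rh" for p z1 z2 z3
  using that rh by (cases p) (auto simp: T_def m_def norm_mult norm_power intro!: mult_mono power_mono mult_nonneg_nonneg)
 have 1: "F (complex_of_real (y $ 1)) (complex_of_real (y $ 2)) (complex_of_real (y $ 3)) = of_real (f y)"
  if "\<forall>i. \<bar>y $ i - x0 $ i\<bar> < rh" for y
 proof -
  have "y \<in> ball x0 r" using that by (intro inball) (auto simp: less_imp_le)
  from has_sum_of_real[OF hs[OF this], where 'a = complex]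
  have "((%p. T p (complex_of_real (y $ 1)) (complex_of_real (y $ 2)) (complex_of_real (y $ 3))) has_sum of_real (f y)) UNIV"
   by (rule has_sum_cong[THEN iffD1, rotated]) (auto simp: T_def)
  then show ?thesis unfolding F_def by (rule infsumI)
 qed
 have 2: "norm (F z1 z2 z3) <= (\<Sum>\<^sub>\<infinity>p. m p)"
  if "norm (z1 - of_real (x0 $ 1)) < rh" "norm (z2 - of_real (x0 $ 2)) < rh" "norm (z3 - of_real (x0 $ 3)) < rh" for z1 z2 z3
 proof -
  have "(%p. norm (T p z1 z2 z3)) summable_on UNIV"
   by (rule summable_on_comparison_test[OF msum]) (auto intro!: Tm that)
  then have "(%p. T p z1 z2 z3) summable_on UNIV" by (rule abs_summable_summable)
  then show ?thesis
   unfolding F_def by (intro norm_infsum_le[OF has_sum_infsum has_sum_infsum] msum Tm that)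
 qed
 have 3: "(%t. F (c1 t) (c2 t) (c3 t)) holomorphic_on S"
  if S: "open S" and h: "c1 holomorphic_on S" "c2 holomorphic_on S" "c3 holomorphic_on S"
   and b: "!!t. t \<in> S ==> norm (c1 t - of_real (x0 $ 1)) < rh \<and> norm (c2 t - of_real (x0 $ 2)) < rh \<and> norm (c3 t - of_real (x0 $ 3)) < rh"
  for S c1 c2 c3
 proof (rule holomorphic_uniform_limit_open)
  show "uniform_limit S (%X t. \<Sum>p\<in>X. T p (c1 t) (c2 t) (c3 t)) (%t. F (c1 t) (c2 t) (c3 t)) (finite_subsets_at_top UNIV)"
   unfolding F_def by (rule Weierstrass_m_test_general[OF _ msum]) (use b in \<open>auto intro!: Tm\<close>)
  show "(%t. \<Sum>p\<in>X. T p (c1 t) (c2 t) (c3 t)) holomorphic_on S" for X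
   unfolding T_def by (intro holomorphic_on_sum) (auto intro!: holomorphic_intros h)
 qed (use S in auto)
 show ?thesis
  unfolding ext_at_def rh_def[symmetric] using 1 2 3 by (intro exI[of _ F] exI[of _ "\<Sum>\<^sub>\<infinity>p. m p"]) simp
qed

text \<open>A finite subcover of the closed cube by half-size balls makes radius and bound uniform;
  halving leaves each point room for a polydisc inside that of its centre.\<close>

lemma analytic_ext:
 assumes "analytic_on_closure f Omega"
 shows "\<exists>rh M. rh > 0 \<and> M > 0 \<and> (\<forall>x\<in>closure Omega. ext_at f x rh M)"
proof -
 obtain U where U: "closure Omega \<subseteq> U" "real_analytic_on f U"
  using assms unfolding analytic_on_closure_def by blast
 have "\<exists>rh M. rh > 0 \<and> ext_at f x rh M" if "x \<in> closure Omega" for x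
 proof -
  have "x \<in> U" using U(1) that by blast
  then obtain r c where "r > 0" "\<forall>y\<in>ball x r. ((%(a, b, k). c a b k * (y $ 1 - x $ 1) ^ a * (y $ 2 - x $ 2) ^ b
                 * (y $ 3 - x $ 3) ^ k) has_sum f y) UNIV"
   using U(2) unfolding real_analytic_on_def by blast
  then obtain M where "ext_at f x (r/4) M" using power_series_ext_at[of r x c f] by blast
  then show ?thesis using \<open>r > 0\<close> by (intro exI[of _ "r/4"] exI[of _ M]) simp
 qed
 then obtain rh M where rhM: "!!x. x \<in> closure Omega ==> rh x > 0 \<and> ext_at f x (rh x) (M x)" by metis
 have cp: "compact (closure Omega)" by (simp add: Omega_box)
 obtain C where C: "C \<subseteq> closure Omega" "finite C" "closure Omega \<subseteq> (\<Union>x\<in>C. ball x (rh x / 2))"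
 proof (rule compactE_image[OF cp, of "closure Omega" "%x. ball x (rh x / 2)"])
  show "closure Omega \<subseteq> (\<Union>x\<in>closure Omega. ball x (rh x / 2))"
   using rhM by (auto intro!: bexI)
 qed auto
 have "(0::R3) \<in> closure Omega" by (simp add: closure_Omega)
 then have ne: "C \<noteq> {}" using C(3) by auto
 define rh0 M0 where "rh0 = Min ((%x. rh x / 2) ` C)" and "M0 = max 1 (Max (M ` C))"
 have "rh0 > 0" using C ne rhM by (auto simp: rh0_def Min_gr_iff)
 moreover have "M0 > 0" by (simp add: M0_def)
 moreover have "ext_at f x rh0 M0" if x: "x \<in> closure Omega" for x
 proof -
  obtain y where y: "y \<in> C" "dist y x < rh y / 2" using C(3) x by auto
  show ?thesis
  proof (rule ext_at_mono)
   show "ext_at f y (rh y) (M y)" using y C rhM by blast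
   show "\<bar>x $ i - y $ i\<bar> <= rh y / 2" for i
    using y(2) component_le_norm_cart[of "x - y" i] by (simp add: dist_norm norm_minus_commute)
   show "rh0 <= rh y / 2" unfolding rh0_def using y C by (intro Min_le) auto
   have "M y <= Max (M ` C)" using y C by (intro Max_ge) auto
   then show "M y <= M0" by (simp add: M0_def)
  qed
 qed
 ultimately show ?thesis by blast
qed

lemma ext_at_self:
 fixes x :: R3
 shows "ext_at f x rh M ==> rh > 0 ==> \<bar>f x\<bar> <= M"
 unfolding ext_at_def
proof (elim exE conjE)
 fix F
 assume "rh > 0" and 1: "\<forall>y. (\<forall>i. \<bar>y $ i - x $ i\<bar> < rh) --> F (complex_of_real (y $ 1)) (complex_of_real (y $ 2)) (complex_of_real (y $ 3)) = complex_of_real (f y)"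
  and 2: "\<forall>z1 z2 z3. norm (z1 - of_real (x $ 1)) < rh --> norm (z2 - of_real (x $ 2)) < rh --> norm (z3 - of_real (x $ 3)) < rh
     --> norm (F z1 z2 z3) <= M"
 then have "F (complex_of_real (x $ 1)) (complex_of_real (x $ 2)) (complex_of_real (x $ 3)) = complex_of_real (f x)" by simp
 moreover have "norm (F (complex_of_real (x $ 1)) (complex_of_real (x $ 2)) (complex_of_real (x $ 3))) <= M"
  using 2 \<open>rh > 0\<close> by simp
 ultimately show ?thesis by simp
qed

text \<open>On the complex line through x and y the function is holomorphic; the bound is
  \<open>fd_holomorphic_bound\<close> for the first difference with step |y - x|.\<close>

lemma ext_at_local_Lipschitz:
 fixes x y :: R3
 assumes "ext_at f x rh M" "rh > 0" and y: "norm (y - x) < rh / 8"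
 shows "\<bar>f y - f x\<bar> <= (4 * M / rh) * norm (y - x)"
proof (cases "y = x")
 case False
 obtain F where 1: "\<forall>y. (\<forall>i. \<bar>y $ i - x $ i\<bar> < rh) --> F (complex_of_real (y $ 1)) (complex_of_real (y $ 2)) (complex_of_real (y $ 3)) = complex_of_real (f y)"
  and 2: "\<forall>z1 z2 z3. norm (z1 - of_real (x $ 1)) < rh --> norm (z2 - of_real (x $ 2)) < rh --> norm (z3 - of_real (x $ 3)) < rh
     --> norm (F z1 z2 z3) <= M"
  and 3: "\<forall>S c1 c2 c3. open S --> c1 holomorphic_on S --> c2 holomorphic_on S --> c3 holomorphic_on S -->
     (\<forall>t\<in>S. norm (c1 t - of_real (x $ 1)) < rh \<and> norm (c2 t - of_real (x $ 2)) < rh \<and> norm (c3 t - of_real (x $ 3)) < rh) -->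
     (%t. F (c1 t) (c2 t) (c3 t)) holomorphic_on S"
  using assms(1) unfolding ext_at_def by (elim exE conjE)
 note 1 = 1[rule_format] and 2 = 2[rule_format] and 3 = 3[rule_format]
 define n where "n = norm (y - x)"
 have n: "n > 0" using False by (simp add: n_def)
 define d where "d = (y - x) /\<^sub>R n"
 have d: "\<bar>d $ i\<bar> <= 1" for i
  using component_le_norm_cart[of "y - x" i] n by (simp add: d_def n_def[symmetric] abs_mult divide_simps)
 define c where "c i t = complex_of_real (x $ i) + t * complex_of_real (d $ i)" for i t
 have c: "norm (c i t - of_real (x $ i)) < rh" if "norm t < rh" for i t
 proof -
  have "norm (c i t - of_real (x $ i)) = norm t * \<bar>d $ i\<bar>" by (simp add: c_def norm_mult)
  also have "... <= norm t * 1" using d by (intro mult_left_mono) auto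
  finally show ?thesis using that by simp
 qed
 define g where "g t = F (c 1 t) (c 2 t) (c 3 t)" for t
 have ch: "c i holomorphic_on ball 0 rh" for i
  unfolding c_def[abs_def] by (intro holomorphic_intros)
 have g: "g holomorphic_on ball 0 rh" unfolding g_def
  by (rule 3) (auto intro!: c ch)
 have gM: "norm (g t) <= M" if "norm t < rh" for t unfolding g_def by (intro 2 c that)
 have gr: "g (of_real t) = of_real (f (x + t *\<^sub>R d))" if "\<bar>t\<bar> < rh" for t
 proof -
  have "\<bar>(x + t *\<^sub>R d) $ i - x $ i\<bar> < rh" for i
  proof -
   have "\<bar>t * d $ i\<bar> <= \<bar>t\<bar> * 1" unfolding abs_mult using d by (intro mult_left_mono) auto
   then show ?thesis using that by simp
  qed
  then show ?thesis using 1[of "x + t *\<^sub>R d"] by (simp add: g_def c_def)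
 qed
 have "\<bar>fd n 1 (%t. f (x + t *\<^sub>R d)) 0\<bar> <= M * fact 1 * (2 * n / rh) ^ 1"
  by (rule fd_holomorphic_bound[OF g gM gr]) (use assms n y in \<open>auto simp: n_def\<close>)
 moreover have "x + n *\<^sub>R d = y" using n by (simp add: d_def)
 moreover have "0 <= M" using order_trans[OF norm_ge_zero gM[of 0]] assms(2) by simp
 ultimately have "\<bar>f y - f x\<bar> <= M * (2 * n / rh)" by simp
 also have "... <= M * (4 * n / rh)"
  using n assms(2) \<open>0 <= M\<close> by (intro mult_left_mono divide_right_mono) auto
 finally show ?thesis by (simp add: n_def[symmetric] mult_ac)
qed simp

lemma analytic_Lipschitz:
 assumes "analytic_on_closure f Omega"
 shows "\<exists>B>0. \<forall>x\<in>closure Omega. \<bar>f x\<bar> <= B \<and> (\<forall>y\<in>closure Omega. \<bar>f y - f x\<bar> <= B * norm (y - x))"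
proof -
 obtain rh M where rh: "rh > 0" and M: "M > 0" and e: "!!x. x\<in>closure Omega ==> ext_at f x rh M"
  using analytic_ext[OF assms] by blast
 have b: "\<bar>f x\<bar> <= M" if "x \<in> closure Omega" for x using ext_at_self[OF e[OF that] rh] .
 have l: "\<bar>f y - f x\<bar> <= (16 * M / rh) * norm (y - x)" if xy: "x \<in> closure Omega" "y \<in> closure Omega" for x y
 proof (cases "norm (y - x) < rh / 8")
  case True
  have "\<bar>f y - f x\<bar> <= (4 * M / rh) * norm (y - x)" by (rule ext_at_local_Lipschitz[OF e[OF xy(1)] rh True])
  also have "... <= (16 * M / rh) * norm (y - x)" using M rh by (intro mult_right_mono divide_right_mono) auto
  finally show ?thesis .
 next
  case False
  have "\<bar>f y - f x\<bar> <= 2 * M" using b xy by (smt (verit))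
  also have "... = (16 * M / rh) * (rh / 8)" using rh by simp
  also have "... <= (16 * M / rh) * norm (y - x)" using False M rh by (intro mult_left_mono) auto
  finally show ?thesis .
 qed
 define B where "B = max M (16 * M / rh)"
 have "\<bar>f y - f x\<bar> <= B * norm (y - x)" if xy: "x \<in> closure Omega" "y \<in> closure Omega" for x y
 proof -
  have "(16 * M / rh) * norm (y - x) <= B * norm (y - x)" by (intro mult_right_mono) (auto simp: B_def)
  then show ?thesis using l[OF xy] by linarith
 qed
 moreover have "\<bar>f x\<bar> <= B" if "x \<in> closure Omega" for x using b[OF that] by (simp add: B_def)
 moreover have "B > 0" using M by (simp add: B_def)
 ultimately show ?thesis by blast
qed

section \<open>Transport of the form and of the weak equation by the flow\<close>

text \<open>Pull-back of the kernel with one Jacobian in each variable: it makes the form of two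
  functions equal to the \<open>Kf\<close> form of the flowed functions
  (\<open>kform_Sf\<close>).\<close>

definition Kf :: "real => R3 => R3 \<times> R3 => real" where
 "Kf s d p = Jf d (fst p) * Jf d (snd p) * kern s (Sf d (fst p)) (Sf d (snd p))"

lemma measurable_Kf [measurable]: "Kf s d \<in> borel_measurable (borel \<Otimes>\<^sub>M borel)"
 unfolding Kf_def[abs_def] by measurable

lemma kern_mono_scale:
 assumes le: "norm (x - z) <= exp c * norm (y - w)" and ne: "x \<noteq> z" "y \<noteq> w" and s: "0 < s" "s < 1" and c: "0 <= c"
 shows "kern s y w <= exp (5 * c) * kern s x z"
proof -
 have "norm (x - z) powr (3 + 2 * s) <= (exp c * norm (y - w)) powr (3 + 2 * s)"
  using le s by (intro powr_mono2) auto
 also have "... = exp (c * (3 + 2 * s)) * norm (y - w) powr (3 + 2 * s)"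
  by (simp add: powr_mult exp_powr_real)
 also have "exp (c * (3 + 2 * s)) <= exp (5 * c)"
 proof -
  have "c * (3 + 2 * s) <= c * 5" using s c by (intro mult_left_mono) auto
  then show ?thesis by (simp add: mult.commute)
 qed
 finally have "norm (x - z) powr (3 + 2 * s) <= exp (5 * c) * norm (y - w) powr (3 + 2 * s)" by (simp add: mult_right_mono)
 then show ?thesis using ne by (simp add: kern_def divide_simps mult.commute)
qed

text \<open>Division by zero gives the kernel the value 0 on the diagonal, so comparisons such as
  \<open>kern_Sf\<close> hold without exceptional pairs.\<close>

lemma kern_refl [simp]: "kern s x x = 0"
 by (simp add: kern_def)

lemma Sf_eq_iff: "Sf d x = Sf d z \<longleftrightarrow> x = z"
 by (metis Sf_inverse(1))

lemma kern_Sf: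
 assumes s: "0 < s" "s < 1"
 shows "kern s x z <= exp (5 * norm d) * kern s (Sf d x) (Sf d z)" "kern s (Sf d x) (Sf d z) <= exp (5 * norm d) * kern s x z"
 using kern_mono_scale[OF Sf_Lipschitz[of d x z] _ _ s] kern_mono_scale[OF Sf_Lipschitz_below[of x z d] _ _ s]
 by (cases "x = z"; simp add: Sf_eq_iff)+

lemma Kf_nonneg: "0 <= Kf s d p"
 unfolding Kf_def by (intro mult_nonneg_nonneg) (auto simp: less_imp_le[OF Jf_pos])

text \<open>11 = 3 + 3 + 5: a Jacobian in each variable, and the kernel, whose degree 3 + 2s is at
  most 5.\<close>

lemma Kf_bound:
 assumes s: "0 < s" "s < 1"
 shows "\<bar>Kf s d p\<bar> <= exp (11 * norm d) * kern2 s p"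
proof -
 have "Kf s d p <= exp (3 * norm d) * exp (3 * norm d) * (exp (5 * norm d) * kern s (fst p) (snd p))"
  unfolding Kf_def by (intro mult_mono Jf_bounds kern_Sf(2)[OF s] mult_nonneg_nonneg) (auto simp: less_imp_le[OF Jf_pos])
 also have "... = exp (11 * norm d) * kern2 s p"
  by (simp add: kern2_def mult.assoc[symmetric] mult_exp_exp)
 finally show ?thesis using Kf_nonneg[of s d p] by simp
qed

lemma gagliardo_Sf:
 assumes [measurable]: "w \<in> borel_measurable borel" and s: "0 < s" "s < 1"
 shows "gagliardo_sq s UNIV (%x. w (Sf d x)) <= ennreal (exp (11 * norm d)) * gagliardo_sq s UNIV w"
proof -
 define G where "G x z = ennreal ((w x - w z)\<^sup>2 * kern s x z)" for x z
 have [measurable]: "(%p. G (fst p) (snd p)) \<in> borel_measurable (borel \<Otimes>\<^sub>M borel)" unfolding G_def by measurable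
 have [measurable]: "G x \<in> borel_measurable borel" for x unfolding G_def by measurable
 have [measurable]: "(%p. G (Sf d (fst p)) (Sf d (snd p))) \<in> borel_measurable (borel \<Otimes>\<^sub>M borel)"
  "(%p. G (Sf d (fst p)) (snd p)) \<in> borel_measurable (borel \<Otimes>\<^sub>M borel)" unfolding G_def by measurable
 have pt: "ennreal ((w (Sf d x) - w (Sf d z))\<^sup>2 * kern s x z) <= ennreal (exp (11 * norm d)) * (ennreal (Jf d x) * (ennreal (Jf d z) * G (Sf d x) (Sf d z)))" for x z
 proof -
  have "1 * (1 * kern s x z) <= (exp (3 * norm d) * Jf d x) * ((exp (3 * norm d) * Jf d z) * (exp (5 * norm d) * kern s (Sf d x) (Sf d z)))"
  proof (intro mult_mono kern_Sf(1)[OF s])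
   have "1 = exp (3 * norm d) * exp (- 3 * norm d)" by (simp add: mult_exp_exp)
   then show "1 <= exp (3 * norm d) * Jf d x" "1 <= exp (3 * norm d) * Jf d z"
    using mult_left_mono[OF Jf_bounds(1)[of d x], of "exp (3 * norm d)"] mult_left_mono[OF Jf_bounds(1)[of d z], of "exp (3 * norm d)"] by auto
  qed (auto intro!: mult_nonneg_nonneg less_imp_le[OF Jf_pos])
  also have "... = exp (11 * norm d) * (Jf d x * (Jf d z * kern s (Sf d x) (Sf d z)))"
  proof -
   have "exp (11 * norm d) = exp (3 * norm d) * exp (3 * norm d) * exp (5 * norm d)" by (simp add: mult_exp_exp)
   then show ?thesis by simp
  qed
  finally have "(w (Sf d x) - w (Sf d z))\<^sup>2 * kern s x z <= (w (Sf d x) - w (Sf d z))\<^sup>2 * (exp (11 * norm d) * (Jf d x * (Jf d z * kern s (Sf d x) (Sf d z))))"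
   by (intro mult_left_mono) auto
  also have "... = exp (11 * norm d) * (Jf d x * (Jf d z * ((w (Sf d x) - w (Sf d z))\<^sup>2 * kern s (Sf d x) (Sf d z))))" by simp
  finally show ?thesis
   unfolding G_def using ennreal_leI by (fastforce simp: ennreal_mult'[symmetric] less_imp_le[OF Jf_pos])
 qed
 have "gagliardo_sq s UNIV (%x. w (Sf d x))
   <= (\<integral>\<^sup>+x. \<integral>\<^sup>+z. ennreal (exp (11 * norm d)) * (ennreal (Jf d x) * (ennreal (Jf d z) * G (Sf d x) (Sf d z))) \<partial>lborel \<partial>lborel)"
  unfolding gagliardo_UNIV by (intro nn_integral_mono pt)
 also have "... = ennreal (exp (11 * norm d)) * (\<integral>\<^sup>+x. ennreal (Jf d x) * (\<integral>\<^sup>+z. ennreal (Jf d z) * G (Sf d x) (Sf d z) \<partial>lborel) \<partial>lborel)"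
  by (simp add: nn_integral_cmult)
 also have "... = ennreal (exp (11 * norm d)) * (\<integral>\<^sup>+x. ennreal (Jf d x) * (\<integral>\<^sup>+z. G (Sf d x) z \<partial>lborel) \<partial>lborel)"
  by (subst nn_integral_Sf[of "G (Sf d x)" d for x]) auto
 also have "... = ennreal (exp (11 * norm d)) * (\<integral>\<^sup>+x. \<integral>\<^sup>+z. G x z \<partial>lborel \<partial>lborel)"
  by (subst nn_integral_Sf[of "%x. \<integral>\<^sup>+z. G x z \<partial>lborel" d]) auto
 finally show ?thesis unfolding G_def gagliardo_UNIV .
qed

lemma Htilde_Sf:
 assumes s: "0 < s" "s < 1" and w: "w \<in> Htilde s Omega"
 shows "(%x. w (Sf d x)) \<in> Htilde s Omega"
proof -
 note HtildeD(1)[OF w, measurable]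
 have "gagliardo_sq s UNIV (%x. w (Sf d x)) <= ennreal (exp (11 * norm d)) * gagliardo_sq s UNIV w"
  by (intro gagliardo_Sf s HtildeD[OF w])
 also have "... < \<infinity>" using HtildeD(2)[OF w] by (simp add: ennreal_mult_less_top)
 finally show ?thesis unfolding Htilde_iff[OF s(1)] using HtildeD(3)[OF w] by (auto simp: Sf_Omega)
qed

lemma enorm_Sf:
 assumes s: "0 < s" "s < 1" and w: "w \<in> Htilde s Omega"
 shows "enorm s (%x. w (Sf d x)) <= exp (6 * norm d) * enorm s w"
proof (rule enorm_le)
 show "(%x. w (Sf d x)) \<in> Htilde s Omega" by (rule Htilde_Sf[OF s w])
 have "gagliardo_sq s UNIV (%x. w (Sf d x)) <= ennreal (exp (11 * norm d)) * gagliardo_sq s UNIV w"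
  by (intro gagliardo_Sf s HtildeD[OF w])
 also have "... = ennreal (exp (11 * norm d) * (enorm s w)\<^sup>2)"
  unfolding gagliardo_eq_enorm[OF w] by (simp add: ennreal_mult'[symmetric])
 also have "... <= ennreal ((exp (6 * norm d) * enorm s w)\<^sup>2)"
 proof (intro ennreal_leI)
  have "exp (11 * norm d) <= (exp (6 * norm d))\<^sup>2" by (simp add: exp_double[symmetric])
  then show "exp (11 * norm d) * (enorm s w)\<^sup>2 <= (exp (6 * norm d) * enorm s w)\<^sup>2"
   unfolding power_mult_distrib by (intro mult_right_mono) auto
 qed
 finally show "gagliardo_sq s UNIV (%x. w (Sf d x)) <= ennreal ((exp (6 * norm d) * enorm s w)\<^sup>2)" .
qed auto

lemma kform_Sf:
 assumes s: "0 < s" "s < 1" and u: "u \<in> Htilde s Omega" and v: "v \<in> Htilde s Omega"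
 shows "kform (kern2 s) u v = kform (Kf s d) (%x. u (Sf d x)) (%x. v (Sf d x))"
proof -
 note HtildeD(1)[OF u, measurable] HtildeD(1)[OF v, measurable]
 define G where "G x z = incr u (x, z) * incr v (x, z) * kern2 s (x, z)" for x z
 have [measurable]: "(%p. G (fst p) (snd p)) \<in> borel_measurable (borel \<Otimes>\<^sub>M borel)" unfolding G_def by measurable
 have [measurable]: "G x \<in> borel_measurable borel" for x unfolding G_def by measurable
 have [measurable]: "(%p. G (Sf d (fst p)) (Sf d (snd p))) \<in> borel_measurable (borel \<Otimes>\<^sub>M borel)"
  "(%p. G (Sf d (fst p)) (snd p)) \<in> borel_measurable (borel \<Otimes>\<^sub>M borel)" unfolding G_def by measurable
 have "kform (kern2 s) u v = (\<integral>x. \<integral>z. G x z \<partial>lborel \<partial>lborel)"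
  unfolding kform_def G_def by (rule lborel_pair.integral_fst'[OF kform_CS(1)[OF u v], symmetric])
 also have "... = (\<integral>x. Jf d x * (\<integral>z. G (Sf d x) z \<partial>lborel) \<partial>lborel)"
  by (rule integral_Sf) measurable
 also have "... = (\<integral>x. \<integral>z. Jf d x * (Jf d z * G (Sf d x) (Sf d z)) \<partial>lborel \<partial>lborel)"
  by (subst integral_Sf[of "G (Sf d x)" d for x]) auto
 also have "... = (\<integral>x. \<integral>z. incr (%x. u (Sf d x)) (x, z) * incr (%x. v (Sf d x)) (x, z) * Kf s d (x, z) \<partial>lborel \<partial>lborel)"
  by (simp add: G_def incr_def Kf_def kern2_def mult_ac)
 also have "... = kform (Kf s d) (%x. u (Sf d x)) (%x. v (Sf d x))"
  unfolding kform_def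
  by (rule lborel_pair.integral_fst'[OF kform_bound(1)[OF Htilde_Sf[OF s u] Htilde_Sf[OF s v] measurable_Kf Kf_bound[OF s]]]) auto
 finally show ?thesis .
qed

text \<open>The flow preserves the cube, so v composed with the inverse flow is an admissible test
  function. Substituting the flow back leaves v fixed and moves all dependence on the time into the
  flowed solution, the kernel and the data, which is the form that can be differenced in
  time.\<close>

lemma weak_Sf:
 assumes s: "0 < s" "s < 1" and u: "u \<in> Htilde s Omega"
  and weak: "\<forall>v \<in> Htilde s Omega. bform s u v = L2_inner Omega f v"
  and f: "continuous_on (closure Omega) f"
  and v: "v \<in> Htilde s Omega"
 shows "kform (Kf s d) (%x. u (Sf d x)) v = 2 / Cconst s * (\<integral>x. indicator Omega x * (f (Sf d x) * Jf d x) * v x \<partial>lborel)"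
proof -
 note HtildeD(1)[OF v, measurable]
 have fm [measurable]: "(%x. indicator Omega x * f x) \<in> borel_measurable borel"
  using borel_measurable_continuous_on_indicator[of Omega f] continuous_on_subset[OF f closure_subset] by simp
 have v': "(%x. v (Sf (- d) x)) \<in> Htilde s Omega" by (rule Htilde_Sf[OF s v])
 have "kform (kern2 s) u (%x. v (Sf (- d) x)) = kform (Kf s d) (%x. u (Sf d x)) v"
  using kform_Sf[OF s u v', of d] by simp
 moreover have "kform (kern2 s) u (%x. v (Sf (- d) x)) = 2 / Cconst s * L2_inner Omega f (%x. v (Sf (- d) x))"
  using weak[rule_format, OF v'] bform_eq_kform[OF u v'] Cconst_pos[OF s] by (simp add: field_simps)
 moreover have "L2_inner Omega f (%x. v (Sf (- d) x)) = (\<integral>x. (indicator Omega x * f x) * v (Sf (- d) x) \<partial>lborel)"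
  by (simp add: L2_inner_def set_lebesgue_integral_def mult_ac)
 moreover have "... = (\<integral>x. Jf d x * ((indicator Omega (Sf d x) * f (Sf d x)) * v (Sf (- d) (Sf d x))) \<partial>lborel)"
  by (rule integral_Sf) measurable
 moreover have "... = (\<integral>x. indicator Omega x * (f (Sf d x) * Jf d x) * v x \<partial>lborel)"
  by (rule Bochner_Integration.integral_cong) (auto simp: indicator_def Sf_Omega)
 ultimately show ?thesis by simp
qed

section \<open>The flow with complex time; analyticity of kernel and data in the time\<close>

text \<open>Complex time at a real point. For |e| at most 1/4 the denominator stays at least 1/2 in
  modulus (\<open>Tc_den\<close>), uniformly in the point.\<close>

definition Tc :: "complex => real => complex" where
 "Tc e t = (if 0 < t \<and> t < 1 then exp e * of_real t / (1 + (exp e - 1) * of_real t) else of_real t)"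

definition dTc :: "complex => real => complex" where
 "dTc e t = (if 0 < t \<and> t < 1 then exp e / (1 + (exp e - 1) * of_real t)\<^sup>2 else 1)"

lemma Tc_of_real: "Tc (of_real e) t = of_real (Tf e t)"
 by (simp add: Tc_def Tf_def exp_of_real)

lemma dTc_of_real: "dTc (of_real e) t = of_real (dTf e t)"
 by (simp add: dTc_def dTf_def exp_of_real)

lemma exp_m1_small: 
 fixes e :: complex assumes "norm e <= 1/4" shows "norm (exp e - 1) <= 2 * norm e" "norm (exp e - 1) <= 1/2"
 using norm_exp_bounds(2)[of e] assms norm_ge_zero[of e] by linarith+

lemma Tc_den:
 fixes e :: complex assumes e: "norm e <= 1/4" and t: "0 <= t" "t <= 1"
 shows "1/2 <= norm (1 + (exp e - 1) * of_real t)"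
proof -
 have "norm ((exp e - 1) * of_real t) <= 1/2 * 1"
  unfolding norm_mult using exp_m1_small(2)[OF e] t by (intro mult_mono) auto
 then show ?thesis using norm_diff_ineq[of 1 "(exp e - 1) * of_real t"] by simp
qed

lemma Tc_den_nz:
 fixes e :: complex assumes e: "norm e <= 1/4" and t: "0 <= t" "t <= 1"
 shows "1 + (exp e - 1) * of_real t \<noteq> 0"
 using Tc_den[OF assms] by auto

lemma dTc_bound:
 assumes e: "norm e <= 1/4"
 shows "norm (dTc e t) <= 6"
proof (cases "0 < t \<and> t < 1")
 case True
 have "norm (exp e) <= 1 + norm (exp e - 1)" using norm_triangle_ineq[of 1 "exp e - 1"] by simp
 then have a: "norm (exp e) <= 3/2" using exp_m1_small(2)[OF e] by simp
 have "(1/2)^2 <= (norm (1 + (exp e - 1) * of_real t))\<^sup>2"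
  using Tc_den[OF e, of t] True by (intro power_mono) auto
 then have "norm (exp e) / (norm (1 + (exp e - 1) * of_real t))\<^sup>2 <= (3/2) / (1/2)^2"
  using a by (intro frac_le) auto
 then show ?thesis using True by (simp add: dTc_def norm_divide norm_mult power2_eq_square)
qed (auto simp: dTc_def)

lemma Tc_clamp01: "Tc e x - of_real x = Tc e (clamp01 x) - of_real (clamp01 x)"
 by (cases "x <= 0"; cases "1 <= x") (auto simp: clamp01_def Tc_def)

lemma Tc_closed: "0 <= t ==> t <= 1 ==> Tc e t = exp e * of_real t / (1 + (exp e - 1) * of_real t)"
 by (cases "t = 0"; cases "t = 1") (auto simp: Tc_def)

text \<open>The displacement caused by a complex time is Lipschitz in the point with a factor
  proportional to |e|. Because the bound is relative to |t - r|, the complexified distance of two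
  points remains comparable to the real one however close they are.\<close>

lemma Tc_increment_closed:
 assumes e: "norm e <= 1/4" and t: "0 <= t" "t <= 1" and r: "0 <= r" "r <= 1"
 shows "norm ((Tc e t - of_real t) - (Tc e r - of_real r)) <= 12 * norm e * \<bar>t - r\<bar>"
proof -
 define E where "E = exp e - 1"
 define a b where "a = 1 + E * of_real t" and "b = 1 + E * of_real r"
 have nz: "a \<noteq> 0" "b \<noteq> 0" using Tc_den_nz[OF e t] Tc_den_nz[OF e r] by (auto simp: a_def b_def E_def)
 have ab: "1/2 <= norm a" "1/2 <= norm b" using Tc_den[OF e t] Tc_den[OF e r] by (auto simp: a_def b_def E_def)
 have E: "norm E <= 2 * norm e" "norm E <= 1/2" using exp_m1_small[OF e] by (auto simp: E_def)
 have "(Tc e t - of_real t) - (Tc e r - of_real r)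
   = of_real (t - r) * (E * (1 - of_real t - of_real r) - E\<^sup>2 * of_real t * of_real r) / (a * b)"
 proof -
  have "exp e = 1 + E" by (simp add: E_def)
  then have q: "Tc e t = (1 + E) * of_real t / a" "Tc e r = (1 + E) * of_real r / b"
   using Tc_closed[OF t, of e] Tc_closed[OF r, of e] by (simp_all add: a_def b_def)
  have "(Tc e t - of_real t) - (Tc e r - of_real r) = ((1 + E) * of_real t * b - (1 + E) * of_real r * a - (of_real t - of_real r) * (a * b)) / (a * b)"
   unfolding q using nz by (simp add: field_simps)
  also have "(1 + E) * of_real t * b - (1 + E) * of_real r * a - (of_real t - of_real r) * (a * b)
    = of_real (t - r) * (E * (1 - of_real t - of_real r) - E\<^sup>2 * of_real t * of_real r)"
   unfolding a_def b_def of_real_diff by algebra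
  finally show ?thesis .
 qed
 also have "norm ... = \<bar>t - r\<bar> * norm (E * (1 - of_real t - of_real r) - E\<^sup>2 * of_real t * of_real r) / (norm a * norm b)"
  by (simp only: norm_mult norm_divide norm_of_real)
 also have "... <= \<bar>t - r\<bar> * (3 * norm e) / (1/2 * (1/2))"
 proof (intro frac_le mult_mono)
  have "norm (E * (1 - of_real t - of_real r) - E\<^sup>2 * of_real t * of_real r)
    <= norm (E * (1 - of_real t - of_real r)) + norm (E\<^sup>2 * of_real t * of_real r)" by (rule norm_triangle_ineq4)
  also have "norm (E * (1 - of_real t - of_real r)) <= norm E * 1"
  proof -
   have "norm (1 - of_real t - of_real r :: complex) = \<bar>1 - t - r\<bar>" by (metis norm_of_real of_real_1 of_real_diff)
   also have "... <= 1" using t r by linarith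
   finally show ?thesis unfolding norm_mult by (intro mult_left_mono) auto
  qed
  also have "norm (E\<^sup>2 * of_real t * of_real r) <= norm E * (1/2) * 1 * 1"
   unfolding norm_mult norm_power power2_eq_square using E t r by (intro mult_mono mult_nonneg_nonneg) auto
  also have "norm E * 1 + norm E * (1/2) * 1 * 1 <= 3 * norm e" using E by simp
  finally show "norm (E * (1 - of_real t - of_real r) - E\<^sup>2 * of_real t * of_real r) <= 3 * norm e" by simp
 qed (use ab in \<open>auto intro!: mult_nonneg_nonneg\<close>)
 finally show ?thesis by (simp add: mult_ac)
qed

lemma Tc_increment:
 assumes e: "norm e <= 1/4"
 shows "norm ((Tc e x - of_real x) - (Tc e y - of_real y)) <= 12 * norm e * \<bar>x - y\<bar>"
proof -
 have "norm ((Tc e x - of_real x) - (Tc e y - of_real y)) <= 12 * norm e * \<bar>clamp01 x - clamp01 y\<bar>"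
  unfolding Tc_clamp01[of e x] Tc_clamp01[of e y] by (intro Tc_increment_closed e clamp01_in)
 also have "... <= 12 * norm e * \<bar>x - y\<bar>"
  using clamp01_split[of x y] by (intro mult_left_mono) auto
 finally show ?thesis .
qed

lemma holomorphic_Tc [holomorphic_intros]:
 assumes "g holomorphic_on S" "!!z. z \<in> S ==> norm (g z) <= 1/4"
 shows "(%z. Tc (g z) t) holomorphic_on S" "(%z. dTc (g z) t) holomorphic_on S"
 unfolding Tc_def dTc_def
 using Tc_den_nz[OF assms(2), of _ t] by (cases "0 < t \<and> t < 1"; auto intro!: holomorphic_intros assms(1))+

lemma norm_sq_R3: "(norm (v::R3))\<^sup>2 = (\<Sum>i\<in>UNIV. (v $ i)\<^sup>2)"
 unfolding power2_norm_eq_inner inner_vec_def by (simp add: power2_eq_square)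

lemma fd_zero: "fd h k (%t. 0) t = 0"
 by (induction k arbitrary: t) auto

text \<open>\<open>D\<close> is the squared distance after the flow divided by that before, written
  without moduli so that it is holomorphic. For |t| < 1/72 each coordinate increment is perturbed by
  at most 12/72 = 1/6 of itself, its square by 13/36, so D stays within 1/2 of 1 and its real power
  is taken with the principal logarithm. The bound is 373248 = 36^3 * 8: two derivative factors of
  at most 6 in each coordinate, and |D| >= 1/2 to an exponent of modulus at most 3.\<close>

lemma Kf_analytic:
 fixes d x z :: R3
 assumes s: "0 < s" "s < 1" and d: "!!i. \<bar>d $ i\<bar> <= 1" and xz: "x \<noteq> z"
 shows "\<exists>g. g holomorphic_on ball 0 (1/72) \<and> (\<forall>t. norm t < 1/72 --> norm (g t) <= 373248)
  \<and> (\<forall>t. \<bar>t\<bar> < 1/72 --> g (of_real t) = of_real (Kf s (t *\<^sub>R d) (x, z) / kern s x z))"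
proof -
 define N where "N = norm (x - z)"
 have N: "N > 0" using xz by (simp add: N_def)
 define e where "e i t = t * complex_of_real (d $ i)" for i t
 have e_small: "norm (e i t) <= norm t" for i t
  using mult_left_mono[OF d[of i], of "norm t"] by (simp add: e_def norm_mult)
 have e4: "norm (e i t) <= 1/4" if "norm t < 1/72" for i t
  using e_small[of i t] that by linarith
 define A where "A i t = Tc (e i t) (x $ i) - Tc (e i t) (z $ i)" for i t
 define D where "D t = (\<Sum>i\<in>UNIV. (A i t)\<^sup>2) / complex_of_real (N\<^sup>2)" for t
 define g where "g t = (\<Prod>i\<in>UNIV. dTc (e i t) (x $ i) * dTc (e i t) (z $ i)) * exp (- complex_of_real ((3 + 2 * s) / 2) * Ln (D t))" for t
 have D1: "norm (D t - 1) <= 1/2" if t: "norm t < 1/72" for t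
 proof -
  have pt: "norm ((A i t)\<^sup>2 - of_real ((x $ i - z $ i)\<^sup>2)) <= 1/2 * (x $ i - z $ i)\<^sup>2" for i
  proof -
   define \<delta> where "\<delta> = A i t - of_real (x $ i - z $ i)"
   define m where "m = \<bar>x $ i - z $ i\<bar>"
   have "norm \<delta> <= 12 * norm (e i t) * m"
    using Tc_increment[OF e4[OF t], of i "x $ i" "z $ i"] by (simp add: \<delta>_def A_def m_def algebra_simps)
   also have "... <= 1/6 * m" using e_small[of i t] t by (intro mult_right_mono) (auto simp: m_def)
   finally have \<delta>: "norm \<delta> <= 1/6 * m" .
   have "(A i t)\<^sup>2 - of_real ((x $ i - z $ i)\<^sup>2) = \<delta> * (2 * of_real (x $ i - z $ i) + \<delta>)"
    unfolding \<delta>_def of_real_power by algebra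
   also have "norm ... <= (1/6 * m) * (2 * m + 1/6 * m)"
   proof -
    have "norm (2 * of_real (x $ i - z $ i) + \<delta>) <= norm (2 * of_real (x $ i - z $ i) :: complex) + norm \<delta>" by (rule norm_triangle_ineq)
    also have "norm (2 * of_real (x $ i - z $ i) :: complex) = 2 * m" unfolding norm_mult norm_of_real m_def by simp
    finally have "norm (2 * of_real (x $ i - z $ i) + \<delta>) <= 2 * m + 1/6 * m" using \<delta> by linarith
    then show ?thesis unfolding norm_mult using \<delta> by (intro mult_mono) (auto simp: m_def)
   qed
   also have "... = 13/36 * m\<^sup>2" by (simp add: power2_eq_square)
   also have "... <= 1/2 * m\<^sup>2" by (intro mult_right_mono) auto
   also have "m\<^sup>2 = (x $ i - z $ i)\<^sup>2" by (simp add: m_def)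
   finally show ?thesis .
  qed
  have N2: "N\<^sup>2 = (\<Sum>i\<in>UNIV. (x $ i - z $ i)\<^sup>2)" unfolding N_def norm_sq_R3 by simp
  have Ns: "(\<Sum>i\<in>UNIV. complex_of_real ((x $ i - z $ i)\<^sup>2)) = of_real (N\<^sup>2)"
   unfolding N2 by (rule of_real_sum[symmetric])
  have "D t - 1 = (\<Sum>i\<in>UNIV. (A i t)\<^sup>2 - of_real ((x $ i - z $ i)\<^sup>2)) / of_real (N\<^sup>2)"
   unfolding D_def sum_subtractf Ns using N by (simp add: diff_divide_distrib)
  also have "norm ... = norm (\<Sum>i\<in>UNIV. (A i t)\<^sup>2 - of_real ((x $ i - z $ i)\<^sup>2)) / N\<^sup>2"
   unfolding norm_divide norm_of_real by simp
  also have "... <= (\<Sum>i\<in>UNIV. 1/2 * (x $ i - z $ i)\<^sup>2) / N\<^sup>2"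
   by (intro divide_right_mono order_trans[OF norm_sum] sum_mono pt) auto
  also have "... = 1/2"
   using N unfolding sum_distrib_left[symmetric] N2[symmetric] by simp
  finally show ?thesis .
 qed
 have ReD: "Re (D t) \<ge> 1/2" if t: "norm t < 1/72" for t
  using D1[OF t] abs_Re_le_cmod[of "D t - 1"] by simp
 have "g holomorphic_on ball 0 (1/72)"
 proof -
  have eh: "(%t. e i t) holomorphic_on ball 0 (1/72)" for i unfolding e_def by (intro holomorphic_intros)
  have Th: "(%t. Tc (e i t) y) holomorphic_on ball 0 (1/72)" "(%t. dTc (e i t) y) holomorphic_on ball 0 (1/72)" for i y
   using e4 by (intro holomorphic_Tc eh; simp)+
  have Dh: "D holomorphic_on ball 0 (1/72)"
   unfolding D_def[abs_def] A_def using N by (intro holomorphic_intros Th) auto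
  have "D t \<notin> \<real>\<^sub>\<le>\<^sub>0" if "t \<in> ball 0 (1/72)" for t
   using ReD[of t] that by (auto simp: complex_nonpos_Reals_iff)
  then show ?thesis
   unfolding g_def[abs_def] by (intro holomorphic_intros Th Dh) auto
 qed
 moreover have "norm (g t) <= 373248" if t: "norm t < 1/72" for t
 proof -
  have "norm (\<Prod>i\<in>UNIV. dTc (e i t) (x $ i) * dTc (e i t) (z $ i)) <= (\<Prod>i\<in>(UNIV::3 set). 36)"
  proof (subst prod_norm[symmetric], rule prod_mono, safe)
   fix i :: 3
   have "norm (dTc (e i t) (x $ i)) * norm (dTc (e i t) (z $ i)) <= 6 * 6"
    by (intro mult_mono dTc_bound e4[OF t]) auto
   then show "norm (dTc (e i t) (x $ i) * dTc (e i t) (z $ i)) <= 36" by (simp add: norm_mult)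
  qed auto
  moreover have "norm (exp (- complex_of_real ((3 + 2 * s) / 2) * Ln (D t))) <= 8"
  proof -
   have nD: "norm (D t) \<ge> 1/2" using ReD[OF t] abs_Re_le_cmod[of "D t"] by linarith
   then have "D t \<noteq> 0" by auto
   have "ln (norm (D t)) \<ge> ln (1/2)" using nD by (subst ln_le_cancel_iff) linarith+
   then have l: "ln (norm (D t)) \<ge> - ln 2" by (simp add: ln_div)
   have "norm (exp (- complex_of_real ((3 + 2 * s) / 2) * Ln (D t))) = exp (- ((3 + 2 * s) / 2) * ln (norm (D t)))"
    using \<open>D t \<noteq> 0\<close> by (simp add: Re_Ln)
   also have "... <= exp (3 * ln 2)"
   proof -
    have "((3 + 2 * s) / 2) * (- ln (norm (D t))) <= ((3 + 2 * s) / 2) * ln 2" using l s by (intro mult_left_mono) auto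
    also have "... <= 3 * ln 2" using s by (intro mult_right_mono) auto
    finally show ?thesis by simp
   qed
   also have "... = 2 ^ 3" using exp_of_nat_mult[of 3 "ln (2::real)"] by simp
   finally show ?thesis by simp
  qed
  ultimately have "norm (g t) <= (\<Prod>i\<in>(UNIV::3 set). 36) * 8"
   unfolding g_def norm_mult by (intro mult_mono) auto
  then show ?thesis by simp
 qed
 moreover have "g (of_real t) = of_real (Kf s (t *\<^sub>R d) (x, z) / kern s x z)" if t: "\<bar>t\<bar> < 1/72" for t
 proof -
  define M where "M = norm (Sf (t *\<^sub>R d) x - Sf (t *\<^sub>R d) z)"
  have M: "M > 0" using xz by (simp add: M_def Sf_eq_iff)
  have er: "e i (of_real t) = of_real ((t *\<^sub>R d) $ i)" for i by (simp add: e_def)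
  have Ar: "A i (of_real t) = of_real ((Sf (t *\<^sub>R d) x - Sf (t *\<^sub>R d) z) $ i)" for i
   unfolding A_def er Tc_of_real by simp
  have Dr: "D (of_real t) = of_real (M\<^sup>2 / N\<^sup>2)"
   unfolding D_def Ar M_def norm_sq_R3 by simp
  have "exp (- complex_of_real ((3 + 2 * s) / 2) * Ln (D (of_real t))) = of_real (exp (- ((3 + 2 * s) / 2) * ln (M\<^sup>2 / N\<^sup>2)))"
   unfolding Dr using M N by (subst Ln_of_real) (simp_all add: exp_of_real[symmetric])
  also have "ln (M\<^sup>2 / N\<^sup>2) = 2 * (ln M - ln N)"
   using M N by (simp add: ln_div ln_realpow)
  also have "exp (- ((3 + 2 * s) / 2) * (2 * (ln M - ln N))) = exp ((3 + 2 * s) * ln N - (3 + 2 * s) * ln M)"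
   by (rule arg_cong[where f = exp]) (simp add: field_simps)
  also have "... = N powr (3 + 2 * s) / M powr (3 + 2 * s)"
   using M N by (simp add: exp_diff powr_def)
  also have "... = kern s (Sf (t *\<^sub>R d) x) (Sf (t *\<^sub>R d) z) / kern s x z"
   using N by (simp add: kern_def M_def N_def)
  finally have 1: "exp (- complex_of_real ((3 + 2 * s) / 2) * Ln (D (of_real t))) = of_real (kern s (Sf (t *\<^sub>R d) x) (Sf (t *\<^sub>R d) z) / kern s x z)" .
  have 2: "(\<Prod>i\<in>UNIV. dTc (e i (of_real t)) (x $ i) * dTc (e i (of_real t)) (z $ i)) = of_real (Jf (t *\<^sub>R d) x * Jf (t *\<^sub>R d) z)"
   unfolding er dTc_of_real Jf_def by (simp add: prod.distrib)
  show ?thesis unfolding g_def 1 2 of_real_mult[symmetric] by (simp add: Kf_def)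
 qed
 ultimately show ?thesis by blast
qed

text \<open>\<open>fd_holomorphic_bound\<close> for R = 1/72, which gives 144 = 2 * 72 and the time
  limit 1/288 = R / 4. The bound is relative to the kernel, as \<open>kform_bound\<close>
  demands.\<close>

lemma Kf_fd:
 fixes d :: R3
 assumes s: "0 < s" "s < 1" and d: "!!i. \<bar>d $ i\<bar> <= 1" and h: "h > 0" "0 <= t" "t + real j * h <= 1/288"
 shows "\<bar>fd h j (%t. Kf s (t *\<^sub>R d) p) t\<bar> <= 373248 * fact j * (144 * h) ^ j * kern2 s p"
proof (cases "fst p = snd p")
 case True
 then show ?thesis by (simp add: Kf_def kern2_def fd_zero)
next
 case False
 obtain x z where p: "p = (x, z)" by (cases p)
 have xz: "x \<noteq> z" using False p by simp
 obtain g where g: "g holomorphic_on ball 0 (1/72)" "!!t. norm t < 1/72 ==> norm (g t) <= 373248"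
   "!!t. \<bar>t\<bar> < 1/72 ==> g (of_real t) = of_real (Kf s (t *\<^sub>R d) (x, z) / kern s x z)"
  using Kf_analytic[OF s d xz] by blast
 have b: "\<bar>fd h j (%t. Kf s (t *\<^sub>R d) (x, z) / kern s x z) t\<bar> <= 373248 * fact j * (2 * h / (1/72)) ^ j"
  by (rule fd_holomorphic_bound[OF g]) (use h in auto)
 have k: "kern s x z > 0" using xz by (simp add: kern_def)
 have "fd h j (%t. Kf s (t *\<^sub>R d) p) t = fd h j (%t. kern s x z * (Kf s (t *\<^sub>R d) (x, z) / kern s x z)) t"
  using k by (simp add: p)
 also have "... = kern s x z * fd h j (%t. Kf s (t *\<^sub>R d) (x, z) / kern s x z) t" by (rule fd_cmult)
 finally have "\<bar>fd h j (%t. Kf s (t *\<^sub>R d) p) t\<bar> = kern s x z * \<bar>fd h j (%t. Kf s (t *\<^sub>R d) (x, z) / kern s x z) t\<bar>"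
  using k by (simp add: abs_mult)
 also have "... <= kern s x z * (373248 * fact j * (2 * h / (1/72)) ^ j)" using b k by (intro mult_left_mono) auto
 finally show ?thesis by (simp add: p kern2_def mult_ac)
qed

lemma norm_le_3: "(!!i. \<bar>(d::R3) $ i\<bar> <= 1) ==> norm d <= 3"
 using norm_le_l1_cart[of d] sum_mono[of UNIV "%i. \<bar>d $ i\<bar>" "%i. 1"] by simp

text \<open>Coercivity of the transported form for short times: 11 * 3/288 is below 1/2, so the
  exponential loss of \<open>Kf_bound\<close>, read downwards, is at most a factor 1/2.\<close>

lemma Kf_lower:
 fixes d :: R3
 assumes s: "0 < s" "s < 1" and d: "!!i. \<bar>d $ i\<bar> <= 1" and t: "0 <= t" "t <= 1/288"
 shows "1/2 * kern2 s p <= Kf s (t *\<^sub>R d) p"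
proof -
 define n where "n = norm (t *\<^sub>R d)"
 have "n <= 1/288 * 3" unfolding n_def norm_scaleR using t norm_le_3[OF d] by (intro mult_mono) auto
 then have "1 - 11 * n \<ge> 1/2" by simp
 then have e: "1/2 <= exp (- 11 * n)" using exp_ge_add_one_self[of "- 11 * n"] by linarith
 have k: "exp (- 5 * n) * kern s (fst p) (snd p) <= kern s (Sf (t *\<^sub>R d) (fst p)) (Sf (t *\<^sub>R d) (snd p))"
 proof -
  have "exp (- 5 * n) * kern s (fst p) (snd p) <= exp (- 5 * n) * (exp (5 * n) * kern s (Sf (t *\<^sub>R d) (fst p)) (Sf (t *\<^sub>R d) (snd p)))"
   unfolding n_def by (intro mult_left_mono kern_Sf(1)[OF s]) auto
  then show ?thesis by (simp add: mult.assoc[symmetric] mult_exp_exp)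
 qed
 have "1/2 * kern2 s p <= exp (- 11 * n) * kern2 s p" using e by (intro mult_right_mono) auto
 also have "... = exp (- 3 * n) * exp (- 3 * n) * (exp (- 5 * n) * kern s (fst p) (snd p))"
  by (simp add: kern2_def mult.assoc[symmetric] mult_exp_exp)
 also have "... <= Kf s (t *\<^sub>R d) p"
  unfolding Kf_def by (intro mult_mono k) (use Jf_bounds(1)[of "t *\<^sub>R d"] in \<open>auto simp: n_def less_imp_le[OF Jf_pos]\<close>)
 finally show ?thesis .
qed

text \<open>For the transported data the disc in the time variable has a radius R independent of the
  point, because the complex flow moves points of the cube by a uniformly small amount.\<close>

lemma rhs_fd:
 assumes "analytic_on_closure f Omega"
 shows "\<exists>R M. R > 0 \<and> M > 0 \<and> (\<forall>x\<in>Omega. \<forall>d::R3. (\<forall>i. \<bar>d $ i\<bar> <= 1) --> (\<forall>h j t. h > 0 --> 0 <= t --> t + real j * h <= R/4 -->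
   \<bar>fd h j (%t. f (Sf (t *\<^sub>R d) x) * Jf (t *\<^sub>R d) x) t\<bar> <= M * fact j * (2 * h / R) ^ j))"
proof -
 obtain rh M where rh: "rh > 0" and M: "M > 0" and ext: "!!x. x\<in>closure Omega ==> ext_at f x rh M"
  using analytic_ext[OF assms] by blast
 \<comment> \<open>1/4 keeps the complex flow defined; rh / 12 keeps its displacement, at most 12 R,
   inside the polydisc on which f extends.\<close>
 define R where "R = min (1/4) (rh / 12)"
 have R: "R > 0" "R <= 1/4" "12 * R <= rh" using rh by (auto simp: R_def)
 have "\<bar>fd h j (%t. f (Sf (t *\<^sub>R d) x) * Jf (t *\<^sub>R d) x) t\<bar> <= (M * 216) * fact j * (2 * h / R) ^ j"
  if x: "x \<in> Omega" and d: "!!i. \<bar>d $ i\<bar> <= 1" and h: "h > 0" "0 <= t" "t + real j * h <= R/4" for x d :: R3 and h j t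
 proof -
  have xc: "x \<in> closure Omega" using x closure_subset by blast
  have xi: "0 < x $ i" "x $ i < 1" for i using x by (auto simp: Omega_def)
  obtain F where 1: "\<forall>y. (\<forall>i. \<bar>y $ i - x $ i\<bar> < rh) --> F (complex_of_real (y $ 1)) (complex_of_real (y $ 2)) (complex_of_real (y $ 3)) = complex_of_real (f y)"
   and 2: "\<forall>z1 z2 z3. norm (z1 - of_real (x $ 1)) < rh --> norm (z2 - of_real (x $ 2)) < rh --> norm (z3 - of_real (x $ 3)) < rh
     --> norm (F z1 z2 z3) <= M"
   and 3: "\<forall>S c1 c2 c3. open S --> c1 holomorphic_on S --> c2 holomorphic_on S --> c3 holomorphic_on S -->
     (\<forall>t\<in>S. norm (c1 t - of_real (x $ 1)) < rh \<and> norm (c2 t - of_real (x $ 2)) < rh \<and> norm (c3 t - of_real (x $ 3)) < rh) -->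
     (%t. F (c1 t) (c2 t) (c3 t)) holomorphic_on S"
   using ext[OF xc] unfolding ext_at_def by (elim exE conjE)
  note 1 = 1[rule_format] and 2 = 2[rule_format] and 3 = 3[rule_format]
  define e where "e i t = t * complex_of_real (d $ i)" for i t
  have e_small: "norm (e i t) <= norm t" for i t
   using mult_left_mono[OF d[of i], of "norm t"] by (simp add: e_def norm_mult)
  have e4: "norm (e i t) <= 1/4" if "norm t < R" for i t
   using e_small[of i t] that R by linarith
  define c where "c i t = Tc (e i t) (x $ i)" for i t
  have crh: "norm (c i t - of_real (x $ i)) < rh" if t: "norm t < R" for i t
  proof -
   have "norm (c i t - of_real (x $ i)) <= 12 * norm (e i t) * \<bar>x $ i - 0\<bar>"
    using Tc_increment[OF e4[OF t], of i "x $ i" 0] by (simp add: c_def Tc_def)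
   also have "... <= 12 * norm t * 1" using xi[of i] e_small[of i t] by (intro mult_mono) auto
   also have "... < rh" using t R by linarith
   finally show ?thesis .
  qed
  have eh: "(%t. e i t) holomorphic_on ball 0 R" for i unfolding e_def by (intro holomorphic_intros)
  have ch: "c i holomorphic_on ball 0 R" "(%t. dTc (e i t) (x $ i)) holomorphic_on ball 0 R" for i
   unfolding c_def[abs_def] using e4 by (intro holomorphic_Tc eh; simp)+
  define g where "g t = F (c 1 t) (c 2 t) (c 3 t) * (\<Prod>i\<in>UNIV. dTc (e i t) (x $ i))" for t
  have g: "g holomorphic_on ball 0 R"
   unfolding g_def[abs_def] by (intro holomorphic_intros 3 ch) (auto intro!: crh)
  have gM: "norm (g t) <= M * 216" if t: "norm t < R" for t
  proof -
   have "norm (\<Prod>i\<in>UNIV. dTc (e i t) (x $ i)) <= (\<Prod>i\<in>(UNIV::3 set). 6)"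
    by (subst prod_norm[symmetric], rule prod_mono) (auto intro!: dTc_bound e4[OF t])
   then show ?thesis unfolding g_def norm_mult using M by (intro mult_mono 2 crh[OF t]) auto
  qed
  have gr: "g (of_real t) = of_real (f (Sf (t *\<^sub>R d) x) * Jf (t *\<^sub>R d) x)" if t: "\<bar>t\<bar> < R" for t
  proof -
   have er: "e i (of_real t) = of_real ((t *\<^sub>R d) $ i)" for i by (simp add: e_def)
   have cr: "c i (of_real t) = of_real (Sf (t *\<^sub>R d) x $ i)" for i unfolding c_def er Tc_of_real by simp
   have "\<bar>Sf (t *\<^sub>R d) x $ i - x $ i\<bar> < rh" for i
    using crh[of "of_real t" i] t unfolding cr by (simp del: Sf_nth flip: of_real_diff)
   then have "F (c 1 (of_real t)) (c 2 (of_real t)) (c 3 (of_real t)) = of_real (f (Sf (t *\<^sub>R d) x))"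
    unfolding cr by (intro 1) simp
   then show ?thesis unfolding g_def er dTc_of_real Jf_def by simp
  qed
  show ?thesis by (rule fd_holomorphic_bound[OF g gM gr]) (use R h in auto)
 qed
 then show ?thesis using R M by (intro exI[of _ R] exI[of _ "M * 216"]) auto
qed

lemma Htilde_fd:
 assumes s: "0 < s" and F: "!!t. F t \<in> Htilde s Omega"
 shows "(%x. fd h k (%t. F t x) t) \<in> Htilde s Omega"
proof (induction k arbitrary: t)
 case 0
 then show ?case using F[of t] by simp
next
 case (Suc k)
 show ?case using Htilde_diff[OF s Suc.IH[of "t + h"] Suc.IH[of t]] by simp
qed

section \<open>Dilations\<close>

lemma integral_affine_R3:
 fixes F :: "R3 => real" and t :: R3
 assumes c: "c \<noteq> 0" and [measurable]: "F \<in> borel_measurable borel"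
 shows "(\<integral>x. F x \<partial>lborel) = \<bar>c\<bar>^3 * (\<integral>x. F (t + c *\<^sub>R x) \<partial>lborel)"
proof -
 have "(\<integral>x. F x \<partial>lborel) = (\<integral>x. F x \<partial>density (distr lborel borel (%x. t + c *\<^sub>R x)) (%_. ennreal (\<bar>c\<bar>^3)))"
  by (subst lborel_affine[OF c, of t]) (simp add: ennreal_power)
 also have "... = (\<integral>x. \<bar>c\<bar>^3 *\<^sub>R F x \<partial>distr lborel borel (%x. t + c *\<^sub>R x))"
  by (rule integral_density) auto
 also have "... = (\<integral>x. \<bar>c\<bar>^3 *\<^sub>R F (t + c *\<^sub>R x) \<partial>lborel)"
  by (rule integral_distr) auto
 finally show ?thesis by simp
qed

text \<open>The exact factor is b^(2s - 3), at most 1 for b >= 1: squeezing the argument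
  concentrates the function and the gain in volume outweighs the growth of the kernel.\<close>

lemma gagliardo_dilation:
 assumes [measurable]: "w \<in> borel_measurable borel" and b: "b \<ge> 1" and s: "0 < s" "s < 1"
 shows "gagliardo_sq s UNIV (%x. w (t + b *\<^sub>R x)) <= gagliardo_sq s UNIV w"
proof -
 define G where "G x z = ennreal ((w x - w z)\<^sup>2 * kern s x z)" for x z
 define y where "y x = t + b *\<^sub>R x" for x :: R3
 have [measurable]: "y \<in> borel_measurable borel" unfolding y_def[abs_def] by measurable
 have [measurable]: "(%p. G (fst p) (snd p)) \<in> borel_measurable (borel \<Otimes>\<^sub>M borel)"
  "(%p. G (y (fst p)) (y (snd p))) \<in> borel_measurable (borel \<Otimes>\<^sub>M borel)"
  "(%p. G (y (fst p)) (snd p)) \<in> borel_measurable (borel \<Otimes>\<^sub>M borel)"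
  unfolding G_def by measurable
 have [measurable]: "G x \<in> borel_measurable borel" for x unfolding G_def by measurable
 have b0: "b \<noteq> 0" "b > 0" using b by auto
 have pt: "ennreal ((w (y x) - w (y z))\<^sup>2 * kern s x z) <= ennreal (\<bar>b\<bar>^3) * (ennreal (\<bar>b\<bar>^3) * G (y x) (y z))" for x z
 proof -
  have "kern s x z <= b^3 * (b^3 * kern s (y x) (y z))"
  proof (cases "x = z")
   case False
   have "y x - y z = b *\<^sub>R (x - z)" by (simp add: y_def algebra_simps)
   then have "norm (y x - y z) = b * norm (x - z)" using b0 by simp
   then have k: "kern s (y x) (y z) = kern s x z / b powr (3 + 2 * s)"
    using b0 by (simp add: kern_def powr_mult)
   have "b powr (3 + 2 * s) <= b powr 6" using b s by (intro powr_mono) auto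
   also have "... = b^3 * b^3" using b0 by (simp add: power_add[symmetric])
   finally have "kern s x z * b powr (3 + 2 * s) <= kern s x z * (b^3 * b^3)" by (intro mult_left_mono) auto
   then show ?thesis unfolding k using b0 by (simp add: field_simps)
  qed simp
  then have "(w (y x) - w (y z))\<^sup>2 * kern s x z <= (w (y x) - w (y z))\<^sup>2 * (b^3 * (b^3 * kern s (y x) (y z)))"
   by (intro mult_left_mono) auto
  also have "... = b^3 * (b^3 * ((w (y x) - w (y z))\<^sup>2 * kern s (y x) (y z)))" by simp
  finally show ?thesis unfolding G_def using b0
   by (simp add: ennreal_mult'[symmetric] ennreal_leI)
 qed
 have "gagliardo_sq s UNIV (%x. w (t + b *\<^sub>R x))
   <= (\<integral>\<^sup>+x. \<integral>\<^sup>+z. ennreal (\<bar>b\<bar>^3) * (ennreal (\<bar>b\<bar>^3) * G (y x) (y z)) \<partial>lborel \<partial>lborel)"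
  unfolding gagliardo_UNIV y_def[symmetric] by (intro nn_integral_mono pt)
 also have "... = (\<integral>\<^sup>+x. ennreal (\<bar>b\<bar>^3) * (\<integral>\<^sup>+z. ennreal (\<bar>b\<bar>^3) * G (y x) (y z) \<partial>lborel) \<partial>lborel)"
  by (intro nn_integral_cong nn_integral_cmult) measurable
 also have "... = (\<integral>\<^sup>+x. ennreal (\<bar>b\<bar>^3) * (\<integral>\<^sup>+z. G (y x) z \<partial>lborel) \<partial>lborel)"
  by (subst nn_integral_affine_R3[OF b0(1), of "G (y x)" t for x]) (auto simp: y_def)
 also have "... = (\<integral>\<^sup>+x. \<integral>\<^sup>+z. G x z \<partial>lborel \<partial>lborel)"
  by (subst nn_integral_affine_R3[OF b0(1), of "%x. \<integral>\<^sup>+z. G x z \<partial>lborel" t]) (auto simp: y_def)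
 finally show ?thesis unfolding G_def gagliardo_UNIV .
qed

section \<open>The solution: differences along the flow and the boundary layer\<close>

locale fractional_solution =
 fixes s :: real and f u :: "R3 => real"
 assumes s: "0 < s" "s < 1"
  and f: "analytic_on_closure f Omega"
  and u: "u \<in> Htilde s Omega"
  and weak: "\<forall>v \<in> Htilde s Omega. bform s u v = L2_inner Omega f v"
begin

lemma f_continuous: "continuous_on (closure Omega) f"
proof -
 obtain B where B: "B > 0" "\<forall>x\<in>closure Omega. \<bar>f x\<bar> <= B \<and> (\<forall>y\<in>closure Omega. \<bar>f y - f x\<bar> <= B * norm (y - x))"
  using analytic_Lipschitz[OF f] by blast
 then have "B-lipschitz_on (closure Omega) f"
  by (intro lipschitz_onI) (auto simp: dist_norm)
 then show ?thesis by (rule lipschitz_on_continuous_on)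
qed

lemma f_measurable [measurable]: "(%x. indicator Omega x * f x) \<in> borel_measurable borel"
 using borel_measurable_continuous_on_indicator[of Omega f] continuous_on_subset[OF f_continuous closure_subset] by simp

lemma kform_weak:
 assumes v: "v \<in> Htilde s Omega"
 shows "kform (kern2 s) u v = 2 / Cconst s * (\<integral>x. indicator Omega x * f x * v x \<partial>lborel)"
 using weak[rule_format, OF v] bform_eq_kform[OF u v] Cconst_pos[OF s]
 by (simp add: L2_inner_def set_lebesgue_integral_def field_simps)

definition wdiff :: "R3 => real => nat => R3 => real" where
 "wdiff d h k x = fd h k (%t. u (Sf (t *\<^sub>R d) x)) 0"

lemma wdiff_Htilde: "wdiff d h k \<in> Htilde s Omega"
 unfolding wdiff_def[abs_def] by (intro Htilde_fd s Htilde_Sf u)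

text \<open>The k-th difference in time of \<open>weak_Sf\<close> with a fixed test function,
  expanded by \<open>fd_Leibniz\<close>. The summand j = 0 pairs the k-th difference of the solution
  with an undifferenced kernel; all other summands contain lower differences of the
  solution.\<close>

lemma kform_fd:
 fixes d :: R3
 assumes d: "!!i. \<bar>d $ i\<bar> <= 1" and h: "h > 0" "real k * h <= 1/288" and v: "v \<in> Htilde s Omega"
 shows "(\<Sum>j\<le>k. real (k choose j) * kform (%p. fd h j (%t. Kf s (t *\<^sub>R d) p) (real (k - j) * h)) (wdiff d h (k - j)) v)
   = 2 / Cconst s * (\<integral>x. indicator Omega x * fd h k (%t. f (Sf (t *\<^sub>R d) x) * Jf (t *\<^sub>R d) x) 0 * v x \<partial>lborel)"
proof -
 note HtildeD(1)[OF v, measurable]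
 define ut where "ut t x = u (Sf (t *\<^sub>R d) x)" for t x
 have ut: "ut t \<in> Htilde s Omega" for t unfolding ut_def[abs_def] by (intro Htilde_Sf s u)
 define Kj where "Kj j p = fd h j (%t. Kf s (t *\<^sub>R d) p) (real (k - j) * h)" for j p
 have Km [measurable]: "Kj j \<in> borel_measurable (borel \<Otimes>\<^sub>M borel)" for j
  unfolding Kj_def[abs_def] by (rule fd_measurable) simp
 have Kb: "\<bar>Kj j p\<bar> <= (373248 * fact j * (144 * h) ^ j) * kern2 s p" if "j <= k" for j p
  unfolding Kj_def using that h by (intro Kf_fd s d) (auto simp: of_nat_diff algebra_simps)
 have int1: "integrable lborel2 (%p. incr (ut t) p * incr v p * Kf s (t *\<^sub>R d) p)" for t
  by (rule kform_bound(1)[OF ut v measurable_Kf Kf_bound[OF s]]) simp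
 have int2: "integrable lborel2 (%p. incr (wdiff d h i) p * incr v p * Kj j p)" if "j <= k" for i j
  by (rule kform_bound(1)[OF wdiff_Htilde v Km Kb[OF that]]) (use h in auto)
 have "fd h k (%t. kform (Kf s (t *\<^sub>R d)) (ut t) v) 0 = (\<integral>p. fd h k (%t. incr (ut t) p * incr v p * Kf s (t *\<^sub>R d) p) 0 \<partial>lborel2)"
  unfolding kform_def by (rule fd_integral(2)[OF int1])
 also have "... = (\<integral>p. (\<Sum>j\<le>k. real (k choose j) * (incr (wdiff d h (k - j)) p * incr v p * Kj j p)) \<partial>lborel2)"
 proof (rule Bochner_Integration.integral_cong[OF refl])
  fix p :: "R3 \<times> R3"
  have "fd h k (%t. incr (ut t) p * incr v p * Kf s (t *\<^sub>R d) p) 0 = fd h k (%t. incr v p * (Kf s (t *\<^sub>R d) p * incr (ut t) p)) 0"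
   by (simp add: mult_ac)
  also have "... = incr v p * (\<Sum>j\<le>k. real (k choose j) * fd h j (%t. Kf s (t *\<^sub>R d) p) (0 + real (k - j) * h) * fd h (k - j) (%t. incr (ut t) p) 0)"
   unfolding fd_cmult fd_Leibniz ..
  also have "... = (\<Sum>j\<le>k. real (k choose j) * (incr (wdiff d h (k - j)) p * incr v p * Kj j p))"
   unfolding sum_distrib_left
   by (intro sum.cong refl) (simp add: incr_def fd_diff wdiff_def ut_def Kj_def)
  finally show "fd h k (%t. incr (ut t) p * incr v p * Kf s (t *\<^sub>R d) p) 0 = ..." .
 qed
 also have "... = (\<Sum>j\<le>k. real (k choose j) * kform (Kj j) (wdiff d h (k - j)) v)"
  unfolding kform_def by (subst Bochner_Integration.integral_sum) (auto intro!: int2 integrable_mult_right)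
 finally have L: "fd h k (%t. kform (Kf s (t *\<^sub>R d)) (ut t) v) 0 = (\<Sum>j\<le>k. real (k choose j) * kform (Kj j) (wdiff d h (k - j)) v)" .
 obtain B where B: "B > 0" "!!x. x\<in>closure Omega ==> \<bar>f x\<bar> <= B"
  using analytic_Lipschitz[OF f] by blast
 define rt where "rt t x = indicator Omega x * (f (Sf (t *\<^sub>R d) x) * Jf (t *\<^sub>R d) x) * v x" for t x
 \<comment> \<open>Measurability is known for \<open>indicator Omega x * f x\<close>, not for f
   itself; invariance of the cube allows the indicator to be composed with the flow.\<close>
 have rt_alt: "rt t x = (indicator Omega (Sf (t *\<^sub>R d) x) * f (Sf (t *\<^sub>R d) x)) * Jf (t *\<^sub>R d) x * v x" for t x
  by (simp add: rt_def indicator_def Sf_Omega)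
 have int3: "integrable lborel (rt t)" for t
 proof (rule Bochner_Integration.integrable_bound)
  show "integrable lborel (%x. (B * exp (3 * norm (t *\<^sub>R d))) * \<bar>v x\<bar>)"
   using L1_le_enorm(1)[OF s(1) v] by (intro integrable_mult_right integrable_abs)
  show "rt t \<in> borel_measurable lborel"
   unfolding rt_alt[abs_def] using measurable_compose[OF measurable_Sf f_measurable] by measurable
  show "AE x in lborel. norm (rt t x) <= norm ((B * exp (3 * norm (t *\<^sub>R d))) * \<bar>v x\<bar>)"
  proof (rule AE_I2)
   fix x
   show "norm (rt t x) <= norm ((B * exp (3 * norm (t *\<^sub>R d))) * \<bar>v x\<bar>)"
   proof (cases "x \<in> Omega")
    case True
    then have "Sf (t *\<^sub>R d) x \<in> closure Omega" using Sf_Omega(1)[of "t *\<^sub>R d" x] closure_subset[of Omega] by blast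
    then have "\<bar>f (Sf (t *\<^sub>R d) x)\<bar> * Jf (t *\<^sub>R d) x * \<bar>v x\<bar> <= B * exp (3 * norm (t *\<^sub>R d)) * \<bar>v x\<bar>"
     using B by (intro mult_right_mono mult_mono Jf_bounds) (auto simp: less_imp_le[OF Jf_pos])
    then show ?thesis using True B(1) by (simp add: rt_def abs_mult less_imp_le[OF Jf_pos])
   qed (simp add: rt_def)
  qed
 qed
 have "fd h k (%t. kform (Kf s (t *\<^sub>R d)) (ut t) v) 0 = fd h k (%t. 2 / Cconst s * integral\<^sup>L lborel (rt t)) 0"
  unfolding ut_def rt_def weak_Sf[OF s u weak f_continuous v] ..
 also have "... = 2 / Cconst s * (\<integral>x. fd h k (%t. rt t x) 0 \<partial>lborel)"
  unfolding fd_cmult fd_integral(2)[OF int3] ..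
 also have "(%x. fd h k (%t. rt t x) 0) = (%x. indicator Omega x * fd h k (%t. f (Sf (t *\<^sub>R d) x) * Jf (t *\<^sub>R d) x) 0 * v x)"
 proof
  fix x
  have "fd h k (%t. rt t x) 0 = fd h k (%t. (indicator Omega x * v x) * (f (Sf (t *\<^sub>R d) x) * Jf (t *\<^sub>R d) x)) 0"
   by (simp add: rt_def mult_ac)
  then show "fd h k (%t. rt t x) 0 = indicator Omega x * fd h k (%t. f (Sf (t *\<^sub>R d) x) * Jf (t *\<^sub>R d) x) 0 * v x"
   unfolding fd_cmult by (simp add: mult_ac)
 qed
 finally show ?thesis using L unfolding Kj_def[abs_def] by simp
qed

text \<open>The k-th differenced equation is tested with the k-th difference itself; coercivity
  bounds its energy by the data and by lower differences. Division by k! h^k cancels the binomial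
  coefficients against the factorials in the kernel bounds, and \<open>recurrence_bound\<close>
  turns the resulting convolution inequality into geometric growth.\<close>

lemma flow_differences:
 "\<exists>C A R. C > 0 \<and> A > 0 \<and> R > 0 \<and> (\<forall>d::R3. (\<forall>i. \<bar>d $ i\<bar> <= 1) --> (\<forall>h>0. \<forall>k. real k * h <= R -->
   enorm s (wdiff d h k) <= C * A ^ k * fact k * h ^ k))"
proof -
 obtain Rf Mf where Rf: "Rf > 0" "Mf > 0" and
  fb: "\<forall>x\<in>Omega. \<forall>d::R3. (\<forall>i. \<bar>d $ i\<bar> <= 1) --> (\<forall>h j t. h > 0 --> 0 <= t --> t + real j * h <= Rf/4 -->
   \<bar>fd h j (%t. f (Sf (t *\<^sub>R d) x) * Jf (t *\<^sub>R d) x) t\<bar> <= Mf * fact j * (2 * h / Rf) ^ j)"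
  using rhs_fd[OF f] by (elim exE conjE)
 note fb = fb[rule_format]
 define MK :: real where "MK = 373248"
 define A where "A = max 144 (2 / Rf)"
 define R where "R = min (1/288) (Rf/4)"
 define c1 where "c1 = 2 / Cconst s * Mf / sqrt (hardy_const s)"
 have A: "A > 0" "144 <= A" "2 / Rf <= A" by (auto simp: A_def)
 have R: "R > 0" using Rf by (simp add: R_def)
 have c1: "c1 > 0" unfolding c1_def using Rf Cconst_pos[OF s] hardy_const_pos[of s] by simp
 have "enorm s (wdiff d h k) <= (2 * c1 * (A * (1 + 2 * MK)) ^ k) * fact k * h ^ k"
  if d: "\<forall>i. \<bar>(d::R3) $ i\<bar> <= 1" and h: "h > 0" and kh: "real k * h <= R" for d h k
 proof -
  define e where "e k = enorm s (wdiff d h k)" for k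
  \<comment> \<open>The value 0 for times beyond R makes the recursion hold for every k, as
    \<open>recurrence_bound\<close> asks.\<close>
  define a where "a k = (if real k * h <= R then e k / (fact k * h ^ k) else 0)" for k
  have a0: "a k \<ge> 0" for k unfolding a_def e_def using h by simp
  have step: "e k <= 2 * (c1 * fact k * (A * h) ^ k) + 2 * (\<Sum>j=1..k. real (k choose j) * (MK * fact j * (A * h) ^ j) * e (k - j))"
   if kR: "real k * h <= R" for k
  proof (cases "e k = 0")
   case True
   have "0 <= (\<Sum>j=1..k. real (k choose j) * (MK * fact j * (A * h) ^ j) * e (k - j))"
    unfolding e_def MK_def using A h by (intro sum_nonneg mult_nonneg_nonneg) auto
   moreover have "0 <= c1 * fact k * (A * h) ^ k" using c1 A h by simp
   ultimately show ?thesis using True by linarith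
  next
   case False
   then have ek: "e k > 0" using enorm_nonneg[of s "wdiff d h k"] unfolding e_def by linarith
   define w where "w = wdiff d h k"
   have w: "w \<in> Htilde s Omega" unfolding w_def by (rule wdiff_Htilde)
   note HtildeD(1)[OF w, measurable]
   define Kj where "Kj j p = fd h j (%t. Kf s (t *\<^sub>R d) p) (real (k - j) * h)" for j p
   have Km [measurable]: "Kj j \<in> borel_measurable (borel \<Otimes>\<^sub>M borel)" for j
    unfolding Kj_def[abs_def] by (rule fd_measurable) simp
   have k288: "real k * h <= 1/288" using kR by (simp add: R_def)
   have Kb: "\<bar>Kj j p\<bar> <= (MK * fact j * (A * h) ^ j) * kern2 s p" if "j <= k" for j p
   proof -
    have "\<bar>Kj j p\<bar> <= MK * fact j * (144 * h) ^ j * kern2 s p"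
     unfolding Kj_def MK_def using that h k288 d by (intro Kf_fd s) (auto simp: of_nat_diff algebra_simps)
    also have "... <= MK * fact j * (A * h) ^ j * kern2 s p"
     using A h by (intro mult_right_mono mult_left_mono power_mono) (auto simp: MK_def)
    finally show ?thesis .
   qed
   define rhs where "rhs = 2 / Cconst s * (\<integral>x. indicator Omega x * fd h k (%t. f (Sf (t *\<^sub>R d) x) * Jf (t *\<^sub>R d) x) 0 * w x \<partial>lborel)"
   have eq: "(\<Sum>j\<le>k. real (k choose j) * kform (Kj j) (wdiff d h (k - j)) w) = rhs"
    unfolding Kj_def[abs_def] rhs_def by (rule kform_fd) (use d h k288 w in auto)
   have "(\<Sum>j\<le>k. real (k choose j) * kform (Kj j) (wdiff d h (k - j)) w)
     = kform (Kj 0) w w + (\<Sum>j=1..k. real (k choose j) * kform (Kj j) (wdiff d h (k - j)) w)"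
    unfolding atMost_atLeast0 by (subst sum.atLeast_Suc_atMost) (auto simp: w_def)
   then have K0: "kform (Kj 0) w w = rhs - (\<Sum>j=1..k. real (k choose j) * kform (Kj j) (wdiff d h (k - j)) w)"
    using eq by simp
   \<comment> \<open>\<open>Kj 0\<close> is the kernel at time k h, not at time 0: this is the shift
     in \<open>fd_Leibniz\<close>, and \<open>Kf_lower\<close> covers it because k h is at most
     1/288.\<close>
   have "1/2 * (e k)\<^sup>2 = (\<integral>p. 1/2 * (incr w p * incr w p * kern2 s p) \<partial>lborel2)"
    by (simp add: e_def w_def[symmetric] enorm_def kform_self_nonneg) (simp add: kform_def)
   also have "... <= kform (Kj 0) w w"
    unfolding kform_def
   proof (rule integral_mono)
    show "integrable lborel2 (%p. 1/2 * (incr w p * incr w p * kern2 s p))"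
     using kform_CS(1)[OF w w] by simp
    show "integrable lborel2 (%p. incr w p * incr w p * Kj 0 p)"
     by (rule kform_bound(1)[OF w w Km Kb]) (use A h in \<open>auto simp: MK_def\<close>)
    fix p
    have "1/2 * kern2 s p <= Kj 0 p"
     unfolding Kj_def using Kf_lower[OF s, of d "real k * h" p] d h k288 by simp
    then have "(incr w p * incr w p) * (1/2 * kern2 s p) <= (incr w p * incr w p) * Kj 0 p"
     by (intro mult_left_mono) auto
    then show "1/2 * (incr w p * incr w p * kern2 s p) <= incr w p * incr w p * Kj 0 p" by simp
   qed
   also have "... <= \<bar>rhs\<bar> + (\<Sum>j=1..k. \<bar>real (k choose j) * kform (Kj j) (wdiff d h (k - j)) w\<bar>)"
    unfolding K0 using sum_abs[of "%j. real (k choose j) * kform (Kj j) (wdiff d h (k - j)) w" "{1..k}"] by linarith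
   also have "... <= c1 * fact k * (A * h) ^ k * e k + (\<Sum>j=1..k. real (k choose j) * (MK * fact j * (A * h) ^ j) * e (k - j) * e k)"
   proof (intro add_mono sum_mono)
    fix j assume j: "j \<in> {1..k}"
    have "\<bar>kform (Kj j) (wdiff d h (k - j)) w\<bar> <= (MK * fact j * (A * h) ^ j) * enorm s (wdiff d h (k - j)) * enorm s w"
     by (rule kform_bound(2)[OF wdiff_Htilde w Km Kb]) (use j A h in \<open>auto simp: MK_def\<close>)
    then have "real (k choose j) * \<bar>kform (Kj j) (wdiff d h (k - j)) w\<bar> <= real (k choose j) * ((MK * fact j * (A * h) ^ j) * e (k - j) * e k)"
     unfolding e_def w_def by (intro mult_left_mono) auto
    then show "\<bar>real (k choose j) * kform (Kj j) (wdiff d h (k - j)) w\<bar> <= real (k choose j) * (MK * fact j * (A * h) ^ j) * e (k - j) * e k"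
     by (simp add: abs_mult mult.assoc)
   next
    have pt: "norm (indicator Omega x * fd h k (%t. f (Sf (t *\<^sub>R d) x) * Jf (t *\<^sub>R d) x) 0 * w x) <= (Mf * fact k * (A * h) ^ k) * \<bar>w x\<bar>" for x
    proof (cases "x \<in> Omega")
     case True
     have "\<bar>fd h k (%t. f (Sf (t *\<^sub>R d) x) * Jf (t *\<^sub>R d) x) 0\<bar> <= Mf * fact k * (2 * h / Rf) ^ k"
      by (rule fb) (use True d h kR in \<open>auto simp: R_def\<close>)
     also have "... <= Mf * fact k * (A * h) ^ k"
      using Rf h mult_right_mono[OF A(3), of h] by (intro mult_left_mono power_mono) auto
     finally show ?thesis using True by (simp add: abs_mult mult_right_mono)
    next
     case False
     then show ?thesis using Rf A h by (simp add: mult_nonneg_nonneg)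
    qed
    have "\<bar>\<integral>x. indicator Omega x * fd h k (%t. f (Sf (t *\<^sub>R d) x) * Jf (t *\<^sub>R d) x) 0 * w x \<partial>lborel\<bar> <= (\<integral>x. (Mf * fact k * (A * h) ^ k) * \<bar>w x\<bar> \<partial>lborel)"
    \<comment> \<open>If the integrand were not integrable, its Bochner integral would be 0 and the
      bound trivial.\<close>
    proof (cases "integrable lborel (%x. indicator Omega x * fd h k (%t. f (Sf (t *\<^sub>R d) x) * Jf (t *\<^sub>R d) x) 0 * w x)")
     case True
     have i: "integrable lborel (%x. (Mf * fact k * (A * h) ^ k) * \<bar>w x\<bar>)"
      using L1_le_enorm(1)[OF s(1) w] by (intro integrable_mult_right integrable_abs)
     from Bochner_Integration.integral_norm_bound_integral[OF True i pt] show ?thesis by (simp only: real_norm_def)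
    next
     case False
     have "0 <= (\<integral>x. (Mf * fact k * (A * h) ^ k) * \<bar>w x\<bar> \<partial>lborel)"
      using Rf A h by (intro integral_nonneg_AE) (auto intro!: mult_nonneg_nonneg)
     then show ?thesis using False by (simp add: not_integrable_integral_eq)
    qed
    also have "... = (Mf * fact k * (A * h) ^ k) * (\<integral>x. \<bar>w x\<bar> \<partial>lborel)" by simp
    also have "... <= (Mf * fact k * (A * h) ^ k) * (enorm s w / sqrt (hardy_const s))"
     using L1_le_enorm(2)[OF s(1) w] Rf A h by (intro mult_left_mono) auto
    finally have "\<bar>rhs\<bar> <= 2 / Cconst s * ((Mf * fact k * (A * h) ^ k) * (enorm s w / sqrt (hardy_const s)))"
    proof -
     assume "\<bar>\<integral>x. indicator Omega x * fd h k (%t. f (Sf (t *\<^sub>R d) x) * Jf (t *\<^sub>R d) x) 0 * w x \<partial>lborel\<bar> <= (Mf * fact k * (A * h) ^ k) * (enorm s w / sqrt (hardy_const s))"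
     from mult_left_mono[OF this, of "2 / Cconst s"] show ?thesis
      unfolding rhs_def abs_mult[of "2 / Cconst s"] using Cconst_pos[OF s] by simp
    qed
    then show "\<bar>rhs\<bar> <= c1 * fact k * (A * h) ^ k * e k"
     by (simp add: c1_def e_def w_def field_simps)
   qed
   also have "... = (c1 * fact k * (A * h) ^ k + (\<Sum>j=1..k. real (k choose j) * (MK * fact j * (A * h) ^ j) * e (k - j))) * e k"
    by (simp add: distrib_right sum_distrib_right)
   finally have "1/2 * e k <= c1 * fact k * (A * h) ^ k + (\<Sum>j=1..k. real (k choose j) * (MK * fact j * (A * h) ^ j) * e (k - j))"
    using ek by (simp add: power2_eq_square)
   then show ?thesis by linarith
  qed
  have "a k <= (2 * MK) * (c1 / MK) * A ^ k + (2 * MK) * (\<Sum>j=1..k. A ^ j * a (k - j))" for k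
  proof (cases "real k * h <= R")
   case True
   have sm: "real (k - j) * h <= R" for j
    using True h by (smt (verit) diff_le_self mult_right_mono of_nat_le_iff)
   have trm: "real (k choose j) * (MK * fact j * (A * h) ^ j) * e (k - j) / (fact k * h ^ k) = MK * (A ^ j * a (k - j))" if "j \<in> {1..k}" for j
   proof -
    have j: "j <= k" using that by simp
    have f1: "real (k choose j) = fact k / (fact j * fact (k - j))" using binomial_fact[OF j] by simp
    have h1: "h ^ k = h ^ j * h ^ (k - j)" using j by (simp add: power_add[symmetric])
    show ?thesis unfolding a_def f1 h1 power_mult_distrib using sm h by (simp add: field_simps)
   qed
   have "a k = e k / (fact k * h ^ k)" using True by (simp add: a_def)
   also have "... <= (2 * (c1 * fact k * (A * h) ^ k) + 2 * (\<Sum>j=1..k. real (k choose j) * (MK * fact j * (A * h) ^ j) * e (k - j))) / (fact k * h ^ k)"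
    using h by (intro divide_right_mono step True) auto
   also have "... = 2 * (c1 * fact k * (A * h) ^ k) / (fact k * h ^ k) + 2 * (\<Sum>j=1..k. real (k choose j) * (MK * fact j * (A * h) ^ j) * e (k - j) / (fact k * h ^ k))"
    by (simp add: add_divide_distrib sum_divide_distrib[symmetric])
   also have "(\<Sum>j=1..k. real (k choose j) * (MK * fact j * (A * h) ^ j) * e (k - j) / (fact k * h ^ k)) = (\<Sum>j=1..k. MK * (A ^ j * a (k - j)))"
    by (intro sum.cong refl trm)
   also have "2 * (c1 * fact k * (A * h) ^ k) / (fact k * h ^ k) = (2 * MK) * (c1 / MK) * A ^ k"
    using h by (simp add: power_mult_distrib MK_def)
   finally show ?thesis by (simp add: sum_distrib_left mult_ac)
  next
   case False
   have "0 <= (\<Sum>j=1..k. A ^ j * a (k - j))" using A a0 by (intro sum_nonneg mult_nonneg_nonneg) auto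
   then show ?thesis using False A c1 by (simp add: a_def MK_def)
  qed
  from recurrence_bound[of a "2 * MK" "c1 / MK" A, OF this _ A(1)]
  have "a k <= (2 * MK) * (c1 / MK) * (A * (1 + 2 * MK)) ^ k" by (simp add: MK_def)
  then have "e k / (fact k * h ^ k) <= 2 * c1 * (A * (1 + 2 * MK)) ^ k"
   using kh by (simp add: a_def MK_def)
  then show ?thesis unfolding e_def using h by (simp add: divide_le_eq mult.assoc)
 qed
 then show ?thesis using A R c1
  by (intro exI[of _ "2 * c1"] exI[of _ "A * (1 + 2 * MK)"] exI[of _ R]) (auto simp: MK_def)
qed

text \<open>Since the dilated \<open>uh\<close> has no more energy, |u - uh|^2 <= 2 a(u, u - uh) up
  to the constant of the form, and the weak equation turns this into an integral of f (u - uh). A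
  rate for u - uh in L1 is not at hand; instead the substitution \<open>xi\<close> moves the
  dilation from \<open>uh\<close> to f, which is Lipschitz, and this yields O(h) for the squared
  norm.\<close>

lemma boundary_layer:
 "\<exists>C>0. \<forall>h. 0 < h --> h < 1/4 --> (\<exists>uh\<in>Htilde s Omega. (\<forall>x. bd x < h --> uh x = 0) \<and> enorm s (%x. u x - uh x) <= C * sqrt h)"
proof -
 obtain B where B: "B > 0" "!!x. x\<in>closure Omega ==> \<bar>f x\<bar> <= B" 
   "!!x y. x\<in>closure Omega ==> y\<in>closure Omega ==> \<bar>f y - f x\<bar> <= B * norm (y - x)"
  using analytic_Lipschitz[OF f] by blast
 note um = HtildeD(1)[OF u, measurable]
 define U where "U = (\<integral>x. \<bar>u x\<bar> \<partial>lborel)"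
 have U0: "U \<ge> 0" by (simp add: U_def)
 \<comment> \<open>4 / \<open>Cconst s\<close> is 2 times the factor 2 / \<open>Cconst s\<close> of
   \<open>kform_weak\<close>. The displacement |x - xi x| <= 3 h contributes 3 B h and the Jacobian
   1 - l^3 <= 6 h contributes 6 B h, rounded up to 12 B h.\<close>
 define C where "C = sqrt (4 / Cconst s * (12 * B) * U) + 1"
 have Cc: "Cconst s > 0" by (rule Cconst_pos[OF s])
 have main: "\<exists>uh\<in>Htilde s Omega. (\<forall>x. bd x < h --> uh x = 0) \<and> enorm s (%x. u x - uh x) <= C * sqrt h"
  if h: "0 < h" "h < 1/4" for h
 proof -
  define l where "l = 1 - 2 * h"
  have l: "1/2 < l" "l < 1" using h by (auto simp: l_def)
  define c :: R3 where "c = (\<chi> i. 1/2)"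
  define uh where "uh x = u ((c - (1/l) *\<^sub>R c) + (1/l) *\<^sub>R x)" for x
  define xi where "xi y = (c - l *\<^sub>R c) + l *\<^sub>R y" for y :: R3
  have uh_xi: "uh (xi y) = u y" for y
   using l by (simp add: uh_def xi_def algebra_simps)
  have um': "uh \<in> borel_measurable borel" unfolding uh_def[abs_def] by measurable
  have yi: "((c - (1/l) *\<^sub>R c) + (1/l) *\<^sub>R x) $ i - 1/2 = (x $ i - 1/2) / l" for x i
   using l by (simp add: c_def field_simps)
  have zero: "uh x = 0" if "bd x < h" for x
  proof -
   obtain i where "\<bar>x $ i - 1/2\<bar> > l/2"
   proof (rule bd_cases[of x])
    fix i assume "bd x = x $ i"
    then have "\<bar>x $ i - 1/2\<bar> > l/2" using \<open>bd x < h\<close> h by (auto simp: l_def abs_if)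
    then show ?thesis by (rule that)
   next
    fix i assume "bd x = 1 - x $ i"
    then have "\<bar>x $ i - 1/2\<bar> > l/2" using \<open>bd x < h\<close> h by (auto simp: l_def abs_if)
    then show ?thesis by (rule that)
   qed
   then have "\<bar>(x $ i - 1/2) / l\<bar> > 1/2" using l by (simp add: abs_divide field_simps)
   then have "\<bar>((c - (1/l) *\<^sub>R c) + (1/l) *\<^sub>R x) $ i - 1/2\<bar> > 1/2" unfolding yi .
   then have "(c - (1/l) *\<^sub>R c) + (1/l) *\<^sub>R x \<notin> closure Omega"
    unfolding closure_Omega mem_Collect_eq by (smt (verit) field_sum_of_halves)
   then show ?thesis unfolding uh_def using HtildeD(3)[OF u] by blast
  qed
  have "gagliardo_sq s UNIV uh <= gagliardo_sq s UNIV u"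
   unfolding uh_def[abs_def] using l by (intro gagliardo_dilation um s) auto
  moreover have "uh x = 0" if "x \<notin> closure Omega" for x
  proof (rule zero)
   have "x \<notin> Omega" using that closure_subset by blast
   then have "bd x <= 0" using bd_pos_iff[of x] by linarith
   then show "bd x < h" using h by simp
  qed
  ultimately have uh: "uh \<in> Htilde s Omega"
   unfolding Htilde_iff[OF s(1)] using um' HtildeD(2)[OF u] le_less_trans by blast
  have ee: "kform (kern2 s) uh uh <= kform (kern2 s) u u"
   using \<open>gagliardo_sq s UNIV uh <= gagliardo_sq s UNIV u\<close> unfolding gagliardo_eq_kform[OF u] gagliardo_eq_kform[OF uh]
   by (simp add: ennreal_le_iff kform_self_nonneg)
  define e where "e = (%x. u x - uh x)"
  have e: "e \<in> Htilde s Omega" unfolding e_def by (rule Htilde_diff[OF s(1) u uh])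
  have "(enorm s e)\<^sup>2 = kform (kern2 s) e e" by (simp add: enorm_def kform_self_nonneg)
  also have "... = kform (kern2 s) u u - 2 * kform (kern2 s) u uh + kform (kern2 s) uh uh"
   unfolding e_def
   using kform_diff_left[OF Htilde_diff[OF s(1) u uh] u uh] kform_diff_right[OF u u uh] kform_diff_right[OF uh u uh]
    kform_commute[of "kern2 s" uh u] by linarith
  also have "... <= 2 * (kform (kern2 s) u u - kform (kern2 s) u uh)" using ee by (simp add: algebra_simps)
  also have "... = 4 / Cconst s * ((\<integral>x. indicator Omega x * f x * u x \<partial>lborel) - (\<integral>x. indicator Omega x * f x * uh x \<partial>lborel))"
   unfolding kform_weak[OF u] kform_weak[OF uh] by (simp add: right_diff_distrib)
  also have "(\<integral>x. indicator Omega x * f x * uh x \<partial>lborel) = \<bar>l\<bar>^3 * (\<integral>y. indicator Omega (xi y) * f (xi y) * uh (xi y) \<partial>lborel)"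
   unfolding xi_def using l um' by (intro integral_affine_R3) auto
  also have "... = (\<integral>y. l^3 * (indicator Omega (xi y) * f (xi y) * u y) \<partial>lborel)"
   using l by (simp add: uh_xi)
  also have "(\<integral>x. indicator Omega x * f x * u x \<partial>lborel) - ... <= 12 * B * h * U"
  proof -
   define F1 where "F1 x = indicator Omega x * f x * u x" for x
   define F2 where "F2 y = l^3 * (indicator Omega (xi y) * f (xi y) * u y)" for y
   have [measurable]: "xi \<in> borel_measurable borel" unfolding xi_def[abs_def] by measurable
   have [measurable]: "(%y. indicator Omega (xi y) * f (xi y)) \<in> borel_measurable borel"
    using measurable_compose[OF _ f_measurable, of xi borel] by simp
   have [measurable]: "F1 \<in> borel_measurable borel" "F2 \<in> borel_measurable borel"
    unfolding F1_def[abs_def] F2_def[abs_def] by measurable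
   have ui: "integrable lborel (%x. \<bar>u x\<bar>)" using L1_le_enorm(1)[OF s(1) u] by (rule integrable_abs)
   have fO: "\<bar>indicator Omega x * f x\<bar> <= B" for x
    using B(1) B(2)[of x] closure_subset[of Omega] by (auto simp: indicator_def)
   have i1: "integrable lborel F1"
    by (rule Bochner_Integration.integrable_bound[OF integrable_mult_right[OF ui, of B]])
     (use fO B(1) in \<open>auto simp: F1_def abs_mult[of _ "u _"] intro!: AE_I2 mult_right_mono\<close>)
   have i2: "integrable lborel F2"
   proof (rule Bochner_Integration.integrable_bound[OF integrable_mult_right[OF ui, of "l^3 * B"]])
    show "AE x in lborel. norm (F2 x) <= norm (l^3 * B * \<bar>u x\<bar>)"
    proof (rule AE_I2)
     fix x
     have "l^3 * \<bar>indicator Omega (xi x) * f (xi x)\<bar> * \<bar>u x\<bar> <= l^3 * B * \<bar>u x\<bar>"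
      using fO[of "xi x"] l by (intro mult_right_mono mult_left_mono) auto
     moreover have "norm (F2 x) = l^3 * \<bar>indicator Omega (xi x) * f (xi x)\<bar> * \<bar>u x\<bar>"
      using l by (simp add: F2_def abs_mult)
     ultimately show "norm (F2 x) <= norm (l^3 * B * \<bar>u x\<bar>)" using l B(1) by simp
    qed
   qed simp
   have "integral\<^sup>L lborel F1 - integral\<^sup>L lborel F2 = (\<integral>x. F1 x - F2 x \<partial>lborel)" using i1 i2 by simp
   also have "... <= (\<integral>x. 12 * B * h * \<bar>u x\<bar> \<partial>lborel)"
   proof (rule integral_mono_AE)
    show "AE x in lborel. F1 x - F2 x <= 12 * B * h * \<bar>u x\<bar>"
    proof (rule eventually_mono[OF AE_not_frontier_Omega])
     fix x :: R3 assume "x \<notin> closure Omega \<or> x \<in> Omega"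
     then consider "x \<notin> closure Omega" | "x \<in> Omega" by blast
     then show "F1 x - F2 x <= 12 * B * h * \<bar>u x\<bar>"
     proof cases
      case 1
      then have "u x = 0" using HtildeD(3)[OF u] by blast
      then show ?thesis by (simp add: F1_def F2_def)
     next
      case 2
      have xii: "xi x $ i = h + l * x $ i" for i by (simp add: xi_def c_def l_def field_simps)
      have xin: "xi x \<in> Omega"
       unfolding Omega_def mem_Collect_eq xii
      proof
       fix i
       have xx: "0 < x $ i" "x $ i < 1" using 2 by (auto simp: Omega_def)
       have "0 < l * x $ i" "l * x $ i < l * 1" using xx l by (auto intro!: mult_strict_left_mono)
       moreover have "l * 1 = 1 - 2 * h" by (simp add: l_def)
       ultimately have "0 < h + l * x $ i" "h + l * x $ i < 1" using h by linarith+
       then show "0 < h + l * x $ i \<and> h + l * x $ i < 1" ..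
      qed
      have nx: "norm (x - xi x) <= 3 * h"
      proof -
       have "norm (x - xi x) <= (\<Sum>i\<in>UNIV. \<bar>(x - xi x) $ i\<bar>)" by (rule norm_le_l1_cart)
       also have "... <= (\<Sum>i\<in>(UNIV::3 set). h)"
       proof (rule sum_mono)
        fix i :: 3
        have xx: "0 < x $ i" "x $ i < 1" using 2 by (auto simp: Omega_def)
        have "(x - xi x) $ i = h * (2 * x $ i - 1)" by (simp add: xii l_def algebra_simps)
        also have "\<bar>...\<bar> <= h * 1" unfolding abs_mult using xx h by (intro mult_mono) auto
        finally show "\<bar>(x - xi x) $ i\<bar> <= h" by simp
       qed
       finally show ?thesis by simp
      qed
      have xc: "x \<in> closure Omega" "xi x \<in> closure Omega" using 2 xin closure_subset by blast+
      have l3: "1 - l^3 <= 6 * h" "0 <= 1 - l^3"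
      proof -
       have "1 - l^3 = (1 - l) * (1 + l + l^2)" by algebra
       also have "... <= (1 - l) * 3" using l power_le_one[of l 2] by (intro mult_left_mono) auto
       also have "... = 6 * h" by (simp add: l_def)
       finally show "1 - l^3 <= 6 * h" .
       show "0 <= 1 - l^3" using l power_le_one[of l 3] by simp
      qed
      have "\<bar>f x - l^3 * f (xi x)\<bar> = \<bar>(f x - f (xi x)) + (1 - l^3) * f (xi x)\<bar>" by (simp add: algebra_simps)
      also have "... <= \<bar>f x - f (xi x)\<bar> + (1 - l^3) * \<bar>f (xi x)\<bar>"
       using l3(2) abs_triangle_ineq[of "f x - f (xi x)" "(1 - l^3) * f (xi x)"] by (simp add: abs_mult)
      also have "... <= B * (3 * h) + 6 * h * B"
      proof (intro add_mono)
       have "\<bar>f x - f (xi x)\<bar> <= B * norm (x - xi x)" by (rule B(3)[OF xc(2,1)])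
       also have "... <= B * (3 * h)" using nx B(1) by (intro mult_left_mono) auto
       finally show "\<bar>f x - f (xi x)\<bar> <= B * (3 * h)" .
       show "(1 - l^3) * \<bar>f (xi x)\<bar> <= 6 * h * B" using l3 B(2)[OF xc(2)] h by (intro mult_mono) auto
      qed
      also have "... <= 12 * B * h" using B(1) h by simp
      finally have le: "\<bar>f x - l^3 * f (xi x)\<bar> <= 12 * B * h" .
      have "F1 x - F2 x = (f x - l^3 * f (xi x)) * u x"
       using 2 xin by (simp add: F1_def F2_def algebra_simps)
      also have "... <= \<bar>f x - l^3 * f (xi x)\<bar> * \<bar>u x\<bar>" by (metis abs_ge_self abs_mult)
      also have "... <= 12 * B * h * \<bar>u x\<bar>" using le by (intro mult_right_mono) auto
      finally show ?thesis .
     qed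
    qed
   qed (use i1 i2 ui in auto)
   also have "... = 12 * B * h * U" by (simp add: U_def)
   finally show ?thesis unfolding F1_def[abs_def] F2_def[abs_def] .
  qed
  finally have "(enorm s e)\<^sup>2 <= 4 / Cconst s * (12 * B * h * U)"
   using Cc by (simp add: divide_right_mono mult_left_mono)
  also have "... = (4 / Cconst s * (12 * B) * U) * h" by (simp add: mult_ac)
  finally have "sqrt ((enorm s e)\<^sup>2) <= sqrt ((4 / Cconst s * (12 * B) * U) * h)" by (rule real_sqrt_le_mono)
  then have "enorm s e <= sqrt (4 / Cconst s * (12 * B) * U) * sqrt h"
   by (simp only: real_sqrt_mult[of _ h] real_sqrt_abs abs_of_nonneg[OF enorm_nonneg])
  also have "... <= C * sqrt h" using h by (intro mult_right_mono) (auto simp: C_def)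
  finally show ?thesis using uh zero unfolding e_def by blast
 qed
 have "C > 0" unfolding C_def using Cc B(1) U0 by (intro add_nonneg_pos) auto
 then show ?thesis using main by blast
qed

end

section \<open>The Gaussian in the flow parameter and its pointwise smoothing estimate\<close>

text \<open>The integrand of \<open>kern_const (1/2)\<close>, namely min 1 r^2 / r^4, is already
  known to be integrable and dominates the Gaussian with exponential growth.\<close>

lemma gauss_nn_finite:
 assumes c: "0 <= c"
 shows "(\<integral>\<^sup>+v. ennreal (exp (- (norm (v::R3))\<^sup>2 + c * norm v)) \<partial>lborel) < \<infinity>"
proof -
 \<comment> \<open>256 = 4^4 comes from r^4 <= 256 exp r; the extra exp r raises c to c + 1, and
   completing the square bounds - r^2 + (c + 1) r by (c + 1)^2.\<close>
 define K where "K = 256 * exp ((c + 1)\<^sup>2)"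
 have K0: "K \<ge> 0" by (simp add: K_def)
 have pt: "exp (- r\<^sup>2 + c * r) <= K * (min 1 (r\<^sup>2) / r powr 4)" if r: "r > 0" for r :: real
 proof -
  have p4: "r powr 4 = r ^ 4" using r by (simp add: powr_numeral)
  have q: "- r\<^sup>2 + a * r <= a\<^sup>2" for a :: real
  proof -
   have "0 <= (r - a/2)\<^sup>2" by simp
   then have "- r\<^sup>2 + a * r <= a\<^sup>2/4" by (simp add: power2_eq_square algebra_simps)
   also have "... <= a\<^sup>2" by simp
   finally show ?thesis .
  qed
  have "r ^ 4 * exp (- r\<^sup>2 + c * r) <= K * min 1 (r\<^sup>2)"
  proof (cases "r \<ge> 1")
   case True
   have "r/4 <= exp (r/4)" using exp_ge_add_one_self[of "r/4"] by linarith
   then have "(r/4)^4 <= (exp (r/4))^4" using r by (intro power_mono) auto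
   also have "(exp (r/4))^4 = exp r" by (simp add: exp_of_nat_mult[symmetric])
   finally have "r^4 <= 256 * exp r" by (simp add: power_divide)
   then have "r ^ 4 * exp (- r\<^sup>2 + c * r) <= 256 * exp r * exp (- r\<^sup>2 + c * r)" by (intro mult_right_mono) auto
   also have "... = 256 * exp (- r\<^sup>2 + (c + 1) * r)" by (simp add: mult_exp_exp algebra_simps)
   also have "... <= K" unfolding K_def using q[of "c + 1"] by simp
   finally show ?thesis using True by (simp add: min_def)
  next
   case False
   have "c * r <= c * 1" using c False by (intro mult_left_mono) auto
   moreover have "c <= (c + 1)\<^sup>2" using c by (simp add: power2_eq_square algebra_simps)
   ultimately have "- r\<^sup>2 + c * r <= (c + 1)\<^sup>2" using zero_le_power2[of r] by linarith
   then have "exp (- r\<^sup>2 + c * r) <= exp ((c + 1)\<^sup>2)" by simp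
   also have "... <= K" by (simp add: K_def)
   finally have e: "exp (- r\<^sup>2 + c * r) <= K" .
   have r2: "r\<^sup>2 <= 1" using r False by (simp add: power_le_one)
   have "r^4 = r\<^sup>2 * r\<^sup>2" by (simp add: power_add[symmetric])
   also have "... <= r\<^sup>2 * 1" using r2 by (intro mult_left_mono) auto
   finally have "r^4 <= r\<^sup>2" by simp
   then have "r ^ 4 * exp (- r\<^sup>2 + c * r) <= r\<^sup>2 * K" using e by (intro mult_mono) auto
   then show ?thesis using r2 by (simp add: min_def mult.commute)
  qed
  then show ?thesis unfolding p4 using r by (simp add: field_simps)
 qed
 have "(\<integral>\<^sup>+v. ennreal (exp (- (norm (v::R3))\<^sup>2 + c * norm v)) \<partial>lborel)
   <= (\<integral>\<^sup>+v. ennreal K * ennreal (min 1 ((norm (v::R3))\<^sup>2) / norm v powr (3 + 2 * (1/2))) \<partial>lborel)"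
 proof (rule nn_integral_mono_AE)
  have "AE v::R3 in lborel. v \<noteq> 0" by (rule AE_lborel_singleton)
  then show "AE v::R3 in lborel. ennreal (exp (- (norm v)\<^sup>2 + c * norm v)) <= ennreal K * ennreal (min 1 ((norm v)\<^sup>2) / norm v powr (3 + 2 * (1/2)))"
  proof (rule eventually_mono)
   fix v :: R3 assume "v \<noteq> 0"
   then show "ennreal (exp (- (norm v)\<^sup>2 + c * norm v)) <= ennreal K * ennreal (min 1 ((norm v)\<^sup>2) / norm v powr (3 + 2 * (1/2)))"
    using pt[of "norm v"] K0 by (simp add: ennreal_mult'[symmetric] ennreal_leI)
  qed
 qed
 also have "... = ennreal K * kern_const (1/2)"
  unfolding kern_const_def by (rule nn_integral_cmult) simp
 also have "... < \<infinity>" using kern_const_finite[of "1/2"] by (simp add: ennreal_mult_less_top)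
 finally show ?thesis .
qed

lemma gauss_integrable:
 assumes c: "0 <= c"
 shows "integrable lborel (%v::R3. exp (- (norm v)\<^sup>2 + c * norm v))"
 by (rule integrableI_nonneg) (use gauss_nn_finite[OF c] in auto)

definition gauss_mass :: real where
 "gauss_mass = (\<integral>v. exp (- (norm (v::R3))\<^sup>2) \<partial>lborel)"

lemma gauss_mass_pos: "gauss_mass > 0"
proof -
 have i: "integrable lborel (%v::R3. exp (- (norm v)\<^sup>2))" using gauss_integrable[of 0] by simp
 have "0 < exp (- 1) * measure lborel (ball (0::R3) 1)" by simp
 also have "... = (\<integral>v. exp (- 1) * indicator (ball (0::R3) 1) v \<partial>lborel)" by simp
 also have "... <= gauss_mass"
  unfolding gauss_mass_def
 proof (rule integral_mono[OF _ i])
  show "integrable lborel (%v::R3. exp (- 1) * indicator (ball 0 1) v :: real)"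
   by (intro integrable_mult_right integrable_real_indicator) (auto simp: emeasure_ball)
  fix v :: R3
  show "exp (- 1) * indicator (ball 0 1) v <= exp (- (norm v)\<^sup>2)"
   by (auto simp: indicator_def power_le_one)
 qed
 finally show ?thesis .
qed

definition gam :: "real => R3 => real" where
 "gam k v = exp (- (norm v / k)\<^sup>2) / (k ^ 3 * gauss_mass)"

lemma gam_nonneg: "k > 0 ==> 0 <= gam k v"
 using gauss_mass_pos by (simp add: gam_def)

lemma measurable_gam [measurable]: "gam k \<in> borel_measurable borel"
 unfolding gam_def[abs_def] by measurable

lemma nn_integral_gam:
 assumes k: "k > 0" and [measurable]: "\<Phi> \<in> borel_measurable borel"
 shows "(\<integral>\<^sup>+v. ennreal (gam k v) * \<Phi> v \<partial>lborel) = (\<integral>\<^sup>+v. ennreal (gam 1 v) * \<Phi> (k *\<^sub>R v) \<partial>lborel)"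
proof -
 have "(\<integral>\<^sup>+v. ennreal (gam k v) * \<Phi> v \<partial>lborel) = (\<integral>\<^sup>+v. ennreal (\<bar>k\<bar>^3) * (ennreal (gam k (0 + k *\<^sub>R v)) * \<Phi> (0 + k *\<^sub>R v)) \<partial>lborel)"
  by (rule nn_integral_affine_R3) (use k in auto)
 also have "... = (\<integral>\<^sup>+v. ennreal (gam 1 v) * \<Phi> (k *\<^sub>R v) \<partial>lborel)"
 proof (rule nn_integral_cong)
  fix v :: R3
  have "\<bar>k\<bar>^3 * gam k (0 + k *\<^sub>R v) = gam 1 v" using k by (simp add: gam_def)
  then show "ennreal (\<bar>k\<bar>^3) * (ennreal (gam k (0 + k *\<^sub>R v)) * \<Phi> (0 + k *\<^sub>R v)) = ennreal (gam 1 v) * \<Phi> (k *\<^sub>R v)"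
   unfolding mult.assoc[symmetric] using k gam_nonneg[OF k] by (subst ennreal_mult'[symmetric]) auto
 qed
 finally show ?thesis .
qed

lemma nn_integral_gam_1:
 assumes k: "k > 0"
 shows "(\<integral>\<^sup>+v. ennreal (gam k v) \<partial>lborel) = 1"
proof -
 have i: "integrable lborel (%v::R3. exp (- (norm v)\<^sup>2))" using gauss_integrable[of 0] by simp
 have "(\<integral>\<^sup>+v. ennreal (gam k v) \<partial>lborel) = (\<integral>\<^sup>+v. ennreal (gam 1 v) \<partial>lborel)"
  using nn_integral_gam[OF k, of "%_. 1"] by simp
 also have "... = ennreal (\<integral>v. gam 1 v \<partial>lborel)"
  by (rule nn_integral_eq_integral) (use i gauss_mass_pos in \<open>auto simp: gam_def\<close>)
 also have "(\<integral>v. gam 1 v \<partial>lborel) = 1"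
  unfolding gam_def using gauss_mass_pos by (simp add: gauss_mass_def)
 finally show ?thesis by simp
qed

lemma integrable_gam: "k > 0 ==> integrable lborel (gam k)"
 by (rule integrableI_nonneg) (auto simp: nn_integral_gam_1 gam_nonneg)

lemma integral_gam: "k > 0 ==> (\<integral>v. gam k v \<partial>lborel) = 1"
 using nn_integral_eq_integral[OF integrable_gam, of k] nn_integral_gam_1[of k] gam_nonneg[of k]
 by (simp add: ennreal_eq_1)

lemma measurable_Sf_pair [measurable]:
 assumes [measurable]: "f \<in> M \<rightarrow>\<^sub>M borel" "g \<in> M \<rightarrow>\<^sub>M borel"
 shows "(%p. Sf (f p) (g p)) \<in> M \<rightarrow>\<^sub>M borel"
proof -
 have [measurable]: "(%p. f p $ i) \<in> borel_measurable M" "(%p. g p $ i) \<in> borel_measurable M" for i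
  using measurable_compose[OF assms(1) measurable_vec_nth] measurable_compose[OF assms(2) measurable_vec_nth] by auto
 have "(%p. Sf (f p) (g p) $ i) \<in> borel_measurable M" for i
  unfolding Sf_nth Tf_def by measurable
 then have "(%p. Sf (f p) (g p) \<bullet> b) \<in> borel_measurable M" if "b \<in> Basis" for b
  using that by (auto simp: Basis_vec_def inner_axis simp del: Sf_nth)
 then show ?thesis by (subst borel_measurable_euclidean_space) auto
qed

text \<open>Bounds the mean of exp (3 |v|), the inverse Jacobian bound, under Gaussians of width at
  most 2; hence the 6.\<close>

definition gauss_exp_const :: ennreal where
 "gauss_exp_const = (\<integral>\<^sup>+v. ennreal (exp (- (norm (v::R3))\<^sup>2 + 6 * norm v) / gauss_mass) \<partial>lborel)"

lemma gauss_exp_const_finite: "gauss_exp_const < \<infinity>"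
proof -
 have "gauss_exp_const = (\<integral>\<^sup>+v. ennreal (1 / gauss_mass) * ennreal (exp (- (norm (v::R3))\<^sup>2 + 6 * norm v)) \<partial>lborel)"
  unfolding gauss_exp_const_def using gauss_mass_pos by (simp add: ennreal_mult'[symmetric])
 also have "... = ennreal (1 / gauss_mass) * (\<integral>\<^sup>+v. ennreal (exp (- (norm (v::R3))\<^sup>2 + 6 * norm v)) \<partial>lborel)"
  by (rule nn_integral_cmult) simp
 also have "... < \<infinity>" using gauss_nn_finite[of 6] by (simp add: ennreal_mult_less_top)
 finally show ?thesis .
qed

lemma nn_integral_gam_exp3:
 assumes k: "0 < k" "k <= 2"
 shows "(\<integral>\<^sup>+v. ennreal (gam k v) * ennreal (exp (3 * norm v)) \<partial>lborel) <= gauss_exp_const"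
proof -
 have "(\<integral>\<^sup>+v. ennreal (gam k v) * ennreal (exp (3 * norm v)) \<partial>lborel) = (\<integral>\<^sup>+v. ennreal (gam 1 v) * ennreal (exp (3 * norm (k *\<^sub>R v))) \<partial>lborel)"
  by (rule nn_integral_gam) (use k in auto)
 also have "... <= gauss_exp_const"
  unfolding gauss_exp_const_def
 proof (rule nn_integral_mono)
  fix v :: R3
  have "3 * norm (k *\<^sub>R v) <= 6 * norm v" using mult_right_mono[OF k(2), of "norm v"] k by simp
  then have "exp (- (norm v)\<^sup>2) * exp (3 * norm (k *\<^sub>R v)) <= exp (- (norm v)\<^sup>2 + 6 * norm v)"
   unfolding mult_exp_exp by simp
  then have "gam 1 v * exp (3 * norm (k *\<^sub>R v)) <= exp (- (norm v)\<^sup>2 + 6 * norm v) / gauss_mass"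
   using gauss_mass_pos by (simp add: gam_def divide_right_mono)
  then show "ennreal (gam 1 v) * ennreal (exp (3 * norm (k *\<^sub>R v))) <= ennreal (exp (- (norm v)\<^sup>2 + 6 * norm v) / gauss_mass)"
   using gam_nonneg[of 1 v] by (simp add: ennreal_mult'[symmetric] ennreal_leI)
 qed
 finally show ?thesis .
qed

text \<open>A shift of size comparable to the width is absorbed by doubling the width, since |v|^2
  <= 2 |v + r|^2 + 2 |r|^2. The 8 is the ratio of the two normalisations.\<close>

lemma gam_shift_le:
 assumes k: "k > 0" and r: "norm r <= 2 * k"
 shows "gam k (v + r) <= exp 4 * 8 * gam (2 * k) v"
proof -
 have n1: "(norm v)\<^sup>2 <= 2 * (norm (v + r))\<^sup>2 + 2 * (norm r)\<^sup>2"
 proof -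
  have "norm v <= norm (v + r) + norm r" using norm_triangle_ineq4[of "v + r" r] by simp
  then have "(norm v)\<^sup>2 <= (norm (v + r) + norm r)\<^sup>2" by (intro power_mono) auto
  also have "... <= 2 * (norm (v + r))\<^sup>2 + 2 * (norm r)\<^sup>2"
   using sum_squares_bound[of "norm (v + r)" "norm r"] by (simp add: power2_sum)
  finally show ?thesis .
 qed
 have "(norm r)\<^sup>2 <= (2 * k)\<^sup>2" using r by (intro power_mono) auto
 then have "(norm r)\<^sup>2 <= 4 * k\<^sup>2" by (simp add: power_mult_distrib)
 then have "(norm v)\<^sup>2 / 4 <= (norm (v + r))\<^sup>2 + 4 * k\<^sup>2"
  using n1 zero_le_power2[of "norm (v + r)"] zero_le_power2[of k] by linarith
 then have "(norm v)\<^sup>2 / 4 / k\<^sup>2 <= ((norm (v + r))\<^sup>2 + 4 * k\<^sup>2) / k\<^sup>2" using k by (intro divide_right_mono) auto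
 then have "- (norm (v + r) / k)\<^sup>2 <= 4 + - (norm v / (2 * k))\<^sup>2"
  using k by (simp add: power_divide power_mult_distrib add_divide_distrib)
 then have "exp (- (norm (v + r) / k)\<^sup>2) <= exp (4 + - (norm v / (2 * k))\<^sup>2)" by simp
 also have "... = exp 4 * exp (- (norm v / (2 * k))\<^sup>2)" by (simp add: mult_exp_exp)
 finally have "exp (- (norm (v + r) / k)\<^sup>2) / (k ^ 3 * gauss_mass) <= exp 4 * exp (- (norm v / (2 * k))\<^sup>2) / (k ^ 3 * gauss_mass)"
  using k gauss_mass_pos by (intro divide_right_mono) auto
 also have "... = exp 4 * 8 * gam (2 * k) v"
  using k by (simp add: gam_def power_mult_distrib)
 finally show ?thesis unfolding gam_def .
qed

lemma ln_ratio_bound: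
 assumes "0 < a" "\<bar>b - a\<bar> <= e * a" "0 <= e" "e <= 1/2"
 shows "\<bar>ln b - ln (a::real)\<bar> <= 2 * e"
proof -
 have b: "b \<ge> a / 2"
 proof -
  have "e * a <= 1/2 * a" using assms by (intro mult_right_mono) auto
  then show ?thesis using assms by linarith
 qed
 then have bp: "b > 0" using assms by linarith
 have "ln b - ln a <= (b - a) / a" using ln_diff_le[OF bp assms(1)] .
 also have "... <= e" using assms by (simp add: divide_le_eq abs_le_iff)
 finally have 1: "ln b - ln a <= 2 * e" using assms by linarith
 have "ln a - ln b <= (a - b) / b" using ln_diff_le[OF assms(1) bp] .
 also have "... <= 2 * e"
 proof -
  have "a - b <= e * a" using assms by linarith
  also have "... <= e * (2 * b)" using b assms by (intro mult_left_mono) auto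
  finally show ?thesis using bp by (simp add: divide_le_eq mult_ac)
 qed
 finally show ?thesis using 1 by linarith
qed

text \<open>The flow is transitive on the open interval: the travel time is the difference of the
  logits.\<close>

lemma Tf_transport:
 assumes "0 < a" "a < 1" "0 < b" "b < 1"
 shows "Tf ((ln b - ln (1 - b)) - (ln a - ln (1 - a))) a = b"
proof -
 define q where "q = exp ((ln b - ln (1 - b)) - (ln a - ln (1 - a)))"
 have "q = (b / (1 - b)) / (a / (1 - a))"
  unfolding q_def using assms by (simp add: exp_diff)
 then have qa: "q * a = b * (1 - a) / (1 - b)" using assms by (simp add: field_simps)
 have "1 + (q - 1) * a = (1 - a) + q * a" by (simp add: algebra_simps)
 also have "... = (1 - a) / (1 - b)" unfolding qa using assms by (simp add: field_simps)
 finally have "q * a / (1 + (q - 1) * a) = b" unfolding qa using assms by simp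
 then show ?thesis using assms by (simp add: Tf_def q_def)
qed

text \<open>Comparing the mollified value at \<open>x\<close> with those at all points of a small ball around \<open>x\<close>
 and averaging replaces a change of variables in the flow parameter.\<close>

lemma gam_pointwise_bound:
 assumes x: "x \<in> Omega" and k: "0 < k" "k <= 1" and [measurable]: "w \<in> borel_measurable borel"
 shows "(\<integral>\<^sup>+v. ennreal (gam k v * \<bar>w (Sf v x)\<bar>) \<partial>lborel)
   <= ennreal (exp 4 * 8 / (4/3 * pi * (k * bd x / 8)^3)) * gauss_exp_const * (\<integral>\<^sup>+x. ennreal \<bar>w x\<bar> \<partial>lborel)"
proof -
 \<comment> \<open>A relative change of k/8 in t and in 1 - t moves each logit by at most k/2, so
   the travel time from x to a point of the ball is at most 3 k / 2 in norm, within the range of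
   \<open>gam_shift_le\<close>.\<close>
 define rh where "rh = k * bd x / 8"
 have b0: "bd x > 0" using x bd_pos_iff by blast
 have rh: "rh > 0" "rh <= bd x / 8" using k b0 mult_right_mono[OF k(2), of "bd x"] by (auto simp: rh_def)
 define I where "I = (\<integral>\<^sup>+v. ennreal (gam k v * \<bar>w (Sf v x)\<bar>) \<partial>lborel)"
 define c where "c = exp 4 * (8::real)"
 have step: "I <= ennreal c * (\<integral>\<^sup>+v. ennreal (gam (2 * k) v) * ennreal \<bar>w (Sf v x')\<bar> \<partial>lborel)" if x': "x' \<in> ball x rh" for x'
 proof -
  have co: "\<bar>x' $ i - x $ i\<bar> <= rh" for i
   using x' component_le_norm_cart[of "x' - x" i] by (simp add: dist_norm norm_minus_commute)
  have xi: "0 < x $ i" "x $ i < 1" "bd x <= x $ i" "bd x <= 1 - x $ i" for i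
   using x bd_le[of x i] by (auto simp: Omega_def)
  have x'i: "0 < x' $ i" "x' $ i < 1" for i using co[of i] xi[of i] rh b0 by linarith+
  define r where "r = (\<chi> i. (ln (x' $ i) - ln (1 - x' $ i)) - (ln (x $ i) - ln (1 - x $ i)))"
  have ri: "\<bar>r $ i\<bar> <= k / 2" for i
  proof -
   have kb: "rh <= k/8 * x $ i" "rh <= k/8 * (1 - x $ i)"
    using xi[of i] k mult_left_mono[OF xi(3)[of i], of "k/8"] mult_left_mono[OF xi(4)[of i], of "k/8"] by (auto simp: rh_def)
   have "\<bar>ln (x' $ i) - ln (x $ i)\<bar> <= 2 * (k/8)"
    by (rule ln_ratio_bound) (use co[of i] kb xi[of i] k in auto)
   moreover have "\<bar>(1 - x' $ i) - (1 - x $ i)\<bar> <= k/8 * (1 - x $ i)" using co[of i] kb(2) by linarith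
   then have "\<bar>ln (1 - x' $ i) - ln (1 - x $ i)\<bar> <= 2 * (k/8)"
    by (intro ln_ratio_bound) (use xi[of i] k in auto)
   ultimately have "\<bar>(ln (x' $ i) - ln (1 - x' $ i)) - (ln (x $ i) - ln (1 - x $ i))\<bar> <= k / 2" by linarith
   then show ?thesis by (simp add: r_def)
  qed
  have "norm r <= (\<Sum>i\<in>UNIV. \<bar>r $ i\<bar>)" by (rule norm_le_l1_cart)
  also have "... <= (\<Sum>i\<in>(UNIV::3 set). k/2)" by (intro sum_mono ri)
  finally have r: "norm r <= 2 * k" using k by simp
  have Sr: "Sf r x = x'"
   using Tf_transport[OF xi(1,2) x'i] by (simp add: vec_eq_iff r_def)
  have "I = (\<integral>\<^sup>+v. ennreal (\<bar>1\<bar>^3) * ennreal (gam k (r + 1 *\<^sub>R v) * \<bar>w (Sf (r + 1 *\<^sub>R v) x)\<bar>) \<partial>lborel)"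
   unfolding I_def by (rule nn_integral_affine_R3) auto
  also have "... = (\<integral>\<^sup>+v. ennreal (gam k (v + r)) * ennreal \<bar>w (Sf v x')\<bar> \<partial>lborel)"
   using gam_nonneg[OF k(1)] by (intro nn_integral_cong) (simp add: Sr[symmetric] Sf_add[symmetric] add.commute ennreal_mult')
  also have "... <= (\<integral>\<^sup>+v. ennreal c * (ennreal (gam (2 * k) v) * ennreal \<bar>w (Sf v x')\<bar>) \<partial>lborel)"
  proof (rule nn_integral_mono)
   fix v
   have "ennreal (gam k (v + r)) <= ennreal c * ennreal (gam (2 * k) v)"
    using gam_shift_le[OF k(1) r, of v] gam_nonneg[of "2 * k" v] k
    by (simp add: c_def ennreal_mult'[symmetric] ennreal_leI)
   then show "ennreal (gam k (v + r)) * ennreal \<bar>w (Sf v x')\<bar> <= ennreal c * (ennreal (gam (2 * k) v) * ennreal \<bar>w (Sf v x')\<bar>)"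
    unfolding mult.assoc[symmetric] by (rule mult_right_mono) simp
  qed
  also have "... = ennreal c * (\<integral>\<^sup>+v. ennreal (gam (2 * k) v) * ennreal \<bar>w (Sf v x')\<bar> \<partial>lborel)"
   by (rule nn_integral_cmult) measurable
  finally show ?thesis .
 qed
 have vol: "emeasure lborel (ball x rh) = ennreal (4/3 * pi * rh^3)"
  using rh by (simp add: emeasure_ball unit_ball_vol_3)
 have "ennreal (4/3 * pi * rh^3) * I = (\<integral>\<^sup>+x'. I * indicator (ball x rh) x' \<partial>lborel)"
  unfolding vol[symmetric] by (subst nn_integral_cmult_indicator) (auto simp: mult.commute)
 also have "... <= (\<integral>\<^sup>+x'. ennreal c * (\<integral>\<^sup>+v. ennreal (gam (2 * k) v) * ennreal \<bar>w (Sf v x')\<bar> \<partial>lborel) \<partial>lborel)"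
  by (intro nn_integral_mono) (use step in \<open>auto split: split_indicator\<close>)
 also have "... = ennreal c * (\<integral>\<^sup>+x'. \<integral>\<^sup>+v. ennreal (gam (2 * k) v) * ennreal \<bar>w (Sf v x')\<bar> \<partial>lborel \<partial>lborel)"
  by (rule nn_integral_cmult) measurable
 also have "(\<integral>\<^sup>+x'. \<integral>\<^sup>+v. ennreal (gam (2 * k) v) * ennreal \<bar>w (Sf v x')\<bar> \<partial>lborel \<partial>lborel)
  = (\<integral>\<^sup>+v. \<integral>\<^sup>+x'. ennreal (gam (2 * k) v) * ennreal \<bar>w (Sf v x')\<bar> \<partial>lborel \<partial>lborel)"
  by (rule lborel_pair.Fubini') measurable
 also have "... <= (\<integral>\<^sup>+v. (ennreal (gam (2 * k) v) * ennreal (exp (3 * norm v))) * (\<integral>\<^sup>+x. ennreal \<bar>w x\<bar> \<partial>lborel) \<partial>lborel)"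
 proof (rule nn_integral_mono)
  fix v :: R3
  have "(\<integral>\<^sup>+x'. ennreal \<bar>w (Sf v x')\<bar> \<partial>lborel) <= (\<integral>\<^sup>+x'. ennreal (exp (3 * norm v)) * (ennreal (Jf v x') * ennreal \<bar>w (Sf v x')\<bar>) \<partial>lborel)"
  proof (rule nn_integral_mono)
   fix x'
   have "1 <= exp (3 * norm v) * Jf v x'"
    using mult_left_mono[OF Jf_bounds(1)[of v x'], of "exp (3 * norm v)"] by (simp add: mult_exp_exp)
   then have "1 * \<bar>w (Sf v x')\<bar> <= exp (3 * norm v) * Jf v x' * \<bar>w (Sf v x')\<bar>" by (intro mult_right_mono) auto
   then show "ennreal \<bar>w (Sf v x')\<bar> <= ennreal (exp (3 * norm v)) * (ennreal (Jf v x') * ennreal \<bar>w (Sf v x')\<bar>)"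
    using Jf_pos[of v x'] by (simp add: ennreal_mult'[symmetric] mult.assoc ennreal_leI)
  qed
  also have "... = ennreal (exp (3 * norm v)) * (\<integral>\<^sup>+x. ennreal \<bar>w x\<bar> \<partial>lborel)"
   by (subst nn_integral_Sf[of "%x. ennreal \<bar>w x\<bar>" v]) (auto simp: nn_integral_cmult)
  finally have "ennreal (gam (2 * k) v) * (\<integral>\<^sup>+x'. ennreal \<bar>w (Sf v x')\<bar> \<partial>lborel)
    <= ennreal (gam (2 * k) v) * (ennreal (exp (3 * norm v)) * (\<integral>\<^sup>+x. ennreal \<bar>w x\<bar> \<partial>lborel))" by (intro mult_left_mono) auto
  then show "(\<integral>\<^sup>+x'. ennreal (gam (2 * k) v) * ennreal \<bar>w (Sf v x')\<bar> \<partial>lborel)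
    <= (ennreal (gam (2 * k) v) * ennreal (exp (3 * norm v))) * (\<integral>\<^sup>+x. ennreal \<bar>w x\<bar> \<partial>lborel)"
   by (subst nn_integral_cmult) (auto simp: mult.assoc)
 qed
 also have "... = (\<integral>\<^sup>+v. ennreal (gam (2 * k) v) * ennreal (exp (3 * norm v)) \<partial>lborel) * (\<integral>\<^sup>+x. ennreal \<bar>w x\<bar> \<partial>lborel)"
  by (rule nn_integral_multc) measurable
 also have "... <= gauss_exp_const * (\<integral>\<^sup>+x. ennreal \<bar>w x\<bar> \<partial>lborel)"
  by (intro mult_right_mono nn_integral_gam_exp3) (use k in auto)
 finally have *: "ennreal (4/3 * pi * rh^3) * I <= ennreal c * (gauss_exp_const * (\<integral>\<^sup>+x. ennreal \<bar>w x\<bar> \<partial>lborel))"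
  by (simp add: mult_left_mono)
 define V where "V = 4/3 * pi * rh^3"
 have V: "V > 0" using rh by (simp add: V_def)
 have "I = ennreal (1 / V) * (ennreal V * I)" using V by (simp add: mult.assoc[symmetric] ennreal_mult'[symmetric])
 also have "... <= ennreal (1 / V) * (ennreal c * (gauss_exp_const * (\<integral>\<^sup>+x. ennreal \<bar>w x\<bar> \<partial>lborel)))"
  using * unfolding V_def by (intro mult_left_mono) auto
 also have "... = ennreal (c / V) * gauss_exp_const * (\<integral>\<^sup>+x. ennreal \<bar>w x\<bar> \<partial>lborel)"
  using V by (simp add: mult.assoc[symmetric] ennreal_mult'[symmetric] c_def)
 finally show ?thesis unfolding I_def c_def V_def rh_def .
qed

section \<open>Holomorphic parameter integrals; bounding an entire function through its
  differences\<close>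

text \<open>Dominated convergence of the difference quotients. Their majorant comes from Cauchy's
  inequality applied to the pointwise bound \<open>B v\<close> on a slightly larger disc, so no
  bound on the derivative has to be assumed.\<close>

lemma holomorphic_param_integral:
 fixes F :: "complex => 'a => complex"
 assumes S: "open S" and h: "!!v. (%z. F z v) holomorphic_on S"
  and m: "!!z. F z \<in> borel_measurable M"
  and b: "!!z v. z \<in> S ==> norm (F z v) <= B v" and B: "integrable M B"
 shows "(%z. \<integral>v. F z v \<partial>M) holomorphic_on S"
 unfolding holomorphic_on_open[OF S]
proof
 fix z0 assume z0: "z0 \<in> S"
 then obtain r0 where r0: "r0 > 0" "cball z0 r0 \<subseteq> S" using S by (meson open_contains_cball)
 define r where "r = r0 / 2"
 have r: "r > 0" using r0 by (simp add: r_def)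
 have sub: "cball z r \<subseteq> S" if "z \<in> cball z0 r" for z
 proof
  fix y assume "y \<in> cball z r"
  then have "dist z0 y <= r0" using that dist_triangle[of z0 y z] by (simp add: r_def)
  then show "y \<in> S" using r0 by auto
 qed
 have int: "integrable M (F z)" if "z \<in> S" for z
  by (rule Bochner_Integration.integrable_bound[OF B m]) (use b[OF that] in \<open>auto intro!: AE_I2 order_trans[OF b[OF that] abs_ge_self]\<close>)
 have lip: "norm (F z v - F z0 v) <= B v / r * norm (z - z0)" if z: "z \<in> cball z0 r" for z v
 proof (rule field_differentiable_bound[of "cball z0 r" _ "deriv (%z. F z v)"])
  fix y assume y: "y \<in> cball z0 r"
  have yS: "y \<in> S" using sub[OF y] r by auto
  show "((%z. F z v) has_field_derivative deriv (%z. F z v) y) (at y within cball z0 r)"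
   using holomorphic_derivI[OF h S yS] has_field_derivative_at_within by blast
  have "norm ((deriv ^^ 1) (%z. F z v) y) <= fact 1 * B v / r ^ 1"
  proof (rule Cauchy_inequality)
   show "(%z. F z v) holomorphic_on ball y r"
    using holomorphic_on_subset[OF h] sub[OF y] ball_subset_cball by blast
   show "continuous_on (cball y r) (%z. F z v)"
    by (rule continuous_on_subset[OF holomorphic_on_imp_continuous_on[OF h] sub[OF y]])
   fix x assume "norm (y - x) = r"
   then have "x \<in> S" using sub[OF y] by (auto simp: dist_norm)
   then show "norm (F x v) <= B v" by (rule b)
  qed (use r in auto)
  then show "norm (deriv (%z. F z v) y) <= B v / r" by simp
 qed (use z r in auto)
 define D where "D = (\<integral>v. deriv (%z. F z v) z0 \<partial>M)"
 have "((%y. ((\<integral>v. F y v \<partial>M) - (\<integral>v. F z0 v \<partial>M)) / (y - z0)) \<longlongrightarrow> D) (at z0)"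
  unfolding tendsto_at_iff_sequentially
 proof (intro allI impI)
  fix X :: "nat => complex" assume X: "\<forall>i. X i \<in> UNIV - {z0}" "X \<longlonglongrightarrow> z0"
  have "eventually (%i. X i \<in> ball z0 r) sequentially"
   using X(2) r by (auto simp: tendsto_iff dist_commute)
  then obtain N where N: "!!i. i \<ge> N ==> X i \<in> ball z0 r" by (auto simp: eventually_sequentially)
  define Y where "Y i = X (i + N)" for i
  have Y: "Y i \<noteq> z0" "Y i \<in> cball z0 r" "Y i \<in> S" for i
   using X(1) N[of "i + N"] sub[of z0] r by (auto simp: Y_def less_imp_le)
  have YX: "Y \<longlonglongrightarrow> z0" unfolding Y_def by (rule LIMSEQ_ignore_initial_segment[OF X(2)])
  define q where "q i v = (F (Y i) v - F z0 v) / (Y i - z0)" for i v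
  have qm: "q i \<in> borel_measurable M" for i unfolding q_def[abs_def] using m by measurable
  have lim: "(%i. q i v) \<longlonglongrightarrow> deriv (%z. F z v) z0" for v
  proof -
   have "((%y. (F y v - F z0 v) / (y - z0)) \<longlongrightarrow> deriv (%z. F z v) z0) (at z0)"
    using holomorphic_derivI[OF h S z0] by (simp add: has_field_derivative_iff)
   then show ?thesis unfolding tendsto_at_iff_sequentially q_def
    using Y(1) YX by (auto simp: o_def)
  qed
  have "(%i. \<integral>v. q i v \<partial>M) \<longlonglongrightarrow> D"
   unfolding D_def
  proof (rule integral_dominated_convergence[where w = "%v. B v / r"])
   show "(%v. deriv (%z. F z v) z0) \<in> borel_measurable M"
    by (rule borel_measurable_LIMSEQ_metric[OF qm lim])
   show "integrable M (%v. B v / r)" using B by simp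
   show "AE v in M. norm (q i v) <= B v / r" for i
    using lip[OF Y(2), of i] Y(1)[of i] by (auto intro!: AE_I2 simp: q_def norm_divide divide_le_eq)
  qed (use qm lim in auto)
  moreover have "(\<integral>v. q i v \<partial>M) = ((\<integral>v. F (Y i) v \<partial>M) - (\<integral>v. F z0 v \<partial>M)) / (Y i - z0)" for i
   unfolding q_def using int[OF Y(3)] int[OF z0] by simp
  ultimately have "(%i. ((\<integral>v. F (X (i + N)) v \<partial>M) - (\<integral>v. F z0 v \<partial>M)) / (X (i + N) - z0)) \<longlonglongrightarrow> D"
   by (simp add: Y_def)
  from LIMSEQ_offset[OF this]
  show "((%y. ((\<integral>v. F y v \<partial>M) - (\<integral>v. F z0 v \<partial>M)) / (y - z0)) \<circ> X) \<longlonglongrightarrow> D"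
   by (simp add: o_def)
 qed
 then show "\<exists>f'. ((%z. \<integral>v. F z v \<partial>M) has_field_derivative f') (at z0)"
  by (auto simp: has_field_derivative_iff)
qed

lemma higher_deriv_real_on_real:
 assumes h: "g holomorphic_on UNIV" and r: "!!t::real. Im (g (of_real t)) = 0"
 shows "Im ((deriv ^^ k) g (of_real t)) = 0"
proof (induction k arbitrary: t)
 case (Suc k)
 have "(deriv ^^ k) g holomorphic_on UNIV" by (intro holomorphic_higher_deriv h) auto
 then have "((deriv ^^ k) g has_field_derivative deriv ((deriv ^^ k) g) (of_real t)) (at (of_real t))"
  using holomorphic_derivI by blast
 then have "((%x. (deriv ^^ k) g (of_real x)) has_vector_derivative deriv ((deriv ^^ k) g) (of_real t)) (at t)"
  by (rule has_vector_derivative_real_field)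
 then have "((%x. Im ((deriv ^^ k) g (of_real x))) has_vector_derivative Im (deriv ((deriv ^^ k) g) (of_real t))) (at t)"
  by (rule bounded_linear.has_vector_derivative[OF bounded_linear_Im])
 then have "((%x. 0) has_vector_derivative Im (deriv ((deriv ^^ k) g) (of_real t))) (at t)"
  by (simp add: Suc.IH)
 then show ?case using vector_derivative_unique_at[OF has_vector_derivative_const] by (metis comp_apply funpow.simps(2))
qed (use r in simp)

text \<open>Differences with arbitrarily small steps control all derivatives at 0. Because g is
  entire its Taylor series at 0 represents it on the imaginary axis, where |y| A <= 1/2 leaves a
  geometric series of sum 2 B.\<close>

lemma entire_bound_from_fd:
 assumes h: "g holomorphic_on UNIV" and gr: "!!t. g (of_real t) = complex_of_real (gr t)"
  and R: "R > 0" and A: "A > 0" and fd: "!!h k. h > 0 ==> real k * h <= R ==> \<bar>fd h k gr 0\<bar> <= B * A ^ k * fact k * h ^ k"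
  and \<nu>: "\<bar>\<nu>\<bar> * A <= 1/2"
 shows "norm (g (\<i> * of_real \<nu>)) <= 2 * B"
proof -
 have d0: "norm ((deriv ^^ k) g 0) <= B * A ^ k * fact k" for k
 proof -
  define f where "f j x = Re ((deriv ^^ j) g (of_real x))" for j x
  have der: "(f j has_real_derivative f (Suc j) x) (at x)" for j x
   unfolding f_def[abs_def] by (intro holomorphic_higher_deriv_real[OF h]) auto
  have f0: "f 0 = gr" by (auto simp: f_def gr)
  have "\<bar>f k 0\<bar> <= B * A ^ k * fact k"
  proof (rule ccontr)
   assume "\<not> ?thesis"
   then have gt: "\<bar>f k 0\<bar> > B * A ^ k * fact k" by simp
   have "isCont (f k) 0" using der DERIV_isCont by blast
   then have "isCont (%x. \<bar>f k x\<bar>) 0" by (intro continuous_intros) auto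
   then have "((%x. \<bar>f k x\<bar>) \<longlongrightarrow> \<bar>f k 0\<bar>) (at 0)" by (simp add: isCont_def)
   then have "eventually (%x. \<bar>f k x\<bar> > B * A ^ k * fact k) (at 0)" using gt by (rule order_tendstoD(1))
   then obtain \<delta> where \<delta>: "\<delta> > 0" "!!x. x \<noteq> 0 ==> \<bar>x\<bar> < \<delta> ==> \<bar>f k x\<bar> > B * A ^ k * fact k"
    unfolding eventually_at by (auto simp: dist_real_def)
   \<comment> \<open>Small enough that the mean value point falls where |f k| still exceeds the
     supposed bound; the \<open>+ 1\<close> covers k = 0.\<close>
   define h where "h = min R (\<delta>/2) / (real k + 1)"
   have h0: "h > 0" using R \<delta> by (simp add: h_def)
   have kh: "real k * h <= min R (\<delta>/2)"
   proof -
    have "real k * h <= (real k + 1) * h" using h0 by (intro mult_right_mono) auto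
    also have "... = min R (\<delta>/2)" by (simp add: h_def)
    finally show ?thesis .
   qed
   have "\<exists>\<xi>. 0 <= \<xi> \<and> \<xi> <= 0 + real k * h \<and> fd h k (f 0) 0 = h ^ k * f k \<xi>"
    by (rule fd_mean_value[where a = "-1" and b = "real k * h + 1"]) (use der h0 in auto)
   then obtain \<xi> where \<xi>: "0 <= \<xi>" "\<xi> <= real k * h" "fd h k gr 0 = h ^ k * f k \<xi>" unfolding f0 by auto
   have "\<bar>\<xi>\<bar> < \<delta>" using \<xi> kh \<delta>(1) by auto
   then have "\<bar>f k \<xi>\<bar> > B * A ^ k * fact k" using \<delta>(2)[of \<xi>] gt by (cases "\<xi> = 0") auto
   then have "h ^ k * \<bar>f k \<xi>\<bar> > h ^ k * (B * A ^ k * fact k)" using h0 by (intro mult_strict_left_mono) auto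
   moreover have "\<bar>fd h k gr 0\<bar> <= B * A ^ k * fact k * h ^ k" using kh h0 by (intro fd) auto
   ultimately show False using \<xi>(3) h0 by (simp add: abs_mult mult_ac)
  qed
  moreover have "Im ((deriv ^^ k) g (of_real 0)) = 0"
   by (rule higher_deriv_real_on_real[OF h]) (simp add: gr)
  ultimately show ?thesis unfolding f_def by (simp add: cmod_eq_Re)
 qed
 define a where "a n = (deriv ^^ n) g 0 / fact n * (\<i> * of_real \<nu> - 0) ^ n" for n
 have sums: "a sums g (\<i> * of_real \<nu>)"
  unfolding a_def by (rule holomorphic_power_series[of _ _ "\<bar>\<nu>\<bar> + 1"]) (use h holomorphic_on_subset in \<open>auto simp: norm_mult\<close>)
 have B0: "B \<ge> 0" using order_trans[OF norm_ge_zero d0[of 0]] by simp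
 have le: "norm (a n) <= B * (1/2) ^ n" for n
 proof -
  have "norm (a n) = norm ((deriv ^^ n) g 0) / fact n * \<bar>\<nu>\<bar> ^ n"
   by (simp add: a_def norm_mult norm_divide norm_power)
  also have "... <= B * A ^ n * fact n / fact n * \<bar>\<nu>\<bar> ^ n"
   by (intro mult_right_mono divide_right_mono d0) auto
  also have "... = B * (\<bar>\<nu>\<bar> * A) ^ n" by (simp add: power_mult_distrib)
  also have "... <= B * (1/2) ^ n" using \<nu> A B0 by (intro mult_left_mono power_mono) auto
  finally show ?thesis .
 qed
 have sm: "summable (%n. B * (1/2::real) ^ n)" by (intro summable_mult summable_geometric) auto
 have "norm (suminf a) <= (\<Sum>n. B * (1/2) ^ n)"
  by (rule norm_suminf_le[OF le sm])
 also have "... = 2 * B" by (subst suminf_mult) (auto simp: suminf_geometric)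
 finally show ?thesis using sums_unique[OF sums] by simp
qed

text \<open>512 = 8^3 stems from the ball of radius \<open>k * bd x / 8\<close> in
  \<open>gam_pointwise_bound\<close>; the final 1 makes the constant positive.\<close>

definition pc :: real where
 "pc = enn2real gauss_exp_const * (exp 4 * 8 * 512 / (4/3 * pi)) + 1"

lemma pc_pos: "pc > 0"
 unfolding pc_def by (intro add_nonneg_pos mult_nonneg_nonneg) auto

lemma gam_pointwise:
 assumes x: "x \<in> Omega" and k: "0 < k" "k <= 1" and [measurable]: "w \<in> borel_measurable borel" and w: "integrable lborel w"
 shows "integrable lborel (%v. gam k v * w (Sf v x))"
  and "\<bar>\<integral>v. gam k v * w (Sf v x) \<partial>lborel\<bar> <= pc / (k * bd x)^3 * (\<integral>x. \<bar>w x\<bar> \<partial>lborel)"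
proof -
 have b0: "bd x > 0" using x bd_pos_iff by blast
 define W where "W = (\<integral>x. \<bar>w x\<bar> \<partial>lborel)"
 have W0: "W \<ge> 0" by (simp add: W_def)
 have "(\<integral>\<^sup>+x. ennreal \<bar>w x\<bar> \<partial>lborel) = ennreal W"
  unfolding W_def by (rule nn_integral_eq_integral) (use w in auto)
 then have "(\<integral>\<^sup>+v. ennreal (gam k v * \<bar>w (Sf v x)\<bar>) \<partial>lborel)
   <= ennreal (exp 4 * 8 / (4/3 * pi * (k * bd x / 8)^3)) * ennreal (enn2real gauss_exp_const) * ennreal W"
  using gam_pointwise_bound[OF x k, of w] gauss_exp_const_finite by (simp add: ennreal_enn2real)
 also have "... = ennreal (exp 4 * 8 / (4/3 * pi * (k * bd x / 8)^3) * enn2real gauss_exp_const * W)"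
  using W0 k b0 by (simp add: ennreal_mult'[symmetric])
 also have "... <= ennreal (pc / (k * bd x)^3 * W)"
 proof (intro ennreal_leI mult_right_mono)
  have "exp 4 * 8 / (4/3 * pi * (k * bd x / 8)^3) * enn2real gauss_exp_const
    = enn2real gauss_exp_const * (exp 4 * 8 * 512 / (4/3 * pi)) / (k * bd x)^3"
   by (simp add: power_divide)
  also have "... <= pc / (k * bd x)^3" using k b0 by (intro divide_right_mono) (auto simp: pc_def)
  finally show "exp 4 * 8 / (4/3 * pi * (k * bd x / 8)^3) * enn2real gauss_exp_const <= pc / (k * bd x)^3" .
 qed (use W0 in simp)
 finally have le: "(\<integral>\<^sup>+v. ennreal (gam k v * \<bar>w (Sf v x)\<bar>) \<partial>lborel) <= ennreal (pc / (k * bd x)^3 * W)" .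
 have i: "integrable lborel (%v. gam k v * \<bar>w (Sf v x)\<bar>)"
  by (rule integrableI_nonneg) (use le gam_nonneg[OF k(1)] in \<open>auto intro: le_less_trans\<close>)
 have abs: "\<bar>gam k v * w (Sf v x)\<bar> = gam k v * \<bar>w (Sf v x)\<bar>" for v using gam_nonneg[OF k(1), of v] by (simp add: abs_mult)
 show i2: "integrable lborel (%v. gam k v * w (Sf v x))"
  by (rule integrable_abs_cancel) (use i in \<open>auto simp: abs\<close>)
 have "\<bar>\<integral>v. gam k v * w (Sf v x) \<partial>lborel\<bar> <= (\<integral>v. gam k v * \<bar>w (Sf v x)\<bar> \<partial>lborel)"
  using integral_abs_bound[of lborel "%v. gam k v * w (Sf v x)"] unfolding abs .
 also have "... <= pc / (k * bd x)^3 * W"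
 proof -
  have "ennreal (\<integral>v. gam k v * \<bar>w (Sf v x)\<bar> \<partial>lborel) <= ennreal (pc / (k * bd x)^3 * W)"
   using le i gam_nonneg[OF k(1)] by (subst (asm) nn_integral_eq_integral) auto
  moreover have "0 <= pc / (k * bd x)^3 * W" using W0 pc_pos k b0 by simp
  ultimately show ?thesis by (simp add: ennreal_le_iff)
 qed
 finally show "\<bar>\<integral>v. gam k v * w (Sf v x) \<partial>lborel\<bar> <= pc / (k * bd x)^3 * (\<integral>x. \<bar>w x\<bar> \<partial>lborel)" unfolding W_def .
qed

text \<open>Expanding the square makes the shift polynomial in the exponent, so that it may be
  replaced by a complex number in \<open>uk_integrand\<close>.\<close>

lemma gam_mult_axis: "gam k (v - t *\<^sub>R axis i 1) = exp (- ((norm v)\<^sup>2 - 2 * t * v $ i + t\<^sup>2) / k\<^sup>2) / (k^3 * gauss_mass)"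
proof -
 have "(norm (v - t *\<^sub>R axis i 1))\<^sup>2 = (norm v)\<^sup>2 - 2 * t * v $ i + t\<^sup>2"
  unfolding power2_norm_eq_inner
  by (simp add: inner_diff_left inner_diff_right inner_axis inner_axis_axis inner_commute[of "axis i 1"] power2_eq_square algebra_simps)
 then show ?thesis by (simp only: gam_def power_divide minus_divide_left)
qed

text \<open>Cauchy-Schwarz for sqrt p and sqrt p * g. The nonnegative integral on the right makes
  the divergent case trivial and lets Tonelli follow directly.\<close>

lemma Jensen_nn:
 assumes [measurable]: "p \<in> borel_measurable M" "g \<in> borel_measurable M" and p: "!!v. 0 <= p v" "integrable M p" "(\<integral>v. p v \<partial>M) = 1"
 shows "ennreal ((\<integral>v. p v * g v \<partial>M)\<^sup>2) <= (\<integral>\<^sup>+v. ennreal (p v * (g v)\<^sup>2) \<partial>M)"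
proof (cases "(\<integral>\<^sup>+v. ennreal (p v * (g v)\<^sup>2) \<partial>M) = \<infinity>")
 case False
 then have i: "integrable M (%v. p v * (g v)\<^sup>2)"
  by (intro integrableI_nonneg) (auto simp: p less_top[symmetric])
 define a b where "a v = sqrt (p v)" and "b v = sqrt (p v) * g v" for v
 have ab: "(%v. a v * b v) = (%v. p v * g v)" using p by (auto simp: a_def b_def mult.assoc[symmetric])
 have a2: "(%v. (a v)\<^sup>2) = p" and b2: "(%v. (b v)\<^sup>2) = (%v. p v * (g v)\<^sup>2)"
  using p by (auto simp: a_def b_def power_mult_distrib)
 have "\<bar>\<integral>v. a v * b v \<partial>M\<bar> <= sqrt (\<integral>v. (a v)\<^sup>2 \<partial>M) * sqrt (\<integral>v. (b v)\<^sup>2 \<partial>M)"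
  by (rule integral_Cauchy_Schwarz(2)) (auto simp: a2 b2 p i, auto simp: a_def[abs_def] b_def[abs_def])
 then have "\<bar>\<integral>v. p v * g v \<partial>M\<bar> <= sqrt (\<integral>v. p v * (g v)\<^sup>2 \<partial>M)" unfolding ab a2 b2 by (simp add: p)
 then have "\<bar>\<integral>v. p v * g v \<partial>M\<bar>\<^sup>2 <= (sqrt (\<integral>v. p v * (g v)\<^sup>2 \<partial>M))\<^sup>2" by (intro power_mono) auto
 also have "... = (\<integral>v. p v * (g v)\<^sup>2 \<partial>M)" by (simp add: p)
 finally have "ennreal ((\<integral>v. p v * g v \<partial>M)\<^sup>2) <= ennreal (\<integral>v. p v * (g v)\<^sup>2 \<partial>M)" by (simp add: ennreal_leI)
 also have "... = (\<integral>\<^sup>+v. ennreal (p v * (g v)\<^sup>2) \<partial>M)"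
  by (rule nn_integral_eq_integral[symmetric]) (auto simp: i p)
 finally show ?thesis .
qed simp

section \<open>Mollification of the solution\<close>

context fractional_solution
begin

definition uk :: "real => R3 => real" where
 "uk k x = (\<integral>v. gam k v * u (Sf v x) \<partial>lborel)"

definition flow_incr :: "R3 => R3 => real" where
 "flow_incr v x = u (Sf v x) - u x"

lemma u_measurable [measurable]: "u \<in> borel_measurable borel"
 by (rule HtildeD(1)[OF u])

lemma u_L1: "integrable lborel u"
 by (rule L1_le_enorm(1)[OF s(1) u])

lemma flow_incr_Htilde: "flow_incr v \<in> Htilde s Omega"
 unfolding flow_incr_def[abs_def] by (intro Htilde_diff s Htilde_Sf u)

text \<open>For short times this is the first difference with step |v| in direction v / |v|; beyond
  R the triangle inequality and the growth exp (6 |v|) of \<open>enorm_Sf\<close> suffice, and the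
  Gaussian integrates that growth.\<close>

lemma flow_incr_bound: "\<exists>C>0. \<forall>v. enorm s (flow_incr v) <= C * norm v * exp (6 * norm v)"
proof -
 obtain C A R where CAR: "C > 0" "A > 0" "R > 0"
  and wd: "\<forall>d::R3. (\<forall>i. \<bar>d $ i\<bar> <= 1) --> (\<forall>h>0. \<forall>k. real k * h <= R -->
   enorm s (wdiff d h k) <= C * A ^ k * fact k * h ^ k)"
  using flow_differences by (elim exE conjE)
 note wd = wd[rule_format]
 define E where "E = C * A + 2 * enorm s u / R"
 have E0: "0 < C * A" "0 <= 2 * enorm s u / R" using CAR by auto
 have "enorm s (flow_incr v) <= E * norm v * exp (6 * norm v)" for v
 proof (cases "norm v <= R")
  case True
  show ?thesis
  proof (cases "v = 0")
   case True
   then have "flow_incr v = (%x. 0)" by (auto simp: flow_incr_def)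
   moreover have "enorm s (%x. 0) = 0" using enorm_scale[of s 0 "%x. 0"] by simp
   ultimately show ?thesis using True by simp
  next
   case False
   define h where "h = norm v"
   define d where "d = v /\<^sub>R h"
   have h: "h > 0" using False by (simp add: h_def)
   have d: "\<bar>d $ i\<bar> <= 1" for i
    using component_le_norm_cart[of v i] h by (simp add: d_def h_def[symmetric] abs_mult divide_simps)
   have "wdiff d h 1 = flow_incr v"
    using h by (auto simp: wdiff_def flow_incr_def d_def)
   then have "enorm s (flow_incr v) <= C * A ^ 1 * fact 1 * h ^ 1"
    using wd[of d h 1] d h True by (simp add: h_def)
   also have "... <= E * norm v * 1" using E0 h by (simp add: h_def[symmetric] E_def)
   also have "... <= E * norm v * exp (6 * norm v)" using E0 by (intro mult_left_mono mult_nonneg_nonneg) (auto simp: E_def)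
   finally show ?thesis .
  qed
 next
  case False
  have "enorm s (flow_incr v) <= enorm s (%x. u (Sf v x)) + enorm s u"
   unfolding flow_incr_def[abs_def] by (intro enorm_diff_triangle s Htilde_Sf u)
  also have "... <= exp (6 * norm v) * enorm s u + exp (6 * norm v) * enorm s u"
   using mult_right_mono[of 1 "exp (6 * norm v)" "enorm s u"] by (intro add_mono enorm_Sf s u) auto
  also have "... = 2 * enorm s u * exp (6 * norm v)" by simp
  also have "... <= (2 * enorm s u * (norm v / R)) * exp (6 * norm v)"
  proof -
   have "2 * enorm s u * 1 <= 2 * enorm s u * (norm v / R)"
    using False CAR by (intro mult_left_mono) auto
   then show ?thesis by (intro mult_right_mono) auto
  qed
  also have "... <= E * norm v * exp (6 * norm v)"
  proof -
   have "2 * enorm s u * (norm v / R) <= E * norm v"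
    using mult_right_mono[of "2 * enorm s u / R" E "norm v"] E0 by (simp add: E_def)
   then show ?thesis by (intro mult_right_mono) auto
  qed
  finally show ?thesis .
 qed
 moreover have "E > 0" using E0 by (simp add: E_def)
 ultimately show ?thesis by blast
qed

lemma gam_u_integrable:
 assumes k: "0 < k" "k <= 1" and x: "x \<notin> closure Omega \<or> x \<in> Omega"
 shows "integrable lborel (%v. gam k v * u (Sf v x))"
proof (cases "x \<in> Omega")
 case True
 then show ?thesis by (intro gam_pointwise(1) k u_L1) auto
next
 case False
 then have "u (Sf v x) = 0" for v using x HtildeD(3)[OF u] Sf_Omega(2)[of v x] by blast
 then show ?thesis by simp
qed

lemma uk_measurable [measurable]: "uk k \<in> borel_measurable borel"
 unfolding uk_def[abs_def] by measurable

text \<open>Jensen inside the double integral and Tonelli reduce the energy of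
  \<open>uk k - u\<close> to the Gaussian mean of the energies of the flow increments, which are
  linear in |v|; rescaling v by k produces the factor k.\<close>

lemma uk_approx: "\<exists>C>0. \<forall>k. 0 < k --> k <= 1 --> uk k \<in> Htilde s Omega \<and> enorm s (%x. uk k x - u x) <= C * k"
proof -
 obtain E where E: "E > 0" "!!v. enorm s (flow_incr v) <= E * norm v * exp (6 * norm v)" using flow_incr_bound by blast
 \<comment> \<open>14 = 2 + 12: |v|^2 <= exp (2 |v|), and squaring exp (6 |v|) gives exp (12
   |v|).\<close>
 define Z where "Z = (\<integral>\<^sup>+v. ennreal (exp (- (norm (v::R3))\<^sup>2 + 14 * norm v) / gauss_mass) \<partial>lborel)"
 have Z: "Z < \<infinity>"
 proof -
  have "Z = (\<integral>\<^sup>+v. ennreal (1 / gauss_mass) * ennreal (exp (- (norm (v::R3))\<^sup>2 + 14 * norm v)) \<partial>lborel)"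
   unfolding Z_def using gauss_mass_pos by (simp add: ennreal_mult'[symmetric])
  also have "... = ennreal (1 / gauss_mass) * (\<integral>\<^sup>+v. ennreal (exp (- (norm (v::R3))\<^sup>2 + 14 * norm v)) \<partial>lborel)"
   by (rule nn_integral_cmult) simp
  also have "... < \<infinity>" using gauss_nn_finite[of 14] by (simp add: ennreal_mult_less_top)
  finally show ?thesis .
 qed
 define C where "C = E * sqrt (enn2real Z) + 1"
 have "uk k \<in> Htilde s Omega \<and> enorm s (%x. uk k x - u x) <= C * k" if k: "0 < k" "k <= 1" for k
 proof -
  define w where "w x = uk k x - u x" for x
  have wm [measurable]: "w \<in> borel_measurable borel" unfolding w_def[abs_def] by measurable
  have fm [measurable]: "(%p. flow_incr (f p) (g p)) \<in> borel_measurable M" if [measurable]: "f \<in> M \<rightarrow>\<^sub>M borel" "g \<in> M \<rightarrow>\<^sub>M borel" for f g and M :: "'z measure"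
   unfolding flow_incr_def by measurable
  have wi: "integrable lborel (%v. gam k v * flow_incr v x)" "w x = (\<integral>v. gam k v * flow_incr v x \<partial>lborel)"
   if x: "x \<notin> closure Omega \<or> x \<in> Omega" for x
  proof -
   have eq: "(%v. gam k v * flow_incr v x) = (%v. gam k v * u (Sf v x) - gam k v * u x)"
    by (auto simp: flow_incr_def algebra_simps)
   have i: "integrable lborel (%v. gam k v * u (Sf v x))" "integrable lborel (%v. gam k v * u x)"
    using gam_u_integrable[OF k x] integrable_gam[OF k(1)] by auto
   show "integrable lborel (%v. gam k v * flow_incr v x)" unfolding eq using i by simp
   show "w x = (\<integral>v. gam k v * flow_incr v x \<partial>lborel)"
    unfolding eq using i integral_gam[OF k(1)] by (simp add: w_def uk_def)
  qed
  define \<Theta> where "\<Theta> v x z = ennreal (gam k v * ((flow_incr v x - flow_incr v z)\<^sup>2 * kern s x z))" for v x z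
  have [measurable]: "(%p. \<Theta> (f p) (g p) (h p)) \<in> borel_measurable M" if [measurable]: "f \<in> M \<rightarrow>\<^sub>M borel" "g \<in> M \<rightarrow>\<^sub>M borel" "h \<in> M \<rightarrow>\<^sub>M borel" for f g h and M :: "'z measure"
   unfolding \<Theta>_def by measurable
  have pt: "ennreal ((w x - w z)\<^sup>2 * kern s x z) <= (\<integral>\<^sup>+v. \<Theta> v x z \<partial>lborel)"
   if x: "x \<notin> closure Omega \<or> x \<in> Omega" and z: "z \<notin> closure Omega \<or> z \<in> Omega" for x z
  proof -
   have "w x - w z = (\<integral>v. gam k v * (flow_incr v x - flow_incr v z) \<partial>lborel)"
    unfolding wi(2)[OF x] wi(2)[OF z] using wi(1)[OF x] wi(1)[OF z] by (simp add: right_diff_distrib)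
   then have "ennreal ((w x - w z)\<^sup>2) <= (\<integral>\<^sup>+v. ennreal (gam k v * (flow_incr v x - flow_incr v z)\<^sup>2) \<partial>lborel)"
    using Jensen_nn[of "gam k" lborel "%v. flow_incr v x - flow_incr v z"] gam_nonneg[OF k(1)] integrable_gam[OF k(1)] integral_gam[OF k(1)]
    by simp
   then have "ennreal ((w x - w z)\<^sup>2) * ennreal (kern s x z) <= (\<integral>\<^sup>+v. ennreal (gam k v * (flow_incr v x - flow_incr v z)\<^sup>2) \<partial>lborel) * ennreal (kern s x z)"
    by (intro mult_right_mono) auto
   also have "... = (\<integral>\<^sup>+v. ennreal (gam k v * (flow_incr v x - flow_incr v z)\<^sup>2) * ennreal (kern s x z) \<partial>lborel)"
    by (rule nn_integral_multc[symmetric]) measurable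
   also have "... = (\<integral>\<^sup>+v. \<Theta> v x z \<partial>lborel)"
    unfolding \<Theta>_def using gam_nonneg[OF k(1)] by (simp add: ennreal_mult'[symmetric] mult.assoc)
   finally show ?thesis by (simp add: ennreal_mult'[symmetric])
  qed
  have "gagliardo_sq s UNIV w <= (\<integral>\<^sup>+x. \<integral>\<^sup>+z. \<integral>\<^sup>+v. \<Theta> v x z \<partial>lborel \<partial>lborel \<partial>lborel)"
   unfolding gagliardo_UNIV
   by (rule nn_integral_mono_AE, rule eventually_mono[OF AE_not_frontier_Omega],
     rule nn_integral_mono_AE, rule eventually_mono[OF AE_not_frontier_Omega], rule pt)
  also have "... = (\<integral>\<^sup>+x. \<integral>\<^sup>+v. \<integral>\<^sup>+z. \<Theta> v x z \<partial>lborel \<partial>lborel \<partial>lborel)"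
   by (intro nn_integral_cong lborel_pair.Fubini') measurable
  also have "... = (\<integral>\<^sup>+v. \<integral>\<^sup>+x. \<integral>\<^sup>+z. \<Theta> v x z \<partial>lborel \<partial>lborel \<partial>lborel)"
   by (rule lborel_pair.Fubini') measurable
  also have "... = (\<integral>\<^sup>+v. ennreal (gam k v) * gagliardo_sq s UNIV (flow_incr v) \<partial>lborel)"
   unfolding \<Theta>_def gagliardo_UNIV using gam_nonneg[OF k(1)]
   by (simp add: ennreal_mult' nn_integral_cmult)
  also have "... <= (\<integral>\<^sup>+v. ennreal (gam k v) * ennreal ((E * norm v * exp (6 * norm v))\<^sup>2) \<partial>lborel)"
  proof (intro nn_integral_mono mult_left_mono)
   fix v
   show "gagliardo_sq s UNIV (flow_incr v) <= ennreal ((E * norm v * exp (6 * norm v))\<^sup>2)"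
    unfolding gagliardo_eq_enorm[OF flow_incr_Htilde] by (intro ennreal_leI power_mono E) auto
  qed auto
  also have "... = (\<integral>\<^sup>+v. ennreal (gam 1 v) * ennreal ((E * norm (k *\<^sub>R v) * exp (6 * norm (k *\<^sub>R v)))\<^sup>2) \<partial>lborel)"
   by (rule nn_integral_gam[OF k(1)]) measurable
  also have "... <= (\<integral>\<^sup>+v. ennreal ((E * k)\<^sup>2) * ennreal (exp (- (norm (v::R3))\<^sup>2 + 14 * norm v) / gauss_mass) \<partial>lborel)"
  proof (rule nn_integral_mono)
   fix v :: R3
   have nk: "norm (k *\<^sub>R v) = k * norm v" "k * norm v <= norm v" using k mult_right_mono[OF k(2), of "norm v"] by auto
   have "(norm v)\<^sup>2 <= (exp (norm v))\<^sup>2" using exp_ge_add_one_self[of "norm v"] norm_ge_zero[of v] by (intro power_mono) linarith+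
   also have "... = exp (2 * norm v)" by (simp add: exp_double)
   finally have n2: "(norm v)\<^sup>2 <= exp (2 * norm v)" .
   have "(exp (6 * norm (k *\<^sub>R v)))\<^sup>2 = exp (12 * (k * norm v))" unfolding nk(1) exp_double[symmetric] by simp
   also have "... <= exp (12 * norm v)" using nk(2) by simp
   finally have e2: "(exp (6 * norm (k *\<^sub>R v)))\<^sup>2 <= exp (12 * norm v)" .
   have "(E * norm (k *\<^sub>R v) * exp (6 * norm (k *\<^sub>R v)))\<^sup>2 = (E * k)\<^sup>2 * ((norm v)\<^sup>2 * (exp (6 * norm (k *\<^sub>R v)))\<^sup>2)"
    unfolding nk(1) by (simp add: power_mult_distrib mult_ac)
   also have "... <= (E * k)\<^sup>2 * (exp (2 * norm v) * exp (12 * norm v))"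
    by (intro mult_left_mono mult_mono n2 e2) auto
   also have "exp (2 * norm v) * exp (12 * norm v) = exp (14 * norm v)" by (simp add: mult_exp_exp)
   finally have "gam 1 v * (E * norm (k *\<^sub>R v) * exp (6 * norm (k *\<^sub>R v)))\<^sup>2 <= gam 1 v * ((E * k)\<^sup>2 * exp (14 * norm v))"
    by (intro mult_left_mono gam_nonneg) auto
   also have "... = (E * k)\<^sup>2 * (exp (- (norm v)\<^sup>2 + 14 * norm v) / gauss_mass)"
    unfolding gam_def exp_add by simp
   finally show "ennreal (gam 1 v) * ennreal ((E * norm (k *\<^sub>R v) * exp (6 * norm (k *\<^sub>R v)))\<^sup>2)
    <= ennreal ((E * k)\<^sup>2) * ennreal (exp (- (norm v)\<^sup>2 + 14 * norm v) / gauss_mass)"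
    using gam_nonneg[of 1 v] by (subst (1 2) ennreal_mult'[symmetric]) (auto intro!: ennreal_leI)
  qed
  also have "... = ennreal ((E * k)\<^sup>2) * Z" unfolding Z_def by (rule nn_integral_cmult) simp
  also have "... = ennreal ((E * k)\<^sup>2 * enn2real Z)" using Z by (simp add: ennreal_mult' ennreal_enn2real)
  finally have g: "gagliardo_sq s UNIV w <= ennreal ((E * k)\<^sup>2 * enn2real Z)" .
  have "w x = 0" if x: "x \<notin> closure Omega" for x
  proof -
   have "u (Sf v x) = 0" for v using x HtildeD(3)[OF u] Sf_Omega(2)[of v x] by blast
   then show ?thesis using HtildeD(3)[OF u x] by (simp add: w_def uk_def)
  qed
  then have w: "w \<in> Htilde s Omega"
   unfolding Htilde_iff[OF s(1)] using wm le_less_trans[OF g] by auto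
  have "enorm s w <= C * k"
  proof (rule enorm_le[OF w])
   show "0 <= C * k" using E k by (simp add: C_def)
   have "(E * k)\<^sup>2 * enn2real Z = (E * sqrt (enn2real Z) * k)\<^sup>2" by (simp add: power_mult_distrib mult_ac)
   also have "... <= (C * k)\<^sup>2" using E k by (intro power_mono mult_right_mono) (auto simp: C_def)
   finally show "gagliardo_sq s UNIV w <= ennreal ((C * k)\<^sup>2)" using g ennreal_leI order_trans by blast
  qed
  moreover have "uk k \<in> Htilde s Omega" using Htilde_add[OF s(1) w u] by (simp add: w_def)
  ultimately show ?thesis unfolding w_def by simp
 qed
 moreover have "C > 0" using E by (simp add: C_def add_nonneg_pos)
 ultimately show ?thesis by blast
qed

end

section \<open>Complex extension of the mollified solution in one flow parameter\<close>

lemma integral_translate_R3: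
 fixes F :: "R3 => 'b::{banach, second_countable_topology}"
 assumes "F \<in> borel_measurable borel"
 shows "(\<integral>x. F x \<partial>lborel) = (\<integral>x. F (t + x) \<partial>lborel)"
proof -
 have "(\<integral>x. F x \<partial>lborel) = (\<integral>x. F x \<partial>distr lborel borel ((+) t))" by (simp add: lborel_distr_plus)
 also have "... = (\<integral>x. F (t + x) \<partial>lborel)" by (rule integral_distr) (use assms in auto)
 finally show ?thesis .
qed

context fractional_solution
begin

text \<open>The Gaussian shifted by the complex amount \<open>\<tau>\<close> along axis i, in the
  polynomial form of \<open>gam_mult_axis\<close>.\<close>

definition uk_integrand :: "real => 3 => R3 => complex => R3 => complex" where
 "uk_integrand k i x \<tau> v = exp (- (of_real ((norm v)\<^sup>2) - 2 * \<tau> * of_real (v $ i) + \<tau>\<^sup>2) / of_real (k\<^sup>2)) / of_real (k^3 * gauss_mass) * of_real (u (Sf v x))"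

definition uk_ext :: "real => 3 => R3 => complex => complex" where
 "uk_ext k i x \<tau> = (\<integral>v. uk_integrand k i x \<tau> v \<partial>lborel)"

lemma uk_integrand_measurable [measurable]: "uk_integrand k i x \<tau> \<in> borel_measurable borel"
 unfolding uk_integrand_def[abs_def] by measurable

text \<open>Splitting 2 rh |v| <= |v|^2 / 2 + 2 rh^2 leaves at least a quarter of |v|^2 in the
  exponent, that is a Gaussian of width 2 k. The factor exp (3 rh^2 / k^2) is admissible for
  holomorphy but not for quantitative use.\<close>

lemma uk_integrand_bound:
 assumes k: "0 < k" and \<tau>: "norm \<tau> < rh"
 shows "norm (uk_integrand k i x \<tau> v) <= exp (3 * rh\<^sup>2 / k\<^sup>2) * 8 * (gam (2 * k) v * \<bar>u (Sf v x)\<bar>)"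
proof -
 define X where "X = of_real ((norm v)\<^sup>2) - 2 * \<tau> * of_real (v $ i) + \<tau>\<^sup>2"
 have rh: "rh > 0" using \<tau> norm_ge_zero[of \<tau>] by linarith
 have "norm (2 * \<tau> * of_real (v $ i) - \<tau>\<^sup>2) <= norm (2 * \<tau> * of_real (v $ i)) + norm (\<tau>\<^sup>2)" by (rule norm_triangle_ineq4)
 also have "... <= 2 * rh * norm v + rh\<^sup>2"
 proof (intro add_mono)
  have "norm (2 * \<tau> * of_real (v $ i)) = 2 * norm \<tau> * \<bar>v $ i\<bar>" by (simp add: norm_mult)
  also have "... <= 2 * rh * norm v" using \<tau> rh component_le_norm_cart[of v i] by (intro mult_mono) auto
  finally show "norm (2 * \<tau> * of_real (v $ i)) <= 2 * rh * norm v" .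
  show "norm (\<tau>\<^sup>2) <= rh\<^sup>2" unfolding norm_power using \<tau> by (intro power_mono) auto
 qed
 also have "2 * rh * norm v <= (norm v)\<^sup>2 / 2 + 2 * rh\<^sup>2"
 proof -
  have "0 <= (norm v - 2 * rh)\<^sup>2" by simp
  then show ?thesis by (simp add: power2_eq_square algebra_simps)
 qed
 finally have n: "norm (2 * \<tau> * of_real (v $ i) - \<tau>\<^sup>2) <= (norm v)\<^sup>2 / 2 + 3 * rh\<^sup>2" by simp
 have "Re X = (norm v)\<^sup>2 - Re (2 * \<tau> * of_real (v $ i) - \<tau>\<^sup>2)" by (simp add: X_def)
 moreover have "Re (2 * \<tau> * of_real (v $ i) - \<tau>\<^sup>2) <= (norm v)\<^sup>2 / 2 + 3 * rh\<^sup>2" using n complex_Re_le_cmod order_trans by blast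
 ultimately have "Re X \<ge> (norm v)\<^sup>2 / 4 - 3 * rh\<^sup>2" using zero_le_power2[of "norm v"] by linarith
 then have "- Re X / k\<^sup>2 <= (3 * rh\<^sup>2 - (norm v)\<^sup>2 / 4) / k\<^sup>2" using k by (intro divide_right_mono) auto
 also have "... = 3 * rh\<^sup>2 / k\<^sup>2 + - (norm v / (2 * k))\<^sup>2"
  by (simp add: diff_divide_distrib power_divide power_mult_distrib)
 finally have e: "exp (- Re X / k\<^sup>2) <= exp (3 * rh\<^sup>2 / k\<^sup>2) * exp (- (norm v / (2 * k))\<^sup>2)"
  unfolding mult_exp_exp by simp
 have "Re (- X / of_real (k\<^sup>2)) = - Re X / k\<^sup>2" by (simp add: Re_divide_of_real del: of_real_power)
 then have "norm (exp (- X / of_real (k\<^sup>2))) = exp (- Re X / k\<^sup>2)" by (metis norm_exp_eq_Re)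
 then have "norm (uk_integrand k i x \<tau> v) = exp (- Re X / k\<^sup>2) / (k^3 * gauss_mass) * \<bar>u (Sf v x)\<bar>"
  unfolding uk_integrand_def X_def[symmetric] norm_mult norm_divide norm_of_real using k gauss_mass_pos by simp
 also have "... <= exp (3 * rh\<^sup>2 / k\<^sup>2) * exp (- (norm v / (2 * k))\<^sup>2) / (k^3 * gauss_mass) * \<bar>u (Sf v x)\<bar>"
  using k gauss_mass_pos by (intro mult_right_mono divide_right_mono e) auto
 also have "... = exp (3 * rh\<^sup>2 / k\<^sup>2) * 8 * (gam (2 * k) v * \<bar>u (Sf v x)\<bar>)"
  by (simp add: gam_def power_mult_distrib)
 finally show ?thesis .
qed

text \<open>\<open>k <= 1/2\<close> keeps the doubled width of the majorant within the range of
  \<open>gam_pointwise\<close>.\<close>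

lemma uk_ext_holomorphic:
 assumes k: "0 < k" "k <= 1/2" and x: "x \<in> Omega"
 shows "uk_ext k i x holomorphic_on UNIV"
proof -
 have b: "uk_ext k i x holomorphic_on ball 0 rh" for rh
  unfolding uk_ext_def[abs_def]
 proof (rule holomorphic_param_integral)
  show "(%\<tau>. uk_integrand k i x \<tau> v) holomorphic_on ball 0 rh" for v
   unfolding uk_integrand_def using k gauss_mass_pos by (intro holomorphic_intros) auto
  show "norm (uk_integrand k i x \<tau> v) <= exp (3 * rh\<^sup>2 / k\<^sup>2) * 8 * (gam (2 * k) v * \<bar>u (Sf v x)\<bar>)" if "\<tau> \<in> ball 0 rh" for \<tau> v
   using that by (intro uk_integrand_bound k) auto
  have "integrable lborel (%v. gam (2 * k) v * \<bar>u (Sf v x)\<bar>)"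
   using gam_pointwise(1)[OF x, of "2 * k" "%x. \<bar>u x\<bar>"] k u_L1 by auto
  then show "integrable lborel (%v. exp (3 * rh\<^sup>2 / k\<^sup>2) * 8 * (gam (2 * k) v * \<bar>u (Sf v x)\<bar>))"
   by (rule integrable_mult_right)
 qed auto
 show ?thesis
  unfolding holomorphic_on_open[OF open_UNIV]
 proof
  fix z :: complex
  show "\<exists>f'. (uk_ext k i x has_field_derivative f') (at z)"
   using b[of "norm z + 1"] by (auto simp: holomorphic_on_open)
 qed
qed

lemma uk_ext_real: 
 assumes k: "0 < k"
 shows "uk_ext k i x (of_real t) = of_real (uk k (Sf (t *\<^sub>R axis i 1) x))"
proof -
 define a :: R3 where "a = t *\<^sub>R axis i 1"
 have "uk_integrand k i x (of_real t) v = of_real (gam k (v - a) * u (Sf v x))" for v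
  unfolding uk_integrand_def a_def gam_mult_axis of_real_mult of_real_divide exp_of_real[symmetric] by simp
 then have "uk_integrand k i x (of_real t) = (%v. of_real (gam k (v - a) * u (Sf v x)))" by blast
 then have "uk_ext k i x (of_real t) = of_real (\<integral>v. gam k (v - a) * u (Sf v x) \<partial>lborel)"
  unfolding uk_ext_def by (simp only: integral_complex_of_real)
 also have "(\<integral>v. gam k (v - a) * u (Sf v x) \<partial>lborel) = (\<integral>v. gam k ((a + v) - a) * u (Sf (a + v) x) \<partial>lborel)"
  by (rule integral_translate_R3) measurable
 also have "... = uk k (Sf a x)"
  unfolding uk_def by (simp add: Sf_add[symmetric] add.commute)
 finally show ?thesis unfolding a_def .
qed

text \<open>The real part of the time can be absorbed into the base point by translating v, so a
  bound on the imaginary axis at every base point is a bound on a strip.\<close>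

lemma uk_ext_shift: "uk_ext k i x (of_real t + \<tau>) = uk_ext k i (Sf (t *\<^sub>R axis i 1) x) \<tau>"
proof -
 define a :: R3 where "a = t *\<^sub>R axis i 1"
 have n: "(norm (a + v))\<^sup>2 = (norm v)\<^sup>2 + 2 * t * v $ i + t\<^sup>2" for v
  unfolding power2_norm_eq_inner a_def
  by (simp add: inner_add_left inner_add_right inner_axis inner_axis_axis inner_commute[of "axis i 1"] power2_eq_square algebra_simps)
 have c: "(a + v) $ i = t + v $ i" for v by (simp add: a_def axis_def)
 have "uk_ext k i x (of_real t + \<tau>) = (\<integral>v. uk_integrand k i x (of_real t + \<tau>) (a + v) \<partial>lborel)"
  unfolding uk_ext_def by (rule integral_translate_R3) measurable
 also have "(%v. uk_integrand k i x (of_real t + \<tau>) (a + v)) = uk_integrand k i (Sf a x) \<tau>"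
 proof
  fix v
  have "complex_of_real ((norm (a + v))\<^sup>2) - 2 * (of_real t + \<tau>) * of_real ((a + v) $ i) + (of_real t + \<tau>)\<^sup>2
   = of_real ((norm v)\<^sup>2) - 2 * \<tau> * of_real (v $ i) + \<tau>\<^sup>2"
   unfolding n c by (simp add: power2_eq_square algebra_simps)
  moreover have "Sf (a + v) x = Sf v (Sf a x)" by (simp add: Sf_add[symmetric] add.commute)
  ultimately show "uk_integrand k i x (of_real t + \<tau>) (a + v) = uk_integrand k i (Sf a x) \<tau> v"
   unfolding uk_integrand_def by simp
 qed
 finally show ?thesis unfolding uk_ext_def a_def .
qed

text \<open>Differences of \<open>uk k\<close> along the flow are Gaussian means of
  \<open>wdiff\<close>: they fall on the solution, where \<open>flow_differences\<close> gives C A^m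
  m! h^m independently of k. Through \<open>entire_bound_from_fd\<close> the strip height 1 / (2 A)
  is free of k, and the mollifier contributes only the factor (k * bd)^(-3) of
  \<open>gam_pointwise\<close>.\<close>

lemma uk_ext_bound:
 "\<exists>C \<theta>. C > 0 \<and> \<theta> > 0 \<and> (\<forall>k x i t \<nu>. 0 < k --> k <= 1/2 --> x \<in> Omega --> \<bar>\<nu>\<bar> <= \<theta> -->
   norm (uk_ext k i x (of_real t + \<i> * of_real \<nu>)) <= C / (k * bd (Sf (t *\<^sub>R axis i 1) x))^3)"
proof -
 obtain C A R where CAR: "C > 0" "A > 0" "R > 0"
  and wd: "\<forall>d::R3. (\<forall>i. \<bar>d $ i\<bar> <= 1) --> (\<forall>h>0. \<forall>k. real k * h <= R -->
   enorm s (wdiff d h k) <= C * A ^ k * fact k * h ^ k)"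
  using flow_differences by (elim exE conjE)
 note wd = wd[rule_format]
 define C' where "C' = 2 * (pc * C / sqrt (hardy_const s))"
 define \<theta> where "\<theta> = 1 / (2 * A)"
 have main: "norm (uk_ext k i x (\<i> * of_real \<nu>)) <= C' / (k * bd x)^3"
  if k: "0 < k" "k <= 1/2" and x: "x \<in> Omega" and \<nu>: "\<bar>\<nu>\<bar> <= \<theta>" for k x i \<nu>
 proof -
  have b0: "bd x > 0" using x bd_pos_iff by blast
  define a :: R3 where "a = axis i 1"
  have a1: "\<bar>a $ j\<bar> <= 1" for j by (simp add: a_def axis_def)
  have k1: "k <= 1" using k by simp
  define B where "B = pc / (k * bd x)^3 * (C / sqrt (hardy_const s))"
  have "norm (uk_ext k i x (\<i> * of_real \<nu>)) <= 2 * B"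
  proof (rule entire_bound_from_fd[OF uk_ext_holomorphic[OF k x] uk_ext_real[OF k(1)] CAR(3,2)])
   fix h :: real and m :: nat assume h: "h > 0" and mh: "real m * h <= R"
   define w where "w = wdiff a h m"
   have w: "w \<in> Htilde s Omega" unfolding w_def by (rule wdiff_Htilde)
   have i: "integrable lborel (%v. gam k v * u (Sf v (Sf (t *\<^sub>R a) x)))" for t
    by (rule gam_u_integrable[OF k(1) k1]) (simp add: Sf_Omega x)
   have "fd h m (%t. uk k (Sf (t *\<^sub>R axis i 1) x)) 0 = (\<integral>v. fd h m (%t. gam k v * u (Sf v (Sf (t *\<^sub>R a) x))) 0 \<partial>lborel)"
    unfolding uk_def a_def[symmetric] by (rule fd_integral(2)[OF i])
   also have "... = (\<integral>v. gam k v * w (Sf v x) \<partial>lborel)"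
    unfolding fd_cmult w_def wdiff_def Sf_add[symmetric] by (simp add: add.commute)
   finally have "\<bar>fd h m (%t. uk k (Sf (t *\<^sub>R axis i 1) x)) 0\<bar> <= pc / (k * bd x)^3 * (\<integral>x. \<bar>w x\<bar> \<partial>lborel)"
    using gam_pointwise(2)[OF x k(1) k1 HtildeD(1)[OF w] L1_le_enorm(1)[OF s(1) w]] by simp
   also have "... <= pc / (k * bd x)^3 * (C * A ^ m * fact m * h ^ m / sqrt (hardy_const s))"
   proof (intro mult_left_mono)
    have "(\<integral>x. \<bar>w x\<bar> \<partial>lborel) <= enorm s w / sqrt (hardy_const s)" by (rule L1_le_enorm(2)[OF s(1) w])
    also have "... <= C * A ^ m * fact m * h ^ m / sqrt (hardy_const s)"
     unfolding w_def using hardy_const_pos[of s] by (intro divide_right_mono wd a1 h mh) auto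
    finally show "(\<integral>x. \<bar>w x\<bar> \<partial>lborel) <= C * A ^ m * fact m * h ^ m / sqrt (hardy_const s)" .
    show "0 <= pc / (k * bd x)^3" using pc_pos k b0 by simp
   qed
   also have "... = B * A ^ m * fact m * h ^ m" by (simp add: B_def)
   finally show "\<bar>fd h m (%t. uk k (Sf (t *\<^sub>R axis i 1) x)) 0\<bar> <= B * A ^ m * fact m * h ^ m" .
  next
   have "\<bar>\<nu>\<bar> * A <= \<theta> * A" using \<nu> CAR by (intro mult_right_mono) auto
   also have "... = 1/2" using CAR by (simp add: \<theta>_def)
   finally show "\<bar>\<nu>\<bar> * A <= 1/2" .
  qed
  also have "2 * B = C' / (k * bd x)^3" by (simp add: B_def C'_def)
  finally show ?thesis .
 qed
 have "norm (uk_ext k i x (of_real t + \<i> * of_real \<nu>)) <= C' / (k * bd (Sf (t *\<^sub>R axis i 1) x))^3"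
  if "0 < k" "k <= 1/2" "x \<in> Omega" "\<bar>\<nu>\<bar> <= \<theta>" for k x i t \<nu>
  unfolding uk_ext_shift using that by (intro main) (auto simp: Sf_Omega)
 moreover have "C' > 0" using pc_pos CAR hardy_const_pos[of s] by (simp add: C'_def)
 moreover have "\<theta> > 0" using CAR by (simp add: \<theta>_def)
 ultimately show ?thesis by blast
qed

end

section \<open>Polynomial approximation of functions holomorphic around the unit interval\<close>

definition ell :: "complex => real" where
 "ell z = norm z + norm (1 - z)"

lemma ell_ge_1: "1 <= ell z"
 using norm_triangle_ineq[of z "1 - z"] by (simp add: ell_def)

text \<open>With \<open>z = sin\<^sup>2 w\<close> one has \<open>ell z = cosh (2 Im w)\<close>, so the logistic map \<open>z \<mapsto> 4 z (1 - z)\<close>,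
 that is \<open>w \<mapsto> 2 w\<close>, maps the confocal ellipses \<open>ell z = c\<close> to \<open>ell z = 2 c\<^sup>2 - 1\<close>.\<close>

lemma ell_logistic: "ell (4 * z * (1 - z)) = 2 * (ell z)\<^sup>2 - 1"
proof -
 have "1 - 4 * z * (1 - z) = (1 - 2 * z)\<^sup>2" by (simp add: power2_eq_square algebra_simps)
 then have "ell (4 * z * (1 - z)) = 4 * norm z * norm (1 - z) + (norm (1 - 2 * z))\<^sup>2"
  unfolding ell_def by (simp add: norm_mult norm_power)
 also have "(norm (1 - 2 * z))\<^sup>2 = 2 * (norm z)\<^sup>2 + 2 * (norm (1 - z))\<^sup>2 - 1"
  by (simp add: cmod_power2) (simp add: power2_eq_square algebra_simps)
 finally show ?thesis by (simp add: ell_def power2_sum algebra_simps)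
qed

text \<open>Iterates of the logistic map, sin^2 w to sin^2 (2^m w): a Chebyshev polynomial of degree
  2^m up to affine changes of variable. It maps the unit interval to itself and is large off it, and
  recursion makes both facts elementary.\<close>

fun logit_poly :: "nat => complex poly" where
 "logit_poly 0 = [:0, 1:]"
| "logit_poly (Suc m) = smult 4 (logit_poly m * (1 - logit_poly m))"

lemma logit_poly_Suc: "poly (logit_poly (Suc m)) z = 4 * poly (logit_poly m) z * (1 - poly (logit_poly m) z)"
 by simp

lemma degree_logit_poly: "degree (logit_poly m) <= 2 ^ m"
proof (induction m)
 case (Suc m)
 have "degree (1 - logit_poly m) <= 2 ^ m" by (rule degree_diff_le) (use Suc in auto)
 then have "degree (logit_poly m * (1 - logit_poly m)) <= 2 ^ m + 2 ^ m"
  using degree_mult_le[of "logit_poly m" "1 - logit_poly m"] Suc by linarith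
 then show ?case by simp
qed simp

text \<open>At e = 1 the tangent of 2 e^2 - 1 has slope 4, so by convexity each step multiplies the
  excess of \<open>ell\<close> over 1 by at least 4.\<close>

lemma logit_poly_ell: "1 + 4 ^ m * (ell z - 1) <= ell (poly (logit_poly m) z)"
proof (induction m)
 case (Suc m)
 define e where "e = ell (poly (logit_poly m) z)"
 have e1: "1 <= e" by (simp add: e_def ell_ge_1)
 have "0 <= (e - 1)\<^sup>2" by simp
 then have "1 + 4 * (e - 1) <= 2 * e\<^sup>2 - 1" by (simp add: power2_eq_square algebra_simps)
 moreover have "4 ^ m * (ell z - 1) <= e - 1" using Suc by (simp add: e_def)
 then have "4 * (4 ^ m * (ell z - 1)) <= 4 * (e - 1)" by (rule mult_left_mono) simp
 ultimately show ?case unfolding logit_poly_Suc ell_logistic e_def[symmetric] by simp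
qed simp

lemma logit_poly_large:
 assumes "4 <= 4 ^ m * (ell z - 1)"
 shows "2 <= norm (poly (logit_poly m) z)"
proof -
 have "ell w <= 2 * norm w + 1" for w using norm_triangle_ineq4[of 1 w] by (simp add: ell_def)
 then show ?thesis using logit_poly_ell[of m z] assms by (smt (verit))
qed

lemma logit_poly_unit:
 assumes "0 <= t" "t <= 1"
 shows "\<exists>r. 0 <= r \<and> r <= 1 \<and> poly (logit_poly m) (of_real t) = of_real r"
proof (induction m)
 case 0
 then show ?case using assms by (intro exI[of _ t]) auto
next
 case (Suc m)
 then obtain r where r: "0 <= r" "r <= 1" "poly (logit_poly m) (of_real t) = of_real r" by blast
 have "4 * r * (1 - r) <= 1"
 proof -
  have "0 <= (2 * r - 1)\<^sup>2" by simp
  then show ?thesis by (simp add: power2_eq_square algebra_simps)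
 qed
 then show ?case using r by (intro exI[of _ "4 * r * (1 - r)"]) (auto simp: logit_poly_Suc)
qed

text \<open>The divided difference as a polynomial in x with coefficients depending on z;
  integrating these coefficients over a contour gives the coefficients of the approximating
  polynomial.\<close>

lemma poly_diff_quotient:
 fixes p :: "complex poly"
 shows "poly p z - poly p x = (z - x) * (\<Sum>j<degree p. (\<Sum>i=Suc j..degree p. coeff p i * z ^ (i - 1 - j)) * x ^ j)"
proof -
 have "poly p z - poly p x = (\<Sum>i\<le>degree p. coeff p i * (z ^ i - x ^ i))"
  by (simp add: poly_altdef sum_subtractf algebra_simps)
 also have "... = (\<Sum>i\<le>degree p. coeff p i * ((z - x) * (\<Sum>j<i. z ^ (i - Suc j) * x ^ j)))"
 proof (intro sum.cong refl arg_cong2[where f = "(*)"])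
  fix i
  show "z ^ i - x ^ i = (z - x) * (\<Sum>j<i. z ^ (i - Suc j) * x ^ j)"
   using power_diff_sumr2[of x i z] by (metis minus_diff_eq mult_minus_left)
 qed
 also have "... = (z - x) * (\<Sum>i\<le>degree p. \<Sum>j<i. coeff p i * z ^ (i - Suc j) * x ^ j)"
  by (simp add: sum_distrib_left mult_ac)
 also have "(\<Sum>i\<le>degree p. \<Sum>j<i. coeff p i * z ^ (i - Suc j) * x ^ j) = (\<Sum>j<degree p. \<Sum>i=Suc j..degree p. coeff p i * z ^ (i - Suc j) * x ^ j)"
  by (subst sum.Sigma, simp, simp, subst sum.Sigma, simp, simp)
    (rule sum.reindex_bij_witness[of _ "%(j, i). (i, j)" "%(i, j). (j, i)"], auto)
 finally show ?thesis by (simp add: sum_distrib_right)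
qed

text \<open>Hermite's remainder formula with T the k-th power of \<open>logit_poly m\<close>: the
  error is the Cauchy integral of g(z) T(x) / T(z) / (z - x) over the rectangle. On the interval |T|
  <= 1; on the rectangle \<open>ell\<close> exceeds 1 by at least et^2, so the condition on m gives
  |T| >= 2^k. The 10 bounds the perimeter 2 + 8 et.\<close>

lemma rect_approx:
 assumes et: "0 < et" "et <= 1" and m: "4 <= 4 ^ m * et\<^sup>2"
  and S: "open S" "g holomorphic_on S" "{z. - et <= Re z \<and> Re z <= 1 + et \<and> \<bar>Im z\<bar> <= et} \<subseteq> S"
  and B: "!!z. - et <= Re z ==> Re z <= 1 + et ==> \<bar>Im z\<bar> <= et ==> norm (g z) <= B"
 shows "\<exists>a :: nat => complex. \<forall>t\<in>{0..1}. norm (g (of_real t) - (\<Sum>j<2^m*k. a j * of_real t ^ j)) <= 10 * B / et * (1/2) ^ k"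
proof -
 define c1 c3 where "c1 = Complex (- et) (- et)" and "c3 = Complex (1 + et) et"
 define \<gamma> where "\<gamma> = rectpath c1 c3"
 define T where "T = logit_poly m ^ k"
 define d where "d = degree T"
 have d: "d <= 2 ^ m * k"
  unfolding d_def T_def using degree_power_le[of "logit_poly m" k] degree_logit_poly[of m] by (meson mult_le_mono1 order_trans)
 have B0: "B \<ge> 0" using order_trans[OF norm_ge_zero B[of 0]] et by simp
 have le: "Re c1 <= Re c3" "Im c1 <= Im c3" using et by (auto simp: c1_def c3_def)
 have pim: "path_image \<gamma> = {z. Re z \<in> {- et, 1 + et} \<and> Im z \<in> {- et..et}} \<union> {z. Im z \<in> {- et, et} \<and> Re z \<in> {- et..1 + et}}"
  unfolding \<gamma>_def path_image_rectpath[OF le] by (simp add: c1_def c3_def)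
 have pR: "- et <= Re z" "Re z <= 1 + et" "\<bar>Im z\<bar> <= et" if "z \<in> path_image \<gamma>" for z
  using that et unfolding pim by auto
 have pdist: "et <= norm (z - of_real t)" if z: "z \<in> path_image \<gamma>" and t: "0 <= t" "t <= 1" for z t
 proof -
  have "et <= \<bar>Re z - t\<bar> \<or> et <= \<bar>Im z\<bar>" using z t et unfolding pim by auto
  then show ?thesis using abs_Re_le_cmod[of "z - of_real t"] abs_Im_le_cmod[of "z - of_real t"] by auto
 qed
 have pell: "et\<^sup>2 <= ell z - 1" if z: "z \<in> path_image \<gamma>" for z
 proof -
  have et2: "et\<^sup>2 <= et" using et by (simp add: power2_eq_square mult_left_le)
  consider "\<bar>Im z\<bar> = et" | "Re z = - et" | "Re z = 1 + et" using z et unfolding pim by auto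
  then show ?thesis
  proof cases
   case 1
   \<comment> \<open>Conjugation keeps |z| and lets the imaginary parts add: the sum is 1 - 2 i Im
     z, of modulus sqrt (1 + 4 et^2) >= 1 + et^2.\<close>
   have "norm (cnj z + (1 - z)) <= norm (cnj z) + norm (1 - z)" by (rule norm_triangle_ineq)
   then have "norm (cnj z + (1 - z)) <= ell z" by (simp add: ell_def)
   moreover have "cnj z + (1 - z) = Complex 1 (- 2 * Im z)" by (simp add: complex_eq_iff)
   ultimately have a: "norm (Complex 1 (- 2 * Im z)) <= ell z" by simp
   have "(Im z)\<^sup>2 = et\<^sup>2" using 1 by (metis power2_abs)
   then have "(norm (Complex 1 (- 2 * Im z)))\<^sup>2 = 1 + 4 * et\<^sup>2" unfolding cmod_power2 by (simp add: power_mult_distrib)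
   moreover have "(1 + et\<^sup>2)\<^sup>2 <= 1 + 4 * et\<^sup>2"
   proof -
    have "(et\<^sup>2)\<^sup>2 <= 1 * et\<^sup>2" unfolding power2_eq_square[of "et\<^sup>2"] using et et2 by (intro mult_right_mono) auto
    moreover have "(1 + et\<^sup>2)\<^sup>2 = 1 + 2 * et\<^sup>2 + (et\<^sup>2)\<^sup>2" by (simp only: power2_sum) simp
    ultimately show ?thesis using zero_le_power2[of et] by (smt (verit))
   qed
   ultimately have "(1 + et\<^sup>2)\<^sup>2 <= (norm (Complex 1 (- 2 * Im z)))\<^sup>2" by (simp only:)
   then have "1 + et\<^sup>2 <= norm (Complex 1 (- 2 * Im z))" by (rule power2_le_imp_le) (rule norm_ge_zero)
   then show ?thesis using a by linarith
  next
   case 2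
   have "\<bar>Re z\<bar> = et" "\<bar>Re (1 - z)\<bar> = 1 + et" using 2 et by auto
   then have "et <= norm z" "1 + et <= norm (1 - z)" by (metis abs_Re_le_cmod)+
   then show ?thesis using et2 et unfolding ell_def by linarith
  next
   case 3
   have "\<bar>Re z\<bar> = 1 + et" "\<bar>Re (1 - z)\<bar> = et" using 3 et by auto
   then have "1 + et <= norm z" "et <= norm (1 - z)" by (metis abs_Re_le_cmod)+
   then show ?thesis using et2 et unfolding ell_def by linarith
  qed
 qed
 have Tlarge: "2 ^ k <= norm (poly T z)" if "z \<in> path_image \<gamma>" for z
 proof -
  have "4 ^ m * et\<^sup>2 <= 4 ^ m * (ell z - 1)" using pell[OF that] by (intro mult_left_mono) auto
  then have "2 <= norm (poly (logit_poly m) z)" using m by (intro logit_poly_large) linarith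
  then have "2 ^ k <= norm (poly (logit_poly m) z) ^ k" by (intro power_mono) auto
  then show ?thesis by (simp add: T_def norm_power)
 qed
 have Tnz: "poly T z \<noteq> 0" if "z \<in> path_image \<gamma>" for z
 proof
  assume "poly T z = 0"
  then have "(2::real) ^ k <= 0" using Tlarge[OF that] by simp
  moreover have "(0::real) < 2 ^ k" by simp
  ultimately show False by linarith
 qed
 have Tsmall: "norm (poly T (of_real t)) <= 1" if t: "0 <= t" "t <= 1" for t
 proof -
  obtain r where "0 <= r" "r <= 1" "poly (logit_poly m) (of_real t) = of_real r" using logit_poly_unit[OF t] by blast
  then show ?thesis by (simp add: T_def norm_power power_le_one)
 qed
 define S1 where "S1 = S \<inter> {z. poly T z \<noteq> 0}"
 have S1: "open S1" unfolding S1_def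
  by (intro open_Int S open_Collect_neq continuous_intros)
 have pS1: "path_image \<gamma> \<subseteq> S1" using pR S(3) Tnz unfolding S1_def by blast
 have vp: "valid_path \<gamma>" by (simp add: \<gamma>_def)
 define q where "q j z = (\<Sum>i=Suc j..d. coeff T i * z ^ (i - 1 - j))" for j z
 have ci: "(%z. g z / poly T z * q j z) contour_integrable_on \<gamma>" for j
  by (rule contour_integrable_holomorphic_simple[OF _ S1 vp pS1])
   (auto simp: S1_def q_def intro!: holomorphic_intros holomorphic_on_subset[OF S(2)])
 \<comment> \<open>The degree of T may be smaller than \<open>2^m * k\<close>; the missing
   coefficients are set to 0.\<close>
 define a where "a j = (if j < d then contour_integral \<gamma> (%z. g z / poly T z * q j z) / (2 * pi * \<i>) else 0)" for j
 have "norm (g (of_real t) - (\<Sum>j<2^m*k. a j * of_real t ^ j)) <= 10 * B / et * (1/2) ^ k" if t: "0 <= t" "t <= 1" for t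
 proof -
  define x where "x = complex_of_real t"
  have xin: "x \<in> box c1 c3" using t et by (auto simp: x_def in_box_complex_iff c1_def c3_def)
  have zx: "z \<noteq> x" if "z \<in> path_image \<gamma>" for z using pdist[OF that t] et by (auto simp: x_def)
  have sub: "cbox c1 c3 \<subseteq> S"
   using S(3) by (auto simp: in_cbox_complex_iff c1_def c3_def abs_le_iff)
  have "((%w. g w / (w - x)) has_contour_integral (2 * pi * \<i> * winding_number \<gamma> x * g x)) \<gamma>"
  proof (rule Cauchy_integral_formula_convex_simple[of "cbox c1 c3"])
   show "g holomorphic_on cbox c1 c3" by (rule holomorphic_on_subset[OF S(2) sub])
   show "x \<in> interior (cbox c1 c3)" using xin by (simp add: interior_cbox)
   show "path_image \<gamma> \<subseteq> cbox c1 c3 - {x}"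
    using path_image_rectpath_subset_cbox[OF le] zx unfolding \<gamma>_def by blast
  qed (auto simp: \<gamma>_def)
  then have C: "((%w. g w / (w - x)) has_contour_integral (2 * pi * \<i> * g x)) \<gamma>"
   using winding_number_rectpath[OF xin] by (simp add: \<gamma>_def)
  have "((%z. \<Sum>j<d. (g z / poly T z * q j z) * x ^ j) has_contour_integral (\<Sum>j<d. contour_integral \<gamma> (%z. g z / poly T z * q j z) * x ^ j)) \<gamma>"
   by (intro has_contour_integral_sum has_contour_integral_rmul has_contour_integral_integral ci) auto
  also have "(\<Sum>j<d. contour_integral \<gamma> (%z. g z / poly T z * q j z) * x ^ j) = 2 * pi * \<i> * (\<Sum>j<2^m*k. a j * x ^ j)"
  proof -
   have e: "(\<Sum>j<2^m*k. a j * x ^ j) = (\<Sum>j<d. a j * x ^ j)"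
    using d by (intro sum.mono_neutral_right) (auto simp: a_def)
   show ?thesis unfolding e sum_distrib_left by (intro sum.cong refl) (simp add: a_def)
  qed
  finally have P: "((%z. \<Sum>j<d. (g z / poly T z * q j z) * x ^ j) has_contour_integral 2 * pi * \<i> * (\<Sum>j<2^m*k. a j * x ^ j)) \<gamma>" .
  define E where "E = 2 * pi * \<i> * (g x - (\<Sum>j<2^m*k. a j * x ^ j))"
  have "((%z. g z / (z - x) - (\<Sum>j<d. (g z / poly T z * q j z) * x ^ j)) has_contour_integral E) \<gamma>"
   unfolding E_def right_diff_distrib by (rule has_contour_integral_diff[OF C P])
  then have "((%z. g z * (poly T x / poly T z) / (z - x)) has_contour_integral E) \<gamma>"
  proof (rule has_contour_integral_eq)
   fix z assume z: "z \<in> path_image \<gamma>"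
   have "(\<Sum>j<d. (g z / poly T z * q j z) * x ^ j) = g z / poly T z * (\<Sum>j<d. q j z * x ^ j)"
    by (simp add: sum_distrib_left mult_ac)
   also have "(\<Sum>j<d. q j z * x ^ j) = (poly T z - poly T x) / (z - x)"
    using poly_diff_quotient[of T z x] zx[OF z] unfolding q_def d_def by simp
   finally have sm: "(\<Sum>j<d. (g z / poly T z * q j z) * x ^ j) = g z / poly T z * ((poly T z - poly T x) / (z - x))" .
   show "g z / (z - x) - (\<Sum>j<d. (g z / poly T z * q j z) * x ^ j) = g z * (poly T x / poly T z) / (z - x)"
   proof -
    have "g z / poly T z * (poly T z - poly T x) = g z - g z * (poly T x / poly T z)"
     using Tnz[OF z] by (simp add: right_diff_distrib)
    then have "g z / poly T z * ((poly T z - poly T x) / (z - x)) = (g z - g z * (poly T x / poly T z)) / (z - x)"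
     by (metis times_divide_eq_right)
    then show ?thesis unfolding sm by (simp add: diff_divide_distrib)
   qed
  qed
  moreover define F where "F z = g z * (poly T x / poly T z) / (z - x)" for z
  ultimately have FE: "(F has_contour_integral E) \<gamma>" by (simp add: F_def[abs_def])
  define \<beta> where "\<beta> = B * (1/2) ^ k / et"
  have \<beta>0: "\<beta> \<ge> 0" using B0 et by (simp add: \<beta>_def)
  have F\<beta>: "norm (F z) <= \<beta>" if z: "z \<in> path_image \<gamma>" for z
  proof -
   have "norm (F z) = norm (g z) * (norm (poly T x) / norm (poly T z)) / norm (z - x)"
    by (simp add: F_def norm_mult norm_divide)
   also have "... <= B * (1 / 2 ^ k) / et"
    using B0 et by (intro frac_le mult_mono B pR[OF z] Tsmall Tlarge[OF z] mult_nonneg_nonneg pdist[OF z] t, simp_all add: x_def Tsmall t pdist[OF z])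
   finally show ?thesis by (simp add: \<beta>_def power_one_over)
  qed
  define c2 c4 where "c2 = Complex (1 + et) (- et)" and "c4 = Complex (- et) et"
  have \<gamma>_eq: "\<gamma> = linepath c1 c2 +++ linepath c2 c3 +++ linepath c3 c4 +++ linepath c4 c1"
   by (simp add: \<gamma>_def rectpath_def Let_def c1_def c2_def c3_def c4_def)
  have Fi: "F contour_integrable_on \<gamma>" using FE by (rule has_contour_integral_integrable)
  have i4: "F contour_integrable_on linepath c1 c2" "F contour_integrable_on linepath c2 c3" "F contour_integrable_on linepath c3 c4" "F contour_integrable_on linepath c4 c1"
   using Fi unfolding \<gamma>_eq by auto
  have "E = contour_integral \<gamma> F" using FE contour_integral_unique by blast
  also have "... = contour_integral (linepath c1 c2) F + (contour_integral (linepath c2 c3) F + (contour_integral (linepath c3 c4) F + contour_integral (linepath c4 c1) F))"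
   unfolding \<gamma>_eq using i4 by simp
  finally have Esum: "E = ..." .
  have seg: "closed_segment c1 c2 \<union> closed_segment c2 c3 \<union> closed_segment c3 c4 \<union> closed_segment c4 c1 \<subseteq> path_image \<gamma>"
   unfolding \<gamma>_eq by (auto simp: path_image_join)
  have nn: "norm (c2 - c1) = 1 + 2 * et" "norm (c3 - c2) = 2 * et" "norm (c4 - c3) = 1 + 2 * et" "norm (c1 - c4) = 2 * et"
   using et by (simp_all add: c1_def c2_def c3_def c4_def cmod_def real_sqrt_mult)
  have b4: "norm (contour_integral (linepath c1 c2) F) <= \<beta> * (1 + 2 * et)" "norm (contour_integral (linepath c2 c3) F) <= \<beta> * (2 * et)"
   "norm (contour_integral (linepath c3 c4) F) <= \<beta> * (1 + 2 * et)" "norm (contour_integral (linepath c4 c1) F) <= \<beta> * (2 * et)"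
  proof -
   have lp: "norm (contour_integral (linepath p p') F) <= \<beta> * norm (p' - p)"
    if "F contour_integrable_on linepath p p'" "closed_segment p p' \<subseteq> path_image \<gamma>" for p p'
    using that \<beta>0 by (intro contour_integral_bound_linepath F\<beta>) auto
   show "norm (contour_integral (linepath c1 c2) F) <= \<beta> * (1 + 2 * et)" using lp[OF i4(1)] seg unfolding nn by blast
   show "norm (contour_integral (linepath c2 c3) F) <= \<beta> * (2 * et)" using lp[OF i4(2)] seg unfolding nn by blast
   show "norm (contour_integral (linepath c3 c4) F) <= \<beta> * (1 + 2 * et)" using lp[OF i4(3)] seg unfolding nn by blast
   show "norm (contour_integral (linepath c4 c1) F) <= \<beta> * (2 * et)" using lp[OF i4(4)] seg unfolding nn by blast
  qed
  have "norm E <= \<beta> * (1 + 2 * et) + (\<beta> * (2 * et) + (\<beta> * (1 + 2 * et) + \<beta> * (2 * et)))"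
   unfolding Esum by (intro order_trans[OF norm_triangle_ineq] add_mono b4)
  also have "... = \<beta> * (2 + 8 * et)" by (simp add: algebra_simps)
  also have "... <= \<beta> * 10" using et \<beta>0 by (intro mult_left_mono) auto
  finally have E10: "norm E <= 10 * \<beta>" by simp
  have "norm E = 2 * pi * norm (g x - (\<Sum>j<2^m*k. a j * x ^ j))" unfolding E_def by (simp add: norm_mult)
  moreover have "1 * norm (g x - (\<Sum>j<2^m*k. a j * x ^ j)) <= 2 * pi * norm (g x - (\<Sum>j<2^m*k. a j * x ^ j))"
   using pi_gt3 by (intro mult_right_mono) auto
  ultimately have "norm (g x - (\<Sum>j<2^m*k. a j * x ^ j)) <= 10 * \<beta>" using E10 by linarith
  then show ?thesis by (simp add: \<beta>_def x_def)
 qed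
 then show ?thesis by (intro exI[of _ a]) auto
qed

lemma real_poly_approx:
 assumes et: "0 < et" "et <= 1" and m: "4 <= 4 ^ m * et\<^sup>2"
  and S: "open S" "g holomorphic_on S" "{z. - et <= Re z \<and> Re z <= 1 + et \<and> \<bar>Im z\<bar> <= et} \<subseteq> S"
  and B: "!!z. - et <= Re z ==> Re z <= 1 + et ==> \<bar>Im z\<bar> <= et ==> norm (g z) <= B"
  and gr: "!!t. 0 <= t ==> t <= 1 ==> g (of_real t) = of_real (gr t)"
 shows "\<exists>p :: real poly. degree p <= n \<and> (\<forall>t\<in>{0..1}. \<bar>gr t - poly p t\<bar> <= 10 * B / et * (1/2) ^ (n div 2^m))"
proof -
 obtain a :: "nat => complex" where a: "!!t. t\<in>{0..1} ==> norm (g (of_real t) - (\<Sum>j<2^m*(n div 2^m). a j * of_real t ^ j)) <= 10 * B / et * (1/2) ^ (n div 2^m)"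
  using rect_approx[OF et m S B] by blast
 define N where "N = 2^m*(n div 2^m)"
 define p where "p = (\<Sum>j<N. monom (Re (a j)) j)"
 have Nn: "N <= n" unfolding N_def by (simp add: mult.commute div_times_less_eq_dividend)
 have "degree p <= n" unfolding p_def
  by (rule degree_sum_le) (use Nn in \<open>auto intro!: order_trans[OF degree_monom_le]\<close>)
 moreover have "\<bar>gr t - poly p t\<bar> <= 10 * B / et * (1/2) ^ (n div 2^m)" if t: "t \<in> {0..1}" for t
 proof -
  have "gr t - poly p t = Re (g (of_real t) - (\<Sum>j<N. a j * of_real t ^ j))"
   using gr[of t] t by (simp add: p_def poly_sum poly_monom flip: of_real_power)
  also have "\<bar>...\<bar> <= norm (g (of_real t) - (\<Sum>j<N. a j * of_real t ^ j))" by (rule abs_Re_le_cmod)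
  also have "... <= 10 * B / et * (1/2) ^ (n div 2^m)" using a[OF t] unfolding N_def .
  finally show ?thesis .
 qed
 ultimately show ?thesis by blast
qed

section \<open>Chebyshev interpolation with stability bounds\<close>

text \<open>Chebyshev polynomials transplanted to the unit interval by x = (1 - cos phi) / 2, so
  that \<open>cheb 1\<close> is 1 - 2 x = cos phi.\<close>

fun cheb :: "nat => real poly" where
 "cheb 0 = 1"
| "cheb (Suc 0) = [:1, -2:]"
| "cheb (Suc (Suc k)) = smult 2 ([:1, -2:] * cheb (Suc k)) - cheb k"

lemma poly_cheb: "poly (cheb k) ((1 - cos \<phi>) / 2) = cos (real k * \<phi>)"
proof (induction k rule: cheb.induct)
 case (3 k)
 have "cos (real (Suc (Suc k)) * \<phi>) = 2 * (cos \<phi> * cos (real (Suc k) * \<phi>)) - cos (real k * \<phi>)"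
  using cos_times_cos[of "real (Suc k) * \<phi>" \<phi>] by (simp add: algebra_simps)
 moreover have "poly (cheb (Suc (Suc k))) ((1 - cos \<phi>) / 2) = 2 * ((1 - 2 * ((1 - cos \<phi>) / 2)) * poly (cheb (Suc k)) ((1 - cos \<phi>) / 2)) - poly (cheb k) ((1 - cos \<phi>) / 2)"
  by (simp add: algebra_simps)
 moreover have "1 - 2 * ((1 - cos \<phi>) / 2) = cos \<phi>" by (simp add: field_simps)
 ultimately show ?case using 3 by (simp only:)
qed (auto simp: diff_divide_distrib)

lemma degree_cheb: "degree (cheb k) <= k"
proof (induction k rule: cheb.induct)
 case (3 k)
 have "degree ([:1, -2:] * cheb (Suc k)) <= Suc (Suc k)"
  using degree_mult_le[of "[:1, -2::real:]" "cheb (Suc k)"] 3 by simp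
 then have "degree (smult 2 ([:1, -2:] * cheb (Suc k))) <= Suc (Suc k)"
  using degree_smult_le order_trans by blast
 then show ?case using 3 by (simp add: degree_diff_le)
qed auto

lemma unit_as_cos:
 assumes "0 <= x" "x <= 1"
 shows "(1 - cos (arccos (1 - 2 * x))) / 2 = x"
 using assms by (subst cos_arccos) auto

lemma cheb_bound: assumes "0 <= x" "x <= 1" shows "\<bar>poly (cheb k) x\<bar> <= 1"
 using poly_cheb[of k "arccos (1 - 2 * x)"] unfolding unit_as_cos[OF assms] by simp

lemma abs_sin_mult: "\<bar>sin (real k * x)\<bar> <= real k * \<bar>sin x\<bar>"
proof (induction k)
 case (Suc k)
 have e: "sin (real (Suc k) * x) = sin (real k * x) * cos x + cos (real k * x) * sin x"
  by (simp add: algebra_simps sin_add)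
 have "\<bar>sin (real (Suc k) * x)\<bar> <= \<bar>sin (real k * x)\<bar> * \<bar>cos x\<bar> + \<bar>cos (real k * x)\<bar> * \<bar>sin x\<bar>"
  unfolding e abs_mult[symmetric] by (rule abs_triangle_ineq)
 also have "... <= \<bar>sin (real k * x)\<bar> * 1 + 1 * \<bar>sin x\<bar>"
  by (intro add_mono mult_left_mono mult_right_mono) auto
 also have "... <= real (Suc k) * \<bar>sin x\<bar>" using Suc by (simp add: algebra_simps)
 finally show ?case .
qed simp

text \<open>The product formula for a difference of cosines and |sin (k x)| <= k |sin x| give a
  quadratic Lipschitz bound directly, without Markov's inequality for derivatives.\<close>

lemma cheb_Lipschitz:
 assumes "0 <= x" "x <= 1" "0 <= y" "y <= 1"
 shows "\<bar>poly (cheb k) x - poly (cheb k) y\<bar> <= 2 * (real k)\<^sup>2 * \<bar>x - y\<bar>"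
proof -
 define a b where "a = arccos (1 - 2 * x)" and "b = arccos (1 - 2 * y)"
 have x: "x = (1 - cos a) / 2" and y: "y = (1 - cos b) / 2" using unit_as_cos assms by (simp_all add: a_def b_def)
 have "poly (cheb k) x - poly (cheb k) y = cos (real k * a) - cos (real k * b)" unfolding x y poly_cheb ..
 also have "... = 2 * (sin (real k * ((a + b) / 2)) * sin (real k * ((b - a) / 2)))"
  unfolding cos_diff_cos by (simp add: algebra_simps add_divide_distrib diff_divide_distrib)
 also have "\<bar>...\<bar> = 2 * (\<bar>sin (real k * ((a + b) / 2))\<bar> * \<bar>sin (real k * ((b - a) / 2))\<bar>)" by (simp add: abs_mult)
 also have "... <= 2 * ((real k * \<bar>sin ((a + b) / 2)\<bar>) * (real k * \<bar>sin ((b - a) / 2)\<bar>))"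
  by (intro mult_left_mono mult_mono abs_sin_mult) auto
 also have "... = (real k)\<^sup>2 * \<bar>2 * (sin ((a + b) / 2) * sin ((b - a) / 2))\<bar>" by (simp add: abs_mult power2_eq_square)
 also have "2 * (sin ((a + b) / 2) * sin ((b - a) / 2)) = cos a - cos b" unfolding cos_diff_cos by simp
 also have "\<bar>cos a - cos b\<bar> = 2 * \<bar>x - y\<bar>" unfolding x y by (simp add: diff_divide_distrib[symmetric] abs_minus_commute)
 finally show ?thesis by (simp add: mult_ac)
qed

text \<open>Weights of the Dirichlet kernel 1 + 2 cos g + 2 cos 2g + ..., which make the discrete
  cosine transform orthogonal.\<close>

definition chw :: "nat => real" where
 "chw k = (if k = 0 then 1 else 2)"

lemma dirichlet_sum: "sin (g / 2) * (\<Sum>k\<le>n. chw k * cos (real k * g)) = sin ((real n + 1/2) * g)"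
proof (induction n)
 case (Suc n)
 have "sin (g / 2) * (2 * cos (real (Suc n) * g)) = sin ((real (Suc n) + 1/2) * g) - sin ((real n + 1/2) * g)"
 proof -
  have "sin ((real (Suc n) + 1/2) * g) = sin (real (Suc n) * g + g/2)" "sin ((real n + 1/2) * g) = sin (real (Suc n) * g - g/2)"
   by (simp_all add: algebra_simps)
  then show ?thesis by (simp add: sin_add sin_diff)
 qed
 then show ?case using Suc by (simp add: distrib_left chw_def)
qed (simp add: chw_def)

lemma dirichlet_at_node:
 assumes m: "m \<in> \<int>" and nz: "sin (m * pi / (2 * (real n + 1))) \<noteq> 0"
 shows "(\<Sum>k\<le>n. chw k * cos (real k * (m * pi / (real n + 1)))) = - cos (m * pi)"
proof -
 define g where "g = m * pi / (real n + 1)"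
 have g2: "g / 2 = m * pi / (2 * (real n + 1))" by (simp add: g_def)
 have "(real n + 1/2) * g = m * pi - g / 2" by (simp add: g_def field_simps)
 then have "sin ((real n + 1/2) * g) = sin (m * pi) * cos (g/2) - cos (m * pi) * sin (g/2)" by (simp add: sin_diff)
 also have "sin (m * pi) = 0" using m by (auto simp: Ints_def sin_zero_iff_int2)
 finally have "sin (g/2) * (\<Sum>k\<le>n. chw k * cos (real k * g)) = sin (g/2) * (- cos (m * pi))"
  unfolding dirichlet_sum by simp
 then show ?thesis using nz unfolding g2[symmetric] g_def[symmetric] mult_cancel_left by blast
qed

text \<open>Angles of the zeros of \<open>cheb (n + 1)\<close>.\<close>

definition chphi :: "nat => nat => real" where
 "chphi n j = (2 * real j + 1) * pi / (2 * (real n + 1))"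

text \<open>Orthogonality over the degree k for two nodes. The product of cosines splits into two
  Dirichlet sums with the integers i - j and i + j + 1; these have opposite parity, so off the
  diagonal the two values cancel.\<close>

lemma cheb_orthogonal:
 assumes i: "i <= n" and j: "j <= n"
 shows "(\<Sum>k\<le>n. chw k * (cos (real k * chphi n i) * cos (real k * chphi n j))) = (if i = j then real n + 1 else 0)"
proof -
 define N where "N = real n + 1"
 have N: "N > 0" by (simp add: N_def)
 define a b where "a = real i - real j" and "b = real i + real j + 1"
 have am: "chphi n i - chphi n j = a * pi / N" and bm: "chphi n i + chphi n j = b * pi / N"
  unfolding chphi_def N_def[symmetric] a_def b_def using N by (simp_all add: field_simps)
 have "(\<Sum>k\<le>n. chw k * (cos (real k * chphi n i) * cos (real k * chphi n j)))
   = ((\<Sum>k\<le>n. chw k * cos (real k * (a * pi / N))) + (\<Sum>k\<le>n. chw k * cos (real k * (b * pi / N)))) / 2"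
  unfolding am[symmetric] bm[symmetric] cos_times_cos sum.distrib[symmetric] sum_divide_distrib
  by (intro sum.cong refl) (simp add: algebra_simps)
 also have "(\<Sum>k\<le>n. chw k * cos (real k * (b * pi / N))) = - cos (b * pi)"
  unfolding N_def
 proof (rule dirichlet_at_node)
  show "b \<in> \<int>" by (simp add: b_def)
  have "b < 2 * N" "b > 0" using i j by (simp_all add: b_def N_def)
  then have "b * pi / (2 * N) < pi" "0 < b * pi / (2 * N)" using N by (simp_all add: divide_less_eq mult.commute)
  then show "sin (b * pi / (2 * (real n + 1))) \<noteq> 0" unfolding N_def[symmetric] using sin_gt_zero by (metis less_irrefl)
 qed
 also have "cos (b * pi) = - cos (a * pi)"
 proof -
  have "b * pi = (a * pi + pi) + 2 * real j * pi" by (simp add: a_def b_def algebra_simps)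
  then have "cos (b * pi) = cos (a * pi + pi)" by (simp only: cos_add[of "a * pi + pi"] cos_2npi sin_2npi mult_zero_right mult_1_right diff_zero)
  then show ?thesis by simp
 qed
 finally have e: "(\<Sum>k\<le>n. chw k * (cos (real k * chphi n i) * cos (real k * chphi n j)))
   = ((\<Sum>k\<le>n. chw k * cos (real k * (a * pi / N))) + cos (a * pi)) / 2" by simp
 show ?thesis
 proof (cases "i = j")
  case True
  then have "a = 0" by (simp add: a_def)
  moreover have "(\<Sum>k\<le>n. chw k) = 2 * real n + 1" by (induction n) (auto simp: chw_def)
  ultimately show ?thesis unfolding e using True by simp
 next
  case False
  have "(\<Sum>k\<le>n. chw k * cos (real k * (a * pi / N))) = - cos (a * pi)"
   unfolding N_def
  proof (rule dirichlet_at_node)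
   show "a \<in> \<int>" by (simp add: a_def)
   have "\<bar>a\<bar> < 2 * N" "a \<noteq> 0" using i j False by (auto simp: a_def N_def)
   then have "\<bar>a\<bar> * pi / (2 * N) < pi" "0 < \<bar>a\<bar> * pi / (2 * N)" using N by (simp_all add: divide_less_eq mult.commute)
   then have "sin (\<bar>a\<bar> * pi / (2 * N)) > 0" by (intro sin_gt_zero)
   then show "sin (a * pi / (2 * (real n + 1))) \<noteq> 0" unfolding N_def[symmetric] by (cases "a \<ge> 0") auto
  qed
  then show ?thesis unfolding e using False by simp
 qed
qed

definition chnode :: "nat => nat => real" where
 "chnode n j = (1 - cos (chphi n j)) / 2"

lemma chnode_in: "0 <= chnode n j" "chnode n j <= 1"
 using cos_le_one[of "chphi n j"] cos_ge_minus_one[of "chphi n j"] unfolding chnode_def by simp_all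

lemma chnode_inj: "inj_on (chnode n) {..n}"
proof (rule inj_onI)
 fix i j assume ij: "i \<in> {..n}" "j \<in> {..n}" "chnode n i = chnode n j"
 have b: "0 <= chphi n k" "chphi n k <= pi" if "k <= n" for k
  using that by (auto simp: chphi_def divide_le_eq)
 have "cos (chphi n i) = cos (chphi n j)" using ij(3) by (simp add: chnode_def)
 then have "chphi n i = chphi n j" using cos_inj_pi[OF b(1)[of i] b(2)[of i] b(1)[of j] b(2)[of j]] ij(1,2) by simp
 then show "i = j" by (simp add: chphi_def)
qed

text \<open>The Lagrange basis at the Chebyshev nodes, given by its Chebyshev coefficients instead
  of the product formula: the sup bound 2 and the Lipschitz bound 4 n^2 then follow term by
  term.\<close>

definition chL :: "nat => nat => real poly" where
 "chL n j = (\<Sum>k\<le>n. smult (chw k * cos (real k * chphi n j) / (real n + 1)) (cheb k))"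

lemma poly_chL: "poly (chL n j) x = (\<Sum>k\<le>n. chw k * cos (real k * chphi n j) / (real n + 1) * poly (cheb k) x)"
 by (simp add: chL_def poly_sum)

lemma degree_chL: "degree (chL n j) <= n"
 unfolding chL_def
 by (rule degree_sum_le) (auto intro!: order_trans[OF degree_smult_le] order_trans[OF degree_cheb])

lemma chL_node: assumes "i <= n" "j <= n" shows "poly (chL n j) (chnode n i) = (if i = j then 1 else 0)"
proof -
 have "poly (chL n j) (chnode n i) = (\<Sum>k\<le>n. chw k * (cos (real k * chphi n i) * cos (real k * chphi n j))) / (real n + 1)"
  unfolding poly_chL chnode_def poly_cheb sum_divide_distrib by (intro sum.cong refl) (simp add: mult_ac)
 then show ?thesis unfolding cheb_orthogonal[OF assms] by simp
qed

lemma chL_bound: assumes "0 <= x" "x <= 1" shows "\<bar>poly (chL n j) x\<bar> <= 2"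
proof -
 have "\<bar>poly (chL n j) x\<bar> <= (\<Sum>k\<le>n. \<bar>chw k * cos (real k * chphi n j) / (real n + 1) * poly (cheb k) x\<bar>)"
  unfolding poly_chL by (rule sum_abs)
 also have "... <= (\<Sum>k\<le>n. 2 * 1 / (real n + 1) * 1)"
  unfolding abs_mult abs_divide
  by (intro sum_mono mult_mono frac_le cheb_bound assms) (auto simp: chw_def)
 also have "... = 2" by (simp add: divide_simps)
 finally show ?thesis .
qed

lemma chL_Lipschitz:
 assumes "0 <= x" "x <= 1" "0 <= y" "y <= 1"
 shows "\<bar>poly (chL n j) x - poly (chL n j) y\<bar> <= 4 * (real n)\<^sup>2 * \<bar>x - y\<bar>"
proof -
 have e: "poly (chL n j) x - poly (chL n j) y = (\<Sum>k\<le>n. chw k * cos (real k * chphi n j) / (real n + 1) * (poly (cheb k) x - poly (cheb k) y))"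
  unfolding poly_chL by (simp add: sum_subtractf right_diff_distrib)
 have "\<bar>poly (chL n j) x - poly (chL n j) y\<bar> <= (\<Sum>k\<le>n. \<bar>chw k * cos (real k * chphi n j) / (real n + 1) * (poly (cheb k) x - poly (cheb k) y)\<bar>)"
  unfolding e by (rule sum_abs)
 also have "... <= (\<Sum>k\<le>n. 2 * 1 / (real n + 1) * (2 * (real n)\<^sup>2 * \<bar>x - y\<bar>))"
  unfolding abs_mult abs_divide
 proof (intro sum_mono mult_mono frac_le)
  fix k assume "k \<in> {..n}"
  then have "2 * (real k)\<^sup>2 * \<bar>x - y\<bar> <= 2 * (real n)\<^sup>2 * \<bar>x - y\<bar>" by (intro mult_right_mono mult_left_mono power_mono) auto
  then show "\<bar>poly (cheb k) x - poly (cheb k) y\<bar> <= 2 * (real n)\<^sup>2 * \<bar>x - y\<bar>" using cheb_Lipschitz[OF assms, of k] by linarith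
 qed (auto simp: chw_def)
 also have "... = 4 * (real n)\<^sup>2 * \<bar>x - y\<bar>" by (simp add: divide_simps)
 finally show ?thesis .
qed

lemma chL_reproduces:
 assumes "degree p <= n"
 shows "(\<Sum>j\<le>n. poly p (chnode n j) * poly (chL n j) x) = poly p x"
proof -
 define q where "q = (\<Sum>j\<le>n. smult (poly p (chnode n j)) (chL n j)) - p"
 have dq: "degree q <= n"
  unfolding q_def by (intro degree_diff_le degree_sum_le assms) (auto intro!: order_trans[OF degree_smult_le] degree_chL)
 have q0: "poly q (chnode n i) = 0" if "i <= n" for i
 proof -
  have "(\<Sum>j\<le>n. poly p (chnode n j) * poly (chL n j) (chnode n i)) = (\<Sum>j\<le>n. if i = j then poly p (chnode n j) else 0)"
   using that by (intro sum.cong refl) (simp add: chL_node)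
  also have "... = poly p (chnode n i)" using that by simp
  finally show ?thesis by (simp add: q_def poly_sum)
 qed
 have "q = 0"
 proof (rule ccontr)
  assume "q \<noteq> 0"
  then have "card {x. poly q x = 0} <= degree q" by (rule card_poly_roots_bound)
  moreover have "chnode n ` {..n} \<subseteq> {x. poly q x = 0}" using q0 by auto
  then have "card (chnode n ` {..n}) <= card {x. poly q x = 0}"
   using poly_roots_finite[OF \<open>q \<noteq> 0\<close>] by (intro card_mono) auto
  moreover have "card (chnode n ` {..n}) = n + 1" by (simp add: card_image[OF chnode_inj])
  ultimately show False using dq by linarith
 qed
 then have "poly q x = 0" by simp
 then show ?thesis by (simp add: q_def poly_sum)
qed

text \<open>Chebyshev interpolation corrected linearly so as to be exact at both end points; the last two nodes are \<open>0\<close> and \<open>1\<close>.\<close>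

definition pnode :: "nat => nat => real" where
 "pnode n j = (if j <= n then chnode n j else if j = n + 1 then 0 else 1)"

definition pbase :: "nat => nat => real poly" where
 "pbase n j = (if j <= n then chL n j - smult (poly (chL n j) 0) [:1, -1:] - smult (poly (chL n j) 1) [:0, 1:]
   else if j = n + 1 then [:1, -1:] else [:0, 1:])"

definition proj :: "nat => (real => real) => real => real" where
 "proj n g x = (\<Sum>j\<le>n + 2. g (pnode n j) * poly (pbase n j) x)"

lemma pnode_in: "0 <= pnode n j" "pnode n j <= 1"
 using chnode_in[of n j] by (auto simp: pnode_def)

lemma degree_pbase:
 assumes "1 <= n" shows "degree (pbase n j) <= n"
proof -
 have l: "degree (smult a [:b, c::real:]) <= n" for a b c
  using assms by (intro order_trans[OF degree_smult_le]) auto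
 show ?thesis unfolding pbase_def using assms degree_chL[of n j] l by (auto intro!: degree_diff_le)
qed

lemma pbase_bound: assumes "0 <= x" "x <= 1" shows "\<bar>poly (pbase n j) x\<bar> <= 4"
proof (cases "j <= n")
 case True
 have "\<bar>poly (chL n j) 0 * (1 - x)\<bar> <= 2 * (1 - x)" "\<bar>poly (chL n j) 1 * x\<bar> <= 2 * x"
  unfolding abs_mult using chL_bound[of 0 n j] chL_bound[of 1 n j] assms by (intro mult_mono; simp)+
 moreover have "poly (pbase n j) x = poly (chL n j) x - poly (chL n j) 0 * (1 - x) - poly (chL n j) 1 * x"
  using True by (simp add: pbase_def algebra_simps)
 ultimately show ?thesis using chL_bound[OF assms, of n j] by (simp add: abs_if split: if_splits)
qed (use assms in \<open>auto simp: pbase_def\<close>)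

lemma pbase_Lipschitz:
 assumes "0 <= x" "x <= 1" "0 <= y" "y <= 1"
 shows "\<bar>poly (pbase n j) x - poly (pbase n j) y\<bar> <= (4 * (real n)\<^sup>2 + 4) * \<bar>x - y\<bar>"
proof (cases "j <= n")
 case True
 have "poly (pbase n j) x - poly (pbase n j) y = (poly (chL n j) x - poly (chL n j) y) + (poly (chL n j) 0 - poly (chL n j) 1) * (x - y)"
  using True by (simp add: pbase_def algebra_simps)
 also have "\<bar>...\<bar> <= \<bar>poly (chL n j) x - poly (chL n j) y\<bar> + \<bar>poly (chL n j) 0 - poly (chL n j) 1\<bar> * \<bar>x - y\<bar>"
  unfolding abs_mult[symmetric] by (rule abs_triangle_ineq)
 also have "... <= 4 * (real n)\<^sup>2 * \<bar>x - y\<bar> + 4 * \<bar>x - y\<bar>"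
  using chL_bound[of 0 n j] chL_bound[of 1 n j] by (intro add_mono chL_Lipschitz assms mult_right_mono) auto
 finally show ?thesis by (simp add: distrib_right)
next
 case False
 have "1 * \<bar>x - y\<bar> <= (4 * (real n)\<^sup>2 + 4) * \<bar>x - y\<bar>" by (intro mult_right_mono) auto
 then show ?thesis using False by (auto simp: pbase_def abs_minus_commute)
qed

lemma proj_alt: "proj n g x = (\<Sum>j\<le>n. g (chnode n j) * poly (chL n j) x)
  + (g 0 - (\<Sum>j\<le>n. g (chnode n j) * poly (chL n j) 0)) * (1 - x) + (g 1 - (\<Sum>j\<le>n. g (chnode n j) * poly (chL n j) 1)) * x"
proof -
 have "(\<Sum>j\<le>n. g (pnode n j) * poly (pbase n j) x) = (\<Sum>j\<le>n. g (chnode n j) * poly (chL n j) x - g (chnode n j) * poly (chL n j) 0 * (1 - x) - g (chnode n j) * poly (chL n j) 1 * x)"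
  by (intro sum.cong refl) (simp add: pnode_def pbase_def algebra_simps)
 also have "... = (\<Sum>j\<le>n. g (chnode n j) * poly (chL n j) x) - (\<Sum>j\<le>n. g (chnode n j) * poly (chL n j) 0) * (1 - x) - (\<Sum>j\<le>n. g (chnode n j) * poly (chL n j) 1) * x"
  by (simp only: sum_subtractf sum_distrib_right)
 finally have e: "(\<Sum>j\<le>n. g (pnode n j) * poly (pbase n j) x) = ..." .
 have "proj n g x = (\<Sum>j\<le>n. g (pnode n j) * poly (pbase n j) x) + g 0 * (1 - x) + g 1 * x"
  by (simp add: proj_def pnode_def pbase_def)
 then show ?thesis unfolding e by (simp only: left_diff_distrib)
qed

lemma proj_ends: "proj n g 0 = g 0" "proj n g 1 = g 1"
 by (simp_all add: proj_alt)

lemma proj_reproduces: assumes "degree p <= n" shows "proj n (poly p) x = poly p x"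
 unfolding proj_alt chL_reproduces[OF assms] by simp

text \<open>A Lebesgue constant growing linearly in n, from a crude bound of each basis polynomial;
  polynomial growth is harmless against exponential convergence.\<close>

lemma proj_bound:
 assumes x: "0 <= x" "x <= 1" and g: "!!t. 0 <= t ==> t <= 1 ==> \<bar>g t\<bar> <= B"
 shows "\<bar>proj n g x\<bar> <= 4 * (real n + 3) * B"
proof -
 have B: "0 <= B" using order_trans[OF abs_ge_zero g[of 0]] by simp
 have "\<bar>proj n g x\<bar> <= (\<Sum>j\<le>n + 2. \<bar>g (pnode n j) * poly (pbase n j) x\<bar>)" unfolding proj_def by (rule sum_abs)
 also have "... <= (\<Sum>j\<le>n + 2. B * 4)"
  unfolding abs_mult using B by (intro sum_mono mult_mono g pnode_in pbase_bound x) auto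
 also have "... = 4 * (real n + 3) * B" by simp
 finally show ?thesis .
qed

lemma proj_Lipschitz:
 assumes x: "0 <= x" "x <= 1" "0 <= y" "y <= 1" and g: "!!t. 0 <= t ==> t <= 1 ==> \<bar>g t\<bar> <= B"
 shows "\<bar>proj n g x - proj n g y\<bar> <= (real n + 3) * (4 * (real n)\<^sup>2 + 4) * B * \<bar>x - y\<bar>"
proof -
 have B: "0 <= B" using order_trans[OF abs_ge_zero g[of 0]] by simp
 have e: "proj n g x - proj n g y = (\<Sum>j\<le>n + 2. g (pnode n j) * (poly (pbase n j) x - poly (pbase n j) y))"
  unfolding proj_def by (simp add: sum_subtractf right_diff_distrib)
 have "\<bar>proj n g x - proj n g y\<bar> <= (\<Sum>j\<le>n + 2. \<bar>g (pnode n j) * (poly (pbase n j) x - poly (pbase n j) y)\<bar>)" unfolding e by (rule sum_abs)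
 also have "... <= (\<Sum>j\<le>n + 2. B * ((4 * (real n)\<^sup>2 + 4) * \<bar>x - y\<bar>))"
  unfolding abs_mult[of "g _"] using B by (intro sum_mono mult_mono g pnode_in pbase_Lipschitz x) auto
 also have "... = (real n + 3) * (4 * (real n)\<^sup>2 + 4) * B * \<bar>x - y\<bar>" by simp
 finally show ?thesis .
qed

lemma proj_diff: "proj n (%t. g t - h t) x = proj n g x - proj n h x"
 by (simp add: proj_def sum_subtractf left_diff_distrib)

text \<open>Lebesgue's inequality: the approximant is reproduced exactly, so the projection acts on
  a remainder of size E; 4 n + 13 = 1 + 4 (n + 3).\<close>

lemma proj_error:
 assumes p: "degree p <= n" "!!t. 0 <= t ==> t <= 1 ==> \<bar>g t - poly p t\<bar> <= E" and x: "0 <= x" "x <= 1"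
 shows "\<bar>g x - proj n g x\<bar> <= (4 * real n + 13) * E"
proof -
 have "g x - proj n g x = (g x - poly p x) - proj n (%t. g t - poly p t) x"
  unfolding proj_diff proj_reproduces[OF p(1)] by simp
 moreover have "\<bar>g x - poly p x\<bar> <= E" by (rule p(2)[OF x])
 moreover have "\<bar>proj n (%t. g t - poly p t) x\<bar> <= 4 * (real n + 3) * E" by (rule proj_bound[OF x p(2)])
 ultimately show ?thesis by (simp add: algebra_simps abs_le_iff)
qed

section \<open>The geometric mesh: gluing Lipschitz bounds, conformity and dimension of the discrete
  space\<close>

definition upd :: "R3 => 3 => real => R3" where
 "upd x i t = (\<chi> d. if d = i then t else x $ d)"

lemma upd_nth [simp]: "upd x i t $ d = (if d = i then t else x $ d)"
 by (simp add: upd_def)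

lemma upd_same [simp]: "upd x i (x $ i) = x"
 by (simp add: vec_eq_iff)

definition geo_cell :: "real => nat => (3 => nat) => R3 set" where
 "geo_cell sg L idx = {x. \<forall>d. geo_node sg L (idx d) <= x $ d \<and> x $ d <= geo_node sg L (Suc (idx d))}"

lemma geo_node_ends [simp]: "geo_node sg L 0 = 0" "geo_node sg L (Suc (2 * L)) = 1"
 by (simp_all add: geo_node_def)

lemma geo_node_less:
 assumes sg: "0 < sg" "sg < 1" and L: "1 <= L" and i: "i < 2 * L + 1"
 shows "geo_node sg L i < geo_node sg L (Suc i)"
proof -
 have dec: "sg ^ Suc m < sg ^ m" for m using sg by simp
 consider "i = 0" | "1 <= i" "i < L" | "i = L" | "L < i" "i < 2 * L" | "i = 2 * L" using i by linarith
 then show ?thesis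
 proof cases
  case 2
  then have "L - i = Suc (L - Suc i)" by simp
  then show ?thesis using 2 dec[of "L - Suc i"] by (simp add: geo_node_def)
 next
  case 4
  then have "Suc i - L = Suc (i - L)" by simp
  then show ?thesis using 4 dec[of "i - L"] by (simp add: geo_node_def)
 qed (use sg L in \<open>auto simp: geo_node_def\<close>)
qed

lemma geo_node_mono:
 assumes sg: "0 < sg" "sg < 1" and L: "1 <= L" and ij: "i <= j" "j <= 2 * L + 1"
 shows "geo_node sg L i <= geo_node sg L j"
 using ij
proof (induction j rule: dec_induct)
 case (step j)
 then show ?case using geo_node_less[OF sg L, of j] by simp
qed simp

lemma geo_node_in:
 assumes sg: "0 < sg" "sg < 1" and L: "1 <= L" and i: "i <= 2 * L + 1"
 shows "0 <= geo_node sg L i" "geo_node sg L i <= 1"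
 using geo_node_mono[OF sg L, of 0 i] geo_node_mono[OF sg L, of i "Suc (2 * L)"] i by simp_all

lemma locate_cell:
 fixes y :: "nat => real"
 assumes "y 0 <= t" "t < y n"
 shows "\<exists>j<n. y j <= t \<and> t < y (Suc j)"
 using assms
proof (induction n)
 case (Suc n)
 then show ?case by (cases "t < y n") (auto intro: less_SucI)
qed simp

lemma geo_locate:
 assumes sg: "0 < sg" "sg < 1" and L: "1 <= L" and t: "0 <= t" "t <= 1"
 shows "\<exists>j<2 * L + 1. geo_node sg L j <= t \<and> t <= geo_node sg L (Suc j)"
proof (cases "t = 1")
 case True
 then show ?thesis using geo_node_in(2)[OF sg L, of "2 * L"] by (intro exI[of _ "2 * L"]) auto
next
 case False
 then show ?thesis using locate_cell[of "geo_node sg L" t "Suc (2 * L)"] t by (force intro: less_imp_le)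
qed

lemma Lipschitz_glue:
 fixes y :: "nat => real" and g :: "real => real"
 assumes y: "!!j. j < n ==> y j <= y (Suc j)"
  and lip: "!!j a b. j < n ==> y j <= a ==> a <= b ==> b <= y (Suc j) ==> \<bar>g a - g b\<bar> <= M * (b - a)"
  and ab: "y 0 <= a" "a <= b" "b <= y n"
 shows "\<bar>g a - g b\<bar> <= M * (b - a)"
 using assms
proof (induction n arbitrary: a b)
 case 0
 then have "a = b" by linarith
 then show ?case by simp
next
 case (Suc n)
 have IH: "\<bar>g a - g b\<bar> <= M * (b - a)" if "y 0 <= a" "a <= b" "b <= y n" for a b
  using Suc.IH[of a b] Suc.prems(1,2) that by (meson less_SucI)
 show ?case
 proof (cases "b <= y n")
  case True
  then show ?thesis using IH Suc.prems by blast
 next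
  case b: False
  show ?thesis
  proof (cases "y n <= a")
   case True
   then show ?thesis using Suc.prems(2)[of n a b] Suc.prems by simp
  next
   case False
   have "\<bar>g a - g (y n)\<bar> <= M * (y n - a)" using IH[of a "y n"] False Suc.prems by simp
   moreover have "\<bar>g (y n) - g b\<bar> <= M * (b - y n)" using Suc.prems(2)[of n "y n" b] b Suc.prems by simp
   ultimately show ?thesis by (simp add: algebra_simps)
  qed
 qed
qed

lemma component_le_norm3: "\<bar>(x :: R3) $ i - z $ i\<bar> <= norm (x - z)"
 using component_le_norm_cart[of "x - z" i] by simp

text \<open>Projecting onto the closed cube keeps exterior points out of the open cube, so a
  function vanishing off the cube is unchanged by precomposition with the projection.\<close>

lemma not_Omega_clampE:
 assumes "z \<notin> Omega"
 shows "(\<chi> d. clamp01 (z $ d)) \<notin> (Omega :: R3 set)"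
proof -
 obtain i where "z $ i <= 0 \<or> 1 <= z $ i" using assms by (auto simp: Omega_def not_less)
 then have "clamp01 (z $ i) = 0 \<or> clamp01 (z $ i) = 1" by (auto simp: clamp01_def)
 then have "\<not> (0 < clamp01 (z $ i) \<and> clamp01 (z $ i) < 1)" by linarith
 then show ?thesis unfolding Omega_def by auto
qed

lemma norm_clamp_le: "norm ((\<chi> d. clamp01 (x $ d)) - (\<chi> d. clamp01 (z $ d)) :: R3) <= norm (x - z)"
 by (rule norm_le_componentwise_cart) (auto simp: clamp01_def)

text \<open>Two points of the cube are joined by three axis-parallel segments; along each the cell
  bounds are glued node by node, whence the 3. Other points are first projected to the closed cube,
  which does not increase distances.\<close>

lemma cellwise_Lipschitz:
 assumes sg: "0 < sg" "sg < 1" and L: "1 <= L" and M: "0 <= M"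
  and zero: "!!x. x \<notin> Omega ==> g x = 0"
  and cell: "!!idx x i t. (\<forall>d. idx d < 2 * L + 1) ==> x \<in> geo_cell sg L idx ==>
    geo_node sg L (idx i) <= t ==> t <= geo_node sg L (Suc (idx i)) ==> \<bar>g x - g (upd x i t)\<bar> <= M * \<bar>x $ i - t\<bar>"
 shows "\<bar>g x - g z\<bar> <= 3 * M * norm (x - z)"
proof -
 have line: "\<bar>g x - g (upd x i t)\<bar> <= M * \<bar>x $ i - t\<bar>" if x: "!!d. 0 <= x $ d \<and> x $ d <= 1" and t: "0 <= t" "t <= 1" for x :: R3 and i t
 proof -
  have "\<forall>d. \<exists>j<2 * L + 1. geo_node sg L j <= x $ d \<and> x $ d <= geo_node sg L (Suc j)" using x geo_locate[OF sg L] by blast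
  then obtain J where J: "!!d. J d < 2 * L + 1" "!!d. geo_node sg L (J d) <= x $ d" "!!d. x $ d <= geo_node sg L (Suc (J d))" by metis
  define G where "G r = g (upd x i r)" for r
  have le: "\<bar>G a - G b\<bar> <= M * (b - a)" if ab: "0 <= a" "a <= b" "b <= 1" for a b
  proof (rule Lipschitz_glue[where y = "geo_node sg L" and n = "Suc (2 * L)"])
   show "geo_node sg L j <= geo_node sg L (Suc j)" if "j < Suc (2 * L)" for j
    using geo_node_less[OF sg L, of j] that by simp
   fix j a b assume j: "j < Suc (2 * L)" "geo_node sg L j <= a" "a <= b" "b <= geo_node sg L (Suc j)"
   have "\<bar>g (upd x i a) - g (upd (upd x i a) i b)\<bar> <= M * \<bar>upd x i a $ i - b\<bar>"
    by (rule cell[of "%d. if d = i then j else J d"]) (use j J in \<open>auto simp: geo_cell_def\<close>)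
   moreover have "upd (upd x i a) i b = upd x i b" by (simp add: vec_eq_iff)
   ultimately show "\<bar>G a - G b\<bar> <= M * (b - a)" using j(3) by (simp add: G_def)
  qed (use ab in auto)
  have "\<bar>G (x $ i) - G t\<bar> <= M * \<bar>x $ i - t\<bar>"
  proof (cases "x $ i <= t")
   case True
   then show ?thesis using le[of "x $ i" t] x[of i] t by (simp add: abs_minus_commute)
  next
   case False
   then show ?thesis using le[of t "x $ i"] x[of i] t by (simp add: abs_minus_commute)
  qed
  then show ?thesis by (simp add: G_def)
 qed
 have cube: "\<bar>g x - g z\<bar> <= 3 * M * norm (x - z)" if x: "!!d. 0 <= x $ d \<and> x $ d <= 1" and z: "!!d. 0 <= z $ d \<and> z $ d <= 1" for x z :: R3
 proof -
  define x1 x2 where "x1 = upd x 1 (z $ 1)" and "x2 = upd x1 2 (z $ 2)"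
  have z3: "z = upd x2 3 (z $ 3)" unfolding x1_def x2_def by (simp add: vec_eq_iff forall_3)
  have c: "0 <= x1 $ d \<and> x1 $ d <= 1" "0 <= x2 $ d \<and> x2 $ d <= 1" for d using x z by (auto simp: x1_def x2_def)
  have n: "M * \<bar>x $ i - z $ i\<bar> <= M * norm (x - z)" for i by (intro mult_left_mono component_le_norm3 M)
  have "\<bar>g x - g x1\<bar> <= M * \<bar>x $ 1 - z $ 1\<bar>" unfolding x1_def using x z by (intro line) auto
  moreover have "\<bar>g x1 - g x2\<bar> <= M * \<bar>x1 $ 2 - z $ 2\<bar>" unfolding x2_def using c z by (intro line) auto
  moreover have "\<bar>g x2 - g (upd x2 3 (z $ 3))\<bar> <= M * \<bar>x2 $ 3 - z $ 3\<bar>" using c z by (intro line) auto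
  moreover have "x1 $ 2 = x $ 2" "x2 $ 3 = x $ 3" by (simp_all add: x1_def x2_def)
  moreover have "\<bar>g x - g z\<bar> <= \<bar>g x - g x1\<bar> + \<bar>g x1 - g x2\<bar> + \<bar>g x2 - g z\<bar>" by linarith
  ultimately have "\<bar>g x - g z\<bar> <= M * norm (x - z) + M * norm (x - z) + M * norm (x - z)"
   using n[of 1] n[of 2] n[of 3] unfolding z3[symmetric] by (smt (verit))
  then show ?thesis by simp
 qed
 define cl :: "R3 => R3" where "cl x = (\<chi> d. clamp01 (x $ d))" for x
 have gcl: "g (cl x) = g x" for x
 proof (cases "x \<in> Omega")
  case True
  then have "cl x = x" by (simp add: cl_def vec_eq_iff clamp01_def Omega_def less_imp_le)
  then show ?thesis by simp
 next
  case False
  then show ?thesis using zero[OF not_Omega_clampE[OF False]] zero[OF False] by (simp add: cl_def)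
 qed
 have "\<bar>g (cl x) - g (cl z)\<bar> <= 3 * M * norm (cl x - cl z)"
  by (rule cube) (auto simp: cl_def clamp01_in)
 also have "... <= 3 * M * norm (x - z)"
  unfolding cl_def by (intro mult_left_mono norm_clamp_le) (use M in auto)
 finally show ?thesis unfolding gcl .
qed

lemma Lipschitz_measurable:
 fixes g :: "R3 => real"
 assumes "!!x z. \<bar>g x - g z\<bar> <= M * norm (x - z)" "0 <= M"
 shows "g \<in> borel_measurable borel"
proof -
 have "M-lipschitz_on UNIV g" using assms by (auto simp: lipschitz_on_def dist_norm)
 then show ?thesis by (intro borel_measurable_continuous_onI lipschitz_on_continuous_on)
qed

lemma Lipschitz_Htilde:
 assumes s: "0 < s" "s < 1" and lip: "!!x z. \<bar>g x - g z\<bar> <= M * norm (x - z)" and M: "0 < M"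
  and zero: "!!x. x \<notin> closure Omega ==> g x = 0" and S: "0 < S" "!!x. \<bar>g x\<bar> <= S"
 shows "g \<in> Htilde s Omega" 
  "gagliardo_sq s UNIV g <= ennreal (8 * S\<^sup>2 * (2 * S / M) powr (- 2 * s)) * kern_const s"
proof -
 have m: "g \<in> borel_measurable borel" using Lipschitz_measurable[OF lip] M by simp
 show gl: "gagliardo_sq s UNIV g <= ennreal (8 * S\<^sup>2 * (2 * S / M) powr (- 2 * s)) * kern_const s"
  by (rule gagliardo_Lipschitz[OF m zero S(1) M S(2) lip])
 also have "... < \<infinity>" using kern_const_finite[OF s] by (simp add: ennreal_mult_less_top)
 finally show "g \<in> Htilde s Omega" using m zero s by (simp add: Htilde_iff)
qed

text \<open>\<open>in_Qq\<close> speaks of the open reference cube; continuity of v carries the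
  polynomial identity to the closed cell, so that neighbouring cells can be compared at their common
  faces.\<close>

lemma closed_cell_poly:
 assumes sg: "0 < sg" "sg < 1" and L: "1 <= L" and v: "v \<in> Sq0 sg L q" and idx: "\<forall>d. idx d < 2 * L + 1"
 shows "\<exists>c :: nat => nat => nat => real. \<forall>\<xi>::R3. (\<forall>d. 0 <= \<xi> $ d \<and> \<xi> $ d <= 1) -->
   v (geo_map sg L idx \<xi>) = (\<Sum>a\<le>q. \<Sum>b\<le>q. \<Sum>k\<le>q. c a b k * (\<xi> $ 1) ^ a * (\<xi> $ 2) ^ b * (\<xi> $ 3) ^ k)"
proof -
 obtain c :: "nat => nat => nat => real" where c: "!!\<xi>::R3. \<xi> \<in> ref_cube ==>
   v (geo_map sg L idx \<xi>) = (\<Sum>a\<le>q. \<Sum>b\<le>q. \<Sum>k\<le>q. c a b k * (\<xi> $ 1) ^ a * (\<xi> $ 2) ^ b * (\<xi> $ 3) ^ k)"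
 proof -
  have "in_Qq q (v \<circ> geo_map sg L idx)" using v idx unfolding Sq0_def by blast
  then show thesis using that unfolding in_Qq_def o_def by blast
 qed
 define P where "P \<xi> = (\<Sum>a\<le>q. \<Sum>b\<le>q. \<Sum>k\<le>q. c a b k * (\<xi> $ 1) ^ a * (\<xi> $ 2) ^ b * (\<xi> $ 3) ^ k)" for \<xi> :: R3
 have rc: "ref_cube = Omega" by (simp add: ref_cube_def Omega_def)
 have contP: "continuous_on (closure Omega) P" unfolding P_def by (intro continuous_intros)
 have into: "geo_map sg L idx ` closure Omega \<subseteq> closure Omega"
 proof clarify
  fix \<xi> :: R3 assume x: "\<xi> \<in> closure Omega"
  have "0 <= geo_map sg L idx \<xi> $ d \<and> geo_map sg L idx \<xi> $ d <= 1" for d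
  proof -
   define a b where "a = geo_node sg L (idx d)" and "b = geo_node sg L (Suc (idx d))"
   have ab: "0 <= a" "a <= b" "b <= 1"
    unfolding a_def b_def using geo_node_in[OF sg L] geo_node_less[OF sg L, of "idx d"] idx[rule_format, of d] by (auto intro: less_imp_le)
   have \<xi>: "0 <= \<xi> $ d" "\<xi> $ d <= 1" using x by (auto simp: closure_Omega)
   have "0 <= (b - a) * \<xi> $ d" "(b - a) * \<xi> $ d <= (b - a) * 1" using ab \<xi> by (auto intro!: mult_left_mono simp del: mult_1_right)
   then show ?thesis using ab by (simp add: geo_map_def a_def[symmetric] b_def[symmetric])
  qed
  then show "geo_map sg L idx \<xi> \<in> closure Omega" by (simp add: closure_Omega)
 qed
 have "continuous_on (closure Omega) v" using v by (simp add: Sq0_def)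
 moreover have "continuous_on (closure Omega) (geo_map sg L idx)"
  unfolding geo_map_def by (intro continuous_intros)
 ultimately have contv: "continuous_on (closure Omega) (%\<xi>. v (geo_map sg L idx \<xi>))"
  using into by (rule continuous_on_compose2)
 have "v (geo_map sg L idx \<xi>) - P \<xi> = 0" if "\<xi> \<in> closure Omega" for \<xi>
  by (rule continuous_constant_on_closure[where S = Omega])
    (use that c in \<open>auto simp: rc P_def intro!: continuous_intros contv contP[unfolded P_def]\<close>)
 then show ?thesis by (intro exI[of _ c]) (auto simp: closure_Omega P_def)
qed

lemma monomial_Lipschitz:
 fixes \<xi> ze :: R3
 assumes x: "!!d. 0 <= \<xi> $ d \<and> \<xi> $ d <= 1" "!!d. 0 <= ze $ d \<and> ze $ d <= 1" and i: "!!d. d \<noteq> i ==> ze $ d = \<xi> $ d"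
  and q: "a <= q" "b <= q" "k <= q"
 shows "\<bar>(\<xi> $ 1) ^ a * (\<xi> $ 2) ^ b * (\<xi> $ 3) ^ k - (ze $ 1) ^ a * (ze $ 2) ^ b * (ze $ 3) ^ k\<bar> <= real q * \<bar>\<xi> $ i - ze $ i\<bar>"
proof -
 have le1: "0 <= (\<xi> $ d) ^ m \<and> (\<xi> $ d) ^ m <= 1" for d m using x(1)[of d] by (simp add: power_le_one)
 have pd: "\<bar>(\<xi> $ i) ^ m - (ze $ i) ^ m\<bar> <= real q * \<bar>\<xi> $ i - ze $ i\<bar>" if "m <= q" for m
 proof -
  have "\<bar>(\<xi> $ i) ^ m - (ze $ i) ^ m\<bar> <= real m * \<bar>\<xi> $ i - ze $ i\<bar>"
   using norm_power_diff[of "\<xi> $ i" "ze $ i" m] x(1)[of i] x(2)[of i] by simp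
  also have "... <= real q * \<bar>\<xi> $ i - ze $ i\<bar>" using that by (intro mult_right_mono) auto
  finally show ?thesis .
 qed
 have key: "\<bar>D * P\<bar> <= real q * \<bar>\<xi> $ i - ze $ i\<bar>" if "\<bar>D\<bar> <= real q * \<bar>\<xi> $ i - ze $ i\<bar>" "0 <= P \<and> P <= 1" for D P :: real
 proof -
  have "\<bar>D * P\<bar> <= (real q * \<bar>\<xi> $ i - ze $ i\<bar>) * 1" unfolding abs_mult using that by (intro mult_mono) auto
  then show ?thesis by simp
 qed
 have pp: "0 <= (\<xi> $ d) ^ m * (\<xi> $ e) ^ l \<and> (\<xi> $ d) ^ m * (\<xi> $ e) ^ l <= 1" for d e m l
  using le1[of d m] le1[of e l] by (simp add: mult_le_one)
 consider "i = 1" | "i = 2" | "i = 3" using exhaust_3 by blast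
 then show ?thesis
 proof cases
  case 1
  then have z: "ze $ 2 = \<xi> $ 2" "ze $ 3 = \<xi> $ 3" using i by simp_all
  show ?thesis using key[OF pd[OF q(1)] pp[of 2 b 3 k]] unfolding z 1 by (simp add: algebra_simps)
 next
  case 2
  then have z: "ze $ 1 = \<xi> $ 1" "ze $ 3 = \<xi> $ 3" using i by simp_all
  show ?thesis using key[OF pd[OF q(2)] pp[of 1 a 3 k]] unfolding z 2 by (simp add: algebra_simps)
 next
  case 3
  then have z: "ze $ 1 = \<xi> $ 1" "ze $ 2 = \<xi> $ 2" using i by simp_all
  show ?thesis using key[OF pd[OF q(3)] pp[of 1 a 2 b]] unfolding z 3 by (simp add: algebra_simps)
 qed
qed

definition geo_coord :: "real => nat => (3 => nat) => R3 => R3" where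
 "geo_coord sg L idx x = (\<chi> d. (x $ d - geo_node sg L (idx d)) / (geo_node sg L (Suc (idx d)) - geo_node sg L (idx d)))"

lemma geo_coord:
 assumes sg: "0 < sg" "sg < 1" and L: "1 <= L" and idx: "\<forall>d. idx d < 2 * L + 1" and x: "x \<in> geo_cell sg L idx"
 shows "geo_map sg L idx (geo_coord sg L idx x) = x"
  "0 <= geo_coord sg L idx x $ d \<and> geo_coord sg L idx x $ d <= 1"
proof -
 have p: "geo_node sg L (idx d) < geo_node sg L (Suc (idx d))" for d using geo_node_less[OF sg L] idx by simp
 show "geo_map sg L idx (geo_coord sg L idx x) = x"
 proof -
  have "geo_node sg L (Suc (idx d)) - geo_node sg L (idx d) \<noteq> 0" for d using p[of d] by linarith
  then show ?thesis by (simp add: geo_map_def geo_coord_def vec_eq_iff)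
 qed
 show "0 <= geo_coord sg L idx x $ d \<and> geo_coord sg L idx x $ d <= 1"
  using p[of d] x by (auto simp: geo_coord_def geo_cell_def)
qed

lemma geo_node_gap:
 assumes sg: "0 < sg" "sg < 1" and L: "1 <= L"
 shows "\<exists>w>0. \<forall>j<2 * L + 1. w <= geo_node sg L (Suc j) - geo_node sg L j"
proof (intro exI conjI allI impI)
 let ?A = "(%j. geo_node sg L (Suc j) - geo_node sg L j) ` {..<2 * L + 1}"
 show "0 < Min ?A" using geo_node_less[OF sg L] by (subst Min_gr_iff) auto
 show "Min ?A <= geo_node sg L (Suc j) - geo_node sg L j" if "j < 2 * L + 1" for j
  using that by (intro Min_le) auto
qed

lemma Sq0_outside: assumes "v \<in> Sq0 sg L q" "x \<notin> Omega" shows "v x = 0"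
proof (cases "x \<in> closure Omega")
 case True
 then have "x \<in> frontier Omega" using assms(2) using interior_subset[of Omega] by (auto simp: frontier_def)
 then show ?thesis using assms(1) by (auto simp: Sq0_def)
qed (use assms in \<open>auto simp: Sq0_def\<close>)

lemma finite_bounded_indices: "finite {idx :: 3 => nat. \<forall>d. idx d < m}"
proof -
 have "{idx :: 3 => nat. \<forall>d. idx d < m} = PiE UNIV (%_. {..<m})" by (auto simp: PiE_def Pi_def)
 then show ?thesis by (simp add: finite_PiE)
qed

text \<open>Conformity: a continuous piecewise polynomial is Lipschitz cell by cell, hence Lipschitz
  on the whole space and of finite energy. It makes differences of discrete functions admissible as
  test functions in the weak equation.\<close>

lemma Sq0_Htilde:
 assumes s: "0 < s" "s < 1" and sg: "0 < sg" "sg < 1" and L: "1 <= L" and v: "v \<in> Sq0 sg L q"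
 shows "v \<in> Htilde s Omega"
proof -
 define I where "I = {idx :: 3 => nat. \<forall>d. idx d < 2 * L + 1}"
 have finI: "finite I" unfolding I_def by (rule finite_bounded_indices)
 obtain w where w: "0 < w" "!!j. j < 2 * L + 1 ==> w <= geo_node sg L (Suc j) - geo_node sg L j" using geo_node_gap[OF sg L] by blast
 have "\<forall>idx\<in>I. \<exists>c :: nat => nat => nat => real. \<forall>\<xi>::R3. (\<forall>d. 0 <= \<xi> $ d \<and> \<xi> $ d <= 1) -->
   v (geo_map sg L idx \<xi>) = (\<Sum>a\<le>q. \<Sum>b\<le>q. \<Sum>k\<le>q. c a b k * (\<xi> $ 1) ^ a * (\<xi> $ 2) ^ b * (\<xi> $ 3) ^ k)"
  using closed_cell_poly[OF sg L v] unfolding I_def by blast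
 then obtain c where c: "!!idx \<xi>. idx \<in> I ==> (\<forall>d. 0 <= (\<xi>::R3) $ d \<and> \<xi> $ d <= 1) ==>
   v (geo_map sg L idx \<xi>) = (\<Sum>a\<le>q. \<Sum>b\<le>q. \<Sum>k\<le>q. c idx a b k * (\<xi> $ 1) ^ a * (\<xi> $ 2) ^ b * (\<xi> $ 3) ^ k)"
  unfolding bchoice_iff by blast
 define A where "A idx = (\<Sum>a\<le>q. \<Sum>b\<le>q. \<Sum>k\<le>q. \<bar>c idx a b k\<bar>)" for idx
 define M where "M = (\<Sum>idx\<in>I. A idx) * real q / w + 1"
 have A0: "0 <= A idx" for idx unfolding A_def by (intro sum_nonneg) auto
 have sumA: "0 <= (\<Sum>idx\<in>I. A idx)" using A0 by (intro sum_nonneg) auto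
 have M0: "0 < M" unfolding M_def using sumA w(1) by (intro add_nonneg_pos divide_nonneg_nonneg mult_nonneg_nonneg) auto
 have cell: "\<bar>v x - v (upd x i t)\<bar> <= M * \<bar>x $ i - t\<bar>"
  if idx: "\<forall>d. idx d < 2 * L + 1" and x: "x \<in> geo_cell sg L idx" and t: "geo_node sg L (idx i) <= t" "t <= geo_node sg L (Suc (idx i))" for idx x i t
 proof -
  have x': "upd x i t \<in> geo_cell sg L idx" using x t by (auto simp: geo_cell_def)
  have iI: "idx \<in> I" using idx by (simp add: I_def)
  define \<xi> ze where "\<xi> = geo_coord sg L idx x" and "ze = geo_coord sg L idx (upd x i t)"
  note gx = geo_coord[OF sg L idx x, folded \<xi>_def] and gz = geo_coord[OF sg L idx x', folded ze_def]
  define wi where "wi = geo_node sg L (Suc (idx i)) - geo_node sg L (idx i)"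
  have wi: "w <= wi" using w(2) idx by (simp add: wi_def)
  have d: "\<xi> $ i - ze $ i = (x $ i - t) / wi" by (simp add: \<xi>_def ze_def geo_coord_def wi_def[symmetric] diff_divide_distrib[symmetric])
  have same: "ze $ d = \<xi> $ d" if "d \<noteq> i" for d using that by (simp add: \<xi>_def ze_def geo_coord_def)
  define m where "m \<xi> a b k = (\<xi> $ 1) ^ a * (\<xi> $ 2) ^ b * (\<xi> $ 3) ^ k" for \<xi> :: R3 and a b k
  have vx: "v x = (\<Sum>a\<le>q. \<Sum>b\<le>q. \<Sum>k\<le>q. c idx a b k * m \<xi> a b k)"
   using c[OF iI, of \<xi>] gx by (simp add: m_def mult.assoc)
  have vz: "v (upd x i t) = (\<Sum>a\<le>q. \<Sum>b\<le>q. \<Sum>k\<le>q. c idx a b k * m ze a b k)"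
   using c[OF iI, of ze] gz by (simp add: m_def mult.assoc)
  have e: "v x - v (upd x i t) = (\<Sum>a\<le>q. \<Sum>b\<le>q. \<Sum>k\<le>q. c idx a b k * (m \<xi> a b k - m ze a b k))"
   unfolding vx vz by (simp add: sum_subtractf right_diff_distrib)
  have "\<bar>v x - v (upd x i t)\<bar> <= (\<Sum>a\<le>q. \<Sum>b\<le>q. \<Sum>k\<le>q. \<bar>c idx a b k\<bar> * (real q * \<bar>\<xi> $ i - ze $ i\<bar>))"
   unfolding e
  proof (intro order_trans[OF sum_abs] sum_mono)
   fix a b k assume abk: "a \<in> {..q}" "b \<in> {..q}" "k \<in> {..q}"
   have "\<bar>m \<xi> a b k - m ze a b k\<bar> <= real q * \<bar>\<xi> $ i - ze $ i\<bar>"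
    unfolding m_def by (rule monomial_Lipschitz) (use gx gz same abk in auto)
   then show "\<bar>c idx a b k * (m \<xi> a b k - m ze a b k)\<bar> <= \<bar>c idx a b k\<bar> * (real q * \<bar>\<xi> $ i - ze $ i\<bar>)"
    unfolding abs_mult by (intro mult_left_mono) auto
  qed
  also have "... = A idx * real q * \<bar>\<xi> $ i - ze $ i\<bar>" by (simp add: A_def sum_distrib_right mult.assoc)
  also have "\<bar>\<xi> $ i - ze $ i\<bar> = \<bar>x $ i - t\<bar> / wi" unfolding d using wi w(1) by simp
  also have "A idx * real q * (\<bar>x $ i - t\<bar> / wi) <= (\<Sum>idx\<in>I. A idx) * real q * (\<bar>x $ i - t\<bar> / w)"
   using A0 sumA w(1) wi finI iI by (intro mult_mono mult_nonneg_nonneg frac_le member_le_sum) auto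
  also have "... = ((\<Sum>idx\<in>I. A idx) * real q / w) * \<bar>x $ i - t\<bar>" by simp
  also have "... <= M * \<bar>x $ i - t\<bar>" unfolding M_def by (intro mult_right_mono) auto
  finally show ?thesis .
 qed
 have lip: "\<bar>v x - v z\<bar> <= (3 * M) * norm (x - z)" for x z
  by (rule cellwise_Lipschitz[OF sg L less_imp_le[OF M0] Sq0_outside[OF v] cell])
 have bound: "\<bar>v x\<bar> <= 9 * M" for x
 proof (cases "x \<in> Omega")
  case True
  have "norm x <= (\<Sum>i\<in>UNIV. \<bar>x $ i\<bar>)" by (rule norm_le_l1_cart)
  also have "... <= (\<Sum>i\<in>(UNIV::3 set). 1)" using True by (intro sum_mono) (auto simp: Omega_def less_imp_le)
  finally have "norm x <= 3" by simp
  moreover have "v 0 = 0" by (rule Sq0_outside[OF v]) (simp add: Omega_def)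
  ultimately have "\<bar>v x\<bar> <= 3 * M * norm x" using lip[of x 0] by simp
  also have "... <= 3 * M * 3" using \<open>norm x <= 3\<close> M0 by (intro mult_left_mono) auto
  finally show ?thesis by simp
 qed (use Sq0_outside[OF v] M0 in simp)
 have out: "x \<notin> closure Omega ==> v x = 0" for x using v by (simp add: Sq0_def)
 show ?thesis
  by (rule Lipschitz_Htilde(1)[OF s lip _ out _ bound]) (use M0 in auto)
qed

lemma in_Qq_diff: assumes "in_Qq q f" "in_Qq q g" shows "in_Qq q (%x. f x - g x)"
proof -
 obtain c c' :: "nat => nat => nat => real" where
  "\<forall>\<xi>\<in>ref_cube. f \<xi> = (\<Sum>a\<le>q. \<Sum>b\<le>q. \<Sum>k\<le>q. c a b k * (\<xi> $ 1) ^ a * (\<xi> $ 2) ^ b * (\<xi> $ 3) ^ k)"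
  "\<forall>\<xi>\<in>ref_cube. g \<xi> = (\<Sum>a\<le>q. \<Sum>b\<le>q. \<Sum>k\<le>q. c' a b k * (\<xi> $ 1) ^ a * (\<xi> $ 2) ^ b * (\<xi> $ 3) ^ k)"
  using assms unfolding in_Qq_def by auto
 then show ?thesis unfolding in_Qq_def
  by (intro exI[of _ "%a b k. c a b k - c' a b k"]) (simp add: sum_subtractf left_diff_distrib)
qed

lemma Sq0_diff: assumes "v \<in> Sq0 sg L q" "w \<in> Sq0 sg L q" shows "(%x. v x - w x) \<in> Sq0 sg L q"
 using assms in_Qq_diff unfolding Sq0_def by (auto simp: o_def intro!: continuous_intros)

lemma fun_vector_space: "vector_space (%c (v :: R3 => real) x. c * v x)"
 by unfold_locales (auto simp: fun_eq_iff algebra_simps)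

lemma sum_fun_apply: "(\<Sum>i\<in>I. f i) x = (\<Sum>i\<in>I. (f i x :: real))" for f :: "'i => R3 => real"
 by (induction I rule: infinite_finite_induct) auto

text \<open>The spanning set consists of discontinuous functions, indicators of cells times
  monomials in local coordinates; it yields an upper bound of the dimension, which is the direction
  that turns decay in L into decay in N.\<close>

lemma fun_dim_Sq0:
 assumes sg: "0 < sg" "sg < 1" and L: "1 <= L"
 shows "fun_dim (Sq0 sg L q) <= ((2 * L + 1) * (q + 1)) ^ 3"
proof -
 interpret V: vector_space "%c (v :: R3 => real) x. c * v x" by (rule fun_vector_space)
 define n where "n = 2 * L + 1"
 define ix where "ix j1 j2 j3 = (%d::3. if d = 1 then j1 else if d = 2 then j2 else j3 :: nat)" for j1 j2 j3
 \<comment> \<open>Half-open cells, so that each point of the open cube lies in exactly one of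
   them.\<close>
 define hc where "hc j1 j2 j3 = {x \<in> Omega. \<forall>d. geo_node sg L (ix j1 j2 j3 d) <= x $ d \<and> x $ d < geo_node sg L (Suc (ix j1 j2 j3 d))}" for j1 j2 j3
 define bf where "bf = (%(j1, j2, j3, a, b, k) x. indicator (hc j1 j2 j3) x *
   ((geo_coord sg L (ix j1 j2 j3) x $ 1) ^ a * (geo_coord sg L (ix j1 j2 j3) x $ 2) ^ b * (geo_coord sg L (ix j1 j2 j3) x $ 3) ^ k) :: real)"
 define I where "I = {..<n} \<times> {..<n} \<times> {..<n} \<times> {..q} \<times> {..q} \<times> {..q}"
 have finI: "finite I" by (simp add: I_def)
 have "Sq0 sg L q \<subseteq> V.span (bf ` I)"
 proof
  fix v assume v: "v \<in> Sq0 sg L q"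
  have "\<forall>idx\<in>{idx. \<forall>d. idx d < n}. \<exists>c :: nat => nat => nat => real. \<forall>\<xi>::R3. (\<forall>d. 0 <= \<xi> $ d \<and> \<xi> $ d <= 1) -->
    v (geo_map sg L idx \<xi>) = (\<Sum>a\<le>q. \<Sum>b\<le>q. \<Sum>k\<le>q. c a b k * (\<xi> $ 1) ^ a * (\<xi> $ 2) ^ b * (\<xi> $ 3) ^ k)"
   using closed_cell_poly[OF sg L v] unfolding n_def by blast
  then obtain c where c: "!!idx \<xi>. (\<forall>d. idx d < n) ==> (\<forall>d. 0 <= (\<xi>::R3) $ d \<and> \<xi> $ d <= 1) ==>
    v (geo_map sg L idx \<xi>) = (\<Sum>a\<le>q. \<Sum>b\<le>q. \<Sum>k\<le>q. c idx a b k * (\<xi> $ 1) ^ a * (\<xi> $ 2) ^ b * (\<xi> $ 3) ^ k)"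
   unfolding bchoice_iff mem_Collect_eq by blast
  define co where "co = (%(j1, j2, j3, a, b, k). c (ix j1 j2 j3) a b k)"
  have "v x = (\<Sum>i\<in>I. co i * bf i x)" for x
  proof (cases "x \<in> Omega")
   case False
   then have "bf i x = 0" for i by (auto simp: bf_def hc_def split: prod.splits)
   then show ?thesis using Sq0_outside[OF v False] by simp
  next
   case True
   have "\<exists>j<n. geo_node sg L j <= x $ d \<and> x $ d < geo_node sg L (Suc j)" for d
    using locate_cell[of "geo_node sg L" "x $ d" "Suc (2 * L)"] True by (auto simp: n_def Omega_def less_imp_le)
   then obtain J where J: "!!d. J d < n" "!!d. geo_node sg L (J d) <= x $ d" "!!d. x $ d < geo_node sg L (Suc (J d))" by metis
   have uniq: "j = J d" if "j < n" "geo_node sg L j <= x $ d" "x $ d < geo_node sg L (Suc j)" for j d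
   proof (rule ccontr)
    assume "j \<noteq> J d"
    then consider "Suc j <= J d" | "Suc (J d) <= j" by linarith
    then show False
    proof cases
     case 1
     have "geo_node sg L (Suc j) <= geo_node sg L (J d)" using J(1)[of d] by (intro geo_node_mono sg L 1) (simp add: n_def)
     then show False using that(3) J(2)[of d] by linarith
    next
     case 2
     have "geo_node sg L (Suc (J d)) <= geo_node sg L j" using that(1) by (intro geo_node_mono sg L 2) (simp add: n_def)
     then show False using that(2) J(3)[of d] by linarith
    qed
   qed
   have ixJ: "ix (J 1) (J 2) (J 3) = J" using exhaust_3 by (fastforce simp: ix_def)
   have ixd: "ix j1 j2 j3 1 = j1" "ix j1 j2 j3 2 = j2" "ix j1 j2 j3 3 = j3" for j1 j2 j3 by (simp_all add: ix_def)
   have ind: "indicator (hc j1 j2 j3) x = (if j1 = J 1 \<and> j2 = J 2 \<and> j3 = J 3 then 1 else 0 :: real)"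
    if "j1 < n" "j2 < n" "j3 < n" for j1 j2 j3
   proof (cases "j1 = J 1 \<and> j2 = J 2 \<and> j3 = J 3")
    case True
    then show ?thesis using J \<open>x \<in> Omega\<close> by (auto simp: hc_def ixJ)
   next
    case False
    have "x \<notin> hc j1 j2 j3"
    proof
     assume "x \<in> hc j1 j2 j3"
     then have h: "geo_node sg L (ix j1 j2 j3 d) <= x $ d" "x $ d < geo_node sg L (Suc (ix j1 j2 j3 d))" for d by (auto simp: hc_def)
     show False using uniq[of j1 1] uniq[of j2 2] uniq[of j3 3] h[of 1] h[of 2] h[of 3] that False unfolding ixd by blast
    qed
    then show ?thesis using False by simp
   qed
   define \<xi> where "\<xi> = geo_coord sg L J x"
   have xJ: "x \<in> geo_cell sg L J" using J by (auto simp: geo_cell_def less_imp_le)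
   have Jn: "\<forall>d. J d < 2 * L + 1" using J(1) by (simp add: n_def)
   have "v x = (\<Sum>a\<le>q. \<Sum>b\<le>q. \<Sum>k\<le>q. c J a b k * (\<xi> $ 1) ^ a * (\<xi> $ 2) ^ b * (\<xi> $ 3) ^ k)"
    using c[of J \<xi>] J(1) geo_coord[OF sg L Jn xJ] by (simp add: \<xi>_def)
   also have "... = (\<Sum>j1<n. \<Sum>j2<n. \<Sum>j3<n. if j1 = J 1 \<and> j2 = J 2 \<and> j3 = J 3 then
     (\<Sum>a\<le>q. \<Sum>b\<le>q. \<Sum>k\<le>q. c J a b k * (\<xi> $ 1) ^ a * (\<xi> $ 2) ^ b * (\<xi> $ 3) ^ k) else 0)"
   proof -
    have s3: "(\<Sum>j1<n. \<Sum>j2<n. \<Sum>j3<n. if j1 = J 1 \<and> j2 = J 2 \<and> j3 = J 3 then X else 0) = (X::real)" for X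
    proof -
     have d: "(\<Sum>j<n. if j = J i then Y else 0) = (Y::real)" for i Y using J(1) by simp
     have "(\<Sum>j3<n. if j1 = J 1 \<and> j2 = J 2 \<and> j3 = J 3 then X else 0) = (if j2 = J 2 then if j1 = J 1 then X else 0 else 0)" for j1 j2
      by (cases "j1 = J 1"; cases "j2 = J 2") (simp_all add: d)
     then show ?thesis by (simp only: d)
    qed
    show ?thesis unfolding s3 ..
   qed
   also have "... = (\<Sum>j1<n. \<Sum>j2<n. \<Sum>j3<n. \<Sum>a\<le>q. \<Sum>b\<le>q. \<Sum>k\<le>q. co (j1, j2, j3, a, b, k) * bf (j1, j2, j3, a, b, k) x)"
   proof (intro sum.cong refl)
    fix j1 j2 j3 assume j: "j1 \<in> {..<n}" "j2 \<in> {..<n}" "j3 \<in> {..<n}"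
    show "(if j1 = J 1 \<and> j2 = J 2 \<and> j3 = J 3 then
     (\<Sum>a\<le>q. \<Sum>b\<le>q. \<Sum>k\<le>q. c J a b k * (\<xi> $ 1) ^ a * (\<xi> $ 2) ^ b * (\<xi> $ 3) ^ k) else 0)
     = (\<Sum>a\<le>q. \<Sum>b\<le>q. \<Sum>k\<le>q. co (j1, j2, j3, a, b, k) * bf (j1, j2, j3, a, b, k) x)"
    proof (cases "j1 = J 1 \<and> j2 = J 2 \<and> j3 = J 3")
     case True
     then show ?thesis using ind[of j1 j2 j3] j by (simp add: co_def bf_def ixJ \<xi>_def mult.assoc)
    next
     case False
     have "indicator (hc j1 j2 j3) x = (0::real)" using ind[of j1 j2 j3] j unfolding if_not_P[OF False] by simp
     then have "bf (j1, j2, j3, a, b, k) x = 0" for a b k by (simp add: bf_def)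
     then show ?thesis unfolding if_not_P[OF False] by simp
    qed
   qed
   also have "... = (\<Sum>i\<in>I. co i * bf i x)" by (simp add: I_def sum.cartesian_product split_def)
   finally show ?thesis .
  qed
  then have "v = (\<Sum>i\<in>I. (%x. co i * bf i x))" by (simp add: fun_eq_iff sum_fun_apply)
  also have "... \<in> V.span (bf ` I)" by (intro V.span_sum V.span_scale V.span_base) auto
  finally show "v \<in> V.span (bf ` I)" .
 qed
 then have "V.dim (Sq0 sg L q) <= card (bf ` I)" using finI by (intro V.dim_le_card) auto
 also have "... <= card I" by (rule card_image_le[OF finI])
 also have "card I = ((2 * L + 1) * (q + 1)) ^ 3" by (simp add: I_def card_cartesian_product n_def power3_eq_cube algebra_simps)
 finally show ?thesis unfolding fun_dim_def .
qed

section \<open>Tensorised interpolation on the mesh\<close>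

lemma proj_at_end:
 assumes "a < b" "t = a \<or> t = b"
 shows "proj n (%r. w (a + (b - a) * r)) ((t - a) / (b - a)) = w t"
 using assms by (auto simp: proj_ends)

text \<open>The choice of the cell is immaterial: \<^const>\<open>proj\<close> is exact at both end points, so neighbouring cells agree at the common node.\<close>

definition pp :: "real => nat => nat => (real => real) => real => real" where
 "pp sg L n w t = (let j = SOME j. j < 2 * L + 1 \<and> geo_node sg L j <= t \<and> t <= geo_node sg L (Suc j);
   a = geo_node sg L j; b = geo_node sg L (Suc j) in proj n (%r. w (a + (b - a) * r)) ((t - a) / (b - a)))"

lemma pp_diff: "pp sg L n (%t. w t - w' t) t = pp sg L n w t - pp sg L n w' t"
 by (simp add: pp_def Let_def proj_diff)

definition vec3 :: "real => real => real => R3" where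
 "vec3 a b c = upd (upd (upd 0 1 a) 2 b) 3 c"

lemma vec3_nth [simp]: "vec3 a b c $ 1 = a" "vec3 a b c $ 2 = b" "vec3 a b c $ 3 = c"
 by (simp_all add: vec3_def)

lemma vec3_self [simp]: "vec3 (x $ 1) (x $ 2) (x $ 3) = x"
 by (simp add: vec_eq_iff forall_3)

lemma upd_vec3: "upd (vec3 a b c) 1 t = vec3 t b c" "upd (vec3 a b c) 2 t = vec3 a t c" "upd (vec3 a b c) 3 t = vec3 a b t"
 by (simp_all add: vec_eq_iff forall_3)

definition pp3 :: "real => nat => nat => (R3 => real) => R3 => real" where
 "pp3 sg L n F x = pp sg L n (%a. pp sg L n (%b. pp sg L n (%c. F (vec3 a b c)) (x $ 3)) (x $ 2)) (x $ 1)"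

context
 fixes sg :: real and L n :: nat
 assumes sg: "0 < sg" "sg < 1" and L: "1 <= L"
begin

lemma pp_cell:
 assumes j: "j < 2 * L + 1" and t: "geo_node sg L j <= t" "t <= geo_node sg L (Suc j)"
 shows "pp sg L n w t = proj n (%r. w (geo_node sg L j + (geo_node sg L (Suc j) - geo_node sg L j) * r))
   ((t - geo_node sg L j) / (geo_node sg L (Suc j) - geo_node sg L j))"
proof -
 define i where "i = (SOME j. j < 2 * L + 1 \<and> geo_node sg L j <= t \<and> t <= geo_node sg L (Suc j))"
 have i: "i < 2 * L + 1" "geo_node sg L i <= t" "t <= geo_node sg L (Suc i)"
  using someI[of "%j. j < 2 * L + 1 \<and> geo_node sg L j <= t \<and> t <= geo_node sg L (Suc j)" j] j t unfolding i_def by blast+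
 have pi: "pp sg L n w t = proj n (%r. w (geo_node sg L i + (geo_node sg L (Suc i) - geo_node sg L i) * r))
   ((t - geo_node sg L i) / (geo_node sg L (Suc i) - geo_node sg L i))" by (simp add: pp_def i_def Let_def)
 consider "i = j" | "Suc i <= j" | "Suc j <= i" by linarith
 then show ?thesis
 proof cases
  case 2
  have "geo_node sg L (Suc i) <= geo_node sg L j" using j by (intro geo_node_mono sg L 2) simp
  then have "t = geo_node sg L (Suc i)" "t = geo_node sg L j" using i t by linarith+
  then show ?thesis unfolding pi
   using proj_at_end[OF geo_node_less[OF sg L i(1)]] proj_at_end[OF geo_node_less[OF sg L j]] by metis
 next
  case 3
  have "geo_node sg L (Suc j) <= geo_node sg L i" using i by (intro geo_node_mono sg L 3) simp
  then have "t = geo_node sg L i" "t = geo_node sg L (Suc j)" using i t by linarith+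
  then show ?thesis unfolding pi
   using proj_at_end[OF geo_node_less[OF sg L i(1)]] proj_at_end[OF geo_node_less[OF sg L j]] by metis
 qed (use pi in simp)
qed

lemma cell_affine:
 assumes j: "j < 2 * L + 1" and r: "0 <= r" "r <= 1"
 shows "geo_node sg L j <= geo_node sg L j + (geo_node sg L (Suc j) - geo_node sg L j) * r"
  "geo_node sg L j + (geo_node sg L (Suc j) - geo_node sg L j) * r <= geo_node sg L (Suc j)"
proof -
 have p: "0 < geo_node sg L (Suc j) - geo_node sg L j" using geo_node_less[OF sg L j] by simp
 have "0 <= (geo_node sg L (Suc j) - geo_node sg L j) * r" "(geo_node sg L (Suc j) - geo_node sg L j) * r <= (geo_node sg L (Suc j) - geo_node sg L j) * 1"
  using p r by (intro mult_nonneg_nonneg mult_left_mono; simp)+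
 then show "geo_node sg L j <= geo_node sg L j + (geo_node sg L (Suc j) - geo_node sg L j) * r"
  "geo_node sg L j + (geo_node sg L (Suc j) - geo_node sg L j) * r <= geo_node sg L (Suc j)" by simp_all
qed

lemma cell_unit:
 assumes j: "j < 2 * L + 1" and t: "geo_node sg L j <= t" "t <= geo_node sg L (Suc j)"
 shows "0 <= (t - geo_node sg L j) / (geo_node sg L (Suc j) - geo_node sg L j)"
  "(t - geo_node sg L j) / (geo_node sg L (Suc j) - geo_node sg L j) <= 1"
 using geo_node_less[OF sg L j] t by simp_all

lemma pp_bound:
 assumes j: "j < 2 * L + 1" and t: "geo_node sg L j <= t" "t <= geo_node sg L (Suc j)"
  and B: "!!r. geo_node sg L j <= r ==> r <= geo_node sg L (Suc j) ==> \<bar>w r\<bar> <= B"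
 shows "\<bar>pp sg L n w t\<bar> <= (4 * real n + 13) * B"
proof -
 have B0: "0 <= B" using order_trans[OF abs_ge_zero B[OF t]] .
 have "\<bar>pp sg L n w t\<bar> <= 4 * (real n + 3) * B"
  unfolding pp_cell[OF j t] by (intro proj_bound cell_unit[OF j t] B cell_affine[OF j])
 also have "... <= (4 * real n + 13) * B" using B0 by (intro mult_right_mono) auto
 finally show ?thesis .
qed

lemma pp_Lipschitz:
 assumes j: "j < 2 * L + 1" and t: "geo_node sg L j <= t" "t <= geo_node sg L (Suc j)" and t': "geo_node sg L j <= t'" "t' <= geo_node sg L (Suc j)"
  and B: "!!r. geo_node sg L j <= r ==> r <= geo_node sg L (Suc j) ==> \<bar>w r\<bar> <= B"
  and h: "0 < h" "h <= geo_node sg L (Suc j) - geo_node sg L j"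
 shows "\<bar>pp sg L n w t - pp sg L n w t'\<bar> <= (4 * (real n)\<^sup>2 + 4) * (4 * real n + 13) * B / h * \<bar>t - t'\<bar>"
proof -
 define g where "g = geo_node sg L (Suc j) - geo_node sg L j"
 have g: "0 < g" "h <= g" using h by (simp_all add: g_def)
 have B0: "0 <= B" using order_trans[OF abs_ge_zero B[OF t]] .
 have "\<bar>pp sg L n w t - pp sg L n w t'\<bar> <= (real n + 3) * (4 * (real n)\<^sup>2 + 4) * B * \<bar>(t - geo_node sg L j) / g - (t' - geo_node sg L j) / g\<bar>"
  unfolding pp_cell[OF j t] pp_cell[OF j t'] g_def by (intro proj_Lipschitz cell_unit[OF j] t t' B cell_affine[OF j])
 also have "(t - geo_node sg L j) / g - (t' - geo_node sg L j) / g = (t - t') / g" by (simp add: diff_divide_distrib)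
 also have "\<bar>(t - t') / g\<bar> = \<bar>t - t'\<bar> / g" using g by simp
 also have "(real n + 3) * (4 * (real n)\<^sup>2 + 4) * B * (\<bar>t - t'\<bar> / g) <= (4 * real n + 13) * (4 * (real n)\<^sup>2 + 4) * B * (\<bar>t - t'\<bar> / h)"
  using B0 g h by (intro mult_mono frac_le mult_nonneg_nonneg) auto
 finally show ?thesis by (simp add: mult_ac)
qed

lemma pp_error:
 assumes j: "j < 2 * L + 1" and t: "geo_node sg L j <= t" "t <= geo_node sg L (Suc j)"
  and p: "\<exists>p. degree p <= n \<and> (\<forall>r\<in>{0..1}. \<bar>w (geo_node sg L j + (geo_node sg L (Suc j) - geo_node sg L j) * r) - poly p r\<bar> <= E)"
 shows "\<bar>w t - pp sg L n w t\<bar> <= (4 * real n + 13) * E"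
proof -
 obtain p where p: "degree p <= n" "!!r. 0 <= r ==> r <= 1 ==> \<bar>w (geo_node sg L j + (geo_node sg L (Suc j) - geo_node sg L j) * r) - poly p r\<bar> <= E"
  using p by auto
 have e: "geo_node sg L j + (geo_node sg L (Suc j) - geo_node sg L j) * ((t - geo_node sg L j) / (geo_node sg L (Suc j) - geo_node sg L j)) = t"
  using geo_node_less[OF sg L j] by simp
 show ?thesis unfolding pp_cell[OF j t] using proj_error[OF p cell_unit[OF j t]] unfolding e .
qed

text \<open>With P1, P2, P3 the interpolations in the three coordinates, I - P1 P2 P3 = (I - P1) +
  P1 (I - P2) + P1 P2 (I - P3). Each factor is bounded by K = 4 n + 13, so approximability along
  coordinate lines suffices. For the Lipschitz bound the varied coordinate costs an extra 4 n^2 + 4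
  over the cell length.\<close>

lemma
 fixes F :: "R3 => real"
 assumes idx: "\<forall>d. idx d < 2 * L + 1" and x: "x \<in> geo_cell sg L idx"
 shows pp3_error: "[| 0 <= E; !!y i. y \<in> geo_cell sg L idx ==> \<exists>p. degree p <= n \<and> (\<forall>r\<in>{0..1}.
   \<bar>F (upd y i (geo_node sg L (idx i) + (geo_node sg L (Suc (idx i)) - geo_node sg L (idx i)) * r)) - poly p r\<bar> <= E) |] ==>
   \<bar>F x - pp3 sg L n F x\<bar> <= 3 * (4 * real n + 13) ^ 3 * E"
 and pp3_Lipschitz: "[| !!y. y \<in> geo_cell sg L idx ==> \<bar>F y\<bar> <= B; 0 < h; !!d. h <= geo_node sg L (Suc (idx d)) - geo_node sg L (idx d);
   geo_node sg L (idx i) <= t; t <= geo_node sg L (Suc (idx i)) |] ==>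
   \<bar>pp3 sg L n F x - pp3 sg L n F (upd x i t)\<bar> <= (4 * (real n)\<^sup>2 + 4) * (4 * real n + 13) ^ 3 * B / h * \<bar>x $ i - t\<bar>"
proof -
 define K where "K = 4 * real n + 13"
 have K: "1 <= K" by (simp add: K_def)
 define I where "I d = {geo_node sg L (idx d)..geo_node sg L (Suc (idx d))}" for d
 have xI: "x $ d \<in> I d" for d using x by (simp add: geo_cell_def I_def)
 have v3: "vec3 a b c \<in> geo_cell sg L idx" if "a \<in> I 1" "b \<in> I 2" "c \<in> I 3" for a b c
  using that by (simp add: geo_cell_def I_def forall_3)
 have jd: "idx d < 2 * L + 1" for d using idx by simp
 have bnd: "\<bar>pp sg L n w t\<bar> <= K * B" if "t \<in> I d" "!!r. r \<in> I d ==> \<bar>w r\<bar> <= B" for w t d B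
  unfolding K_def using that by (intro pp_bound[OF jd[of d]]) (auto simp: I_def)
 let ?P = "pp sg L n"
 define G where "G a b c = F (vec3 a b c)" for a b c
 have pG: "pp3 sg L n F x = ?P (%a. ?P (%b. ?P (G a b) (x $ 3)) (x $ 2)) (x $ 1)" for x by (simp add: pp3_def G_def[abs_def])
 {
  assume E0: "0 <= E" and ap: "!!y i. y \<in> geo_cell sg L idx ==> \<exists>p. degree p <= n \<and> (\<forall>r\<in>{0..1}.
   \<bar>F (upd y i (geo_node sg L (idx i) + (geo_node sg L (Suc (idx i)) - geo_node sg L (idx i)) * r)) - poly p r\<bar> <= E)"
  have e1: "\<bar>G a b c - ?P (%a. G a b c) a\<bar> <= K * E" if "a \<in> I 1" "b \<in> I 2" "c \<in> I 3" for a b c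
   unfolding K_def using that ap[OF v3[OF that], of 1]
   by (intro pp_error[OF jd[of 1], where w = "%a. G a b c"]) (auto simp: I_def G_def upd_vec3)
  have e2: "\<bar>G a b c - ?P (%b. G a b c) b\<bar> <= K * E" if "a \<in> I 1" "b \<in> I 2" "c \<in> I 3" for a b c
   unfolding K_def using that ap[OF v3[OF that], of 2]
   by (intro pp_error[OF jd[of 2], where w = "%b. G a b c"]) (auto simp: I_def G_def upd_vec3)
  have e3: "\<bar>G a b c - ?P (%c. G a b c) c\<bar> <= K * E" if "a \<in> I 1" "b \<in> I 2" "c \<in> I 3" for a b c
   unfolding K_def using that ap[OF v3[OF that], of 3]
   by (intro pp_error[OF jd[of 3], where w = "%c. G a b c"]) (auto simp: I_def G_def upd_vec3)
  define X Y Z where "X = x $ 1" and "Y = x $ 2" and "Z = x $ 3"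
  have XYZ: "X \<in> I 1" "Y \<in> I 2" "Z \<in> I 3" using xI by (simp_all add: X_def Y_def Z_def)
  have d2: "\<bar>?P (%a. G a Y Z - ?P (%b. G a b Z) Y) X\<bar> <= K * (K * E)"
   by (rule bnd[OF XYZ(1)]) (intro e2 XYZ)
  have d3: "\<bar>?P (%a. ?P (%b. G a b Z - ?P (G a b) Z) Y) X\<bar> <= K * (K * (K * E))"
   by (rule bnd[OF XYZ(1)], rule bnd[OF XYZ(2)]) (intro e3 XYZ)
  have "F x - pp3 sg L n F x = (G X Y Z - ?P (%a. G a Y Z) X) + ?P (%a. G a Y Z - ?P (%b. G a b Z) Y) X
    + ?P (%a. ?P (%b. G a b Z - ?P (G a b) Z) Y) X"
   unfolding pG pp_diff by (simp add: X_def Y_def Z_def G_def)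
  then have "\<bar>F x - pp3 sg L n F x\<bar> <= K * E + K * (K * E) + K * (K * (K * E))"
   using e1[OF XYZ] d2 d3 by linarith
  also have "... <= K * (K * (K * E)) + K * (K * (K * E)) + K * (K * (K * E))"
  proof -
   have m: "y <= K * y" if "0 <= y" for y using mult_right_mono[OF K that] by simp
   have "0 <= K * E" "0 <= K * (K * E)" using K E0 by simp_all
   then show ?thesis using m[of "K * E"] m[of "K * (K * E)"] by linarith
  qed
  also have "... = 3 * K ^ 3 * E" by (simp add: power3_eq_cube)
  finally show "\<bar>F x - pp3 sg L n F x\<bar> <= 3 * (4 * real n + 13) ^ 3 * E" unfolding K_def .
 next
  assume FB: "!!y. y \<in> geo_cell sg L idx ==> \<bar>F y\<bar> <= B" and h: "0 < h" "!!d. h <= geo_node sg L (Suc (idx d)) - geo_node sg L (idx d)"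
   and t: "geo_node sg L (idx i) <= t" "t <= geo_node sg L (Suc (idx i))"
  have GB: "\<bar>G a b c\<bar> <= B" if "a \<in> I 1" "b \<in> I 2" "c \<in> I 3" for a b c unfolding G_def using that by (intro FB v3)
  define X Y Z where "X = x $ 1" and "Y = x $ 2" and "Z = x $ 3"
  have XYZ: "X \<in> I 1" "Y \<in> I 2" "Z \<in> I 3" using xI by (simp_all add: X_def Y_def Z_def)
  define A where "A = (4 * (real n)\<^sup>2 + 4)"
  have lip: "\<bar>?P w r - ?P w r'\<bar> <= A * K * B' / h * \<bar>r - r'\<bar>" if "r \<in> I d" "r' \<in> I d" "!!r. r \<in> I d ==> \<bar>w r\<bar> <= B'" for w r r' d B'
   unfolding K_def A_def using that h by (intro pp_Lipschitz[OF jd[of d]]) (auto simp: I_def)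
  have b3: "\<bar>?P (G a b) Z\<bar> <= K * B" if "a \<in> I 1" "b \<in> I 2" for a b using that by (intro bnd[OF XYZ(3)] GB)
  have b2: "\<bar>?P (%b. ?P (G a b) Z) Y\<bar> <= K * (K * B)" if "a \<in> I 1" for a using that by (intro bnd[OF XYZ(2)] b3)
  consider "i = 1" | "i = 2" | "i = 3" using exhaust_3 by blast
  then have "\<bar>pp3 sg L n F x - pp3 sg L n F (upd x i t)\<bar> <= A * K ^ 3 * B / h * \<bar>x $ i - t\<bar>"
  proof cases
   case 1
   have "t \<in> I 1" using t by (simp add: I_def 1)
   then have "\<bar>?P (%a. ?P (%b. ?P (G a b) Z) Y) X - ?P (%a. ?P (%b. ?P (G a b) Z) Y) t\<bar> <= A * K * (K * (K * B)) / h * \<bar>X - t\<bar>"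
    by (intro lip[OF XYZ(1)] b2)
   then show ?thesis unfolding pG 1 by (simp add: X_def Y_def Z_def power3_eq_cube mult_ac)
  next
   case 2
   have tI: "t \<in> I 2" using t by (simp add: I_def 2)
   have "\<bar>?P (%a. ?P (%b. ?P (G a b) Z) Y - ?P (%b. ?P (G a b) Z) t) X\<bar> <= K * (A * K * (K * B) / h * \<bar>Y - t\<bar>)"
    by (rule bnd[OF XYZ(1)]) (intro lip[OF XYZ(2) tI] b3)
   then show ?thesis unfolding pG pp_diff 2 by (simp add: X_def Y_def Z_def power3_eq_cube mult_ac)
  next
   case 3
   have tI: "t \<in> I 3" using t by (simp add: I_def 3)
   have "\<bar>?P (%a. ?P (%b. ?P (G a b) Z - ?P (G a b) t) Y) X\<bar> <= K * (K * (A * K * B / h * \<bar>Z - t\<bar>))"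
    by (rule bnd[OF XYZ(1)], rule bnd[OF XYZ(2)]) (intro lip[OF XYZ(3) tI] GB)
   then show ?thesis unfolding pG pp_diff 3 by (simp add: X_def Y_def Z_def power3_eq_cube mult_ac)
  qed
  then show "\<bar>pp3 sg L n F x - pp3 sg L n F (upd x i t)\<bar> <= (4 * (real n)\<^sup>2 + 4) * (4 * real n + 13) ^ 3 * B / h * \<bar>x $ i - t\<bar>"
   unfolding A_def K_def .
 }
qed

lemma pp3_cell:
 assumes idx: "\<forall>d. idx d < 2 * L + 1" and \<xi>: "!!d. 0 <= (\<xi>::R3) $ d \<and> \<xi> $ d <= 1"
 shows "pp3 sg L n F (geo_map sg L idx \<xi>) = (\<Sum>i\<le>n+2. \<Sum>j\<le>n+2. \<Sum>k\<le>n+2.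
   F (geo_map sg L idx (vec3 (pnode n i) (pnode n j) (pnode n k))) * (poly (pbase n i) (\<xi> $ 1) * poly (pbase n j) (\<xi> $ 2) * poly (pbase n k) (\<xi> $ 3)))"
proof -
 define a g where "a d = geo_node sg L (idx d)" and "g d = geo_node sg L (Suc (idx d)) - geo_node sg L (idx d)" for d
 have g: "0 < g d" for d using geo_node_less[OF sg L, of "idx d"] idx by (simp add: g_def)
 have nth: "geo_map sg L idx ze $ d = a d + g d * ze $ d" for d and ze :: R3 by (simp add: geo_map_def a_def g_def)
 have P: "pp sg L n w (a d + g d * \<xi> $ d) = (\<Sum>j\<le>n+2. w (a d + g d * pnode n j) * poly (pbase n j) (\<xi> $ d))" for w d
 proof -
  have "pp sg L n w (a d + g d * \<xi> $ d) = proj n (%r. w (a d + g d * r)) ((a d + g d * \<xi> $ d - a d) / g d)"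
   using pp_cell[OF idx[rule_format, of d], of "a d + g d * \<xi> $ d" w] cell_affine[OF idx[rule_format, of d], of "\<xi> $ d"] \<xi>[of d]
   unfolding a_def g_def by simp
  also have "(a d + g d * \<xi> $ d - a d) / g d = \<xi> $ d" using g[of d] by simp
  finally show ?thesis by (simp add: proj_def)
 qed
 have v: "vec3 (a 1 + g 1 * r) (a 2 + g 2 * r') (a 3 + g 3 * r'') = geo_map sg L idx (vec3 r r' r'')" for r r' r''
  by (simp add: vec_eq_iff forall_3 nth)
 show ?thesis unfolding pp3_def nth P v sum_distrib_right
  by (intro sum.cong refl) (simp only: mult_ac)
qed

end

section \<open>Polynomial spaces on cells and mesh-aligned cut-off functions\<close>

lemma in_Qq_cong: assumes "in_Qq q f" "!!\<xi>. \<xi> \<in> ref_cube ==> f \<xi> = g \<xi>" shows "in_Qq q g"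
 using assms unfolding in_Qq_def by auto

lemma in_Qq_scale: assumes "in_Qq q f" shows "in_Qq q (%\<xi>. r * f \<xi>)"
proof -
 obtain c :: "nat => nat => nat => real" where
  "\<forall>\<xi>\<in>ref_cube. f \<xi> = (\<Sum>a\<le>q. \<Sum>b\<le>q. \<Sum>k\<le>q. c a b k * (\<xi> $ 1) ^ a * (\<xi> $ 2) ^ b * (\<xi> $ 3) ^ k)"
  using assms unfolding in_Qq_def by auto
 then show ?thesis unfolding in_Qq_def
  by (intro exI[of _ "%a b k. r * c a b k"]) (simp add: sum_distrib_left mult.assoc)
qed

lemma in_Qq_zero: "in_Qq q (%\<xi>. 0)"
 unfolding in_Qq_def by (intro exI[of _ "%a b k. 0"]) simp

lemma in_Qq_add: assumes "in_Qq q f" "in_Qq q g" shows "in_Qq q (%\<xi>. f \<xi> + g \<xi>)"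
proof (rule in_Qq_cong)
 show "in_Qq q (%\<xi>. f \<xi> - (-1) * g \<xi>)" by (intro in_Qq_diff in_Qq_scale assms)
qed simp

lemma in_Qq_sum: assumes "!!i. i \<in> I ==> in_Qq q (f i)" shows "in_Qq q (%\<xi>. \<Sum>i\<in>I. f i \<xi>)"
 using assms by (induction I rule: infinite_finite_induct) (auto intro: in_Qq_zero in_Qq_add)

lemma in_Qq_product:
 assumes "degree A1 <= q" "degree A2 <= q" "degree A3 <= q"
 shows "in_Qq q (%\<xi>::R3. poly A1 (\<xi> $ 1) * poly A2 (\<xi> $ 2) * poly A3 (\<xi> $ 3))"
proof -
 have e: "poly A x = (\<Sum>a\<le>q. coeff A a * x ^ a)" if "degree A <= q" for A :: "real poly" and x
  unfolding poly_altdef using that by (intro sum.mono_neutral_left) (auto simp: coeff_eq_0)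
 show ?thesis unfolding in_Qq_def e[OF assms(1)] e[OF assms(2)] e[OF assms(3)]
  by (intro exI[of _ "%a b k. coeff A1 a * coeff A2 b * coeff A3 k"])
    (simp add: sum_distrib_right sum_distrib_left mult_ac, intro ballI sum.swap)
qed

text \<open>The ramps between h1 and h2, and symmetrically at 1, will each fill exactly one mesh
  interval. The cut-off is then affine on every cell, and multiplying by it raises the degree by one
  in each variable.\<close>

definition cut :: "real => real => real => real" where
 "cut h1 h2 t = max 0 (min 1 ((min t (1 - t) - h1) / (h2 - h1)))"

definition cut3 :: "real => real => R3 => real" where
 "cut3 h1 h2 x = cut h1 h2 (x $ 1) * cut h1 h2 (x $ 2) * cut h1 h2 (x $ 3)"

lemma cut_in: "0 <= cut h1 h2 t" "cut h1 h2 t <= 1"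
 by (auto simp: cut_def)

lemma cut_Lipschitz:
 assumes "h1 < h2" shows "\<bar>cut h1 h2 t - cut h1 h2 t'\<bar> <= \<bar>t - t'\<bar> / (h2 - h1)"
proof -
 have "\<bar>cut h1 h2 t - cut h1 h2 t'\<bar> <= \<bar>(min t (1 - t) - h1) / (h2 - h1) - (min t' (1 - t') - h1) / (h2 - h1)\<bar>"
  unfolding cut_def by (simp add: max_def min_def)
 also have "... = \<bar>min t (1 - t) - min t' (1 - t')\<bar> / (h2 - h1)"
  using assms by (simp add: diff_divide_distrib[symmetric])
 also have "... <= \<bar>t - t'\<bar> / (h2 - h1)" using assms by (intro divide_right_mono) auto
 finally show ?thesis .
qed

lemma cut_eq_0: assumes "h1 < h2" "t <= h1 \<or> 1 - h1 <= t" shows "cut h1 h2 t = 0"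
proof -
 have "(min t (1 - t) - h1) / (h2 - h1) <= 0" using assms by (intro divide_nonpos_pos) auto
 then show ?thesis by (simp add: cut_def)
qed

lemma cut_eq_1: assumes "h1 < h2" "h2 <= t" "t <= 1 - h2" shows "cut h1 h2 t = 1"
proof -
 have "1 <= (min t (1 - t) - h1) / (h2 - h1)" using assms by (subst le_divide_eq_1_pos) auto
 then show ?thesis by (simp add: cut_def)
qed

lemma cut_left: assumes "h1 < h2" "h2 <= 1/2" "h1 <= t" "t <= h2" shows "cut h1 h2 t = (t - h1) / (h2 - h1)"
proof -
 have "min t (1 - t) = t" using assms by simp
 moreover have "0 <= (t - h1) / (h2 - h1)" "(t - h1) / (h2 - h1) <= 1" using assms by auto
 ultimately show ?thesis by (simp add: cut_def)
qed

lemma cut_right: assumes "h1 < h2" "h2 <= 1/2" "1 - h2 <= t" "t <= 1 - h1" shows "cut h1 h2 t = (1 - t - h1) / (h2 - h1)"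
proof -
 have "min t (1 - t) = 1 - t" using assms by simp
 moreover have "0 <= (1 - t - h1) / (h2 - h1)" "(1 - t - h1) / (h2 - h1) <= 1" using assms by auto
 ultimately show ?thesis by (simp add: cut_def)
qed

lemma cut3_in: "0 <= cut3 h1 h2 x" "cut3 h1 h2 x <= 1"
 unfolding cut3_def using cut_in by (auto intro!: mult_nonneg_nonneg mult_le_one)

lemma cut3_eq_0: assumes "h1 < h2" "(x::R3) $ d <= h1 \<or> 1 - h1 <= x $ d" shows "cut3 h1 h2 x = 0"
 using cut_eq_0[OF assms] exhaust_3[of d] by (auto simp: cut3_def)

lemma cut3_upd_Lipschitz:
 assumes "h1 < h2" shows "\<bar>cut3 h1 h2 x - cut3 h1 h2 (upd x i t)\<bar> <= \<bar>x $ i - t\<bar> / (h2 - h1)"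
proof -
 let ?c = "cut h1 h2"
 have k: "\<bar>(?c (x $ i) - ?c t) * (p * q)\<bar> <= \<bar>x $ i - t\<bar> / (h2 - h1)" if "0 <= p" "p <= 1" "0 <= q" "q <= 1" for p q
 proof -
  have "0 <= p * q" "p * q <= 1" using that by (auto intro: mult_le_one)
  then have "\<bar>(?c (x $ i) - ?c t) * (p * q)\<bar> <= (\<bar>x $ i - t\<bar> / (h2 - h1)) * 1"
   unfolding abs_mult using cut_Lipschitz[OF assms] assms by (intro mult_mono) auto
  then show ?thesis by simp
 qed
 consider "i = 1" | "i = 2" | "i = 3" using exhaust_3 by blast
 then show ?thesis
 proof cases
  case 1
  show ?thesis using k[OF cut_in[of h1 h2 "x $ 2"] cut_in[of h1 h2 "x $ 3"]] unfolding 1 by (simp add: cut3_def algebra_simps)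
 next
  case 2
  show ?thesis using k[OF cut_in[of h1 h2 "x $ 1"] cut_in[of h1 h2 "x $ 3"]] unfolding 2 by (simp add: cut3_def algebra_simps)
 next
  case 3
  show ?thesis using k[OF cut_in[of h1 h2 "x $ 1"] cut_in[of h1 h2 "x $ 2"]] unfolding 3 by (simp add: cut3_def algebra_simps)
 qed
qed

lemma cut3_Lipschitz:
 assumes "h1 < h2" shows "\<bar>cut3 h1 h2 x - cut3 h1 h2 z\<bar> <= 3 * norm (x - z) / (h2 - h1)"
proof -
 define x1 x2 where "x1 = upd x 1 (z $ 1)" and "x2 = upd x1 2 (z $ 2)"
 have z3: "z = upd x2 3 (z $ 3)" unfolding x1_def x2_def by (simp add: vec_eq_iff forall_3)
 have n: "\<bar>x $ i - z $ i\<bar> / (h2 - h1) <= norm (x - z) / (h2 - h1)" for i using assms by (intro divide_right_mono component_le_norm3) simp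
 have "\<bar>cut3 h1 h2 x - cut3 h1 h2 x1\<bar> <= \<bar>x $ 1 - z $ 1\<bar> / (h2 - h1)" unfolding x1_def by (rule cut3_upd_Lipschitz[OF assms])
 moreover have "\<bar>cut3 h1 h2 x1 - cut3 h1 h2 x2\<bar> <= \<bar>x1 $ 2 - z $ 2\<bar> / (h2 - h1)" unfolding x2_def by (rule cut3_upd_Lipschitz[OF assms])
 moreover have "\<bar>cut3 h1 h2 x2 - cut3 h1 h2 z\<bar> <= \<bar>x2 $ 3 - z $ 3\<bar> / (h2 - h1)" using cut3_upd_Lipschitz[OF assms, of x2 3 "z $ 3"] unfolding z3[symmetric] .
 moreover have "x1 $ 2 = x $ 2" "x2 $ 3 = x $ 3" by (simp_all add: x1_def x2_def)
 moreover have "\<bar>cut3 h1 h2 x - cut3 h1 h2 z\<bar> <= \<bar>cut3 h1 h2 x - cut3 h1 h2 x1\<bar> + \<bar>cut3 h1 h2 x1 - cut3 h1 h2 x2\<bar> + \<bar>cut3 h1 h2 x2 - cut3 h1 h2 z\<bar>" by linarith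
 ultimately have "\<bar>cut3 h1 h2 x - cut3 h1 h2 z\<bar> <= norm (x - z) / (h2 - h1) + norm (x - z) / (h2 - h1) + norm (x - z) / (h2 - h1)"
  using n[of 1] n[of 2] n[of 3] by (smt (verit))
 then show ?thesis by simp
qed

lemma cut3_eq_1: assumes "h1 < h2" "h2 <= bd x" shows "cut3 h1 h2 x = 1"
proof -
 have "cut h1 h2 (x $ i) = 1" for i using bd_le[of x i] assms by (intro cut_eq_1) auto
 then show ?thesis by (simp add: cut3_def)
qed

lemma bd_diff_le: "bd x - bd z <= norm (x - z)"
proof (rule bd_cases[of z])
 fix i assume "bd z = z $ i"
 then show ?thesis using bd_le(1)[of x i] component_le_norm3[of x i z] by linarith
next
 fix i assume "bd z = 1 - z $ i"
 then show ?thesis using bd_le(2)[of x i] component_le_norm3[of x i z] by linarith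
qed

text \<open>Provides the hypothesis of \<open>gagliardo_multiplier\<close> with a constant depending
  on sg alone. Where \<open>bd x <= 2 * h2\<close> the slope 3 / ((1 - sg) h2) is of order 1 /
  \<open>bd x\<close>. Farther inside the cut-off is 1, and a point z where it differs is at
  distance at least \<open>bd x / 2\<close>.\<close>

lemma cut3_multiplier:
 assumes h: "0 < h1" "h1 = sg * h2" "sg < 1" "0 < sg" and x: "x \<in> Omega"
 shows "\<bar>cut3 h1 h2 x - cut3 h1 h2 z\<bar> <= 6 / (1 - sg) * norm (x - z) / bd x"
proof -
 have h2: "0 < h2" using h by (simp add: zero_less_mult_iff)
 have lt: "h1 < h2" using h h2 by simp
 have bx: "0 < bd x" using x by (simp add: bd_pos_iff)
 have d: "h2 - h1 = (1 - sg) * h2" using h by (simp add: algebra_simps)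
 show ?thesis
 proof (cases "bd x <= 2 * h2")
  case True
  have "3 * norm (x - z) / (h2 - h1) = 3 * norm (x - z) / (1 - sg) * (1 / h2)" by (simp add: d)
  also have "... <= 3 * norm (x - z) / (1 - sg) * (2 / bd x)"
   using True h h2 bx by (intro mult_left_mono) (auto simp: divide_simps)
  finally show ?thesis using cut3_Lipschitz[OF lt, of x z] by simp
 next
  case False
  show ?thesis
  proof (cases "h2 <= bd z")
   case True
   then show ?thesis using cut3_eq_1[OF lt] False h2 bx h by simp
  next
   case z: False
   have "1 * bd x <= 2 * norm (x - z)" using False z bd_diff_le[of x z] by linarith
   then have "1 <= 2 * norm (x - z) / bd x" using bx by (simp add: le_divide_eq)
   also have "... <= 6 / (1 - sg) * norm (x - z) / bd x"
   proof -
    have "2 <= 6 / (1 - sg)" using h by (simp add: le_divide_eq)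
    then show ?thesis using bx by (intro divide_right_mono mult_right_mono) auto
   qed
   finally show ?thesis using cut3_in[of h1 h2 x] cut3_in[of h1 h2 z] by (simp add: abs_if)
  qed
 qed
qed

lemma geo_nodes_cut:
 assumes p: "1 <= p" "p < L"
 shows "geo_node sg L (L - p) = sg ^ p / 2" "geo_node sg L (Suc (L - p)) = sg ^ (p - 1) / 2"
  "geo_node sg L (L + p - 1) = 1 - sg ^ (p - 1) / 2" "geo_node sg L (L + p) = 1 - sg ^ p / 2"
proof -
 have "L - Suc (L - p) = p - 1" using p by simp
 then show "geo_node sg L (Suc (L - p)) = sg ^ (p - 1) / 2" using p by (simp add: geo_node_def)
 \<comment> \<open>For p = 1 the index is L, which belongs to the left branch of
   \<open>geo_node\<close>; both branches give 1/2.\<close>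
 show "geo_node sg L (L + p - 1) = 1 - sg ^ (p - 1) / 2" using p by (cases "p = 1") (auto simp: geo_node_def)
qed (use p in \<open>auto simp: geo_node_def\<close>)

text \<open>The grading makes the length of a cell at most 1 / sg times its distance to either end,
  independently of L and p; this is the uniform shape of the complex neighbourhoods. The cells j < L
  refine towards 0, those with j > L towards 1, and j = L is the transition from 1/2 to 1 -
  sg/2.\<close>

lemma inner_cell:
 assumes sg: "0 < sg" "sg < 1" and p: "1 <= p" "p < L" and j: "L - p <= j" "j < L + p"
 defines "a \<equiv> geo_node sg L j" and "b \<equiv> geo_node sg L (Suc j)"
 shows "sg ^ p / 2 <= a" "b <= 1 - sg ^ p / 2" "(1 - sg) * (sg ^ p / 2) <= b - a" "b - a <= 1 / sg * a" "b - a <= 1 / sg * (1 - b)"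
proof -
 have L: "1 <= L" using p by simp
 note n = geo_nodes_cut[OF p, of sg]
 show a: "sg ^ p / 2 <= a" using geo_node_mono[OF sg L, of "L - p" j] n j p by (simp add: a_def)
 show b: "b <= 1 - sg ^ p / 2" using geo_node_mono[OF sg L, of "Suc j" "L + p"] n j p by (simp add: b_def)
 have sgp: "sg ^ p <= sg ^ m" if "m <= p" for m using sg that by (intro power_decreasing) auto
 have le1: "sg ^ m <= 1" for m using sg by (simp add: power_le_one)
 have inv: "1 <= 1 / sg" using sg by simp
 consider "j < L" | "j = L" | "L < j" by linarith
 then have "(1 - sg) * (sg ^ p / 2) <= b - a \<and> b - a <= 1 / sg * a \<and> b - a <= 1 / sg * (1 - b)"
 proof cases
  case 1
  define m where "m = L - Suc j"
  have m: "L - j = Suc m" "m <= p" using 1 j by (simp_all add: m_def)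
  have ab: "a = sg * (sg ^ m / 2)" "b = sg ^ m / 2" using 1 j p m by (simp_all add: a_def b_def geo_node_def m_def[symmetric])
  have "(1 - sg) * (sg ^ p / 2) <= (1 - sg) * (sg ^ m / 2)" using sg sgp[OF m(2)] by (intro mult_left_mono) auto
  moreover have "b - a = (1 - sg) * (sg ^ m / 2)" by (simp add: ab algebra_simps)
  moreover have "b - a <= 1 / sg * a" using sg by (simp add: ab)
  moreover have "b - a <= 1 / sg * (1 - b)"
  proof -
   have "0 <= a" using sg by (simp add: ab)
   then have "b - a <= 1 * (1 - b)" using le1[of m] by (simp add: ab)
   also have "... <= 1 / sg * (1 - b)" using inv le1[of m] by (intro mult_right_mono) (auto simp: ab)
   finally show ?thesis .
  qed
  ultimately show ?thesis by simp
 next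
  case 2
  have ab: "a = 1 / 2" "b = 1 - sg / 2" using 2 L by (simp_all add: a_def b_def geo_node_def)
  have "(1 - sg) * (sg ^ p / 2) <= (1 - sg) * (1 / 2)" using sg le1[of p] by (intro mult_left_mono) auto
  moreover have "b - a = (1 - sg) * (1 / 2)" by (simp add: ab algebra_simps)
  moreover have "1 / sg * (1 - b) = 1 / 2" using sg by (simp add: ab)
  moreover have "1 / 2 <= 1 / sg * a" using mult_right_mono[OF inv, of "1/2"] by (simp add: ab)
  moreover have "b - a <= 1 / 2" using sg by (simp add: ab)
  ultimately show ?thesis by (intro conjI) linarith+
 next
  case 3
  define m where "m = j - L"
  have m: "Suc j - L = Suc m" "Suc m <= p" "1 <= m" using 3 j by (auto simp: m_def)
  have ab: "1 - a = sg ^ m / 2" "1 - b = sg * (sg ^ m / 2)"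
   using 3 j p m by (simp_all add: a_def b_def geo_node_def m_def[symmetric])
  have d: "b - a = (1 - sg) * (sg ^ m / 2)" using ab by (simp add: algebra_simps)
  have "(1 - sg) * (sg ^ p / 2) <= (1 - sg) * (sg ^ m / 2)" using sg sgp[of m] m by (intro mult_left_mono) auto
  moreover have "b - a <= 1 / sg * (1 - b)"
  proof -
   have "1 / sg * (1 - b) = sg ^ m / 2" unfolding ab(2) using sg by simp
   moreover have "0 <= 1 - b" unfolding ab(2) using sg by simp
   ultimately show ?thesis using ab(1) by linarith
  qed
  moreover have "b - a <= 1 / sg * a"
  proof -
   have a12: "1 / 2 <= a" using ab(1) le1[of m] by linarith
   have "0 <= 1 - b" unfolding ab(2) using sg by simp
   then have "b - a <= 1 * a" using a12 by linarith
   also have "... <= 1 / sg * a" using inv a12 by (intro mult_right_mono) auto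
   finally show ?thesis .
  qed
  ultimately show ?thesis unfolding d[symmetric] by blast
 qed
 then show "(1 - sg) * (sg ^ p / 2) <= b - a" "b - a <= 1 / sg * a" "b - a <= 1 / sg * (1 - b)" by auto
qed

lemma outer_cell:
 assumes sg: "0 < sg" "sg < 1" and p: "1 <= p" "p < L" and j: "j < L - p \<or> L + p <= j" "j < 2 * L + 1"
  and t: "geo_node sg L j <= t" "t <= geo_node sg L (Suc j)"
 shows "t <= sg ^ p / 2 \<or> 1 - sg ^ p / 2 <= t"
proof -
 have L: "1 <= L" using p by simp
 note n = geo_nodes_cut[OF p, of sg]
 show ?thesis
 proof (cases "j < L - p")
  case True
  have "geo_node sg L (Suc j) <= geo_node sg L (L - p)" using True by (intro geo_node_mono sg L) auto
  then show ?thesis using t n by simp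
 next
  case False
  have "geo_node sg L (L + p) <= geo_node sg L j" using False j by (intro geo_node_mono sg L) auto
  then show ?thesis using t n by simp
 qed
qed

text \<open>The nodes h1 and h2 are consecutive, so the two ramps are precisely the cells L - p and
  L + p - 1; the cut-off is 1 between them and 0 outside.\<close>

lemma cut_affine:
 assumes sg: "0 < sg" "sg < 1" and p: "1 <= p" "p < L" and j: "j < 2 * L + 1"
 shows "\<exists>\<alpha> \<beta>. \<forall>t. geo_node sg L j <= t --> t <= geo_node sg L (Suc j) --> cut (sg ^ p / 2) (sg ^ (p - 1) / 2) t = \<alpha> + \<beta> * t"
proof -
 define h1 h2 where "h1 = sg ^ p / 2" and "h2 = sg ^ (p - 1) / 2"
 have L: "1 <= L" using p by simp
 have "sg ^ p = sg * sg ^ (p - 1)" using p by (cases p) auto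
 then have h12: "h1 < h2" using sg by (simp add: h1_def h2_def)
 have h22: "h2 <= 1 / 2" using sg by (simp add: h2_def power_le_one)
 note n = geo_nodes_cut[OF p, of sg, folded h1_def h2_def]
 consider "j < L - p \<or> L + p <= j" | "j = L - p" | "Suc (L - p) <= j" "Suc j <= L + p - 1" | "j = L + p - 1" using p by linarith
 then show ?thesis unfolding h1_def[symmetric] h2_def[symmetric]
 proof cases
  case 1
  have "cut h1 h2 t = 0 + 0 * t" if "geo_node sg L j <= t" "t <= geo_node sg L (Suc j)" for t
   using cut_eq_0[OF h12] outer_cell[OF sg p 1 j that] by (simp add: h1_def)
  then show "\<exists>\<alpha> \<beta>. \<forall>t. geo_node sg L j <= t --> t <= geo_node sg L (Suc j) --> cut h1 h2 t = \<alpha> + \<beta> * t" by blast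
 next
  case 2
  have "cut h1 h2 t = - h1 / (h2 - h1) + (1 / (h2 - h1)) * t" if "geo_node sg L j <= t" "t <= geo_node sg L (Suc j)" for t
   using cut_left[OF h12 h22, of t] that n 2 by (simp add: diff_divide_distrib)
  then show "\<exists>\<alpha> \<beta>. \<forall>t. geo_node sg L j <= t --> t <= geo_node sg L (Suc j) --> cut h1 h2 t = \<alpha> + \<beta> * t" by blast
 next
  case 3
  have "geo_node sg L (Suc (L - p)) <= geo_node sg L j" "geo_node sg L (Suc j) <= geo_node sg L (L + p - 1)"
   using 3 j p by (intro geo_node_mono sg L; simp)+
  then have "cut h1 h2 t = 1 + 0 * t" if "geo_node sg L j <= t" "t <= geo_node sg L (Suc j)" for t
   using cut_eq_1[OF h12, of t] that n by simp
  then show "\<exists>\<alpha> \<beta>. \<forall>t. geo_node sg L j <= t --> t <= geo_node sg L (Suc j) --> cut h1 h2 t = \<alpha> + \<beta> * t" by blast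
 next
  case 4
  have "Suc j = L + p" using 4 p by simp
  then have "cut h1 h2 t = (1 - h1) / (h2 - h1) + (- 1 / (h2 - h1)) * t" if "geo_node sg L j <= t" "t <= geo_node sg L (Suc j)" for t
   using cut_right[OF h12 h22, of t] that n 4 by (simp add: diff_divide_distrib)
  then show "\<exists>\<alpha> \<beta>. \<forall>t. geo_node sg L j <= t --> t <= geo_node sg L (Suc j) --> cut h1 h2 t = \<alpha> + \<beta> * t" by blast
 qed
qed

lemma cut_pp3_in_Qq:
 assumes sg: "0 < sg" "sg < 1" and p: "1 <= p" "p < L" and idx: "\<forall>d. idx d < 2 * L + 1" and n: "1 <= n"
 shows "in_Qq (n + 1) ((%x. cut3 (sg ^ p / 2) (sg ^ (p - 1) / 2) x * pp3 sg L n F x) \<circ> geo_map sg L idx)"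
proof -
 define h1 h2 where "h1 = sg ^ p / 2" and "h2 = sg ^ (p - 1) / 2"
 have L: "1 <= L" using p by simp
 have "\<forall>d. \<exists>\<alpha> \<beta>. \<forall>t. geo_node sg L (idx d) <= t --> t <= geo_node sg L (Suc (idx d)) --> cut h1 h2 t = \<alpha> + \<beta> * t"
  unfolding h1_def h2_def using cut_affine[OF sg p] idx by blast
 then obtain \<alpha> \<beta> where ab: "!!d t. geo_node sg L (idx d) <= t ==> t <= geo_node sg L (Suc (idx d)) ==> cut h1 h2 t = \<alpha> d + \<beta> d * t" by metis
 define l where "l d = [:\<alpha> d + \<beta> d * geo_node sg L (idx d), \<beta> d * (geo_node sg L (Suc (idx d)) - geo_node sg L (idx d)):]" for d
 have dl: "degree (l d * pbase n i) <= n + 1" for d i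
 proof -
  have "degree (l d * pbase n i) <= degree (l d) + degree (pbase n i)" by (rule degree_mult_le)
  moreover have "degree (l d) <= 1" by (simp add: l_def)
  ultimately show ?thesis using degree_pbase[OF n, of i] by linarith
 qed
 define W where "W i j k = F (geo_map sg L idx (vec3 (pnode n i) (pnode n j) (pnode n k)))" for i j k
 have "in_Qq (n + 1) (%\<xi>::R3. \<Sum>i\<le>n+2. \<Sum>j\<le>n+2. \<Sum>k\<le>n+2. W i j k *
   (poly (l 1 * pbase n i) (\<xi> $ 1) * poly (l 2 * pbase n j) (\<xi> $ 2) * poly (l 3 * pbase n k) (\<xi> $ 3)))"
  by (intro in_Qq_sum in_Qq_scale in_Qq_product dl)
 then show ?thesis unfolding h1_def[symmetric] h2_def[symmetric]
 proof (rule in_Qq_cong)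
  fix \<xi> :: R3 assume "\<xi> \<in> ref_cube"
  then have \<xi>: "0 <= \<xi> $ d \<and> \<xi> $ d <= 1" for d by (auto simp: ref_cube_def less_imp_le)
  have cl: "cut h1 h2 (geo_map sg L idx \<xi> $ d) = poly (l d) (\<xi> $ d)" for d
  proof -
   have "cut h1 h2 (geo_map sg L idx \<xi> $ d) = \<alpha> d + \<beta> d * (geo_map sg L idx \<xi> $ d)"
    using cell_affine[OF sg L idx[rule_format, of d], of "\<xi> $ d"] \<xi>[of d] by (intro ab) (simp_all add: geo_map_def)
   then show ?thesis by (simp add: geo_map_def l_def algebra_simps)
  qed
  show "(\<Sum>i\<le>n+2. \<Sum>j\<le>n+2. \<Sum>k\<le>n+2. W i j k * (poly (l 1 * pbase n i) (\<xi> $ 1) * poly (l 2 * pbase n j) (\<xi> $ 2) * poly (l 3 * pbase n k) (\<xi> $ 3)))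
   = ((%x. cut3 h1 h2 x * pp3 sg L n F x) \<circ> geo_map sg L idx) \<xi>"
   unfolding o_def cut3_def cl pp3_cell[OF sg L idx \<xi>] W_def sum_distrib_left by (intro sum.cong refl) (simp add: mult_ac)
 qed
qed

section \<open>Logit coordinates along a mesh line; products with the cut-off\<close>

lemma abs_arctan_le: "\<bar>arctan x\<bar> <= \<bar>x\<bar>"
proof -
 have "norm (arctan x - arctan 0) <= 1 * norm (x - 0)"
 proof (rule field_differentiable_bound[where S = UNIV])
  show "(arctan has_field_derivative inverse (1 + z\<^sup>2)) (at z within UNIV)" for z by (rule DERIV_arctan)
  show "norm (inverse (1 + z\<^sup>2)) <= 1" for z :: real using zero_le_power2[of z] by (simp add: inverse_le_1_iff)
 qed auto
 then show ?thesis by simp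
qed

lemma abs_Im_Ln_le:
 assumes "0 < Re z" shows "\<bar>Im (Ln z)\<bar> <= \<bar>Im z\<bar> / Re z"
proof -
 have "z \<noteq> 0" using assms by auto
 then have "Im (Ln z) = arctan (Im z / Re z)" using assms arg_conv_arctan[of z] by (simp add: Arg_eq_Im_Ln)
 then show ?thesis using abs_arctan_le[of "Im z / Re z"] assms by simp
qed

lemma Sf_axis_transport:
 assumes x: "x \<in> Omega" and t: "0 < t" "t < 1"
 shows "Sf ((ln t - ln (1 - t) - (ln (x $ i) - ln (1 - x $ i))) *\<^sub>R axis i 1) x = upd x i t"
proof -
 have "Tf 0 r = r" for r by (simp add: Tf_def)
 then show ?thesis using x Tf_transport[of "x $ i" t] t by (auto simp: Sf_def vec_eq_iff axis_def Omega_def)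
qed

lemma bd_geI: assumes "!!d. h <= (x::R3) $ d \<and> h <= 1 - x $ d" shows "h <= bd x"
 using assms by (cases rule: bd_cases[of x]) auto

text \<open>Bounds for r are assumed on the inner cells alone, where the mollified solution is
  controlled; on all other cells the cut-off vanishes, so the product is globally Lipschitz.\<close>

lemma cut_product_Lipschitz:
 assumes sg: "0 < sg" "sg < 1" and p: "1 <= p" "p < L" and R: "0 <= R" "0 <= A"
  and bound: "!!idx x. (\<forall>d. L - p <= idx d \<and> idx d < L + p) ==> x \<in> geo_cell sg L idx ==> \<bar>r x\<bar> <= R"
  and lip: "!!idx x i t. (\<forall>d. L - p <= idx d \<and> idx d < L + p) ==> x \<in> geo_cell sg L idx ==>
    geo_node sg L (idx i) <= t ==> t <= geo_node sg L (Suc (idx i)) ==> \<bar>r x - r (upd x i t)\<bar> <= A * \<bar>x $ i - t\<bar>"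
 defines "h1 \<equiv> sg ^ p / 2" and "h2 \<equiv> sg ^ (p - 1) / 2"
 shows "\<bar>cut3 h1 h2 x * r x - cut3 h1 h2 z * r z\<bar> <= 3 * (R / (h2 - h1) + A) * norm (x - z)"
  and "\<bar>cut3 h1 h2 x * r x\<bar> <= R" and "x \<notin> Omega ==> cut3 h1 h2 x * r x = 0"
proof -
 have L: "1 <= L" using p by simp
 have "sg ^ p = sg * sg ^ (p - 1)" using p by (cases p) auto
 then have h12: "h1 < h2" using sg by (simp add: h1_def h2_def)
 have h1: "0 < h1" using sg by (simp add: h1_def)
 have out: "cut3 h1 h2 y = 0" if y: "y \<notin> Omega" for y
 proof -
  obtain d where "y $ d <= 0 \<or> 1 <= y $ d" using y by (auto simp: Omega_def not_less)
  then have "y $ d <= h1 \<or> 1 - h1 <= y $ d" using h1 by linarith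
  then show ?thesis by (rule cut3_eq_0[OF h12])
 qed
 then show "cut3 h1 h2 x * r x = 0" if "x \<notin> Omega" using that by simp
 have outer: "cut3 h1 h2 y = 0" if idx: "\<forall>d. idx d < 2 * L + 1" "\<not> (\<forall>d. L - p <= idx d \<and> idx d < L + p)" and y: "y \<in> geo_cell sg L idx" for idx y
 proof -
  obtain d where "idx d < L - p \<or> L + p <= idx d" using idx(2) by (auto simp: not_le not_less)
  then have "y $ d <= h1 \<or> 1 - h1 <= y $ d"
   unfolding h1_def using idx(1) y by (intro outer_cell[OF sg p]) (auto simp: geo_cell_def)
  then show ?thesis by (rule cut3_eq_0[OF h12])
 qed
 show "\<bar>cut3 h1 h2 x * r x\<bar> <= R"
 proof (cases "x \<in> Omega")
  case True
  then have "\<forall>d. \<exists>j<2 * L + 1. geo_node sg L j <= x $ d \<and> x $ d <= geo_node sg L (Suc j)"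
   using geo_locate[OF sg L] by (simp add: Omega_def less_imp_le)
  then obtain J where J: "!!d. J d < 2 * L + 1" "!!d. geo_node sg L (J d) <= x $ d" "!!d. x $ d <= geo_node sg L (Suc (J d))" by metis
  have xJ: "x \<in> geo_cell sg L J" using J by (simp add: geo_cell_def)
  show ?thesis
  proof (cases "\<forall>d. L - p <= J d \<and> J d < L + p")
   case True
   have "\<bar>cut3 h1 h2 x * r x\<bar> <= 1 * R" unfolding abs_mult using cut3_in[of h1 h2 x] bound[OF True xJ] by (intro mult_mono) auto
   then show ?thesis by simp
  next
   case False
   have "cut3 h1 h2 x = 0" by (rule outer[OF _ False xJ]) (use J(1) in simp)
   then show ?thesis using R by simp
  qed
 next
  case False
  then show ?thesis using out R by simp
 qed
 define M where "M = R / (h2 - h1) + A"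
 have M: "0 <= M" unfolding M_def using R h12 by (intro add_nonneg_nonneg divide_nonneg_nonneg) auto
 have "\<bar>cut3 h1 h2 x * r x - cut3 h1 h2 z * r z\<bar> <= 3 * M * norm (x - z)"
 proof (rule cellwise_Lipschitz[OF sg L M])
  show "cut3 h1 h2 x * r x = 0" if "x \<notin> Omega" for x using out that by simp
  fix idx x i t assume a: "\<forall>d. idx d < 2 * L + 1" "x \<in> geo_cell sg L idx" "geo_node sg L (idx i) <= t" "t <= geo_node sg L (Suc (idx i))"
  have x': "upd x i t \<in> geo_cell sg L idx" using a by (auto simp: geo_cell_def)
  show "\<bar>cut3 h1 h2 x * r x - cut3 h1 h2 (upd x i t) * r (upd x i t)\<bar> <= M * \<bar>x $ i - t\<bar>"
  proof (cases "\<forall>d. L - p <= idx d \<and> idx d < L + p")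
   case True
   have "cut3 h1 h2 x * r x - cut3 h1 h2 (upd x i t) * r (upd x i t)
    = (cut3 h1 h2 x - cut3 h1 h2 (upd x i t)) * r x + cut3 h1 h2 (upd x i t) * (r x - r (upd x i t))" by (simp add: algebra_simps)
   moreover have "\<bar>(cut3 h1 h2 x - cut3 h1 h2 (upd x i t)) * r x\<bar> <= (\<bar>x $ i - t\<bar> / (h2 - h1)) * R"
    unfolding abs_mult using h12 by (intro mult_mono cut3_upd_Lipschitz bound[OF True a(2)]) auto
   moreover have "\<bar>cut3 h1 h2 (upd x i t) * (r x - r (upd x i t))\<bar> <= 1 * (A * \<bar>x $ i - t\<bar>)"
    unfolding abs_mult using cut3_in[of h1 h2 "upd x i t"] lip[OF True a(2-4)] by (intro mult_mono) auto
   ultimately have "\<bar>cut3 h1 h2 x * r x - cut3 h1 h2 (upd x i t) * r (upd x i t)\<bar> <= (\<bar>x $ i - t\<bar> / (h2 - h1)) * R + A * \<bar>x $ i - t\<bar>" by linarith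
   also have "... = M * \<bar>x $ i - t\<bar>" by (simp add: M_def algebra_simps)
   finally show ?thesis .
  next
   case False
   show ?thesis using outer[OF a(1) False a(2)] outer[OF a(1) False x'] M by simp
  qed
 qed
 then show "\<bar>cut3 h1 h2 x * r x - cut3 h1 h2 z * r z\<bar> <= 3 * (R / (h2 - h1) + A) * norm (x - z)" unfolding M_def .
qed

lemma multiplier_enorm:
 assumes s: "0 < s" "s < 1" and w: "w \<in> Htilde s Omega" and m: "\<phi> \<in> borel_measurable borel"
  and bound: "!!x. \<bar>\<phi> x\<bar> <= 1" and lip: "!!x z. x \<in> Omega ==> \<bar>\<phi> x - \<phi> z\<bar> <= C * norm (x - z) / bd x" and C: "C \<ge> 1"
 shows "(%x. \<phi> x * w x) \<in> Htilde s Omega"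
  "enorm s (%x. \<phi> x * w x) <= sqrt (2 + 8 * (C\<^sup>2 / hardy_const s) * enn2real (kern_const s)) * enorm s w"
proof -
 define \<kappa> where "\<kappa> = enn2real (kern_const s)"
 have kc: "kern_const s = ennreal \<kappa>" using kern_const_finite[OF s] by (simp add: \<kappa>_def)
 have \<kappa>0: "0 <= \<kappa>" by (simp add: \<kappa>_def)
 have hp: "0 <= C\<^sup>2 / hardy_const s" using hardy_const_pos[of s] s by simp
 define D where "D = sqrt (2 + 8 * (C\<^sup>2 / hardy_const s) * \<kappa>)"
 have D0: "0 <= 2 + 8 * (C\<^sup>2 / hardy_const s) * \<kappa>" using hp \<kappa>0 by (intro add_nonneg_nonneg mult_nonneg_nonneg) auto
 note wD = HtildeD[OF w]
 have "gagliardo_sq s UNIV (%x. \<phi> x * w x) <= (2 + 8 * ennreal (C\<^sup>2 / hardy_const s) * kern_const s) * gagliardo_sq s UNIV w"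
  by (rule gagliardo_multiplier[OF wD(1) m wD(3) s(1) bound lip C])
 also have "2 + 8 * ennreal (C\<^sup>2 / hardy_const s) * kern_const s = ennreal (2 + 8 * (C\<^sup>2 / hardy_const s) * \<kappa>)"
 proof -
  have e: "ennreal (2 + 8 * c * \<kappa>) = 2 + 8 * ennreal c * ennreal \<kappa>" if "0 <= c" for c
   using that \<kappa>0 by (simp add: ennreal_mult ennreal_plus)
  show ?thesis unfolding kc e[OF hp] ..
 qed
 also have "... * gagliardo_sq s UNIV w = ennreal ((D * enorm s w)\<^sup>2)"
  unfolding gagliardo_eq_enorm[OF w] using D0 by (simp add: ennreal_mult'' power_mult_distrib D_def)
 finally have g: "gagliardo_sq s UNIV (%x. \<phi> x * w x) <= ennreal ((D * enorm s w)\<^sup>2)" .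
 show H: "(%x. \<phi> x * w x) \<in> Htilde s Omega"
  unfolding Htilde_iff[OF s(1)] using wD m le_less_trans[OF g] by auto
 have "enorm s (%x. \<phi> x * w x) <= D * enorm s w"
  using enorm_nonneg[of s w] D0 by (intro enorm_le[OF H g] mult_nonneg_nonneg) (auto simp: D_def)
 then show "enorm s (%x. \<phi> x * w x) <= sqrt (2 + 8 * (C\<^sup>2 / hardy_const s) * enn2real (kern_const s)) * enorm s w"
  by (simp add: D_def \<kappa>_def)
qed

section \<open>Approximation of the solution by discrete functions\<close>

context fractional_solution
begin

text \<open>Along an axis-parallel line the mollified solution is \<open>uk_ext\<close> evaluated at
  a difference of logits. On a rectangle around the unit interval whose size depends only on
  \<Lambda>, the logit of the affine image has small imaginary part, so \<open>uk_ext_bound\<close>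
  bounds the continuation and \<open>real_poly_approx\<close> applies. The Lipschitz estimate is
  Cauchy's inequality on discs of radius \<open>et\<close>.\<close>

lemma uk_line:
 assumes \<Lambda>: "1 <= \<Lambda>"
 shows "\<exists>C m. 0 < C \<and> (\<forall>k h n x i a b. 0 < k --> k <= 1/2 --> 0 < h --> h <= a --> a < b --> b <= 1 - h --> b - a <= \<Lambda> * a --> b - a <= \<Lambda> * (1 - b) -->
   (\<forall>d. h <= x $ d \<and> x $ d <= 1 - h) -->
   (\<exists>p. degree p <= n \<and> (\<forall>r\<in>{0..1}. \<bar>uk k (upd x i (a + (b - a) * r)) - poly p r\<bar> <= C / (k * h) ^ 3 * (1/2) ^ (n div 2 ^ m)))
   \<and> (\<forall>r\<in>{0..1}. \<forall>r'\<in>{0..1}. \<bar>uk k (upd x i (a + (b - a) * r)) - uk k (upd x i (a + (b - a) * r'))\<bar> <= C / (k * h) ^ 3 * \<bar>r - r'\<bar>)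
   \<and> \<bar>uk k x\<bar> <= C / (k * h) ^ 3)"
proof -
 obtain C0 \<theta> where C0: "C0 > 0" and \<theta>: "\<theta> > 0" and ext: "!!k x i t \<nu>. 0 < k ==> k <= 1/2 ==> x \<in> Omega ==> \<bar>\<nu>\<bar> <= \<theta> ==>
   norm (uk_ext k i x (of_real t + \<i> * of_real \<nu>)) <= C0 / (k * bd (Sf (t *\<^sub>R axis i 1) x))^3"
  using uk_ext_bound by blast
 \<comment> \<open>\<Lambda> et <= 1/2 keeps the image of the rectangle at half the original
   distance from 0 and 1; 4 \<Lambda> et <= \<theta> keeps the imaginary part of the logit within
   the strip.\<close>
 define et where "et = min (1/2) (\<theta> / 4) / \<Lambda>"
 have et0: "0 < et" using \<theta> \<Lambda> by (simp add: et_def)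
 have \<Lambda>et: "\<Lambda> * et = min (1/2) (\<theta> / 4)" using \<Lambda> by (simp add: et_def)
 then have et2: "\<Lambda> * et <= 1 / 2" "4 * (\<Lambda> * et) <= \<theta>" by auto
 have "1 * et <= \<Lambda> * et" using \<Lambda> et0 by (intro mult_right_mono) auto
 then have et1: "et <= 1" using et2 by linarith
 obtain m where "4 / et\<^sup>2 < (4::real) ^ m" using real_arch_pow[of 4 "4 / et\<^sup>2"] by auto
 then have m: "4 <= 4 ^ m * et\<^sup>2" using et0 by (simp add: divide_less_eq)
 \<comment> \<open>512 = 8^3, since the distance to the boundary degrades from h to at worst h / 8;
   the 10 is the constant of \<open>real_poly_approx\<close>.\<close>
 define C where "C = 5120 * C0 / et"
 have C: "0 < C" using C0 et0 by (simp add: C_def)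
 have C512: "512 * C0 <= C" "512 * C0 / et <= C"
 proof -
  have "512 * C0 * 1 <= 512 * C0 * (1 / et)" using C0 et0 et1 by (intro mult_left_mono) (auto simp: le_divide_eq)
  moreover have "0 < C0 / et" using C0 et0 by simp
  ultimately show "512 * C0 <= C" "512 * C0 / et <= C" by (simp_all add: C_def)
 qed
 have main: "(\<exists>p. degree p <= n \<and> (\<forall>r\<in>{0..1}. \<bar>uk k (upd x i (a + (b - a) * r)) - poly p r\<bar> <= C / (k * h) ^ 3 * (1/2) ^ (n div 2 ^ m)))
   \<and> (\<forall>r\<in>{0..1}. \<forall>r'\<in>{0..1}. \<bar>uk k (upd x i (a + (b - a) * r)) - uk k (upd x i (a + (b - a) * r'))\<bar> <= C / (k * h) ^ 3 * \<bar>r - r'\<bar>)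
   \<and> \<bar>uk k x\<bar> <= C / (k * h) ^ 3"
  if k: "0 < k" "k <= 1/2" and h: "0 < h" and ab: "h <= a" "a < b" "b <= 1 - h" and gap: "b - a <= \<Lambda> * a" "b - a <= \<Lambda> * (1 - b)"
   and xh: "\<forall>d. h <= x $ d \<and> x $ d <= 1 - h" for k h n and x :: R3 and i a b
 proof -
  have x: "x \<in> Omega" unfolding Omega_def
  proof (intro CollectI allI)
   fix d show "0 < x $ d \<and> x $ d < 1" using xh[rule_format, of d] h by linarith
  qed
  define B where "B = 512 * C0 / (k * h) ^ 3"
  have kh: "0 < (k * h) ^ 3" using k h by simp
  have B0: "0 < B" using C0 kh by (simp add: B_def)
  have bdB: "C0 / (k * rh) ^ 3 <= B" if "h / 8 <= rh" for rh
  proof -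
   have "(k * h / 8) ^ 3 <= (k * rh) ^ 3" using that k h by (intro power_mono) auto
   moreover have "0 < (k * h / 8) ^ 3" using k h by simp
   ultimately have "C0 / (k * rh) ^ 3 <= C0 / (k * h / 8) ^ 3" using C0 by (intro frac_le) auto
   also have "... = B" by (simp add: B_def power_divide)
   finally show ?thesis .
  qed
  define c0 where "c0 = ln (x $ i) - ln (1 - x $ i)"
  define y :: "complex => complex" where "y ze = of_real a + of_real (b - a) * ze" for ze
  have Rey: "Re (y ze) = a + (b - a) * Re ze" and Imy: "Im (y ze) = (b - a) * Im ze" for ze by (simp_all add: y_def)
  define g where "g ze = uk_ext k i x (Ln (y ze) - Ln (1 - y ze) - of_real c0)" for ze
  define S where "S = {ze. 0 < Re (y ze) \<and> Re (y ze) < 1}"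
  have oS: "open S" unfolding S_def y_def by (intro open_Collect_conj open_Collect_less continuous_intros)
  have hol: "g holomorphic_on S"
  proof -
   have "(%ze. Ln (y ze) - Ln (1 - y ze) - of_real c0) holomorphic_on S"
    unfolding y_def by (intro holomorphic_intros) (auto simp: S_def y_def complex_nonpos_Reals_iff)
   then have "(uk_ext k i x \<circ> (%ze. Ln (y ze) - Ln (1 - y ze) - of_real c0)) holomorphic_on S"
    by (rule holomorphic_on_compose) (rule holomorphic_on_subset[OF uk_ext_holomorphic[OF k x]], simp)
   then show ?thesis by (simp add: g_def[abs_def] o_def)
  qed
  have get: "(b - a) * et <= a / 2" "(b - a) * et <= (1 - b) / 2"
  proof -
   have "(b - a) * et <= (\<Lambda> * a) * et" using gap et0 by (intro mult_right_mono) auto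
   also have "... = (\<Lambda> * et) * a" by simp
   also have "... <= (1 / 2) * a" using et2 ab h by (intro mult_right_mono) auto
   finally show "(b - a) * et <= a / 2" by simp
   have "(b - a) * et <= (\<Lambda> * (1 - b)) * et" using gap et0 by (intro mult_right_mono) auto
   also have "... = (\<Lambda> * et) * (1 - b)" by simp
   also have "... <= (1 / 2) * (1 - b)" using et2 ab h by (intro mult_right_mono) auto
   finally show "(b - a) * et <= (1 - b) / 2" by simp
  qed
  have rect: "a / 2 <= Re (y ze)" "(1 - b) / 2 <= 1 - Re (y ze)" "\<bar>Im (y ze)\<bar> <= (b - a) * et"
   if ze: "- et <= Re ze" "Re ze <= 1 + et" "\<bar>Im ze\<bar> <= et" for ze
  proof -
   have "(b - a) * (- et) <= (b - a) * Re ze" "(b - a) * Re ze <= (b - a) * (1 + et)" using ab ze by (intro mult_left_mono; simp)+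
   then show "a / 2 <= Re (y ze)" "(1 - b) / 2 <= 1 - Re (y ze)" using get unfolding Rey by (simp_all add: distrib_left)
   show "\<bar>Im (y ze)\<bar> <= (b - a) * et" unfolding Imy abs_mult using ab ze by (intro mult_mono) auto
  qed
  have pos: "0 < Re (y ze)" "0 < 1 - Re (y ze)" if ze: "- et <= Re ze" "Re ze <= 1 + et" "\<bar>Im ze\<bar> <= et" for ze
  proof -
   have "0 < a / 2" "0 < (1 - b) / 2" using ab h by simp_all
   then show "0 < Re (y ze)" "0 < 1 - Re (y ze)" using rect(1,2)[OF ze] by linarith+
  qed
  have sub: "{ze. - et <= Re ze \<and> Re ze <= 1 + et \<and> \<bar>Im ze\<bar> <= et} \<subseteq> S" using pos by (force simp: S_def)
  have gB: "norm (g ze) <= B" if ze: "- et <= Re ze" "Re ze <= 1 + et" "\<bar>Im ze\<bar> <= et" for ze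
  proof -
   define z where "z = y ze"
   note r = rect[OF ze, folded z_def] and p = pos[OF ze, folded z_def]
   have nz: "z \<noteq> 0" "1 - z \<noteq> 0" using p by auto
   define \<tau> where "\<tau> = Ln z - Ln (1 - z) - of_real c0"
   have Re\<tau>: "Re \<tau> = ln (norm z) - ln (norm (1 - z)) - c0" using nz by (simp add: \<tau>_def)
   have Im\<tau>: "\<bar>Im \<tau>\<bar> <= \<theta>"
   proof -
    have "\<bar>Im (Ln z)\<bar> <= \<bar>Im z\<bar> / Re z" "\<bar>Im (Ln (1 - z))\<bar> <= \<bar>Im (1 - z)\<bar> / Re (1 - z)"
     using p by (intro abs_Im_Ln_le; simp)+
    moreover have "\<bar>Im z\<bar> / Re z <= ((b - a) * et) / (a / 2)" using r ab h by (intro frac_le) auto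
    moreover have "((b - a) * et) / (a / 2) <= ((\<Lambda> * a) * et) / (a / 2)" using gap et0 ab h by (intro divide_right_mono mult_right_mono) auto
    moreover have "((\<Lambda> * a) * et) / (a / 2) = 2 * (\<Lambda> * et)" using ab h by (simp add: field_simps)
    moreover have "\<bar>Im (1 - z)\<bar> / Re (1 - z) <= ((b - a) * et) / ((1 - b) / 2)" using r ab h by (intro frac_le) auto
    moreover have "((b - a) * et) / ((1 - b) / 2) <= ((\<Lambda> * (1 - b)) * et) / ((1 - b) / 2)" using gap et0 ab h by (intro divide_right_mono mult_right_mono) auto
    moreover have "((\<Lambda> * (1 - b)) * et) / ((1 - b) / 2) = 2 * (\<Lambda> * et)"
    proof -
     have "1 - b \<noteq> 0" using ab h by linarith
     then show ?thesis by (simp add: mult.commute)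
    qed
    moreover have "\<bar>Im \<tau>\<bar> <= \<bar>Im (Ln z)\<bar> + \<bar>Im (Ln (1 - z))\<bar>" by (simp add: \<tau>_def)
    ultimately show ?thesis using et2(2) by linarith
   qed
   \<comment> \<open>The real point with the same logit as |z| : |1 - z|: the real part of the
     complex time carries x to coordinate \<beta>, whose distance to 0 and 1 is at least (h/2) /
     4.\<close>
   define \<beta> where "\<beta> = norm z / (norm z + norm (1 - z))"
   have zn: "h / 2 <= norm z" "h / 2 <= norm (1 - z)" "norm z <= 2" "norm (1 - z) <= 2"
   proof -
    show "h / 2 <= norm z" using complex_Re_le_cmod[of z] r(1) ab by linarith
    show "h / 2 <= norm (1 - z)" using complex_Re_le_cmod[of "1 - z"] r(2) ab by simp
    have i1: "\<bar>Im z\<bar> <= 1" using r(3) get(1) ab h by linarith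
    show "norm z <= 2" using cmod_le[of z] i1 p by simp
    show "norm (1 - z) <= 2" using cmod_le[of "1 - z"] i1 p by simp
   qed
   define s where "s = norm z + norm (1 - z)"
   have s: "0 < s" "s <= 4" "0 < norm z" "0 < norm (1 - z)" using zn h nz by (auto simp: s_def)
   have \<beta>': "1 - \<beta> = norm (1 - z) / s" unfolding \<beta>_def s_def[symmetric] using s(1) by (simp add: s_def field_simps)
   have \<beta>s: "\<beta> = norm z / s" by (simp add: \<beta>_def s_def)
   have \<beta>01: "0 < \<beta>" unfolding \<beta>s using s by simp
   have \<beta>11: "0 < 1 - \<beta>" unfolding \<beta>' using s by simp
   have "ln \<beta> - ln (1 - \<beta>) = ln (norm z) - ln (norm (1 - z))" unfolding \<beta>' unfolding \<beta>s using s by (simp add: ln_div)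
   then have Sfb: "Sf (Re \<tau> *\<^sub>R axis i 1) x = upd x i \<beta>"
    using Sf_axis_transport[OF x, of \<beta> i] \<beta>01 \<beta>11 unfolding Re\<tau> c0_def by simp
   have \<beta>8: "h / 8 <= \<beta>" "h / 8 <= 1 - \<beta>"
   proof -
    have "(h / 2) / 4 <= norm z / s" "(h / 2) / 4 <= norm (1 - z) / s" using zn s h by (intro frac_le; simp)+
    then show "h / 8 <= \<beta>" "h / 8 <= 1 - \<beta>" unfolding \<beta>' unfolding \<beta>s by simp_all
   qed
   have "h / 8 <= bd (upd x i \<beta>)"
   proof (rule bd_geI)
    fix d show "h / 8 <= upd x i \<beta> $ d \<and> h / 8 <= 1 - upd x i \<beta> $ d" using \<beta>8 xh[rule_format, of d] h by auto
   qed
   then have "C0 / (k * bd (Sf (Re \<tau> *\<^sub>R axis i 1) x))^3 <= B" unfolding Sfb by (rule bdB)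
   moreover have "norm (uk_ext k i x \<tau>) <= C0 / (k * bd (Sf (Re \<tau> *\<^sub>R axis i 1) x))^3"
    using ext[OF k x Im\<tau>, of i "Re \<tau>"] by (simp add: complex_eq[symmetric])
   ultimately show ?thesis by (simp add: g_def \<tau>_def z_def)
  qed
  define G where "G r = uk k (upd x i (a + (b - a) * r))" for r
  have gG: "g (of_real r) = of_real (G r)" if r: "0 <= r" "r <= 1" for r
  proof -
   define t where "t = a + (b - a) * r"
   have "0 <= (b - a) * r" "(b - a) * r <= (b - a) * 1" using ab r by (intro mult_nonneg_nonneg mult_left_mono; simp)+
   moreover have "b < 1" using ab(3) h by linarith
   ultimately have t: "0 < t" "t < 1" using ab h unfolding t_def mult_1_right by linarith+
   have yt: "y (of_real r) = of_real t" by (simp add: y_def t_def)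
   have "Ln (y (of_real r)) - Ln (1 - y (of_real r)) - of_real c0 = of_real (ln t - ln (1 - t) - c0)"
    unfolding yt using t Ln_of_real[of t] Ln_of_real[of "1 - t"] by simp
   then have "g (of_real r) = uk_ext k i x (of_real (ln t - ln (1 - t) - c0))" by (simp add: g_def)
   also have "... = of_real (uk k (Sf ((ln t - ln (1 - t) - c0) *\<^sub>R axis i 1) x))" by (rule uk_ext_real[OF k(1)])
   also have "Sf ((ln t - ln (1 - t) - c0) *\<^sub>R axis i 1) x = upd x i t" unfolding c0_def by (rule Sf_axis_transport[OF x t])
   finally show ?thesis by (simp add: G_def t_def)
  qed
  have Ceq: "10 * B / et = C / (k * h) ^ 3" by (simp add: B_def C_def)
  have 1: "\<exists>p. degree p <= n \<and> (\<forall>r\<in>{0..1}. \<bar>G r - poly p r\<bar> <= C / (k * h) ^ 3 * (1/2) ^ (n div 2 ^ m))"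
   unfolding Ceq[symmetric] by (rule real_poly_approx[OF et0 et1 m oS hol sub gB gG])
  have CB: "B <= C / (k * h) ^ 3" "B / et <= C / (k * h) ^ 3"
  proof -
   show "B <= C / (k * h) ^ 3" unfolding B_def using C512(1) kh by (intro divide_right_mono) auto
   have "B / et = (512 * C0 / et) / (k * h) ^ 3" by (simp add: B_def)
   also have "... <= C / (k * h) ^ 3" using C512(2) kh by (intro divide_right_mono) auto
   finally show "B / et <= C / (k * h) ^ 3" .
  qed
  have 2: "\<bar>G r - G r'\<bar> <= C / (k * h) ^ 3 * \<bar>r - r'\<bar>" if r: "r \<in> {0..1}" "r' \<in> {0..1}" for r r'
  proof -
   have seg: "ze \<in> S \<and> cball ze et \<subseteq> {ze. - et <= Re ze \<and> Re ze <= 1 + et \<and> \<bar>Im ze\<bar> <= et}" if ze: "ze \<in> closed_segment 0 1" for ze :: complex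
   proof
    obtain c where "0 <= c" "c <= 1" "ze = (1 - c) *\<^sub>R 0 + c *\<^sub>R 1" using ze unfolding in_segment by blast
    then have c: "0 <= c" "c <= 1" "ze = of_real c" by (simp_all add: scaleR_conv_of_real)
    show cb: "cball ze et \<subseteq> {ze. - et <= Re ze \<and> Re ze <= 1 + et \<and> \<bar>Im ze\<bar> <= et}"
    proof
     fix w assume "w \<in> cball ze et"
     then have "\<bar>Re (ze - w)\<bar> <= et" "\<bar>Im (ze - w)\<bar> <= et"
      using abs_Re_le_cmod[of "ze - w"] abs_Im_le_cmod[of "ze - w"] by (auto simp: dist_norm)
     then show "w \<in> {ze. - et <= Re ze \<and> Re ze <= 1 + et \<and> \<bar>Im ze\<bar> <= et}" using c by (auto simp: abs_le_iff)
    qed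
    then show "ze \<in> S" using sub et0 by (meson centre_in_cball less_imp_le subsetD)
   qed
   have "norm (g (of_real r) - g (of_real r')) <= B / et * norm (of_real r - of_real r' :: complex)"
   proof (rule field_differentiable_bound[where S = "closed_segment 0 1" and f' = "deriv g"])
    show "(g has_field_derivative deriv g ze) (at ze within closed_segment 0 1)" if "ze \<in> closed_segment 0 1" for ze
     using holomorphic_derivI[OF hol oS] seg[OF that] by (blast intro: has_field_derivative_at_within)
    show "norm (deriv g ze) <= B / et" if "ze \<in> closed_segment 0 1" for ze
    proof -
     have cb: "cball ze et \<subseteq> S" using seg[OF that] sub by blast
     have "norm ((deriv ^^ 1) g ze) <= fact 1 * B / et ^ 1"
     proof (rule Cauchy_inequality)
      show "g holomorphic_on ball ze et" using hol cb by (meson ball_subset_cball holomorphic_on_subset order_trans)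
      show "continuous_on (cball ze et) g" using hol cb by (meson holomorphic_on_imp_continuous_on holomorphic_on_subset)
      show "norm (g w) <= B" if "norm (ze - w) = et" for w
      proof -
       have "w \<in> cball ze et" using that by (simp add: dist_norm)
       then show ?thesis using seg[OF \<open>ze \<in> closed_segment 0 1\<close>] gB by blast
      qed
     qed (rule et0)
     then show ?thesis by simp
    qed
    show "of_real r \<in> closed_segment (0::complex) 1" "of_real r' \<in> closed_segment (0::complex) 1"
     using r by (auto simp: in_segment scaleR_conv_of_real)
   qed (rule convex_closed_segment)
   then have "\<bar>G r - G r'\<bar> <= B / et * \<bar>r - r'\<bar>"
    using r gG[of r] gG[of r'] by (simp flip: of_real_diff)
   also have "... <= C / (k * h) ^ 3 * \<bar>r - r'\<bar>" using CB(2) by (intro mult_right_mono) auto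
   finally show ?thesis .
  qed
  have 3: "\<bar>uk k x\<bar> <= C / (k * h) ^ 3"
  proof -
   have S0: "Sf ((0::real) *\<^sub>R axis i 1) x = x" by (simp add: Sf_def Tf_def vec_eq_iff)
   have "\<bar>uk k x\<bar> = norm (uk_ext k i x (of_real 0 + \<i> * of_real 0))"
    using uk_ext_real[OF k(1), of i x 0] unfolding S0 by simp
   also have "... <= C0 / (k * bd x) ^ 3" using ext[OF k x, of 0 i 0] \<theta> unfolding S0 by simp
   also have "... <= B"
   proof (rule bdB, rule bd_geI)
    fix d show "h / 8 <= x $ d \<and> h / 8 <= 1 - x $ d" using xh[rule_format, of d] h by auto
   qed
   finally show ?thesis using CB(1) by linarith
  qed
  show ?thesis using 1 2 3 unfolding G_def by blast
 qed
 show ?thesis by (rule exI[of _ C], rule exI[of _ m], rule conjI[OF C], intro allI impI, rule main) assumption+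
qed

text \<open>The discrete function is the cut-off times the interpolant of \<open>uk h1\<close>. The
  power 7 counts (k h)^3 with k = h = h1, hence six powers, and one inverse cell length for the
  Lipschitz constant; the power 1 - s is the interpolation in
  \<open>gagliardo_Lipschitz\<close>.\<close>

lemma mesh_approx:
 assumes sg: "0 < sg" "sg < 1"
 shows "\<exists>C m. 0 < C \<and> (\<forall>L p n. 1 <= p --> p < L --> sg ^ (p - 1) < 1/2 --> 1 <= n -->
   (\<exists>v\<in>Sq0 sg L (n + 1). enorm s (%x. u x - v x) <= C * (sqrt (sg ^ p) + (4 * real n + 13) ^ 5 / (sg ^ p) ^ 7 * ((1/2) ^ (n div 2 ^ m)) powr (1 - s))))"
proof -
 have sg1: "1 <= 1 / sg" using sg by simp
 obtain C1 m where CM: "0 < C1 \<and> (\<forall>k h n x i a b. 0 < k --> k <= 1/2 --> 0 < h --> h <= a --> a < b --> b <= 1 - h --> b - a <= 1 / sg * a --> b - a <= 1 / sg * (1 - b) -->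
   (\<forall>d. h <= x $ d \<and> x $ d <= 1 - h) -->
   (\<exists>p. degree p <= n \<and> (\<forall>r\<in>{0..1}. \<bar>uk k (upd x i (a + (b - a) * r)) - poly p r\<bar> <= C1 / (k * h) ^ 3 * (1/2) ^ (n div 2 ^ m)))
   \<and> (\<forall>r\<in>{0..1}. \<forall>r'\<in>{0..1}. \<bar>uk k (upd x i (a + (b - a) * r)) - uk k (upd x i (a + (b - a) * r'))\<bar> <= C1 / (k * h) ^ 3 * \<bar>r - r'\<bar>)
   \<and> \<bar>uk k x\<bar> <= C1 / (k * h) ^ 3)"
  using uk_line[OF sg1] by (elim exE)
 note C1 = conjunct1[OF CM] and line = conjunct2[OF CM, rule_format]
 obtain C2 where C2: "0 < C2" and bl: "!!h. 0 < h ==> h < 1/4 ==> \<exists>uh\<in>Htilde s Omega. (\<forall>x. bd x < h --> uh x = 0) \<and> enorm s (%x. u x - uh x) <= C2 * sqrt h"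
  using boundary_layer by blast
 obtain C3 where C3: "0 < C3" and uka: "!!k. 0 < k ==> k <= 1 ==> uk k \<in> Htilde s Omega \<and> enorm s (%x. uk k x - u x) <= C3 * k"
  using uk_approx by blast
 define \<kappa> where "\<kappa> = enn2real (kern_const s)"
 have kc: "kern_const s = ennreal \<kappa>" using kern_const_finite[OF s] by (simp add: \<kappa>_def)
 have \<kappa>0: "0 <= \<kappa>" by (simp add: \<kappa>_def)
 define c where "c = 6 / (1 - sg)"
 have c1: "1 <= c" using sg by (simp add: c_def)
 define D where "D = sqrt (2 + 8 * (c\<^sup>2 / hardy_const s) * \<kappa>)"
 have D0: "0 <= D"
  unfolding D_def using \<kappa>0 hardy_const_pos[of s] s by (intro real_sqrt_ge_zero add_nonneg_nonneg mult_nonneg_nonneg divide_nonneg_nonneg) auto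
 \<comment> \<open>1920 = 15 * 2^7: the 15 of \<open>M\<close> below and the seven halves in h1 =
   sg^p / 2.\<close>
 define Q where "Q = 1920 * C1 / (1 - sg)"
 have Q0: "0 < Q" using C1 sg by (simp add: Q_def)
 define C where "C = D * C2 / sqrt sg + D * C3 + sqrt (8 * \<kappa>) * Q + 1"
 have "0 <= D * C2 / sqrt sg" "0 <= D * C3" "0 <= sqrt (8 * \<kappa>) * Q"
  using D0 C2 C3 \<kappa>0 Q0 sg by auto
 then have C: "0 < C" by (simp add: C_def)
 have "\<exists>v\<in>Sq0 sg L (n + 1). enorm s (%x. u x - v x) <= C * (sqrt (sg ^ p) + (4 * real n + 13) ^ 5 / (sg ^ p) ^ 7 * ((1/2) ^ (n div 2 ^ m)) powr (1 - s))"
  if p: "1 <= p" "p < L" and small: "sg ^ (p - 1) < 1/2" and n: "1 <= n" for L p n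
 proof -
  have L: "1 <= L" using p by simp
  define h1 h2 where "h1 = sg ^ p / 2" and "h2 = sg ^ (p - 1) / 2"
  have pp: "sg ^ p = sg * sg ^ (p - 1)" using p by (cases p) auto
  have h12: "h1 = sg * h2" by (simp add: h1_def h2_def pp)
  have h0: "0 < h1" "0 < h2" "h2 < 1/4" using sg small by (simp_all add: h1_def h2_def)
  have hlt: "h1 < h2" using h12 h0 sg by simp
  have hle: "h1 <= 1/2" using hlt h0 by simp
  define gp where "gp = (1 - sg) * h1"
  have gp: "0 < gp" "gp <= 1" "gp <= h2 - h1"
  proof -
   show "0 < gp" using sg h0 by (simp add: gp_def)
   have "(1 - sg) * h1 <= 1 * 1" using sg h0 hle by (intro mult_mono) auto
   then show "gp <= 1" by (simp add: gp_def)
   have "(1 - sg) * h1 <= (1 - sg) * h2" using sg hlt by (intro mult_left_mono) auto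
   then show "gp <= h2 - h1" by (simp add: gp_def h12 algebra_simps)
  qed
  \<comment> \<open>The mollification width equals the cut-off distance h1: its error of order h1 is
    dominated by the layer error of order sqrt h1.\<close>
  define F where "F = uk h1"
  define B where "B = C1 / (h1 * h1) ^ 3"
  define \<delta> :: real where "\<delta> = (1/2) ^ (n div 2 ^ m)"
  have \<delta>: "0 < \<delta>" "\<delta> <= 1" by (simp_all add: \<delta>_def power_le_one)
  have B: "0 < B" using C1 h0 by (simp add: B_def)
  define K where "K = 4 * real n + 13"
  have K1: "1 <= K" by (simp add: K_def)
  define P where "P = pp3 sg L n F"
  have inner: "h1 <= geo_node sg L (idx i)" "geo_node sg L (Suc (idx i)) <= 1 - h1" "gp <= geo_node sg L (Suc (idx i)) - geo_node sg L (idx i)"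
    "geo_node sg L (Suc (idx i)) - geo_node sg L (idx i) <= 1 / sg * geo_node sg L (idx i)" "geo_node sg L (Suc (idx i)) - geo_node sg L (idx i) <= 1 / sg * (1 - geo_node sg L (Suc (idx i)))"
   if "\<forall>d. L - p <= idx d \<and> idx d < L + p" for idx :: "3 => nat" and i
   using inner_cell[OF sg p, of "idx i"] that unfolding h1_def gp_def by auto
  have idxn: "\<forall>d. idx d < 2 * L + 1" if "\<forall>d. L - p <= idx d \<and> idx d < L + p" for idx :: "3 => nat"
   using that p by (auto intro: less_trans)
  have coord: "\<forall>d. h1 <= x $ d \<and> x $ d <= 1 - h1" if "\<forall>d. L - p <= idx d \<and> idx d < L + p" "x \<in> geo_cell sg L idx" for idx and x :: R3
   using inner(1,2)[OF that(1)] that(2) unfolding geo_cell_def by (auto intro: order_trans)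
  have line': "(\<exists>p. degree p <= n \<and> (\<forall>r\<in>{0..1}. \<bar>F (upd x i (geo_node sg L (idx i) + (geo_node sg L (Suc (idx i)) - geo_node sg L (idx i)) * r)) - poly p r\<bar> <= B * \<delta>))
    \<and> (\<forall>r\<in>{0..1}. \<forall>r'\<in>{0..1}. \<bar>F (upd x i (geo_node sg L (idx i) + (geo_node sg L (Suc (idx i)) - geo_node sg L (idx i)) * r))
      - F (upd x i (geo_node sg L (idx i) + (geo_node sg L (Suc (idx i)) - geo_node sg L (idx i)) * r'))\<bar> <= B * \<bar>r - r'\<bar>)
    \<and> \<bar>F x\<bar> <= B"
   if idx: "\<forall>d. L - p <= idx d \<and> idx d < L + p" and x: "x \<in> geo_cell sg L idx" for idx x i
   unfolding F_def B_def \<delta>_def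
  proof (rule line[OF h0(1) hle h0(1) inner(1)[OF idx] _ inner(2)[OF idx] inner(4,5)[OF idx]])
   show "geo_node sg L (idx i) < geo_node sg L (Suc (idx i))" using inner(3)[OF idx, of i] gp(1) by linarith
  qed (use coord[OF idx x] in blast)
  have FB: "\<bar>F x\<bar> <= B" if "\<forall>d. L - p <= idx d \<and> idx d < L + p" "x \<in> geo_cell sg L idx" for idx x
   using line'[OF that, of 1] by blast
  have FL: "\<bar>F x - F (upd x i t)\<bar> <= B / gp * \<bar>x $ i - t\<bar>"
   if idx: "\<forall>d. L - p <= idx d \<and> idx d < L + p" and x: "x \<in> geo_cell sg L idx"
    and t: "geo_node sg L (idx i) <= t" "t <= geo_node sg L (Suc (idx i))" for idx x i t
  proof -
   define a g where "a = geo_node sg L (idx i)" and "g = geo_node sg L (Suc (idx i)) - geo_node sg L (idx i)"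
   have g: "0 < g" "gp <= g" using inner(3)[OF idx, of i] gp(1) by (simp_all add: g_def)
   have xi: "a <= x $ i" "x $ i - a <= g" using x by (simp_all add: geo_cell_def a_def g_def)
   have ti: "a <= t" "t - a <= g" using t by (simp_all add: a_def g_def)
   define r r' where "r = (x $ i - a) / g" and "r' = (t - a) / g"
   have rr: "r \<in> {0..1}" "r' \<in> {0..1}" using xi ti g by (simp_all add: r_def r'_def)
   have e: "a + g * r = x $ i" "a + g * r' = t" using g by (simp_all add: r_def r'_def)
   have "\<bar>F (upd x i (a + g * r)) - F (upd x i (a + g * r'))\<bar> <= B * \<bar>r - r'\<bar>"
    using line'[OF idx x, of i] rr unfolding a_def g_def by blast
   also have "r - r' = (x $ i - t) / g" by (simp add: r_def r'_def diff_divide_distrib)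
   also have "B * \<bar>(x $ i - t) / g\<bar> = B / g * \<bar>x $ i - t\<bar>" using g by simp
   also have "... <= B / gp * \<bar>x $ i - t\<bar>" using g gp B by (intro mult_right_mono frac_le) auto
   finally show ?thesis unfolding e by simp
  qed
  have FP: "\<bar>F x - P x\<bar> <= 3 * K ^ 3 * (B * \<delta>)" if idx: "\<forall>d. L - p <= idx d \<and> idx d < L + p" and x: "x \<in> geo_cell sg L idx" for idx x
   unfolding K_def P_def using B \<delta> line'[OF idx] by (intro pp3_error[OF sg L idxn[OF idx] x]) auto
  have PL: "\<bar>P x - P (upd x i t)\<bar> <= (4 * (real n)\<^sup>2 + 4) * K ^ 3 * B / gp * \<bar>x $ i - t\<bar>"
   if idx: "\<forall>d. L - p <= idx d \<and> idx d < L + p" and x: "x \<in> geo_cell sg L idx"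
    and t: "geo_node sg L (idx i) <= t" "t <= geo_node sg L (Suc (idx i))" for idx x i t
   unfolding K_def P_def by (rule pp3_Lipschitz[OF sg L idxn[OF idx] x FB[OF idx] gp(1) inner(3)[OF idx] t])
  define R1 A1 where "R1 = 3 * K ^ 3 * (B * \<delta>)" and "A1 = (4 * (real n)\<^sup>2 + 4) * K ^ 3 * B / gp + B / gp"
  have R10: "0 <= R1" using B \<delta> K1 by (simp add: R1_def)
  have A00: "0 <= (4 * (real n)\<^sup>2 + 4) * K ^ 3 * B / gp" using B gp K1 by (intro divide_nonneg_nonneg mult_nonneg_nonneg) auto
  have A10: "0 <= A1" using A00 B gp by (simp add: A1_def)
  let ?\<chi> = "cut3 h1 h2"
  define e where "e x = ?\<chi> x * (F x - P x)" for x
  define v where "v x = ?\<chi> x * P x" for x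
  have rl: "\<bar>(F x - P x) - (F (upd x i t) - P (upd x i t))\<bar> <= A1 * \<bar>x $ i - t\<bar>"
   if a: "\<forall>d. L - p <= idx d \<and> idx d < L + p" "x \<in> geo_cell sg L idx" "geo_node sg L (idx i) <= t" "t <= geo_node sg L (Suc (idx i))" for idx x i t
   using FL[OF a] PL[OF a] unfolding A1_def distrib_right by linarith
  note FPR = FP[folded R1_def]
  have eL: "\<bar>e x - e z\<bar> <= 3 * (R1 / (h2 - h1) + A1) * norm (x - z)" for x z unfolding e_def h1_def h2_def
   by (rule cut_product_Lipschitz(1)[where r = "%x. F x - P x", OF sg p R10 A10]) (erule (1) FPR, erule (3) rl)
  have eB: "\<bar>e x\<bar> <= R1" for x unfolding e_def h1_def h2_def
   by (rule cut_product_Lipschitz(2)[where r = "%x. F x - P x", OF sg p R10 A10]) (erule (1) FPR, erule (3) rl)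
  have e0: "e x = 0" if "x \<notin> Omega" for x unfolding e_def h1_def h2_def
   by (rule cut_product_Lipschitz(3)[where r = "%x. F x - P x", OF sg p R10 A10]) (erule (1) FPR, erule (3) rl, rule that)
  have PB: "\<bar>P x\<bar> <= B + R1" if "\<forall>d. L - p <= idx d \<and> idx d < L + p" "x \<in> geo_cell sg L idx" for idx x
   using FB[OF that] FP[OF that] unfolding R1_def by linarith
  have BR: "0 <= B + R1" using B R10 by simp
  have vL: "\<bar>v x - v z\<bar> <= 3 * ((B + R1) / (h2 - h1) + (4 * (real n)\<^sup>2 + 4) * K ^ 3 * B / gp) * norm (x - z)" for x z unfolding v_def h1_def h2_def
   by (rule cut_product_Lipschitz(1)[where r = "P", OF sg p BR A00]) (erule (1) PB, erule (3) PL)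
  have v0: "v x = 0" if "x \<notin> Omega" for x unfolding v_def h1_def h2_def
   by (rule cut_product_Lipschitz(3)[where r = "P", OF sg p BR A00]) (erule (1) PB, erule (3) PL, rule that)
  have vS: "v \<in> Sq0 sg L (n + 1)"
   unfolding Sq0_def
  proof (intro CollectI conjI ballI allI impI)
   have "(3 * ((B + R1) / (h2 - h1) + (4 * (real n)\<^sup>2 + 4) * K ^ 3 * B / gp))-lipschitz_on (closure Omega) v"
    unfolding lipschitz_on_def using vL A00 BR hlt by (auto simp: dist_norm)
   then show "continuous_on (closure Omega) v" by (rule lipschitz_on_continuous_on)
   have "open Omega" by (simp add: Omega_box open_box)
   then show "v x = 0" if "x \<in> frontier Omega" for x using v0 that by (simp add: frontier_def interior_open)
   show "v x = 0" if "x \<notin> closure Omega" for x using v0 that closure_subset[of Omega] by blast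
   show "in_Qq (n + 1) (v \<circ> geo_map sg L idx)" if "\<forall>d. idx d < 2 * L + 1" for idx
    using cut_pp3_in_Qq[OF sg p that n, of F] unfolding v_def[abs_def] P_def h1_def h2_def .
  qed
  \<comment> \<open>One constant for two purposes: it is a Lipschitz bound of the interpolation
    error \<open>e\<close>, and times \<delta> it bounds \<open>e\<close> itself. 15 = 3 * (3 + 1 +
    1), and K^5 absorbs 4 n^2 + 4 <= K^2 times K^3.\<close>
  define M where "M = 15 * K ^ 5 * B / gp"
  have M0: "0 < M" using K1 B gp by (simp add: M_def)
  have K35: "K ^ 3 <= K ^ 5" using K1 by (intro power_increasing) auto
  have Mle: "3 * (R1 / (h2 - h1) + A1) <= M"
  proof -
   have "R1 / (h2 - h1) <= 3 * K ^ 5 * B / gp"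
   proof (rule frac_le)
    have "3 * K ^ 3 * (B * \<delta>) <= 3 * K ^ 5 * (B * 1)" using K35 B \<delta> K1 by (intro mult_mono) auto
    then show "R1 <= 3 * K ^ 5 * B" by (simp add: R1_def)
   qed (use gp B K1 in auto)
   moreover have "(4 * (real n)\<^sup>2 + 4) * K ^ 3 * B / gp <= K ^ 5 * B / gp"
   proof -
    have "4 * (real n)\<^sup>2 + 4 <= K\<^sup>2" by (simp add: K_def power2_eq_square algebra_simps)
    then have "(4 * (real n)\<^sup>2 + 4) * K ^ 3 <= K\<^sup>2 * K ^ 3" using K1 by (intro mult_right_mono) auto
    also have "K\<^sup>2 * K ^ 3 = K ^ 5" by (simp flip: power_add)
    finally show ?thesis using B gp by (intro divide_right_mono mult_right_mono) auto
   qed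
   moreover have "B / gp <= K ^ 5 * B / gp"
   proof -
    have "1 * B <= K ^ 5 * B" using K1 B by (intro mult_right_mono) auto
    then show ?thesis using gp by (intro divide_right_mono) auto
   qed
   moreover have e3: "3 * K ^ 5 * B / gp = 3 * (K ^ 5 * B / gp)" and eM: "M = 15 * (K ^ 5 * B / gp)" by (simp_all add: M_def)
   moreover have "3 * (r + (a + b)) <= 15 * y" if "r <= 3 * y" "a <= y" "b <= y" for r a b y :: real
    using add_mono[OF that(1) add_mono[OF that(2,3)]] by simp
   ultimately show ?thesis unfolding A1_def eM by (simp only: e3)
  qed
  have RS: "R1 <= M * \<delta>"
  proof -
   have "3 * K ^ 3 * B <= 15 * K ^ 5 * B" using K35 K1 B by (intro mult_right_mono mult_mono) auto
   also have "... <= M" using gp B K1 unfolding M_def by (simp add: le_divide_eq mult_left_le)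
   finally have "3 * K ^ 3 * B * \<delta> <= M * \<delta>" using \<delta> by (intro mult_right_mono) auto
   then show ?thesis by (simp add: R1_def mult.assoc)
  qed
  have eM: "\<bar>e x - e z\<bar> <= M * norm (x - z)" for x z
   using eL[of x z] mult_right_mono[OF Mle norm_ge_zero[of "x - z"]] by linarith
  have eS: "\<bar>e x\<bar> <= M * \<delta>" for x using eB[of x] RS by linarith
  have S0: "0 < M * \<delta>" using M0 \<delta> by simp
  have eout: "x \<notin> closure Omega ==> e x = 0" for x using e0 closure_subset[of Omega] by blast
  note eH = Lipschitz_Htilde[OF s eM M0 eout S0 eS]
  have en: "enorm s e <= sqrt (8 * \<kappa>) * M * \<delta> powr (1 - s)"
  proof (rule enorm_le[OF eH(1)])
   \<comment> \<open>With S = M \<delta> the handover length 2 S / M is 2 \<delta>; the exponent is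
     negative, so the 2 may be dropped.\<close>
   have "8 * (M * \<delta>)\<^sup>2 * (2 * (M * \<delta>) / M) powr (- 2 * s) <= 8 * M\<^sup>2 * (\<delta> powr (1 - s))\<^sup>2"
   proof -
    have "(2 * (M * \<delta>) / M) powr (- 2 * s) <= \<delta> powr (- 2 * s)"
     using M0 \<delta> s by (intro powr_mono2') auto
    then have "8 * (M * \<delta>)\<^sup>2 * (2 * (M * \<delta>) / M) powr (- 2 * s) <= 8 * (M * \<delta>)\<^sup>2 * \<delta> powr (- 2 * s)"
     by (intro mult_left_mono) auto
    also have "... = 8 * M\<^sup>2 * (\<delta>\<^sup>2 * \<delta> powr (- 2 * s))" by (simp add: power_mult_distrib)
    also have "\<delta>\<^sup>2 * \<delta> powr (- 2 * s) = (\<delta> powr (1 - s))\<^sup>2"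
    proof -
     have "\<delta>\<^sup>2 = \<delta> powr 2" using \<delta> by simp
     then have "\<delta>\<^sup>2 * \<delta> powr (- 2 * s) = \<delta> powr (2 + - 2 * s)" by (simp only: powr_add)
     also have "2 + - 2 * s = (1 - s) + (1 - s)" by simp
     also have "\<delta> powr ((1 - s) + (1 - s)) = (\<delta> powr (1 - s))\<^sup>2" by (simp only: powr_add power2_eq_square)
     finally show ?thesis .
    qed
    finally show ?thesis .
   qed
   then have "gagliardo_sq s UNIV e <= ennreal (8 * M\<^sup>2 * (\<delta> powr (1 - s))\<^sup>2) * ennreal \<kappa>"
    using eH(2) unfolding kc by (meson ennreal_leI mult_right_mono order_trans zero_le)
   also have "... = ennreal ((sqrt (8 * \<kappa>) * M * \<delta> powr (1 - s))\<^sup>2)"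
    using \<kappa>0 by (simp add: power_mult_distrib mult_ac flip: ennreal_mult)
   finally show "gagliardo_sq s UNIV e <= ennreal ((sqrt (8 * \<kappa>) * M * \<delta> powr (1 - s))\<^sup>2)" .
   show "0 <= sqrt (8 * \<kappa>) * M * \<delta> powr (1 - s)" using \<kappa>0 M0 by simp
  qed
  have MQ: "M = Q * (K ^ 5 / (sg ^ p) ^ 7)"
  proof -
   have e7: "(h1 * h1) ^ 3 * h1 = (sg ^ p) ^ 7 / 128" by (simp add: h1_def eval_nat_numeral)
   have "M = 15 * K ^ 5 * C1 / ((1 - sg) * ((h1 * h1) ^ 3 * h1))" by (simp add: M_def B_def gp_def mult_ac)
   also have "... = Q * (K ^ 5 / (sg ^ p) ^ 7)" unfolding e7 by (simp add: Q_def)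
   finally show ?thesis .
  qed
  obtain uh where uh: "uh \<in> Htilde s Omega" "!!x. bd x < h2 ==> uh x = 0" "enorm s (%x. u x - uh x) <= C2 * sqrt h2"
   using bl[OF h0(2,3)] by blast
  have k1: "h1 <= 1" using hle by simp
  note uk1 = uka[OF h0(1) k1, folded F_def]
  have \<chi>m: "?\<chi> \<in> borel_measurable borel"
  proof (rule Lipschitz_measurable)
   show "\<bar>?\<chi> x - ?\<chi> z\<bar> <= (3 / (h2 - h1)) * norm (x - z)" for x z using cut3_Lipschitz[OF hlt, of x z] by simp
  qed (use hlt in simp)
  have \<chi>c: "\<bar>?\<chi> x - ?\<chi> z\<bar> <= c * norm (x - z) / bd x" if "x \<in> Omega" for x z
   unfolding c_def by (rule cut3_multiplier[OF h0(1) h12 sg(2,1) that])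
  have H1: "(%x. u x - uh x) \<in> Htilde s Omega" by (rule Htilde_diff[OF s(1) u uh(1)])
  have H2: "(%x. u x - F x) \<in> Htilde s Omega" using uk1 by (intro Htilde_diff[OF s(1) u]) simp
  have ph: "(%x. 1 - ?\<chi> x) \<in> borel_measurable borel" "!!x. \<bar>1 - ?\<chi> x\<bar> <= 1" "!!x. \<bar>?\<chi> x\<bar> <= 1"
   "!!x z. x \<in> Omega ==> \<bar>(1 - ?\<chi> x) - (1 - ?\<chi> z)\<bar> <= c * norm (x - z) / bd x"
   using \<chi>m cut3_in[of h1 h2] \<chi>c by (simp_all add: abs_minus_commute abs_le_iff)
  note m1 = multiplier_enorm[OF s H1 ph(1,2,4) c1]
  note m2 = multiplier_enorm[OF s H2 \<chi>m ph(3) \<chi>c c1]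
  have m1D: "enorm s (%x. (1 - ?\<chi> x) * (u x - uh x)) <= D * enorm s (%x. u x - uh x)"
   and m2D: "enorm s (%x. ?\<chi> x * (u x - F x)) <= D * enorm s (%x. u x - F x)"
   using m1(2) m2(2) unfolding D_def \<kappa>_def by simp_all
  \<comment> \<open>The term with \<open>uh\<close> disappears: \<open>uh\<close> vanishes where
    \<open>bd x < h2\<close>, and elsewhere the cut-off is 1. The layer error is thus charged to u -
    uh, the interior error to u - F and to the interpolation error.\<close>
  have dec: "u x - v x = ((1 - ?\<chi> x) * (u x - uh x) + ?\<chi> x * (u x - F x)) + e x" for x
  proof -
   have "(1 - ?\<chi> x) * uh x = 0" using uh(2)[of x] cut3_eq_1[OF hlt, of x] by (cases "bd x < h2") auto
   then show ?thesis by (simp add: v_def e_def algebra_simps)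
  qed
  have "enorm s (%x. u x - v x) <= enorm s (%x. (1 - ?\<chi> x) * (u x - uh x) + ?\<chi> x * (u x - F x)) + enorm s e"
   unfolding dec by (rule enorm_triangle[OF s(1) Htilde_add[OF s(1) m1(1) m2(1)] eH(1)])
  moreover have "enorm s (%x. (1 - ?\<chi> x) * (u x - uh x) + ?\<chi> x * (u x - F x)) <= enorm s (%x. (1 - ?\<chi> x) * (u x - uh x)) + enorm s (%x. ?\<chi> x * (u x - F x))"
   by (rule enorm_triangle[OF s(1) m1(1) m2(1)])
  moreover have "enorm s (%x. (1 - ?\<chi> x) * (u x - uh x)) <= D * C2 / sqrt sg * sqrt (sg ^ p)"
  proof -
   have "D * enorm s (%x. u x - uh x) <= D * (C2 * sqrt h2)" using uh(3) D0 by (intro mult_left_mono)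
   also have "sqrt h2 <= sqrt (sg ^ p / sg)" using sg by (simp add: h2_def pp)
   then have "D * (C2 * sqrt h2) <= D * (C2 * sqrt (sg ^ p / sg))" using D0 C2 by (intro mult_left_mono) auto
   finally have "enorm s (%x. (1 - ?\<chi> x) * (u x - uh x)) <= D * (C2 * sqrt (sg ^ p / sg))" by (rule order_trans[OF m1D])
   then show ?thesis by (simp add: real_sqrt_divide mult.assoc)
  qed
  moreover have "enorm s (%x. ?\<chi> x * (u x - F x)) <= D * C3 * sqrt (sg ^ p)"
  proof -
   have "enorm s (%x. u x - F x) <= C3 * h1" using uk1 enorm_minus_commute[of s u F] by simp
   also have "h1 <= sqrt (sg ^ p)"
   proof -
    have y: "0 <= sg ^ p" "sg ^ p <= 1" using sg by (simp_all add: power_le_one)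
    have "(sg ^ p)\<^sup>2 <= sg ^ p" using y by (simp add: power2_eq_square mult_left_le)
    then have "sg ^ p <= sqrt (sg ^ p)" by (rule real_le_rsqrt)
    then show ?thesis using y by (simp add: h1_def)
   qed
   then have "C3 * h1 <= C3 * sqrt (sg ^ p)" using C3 by (intro mult_left_mono) auto
   finally have "D * enorm s (%x. u x - F x) <= D * (C3 * sqrt (sg ^ p))" using D0 by (intro mult_left_mono) auto
   then show ?thesis unfolding mult.assoc by (rule order_trans[OF m2D])
  qed
  moreover have "enorm s e <= sqrt (8 * \<kappa>) * Q * (K ^ 5 / (sg ^ p) ^ 7 * \<delta> powr (1 - s))"
   using en unfolding MQ by (simp add: mult_ac)
  ultimately have "enorm s (%x. u x - v x) <= (D * C2 / sqrt sg + D * C3) * sqrt (sg ^ p) + sqrt (8 * \<kappa>) * Q * (K ^ 5 / (sg ^ p) ^ 7 * \<delta> powr (1 - s))"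
   unfolding distrib_right by linarith
  also have "... <= C * sqrt (sg ^ p) + C * (K ^ 5 / (sg ^ p) ^ 7 * \<delta> powr (1 - s))"
  proof (intro add_mono mult_right_mono)
   show "D * C2 / sqrt sg + D * C3 <= C" "sqrt (8 * \<kappa>) * Q <= C"
    using \<open>0 <= D * C2 / sqrt sg\<close> \<open>0 <= D * C3\<close> \<open>0 <= sqrt (8 * \<kappa>) * Q\<close> unfolding C_def by simp_all
  qed (use sg K1 in auto)
  finally show ?thesis using vS unfolding K_def \<delta>_def distrib_left[symmetric] by blast
 qed
 then show ?thesis using C by blast
qed

text \<open>Choice of p as a fixed small fraction of L. Interpolation decays like exp (- \<beta> L);
  the algebraic factors may consume half of \<beta>, and the layer error sqrt (sg^p) is exponential
  in L because p is proportional to L.\<close>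

lemma mesh_exponential:
 assumes sg: "0 < sg" "sg < 1" and c: "0 < c1" "c1 <= c2"
 shows "\<exists>b C. 0 < b \<and> 0 < C \<and> (\<forall>L q. 1 <= L --> c1 * real L <= real q --> real q <= c2 * real L -->
   (\<exists>v\<in>Sq0 sg L q. enorm s (%x. u x - v x) <= C * exp (- b * real L)))"
proof -
 obtain C0 m where CM: "0 < C0 \<and> (\<forall>L p n. 1 <= p --> p < L --> sg ^ (p - 1) < 1/2 --> 1 <= n -->
   (\<exists>v\<in>Sq0 sg L (n + 1). enorm s (%x. u x - v x) <= C0 * (sqrt (sg ^ p) + (4 * real n + 13) ^ 5 / (sg ^ p) ^ 7 * ((1/2) ^ (n div 2 ^ m)) powr (1 - s))))"
  using mesh_approx[OF sg] by (elim exE)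
 note C0 = conjunct1[OF CM] and mesh = conjunct2[OF CM, rule_format]
 define \<omega> where "\<omega> = - ln sg"
 have \<omega>: "0 < \<omega>" using sg by (simp add: \<omega>_def)
 have sge: "sg ^ j = exp (- \<omega> * real j)" for j
  using sg by (simp add: \<omega>_def exp_of_nat2_mult)
 define D where "D = real (2 ^ m)"
 have D: "1 <= D" by (simp add: D_def)
 define \<gamma> where "\<gamma> = ln 2 * (1 - s)"
 have \<gamma>: "0 < \<gamma>" using s by (simp add: \<gamma>_def)
 define \<beta> where "\<beta> = \<gamma> * c1 / D"
 have \<beta>: "0 < \<beta>" using \<gamma> c D by (simp add: \<beta>_def)
 \<comment> \<open>The bound 1/2 gives p < L; the other makes the loss (sg^p)^(-7) at most exp
   (\<beta> L / 4).\<close>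
 define \<tau> where "\<tau> = min (1/2) (\<beta> / (28 * \<omega>))"
 have \<tau>: "0 < \<tau>" "\<tau> <= 1/2" "7 * \<omega> * \<tau> <= \<beta> / 4"
 proof -
  show "0 < \<tau>" "\<tau> <= 1/2" using \<beta> \<omega> by (simp_all add: \<tau>_def)
  have "7 * \<omega> * \<tau> <= 7 * \<omega> * (\<beta> / (28 * \<omega>))" using \<omega> by (intro mult_left_mono) (auto simp: \<tau>_def)
  also have "... = \<beta> / 4" using \<omega> by simp
  finally show "7 * \<omega> * \<tau> <= \<beta> / 4" .
 qed
 \<comment> \<open>The fifth power of the polynomial factor then costs exp (5 \<epsilon> L) = exp
   (\<beta> L / 4), the second quarter.\<close>
 define \<epsilon> where "\<epsilon> = \<beta> / 20"
 have \<epsilon>: "0 < \<epsilon>" using \<beta> by (simp add: \<epsilon>_def)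
 define A where "A = 4 * c2 / \<epsilon> + 13"
 have A: "0 < A" using c \<epsilon> by (simp add: A_def add_nonneg_pos)
 define b where "b = min (\<beta> / 2) (\<omega> * \<tau> / 2)"
 have b: "0 < b" "b <= \<beta> / 2" "b <= \<omega> * \<tau> / 2" using \<beta> \<omega> \<tau> by (simp_all add: b_def)
 define C' where "C' = C0 * (exp (\<omega> / 2) + A ^ 5 * exp (2 * \<gamma>))"
 obtain j0 where j0: "sg ^ j0 < 1/2" using real_arch_pow_inv[of "1/2" sg] sg by auto
 \<comment> \<open>Beyond L0 rounding leaves p >= j0 + 1, so the ramp is narrow enough, and q >= 2,
   so n = q - 1 >= 1. Smaller L are served by the zero function at the price of a larger
   constant.\<close>
 define L0 where "L0 = max ((real j0 + 2) / \<tau>) (2 / c1)"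
 define C where "C = C' + (enorm s u + 1) * exp (b * L0)"
 have C': "0 <= C'" using C0 A by (simp add: C'_def)
 have C2: "0 < (enorm s u + 1) * exp (b * L0)" by (intro mult_pos_pos add_nonneg_pos enorm_nonneg) auto
 have C: "0 < C" "C' <= C" "(enorm s u + 1) * exp (b * L0) <= C" using C' C2 by (simp_all add: C_def)
 have "\<exists>v\<in>Sq0 sg L q. enorm s (%x. u x - v x) <= C * exp (- b * real L)"
  if L: "1 <= L" and q: "c1 * real L <= real q" "real q <= c2 * real L" for L q
 proof (cases "real L < L0")
  case True
  have z: "(%x. 0) \<in> Sq0 sg L q" by (auto simp: Sq0_def o_def in_Qq_zero)
  have "enorm s u <= (enorm s u + 1) * exp (b * L0 - b * real L)"
  proof -
   have "0 <= b * L0 - b * real L" using True b(1) by simp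
   then have "1 <= exp (b * L0 - b * real L)" by simp
   then have "enorm s u * 1 <= (enorm s u + 1) * exp (b * L0 - b * real L)" using enorm_nonneg[of s u] by (intro mult_mono) auto
   then show ?thesis by simp
  qed
  also have "... = (enorm s u + 1) * exp (b * L0) * exp (- b * real L)" by (simp add: exp_diff exp_minus divide_inverse)
  also have "... <= C * exp (- b * real L)" using C by (intro mult_right_mono) auto
  finally show ?thesis using z by (intro bexI[of _ "%x. 0"]) auto
 next
  case False
  then have LL: "real j0 + 2 <= \<tau> * real L" "2 <= c1 * real L" using \<tau> c by (simp_all add: L0_def pos_divide_le_eq mult.commute not_less)
  define p where "p = nat \<lfloor>\<tau> * real L\<rfloor>"
  have \<tau>L: "0 <= \<tau> * real L" using \<tau> by simp
  have p: "real p <= \<tau> * real L" "\<tau> * real L - 1 < real p"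
   using \<tau>L unfolding p_def by linarith+
  have p1: "j0 + 1 <= p" using p LL(1) by linarith
  have "\<tau> * real L < 1 * real L" using \<tau> L by (intro mult_strict_right_mono) auto
  then have pL: "p < L" using p by linarith
  have "sg ^ (p - 1) <= sg ^ j0" using p1 sg by (intro power_decreasing) auto
  then have small: "sg ^ (p - 1) < 1/2" using j0 by linarith
  have q2: "2 <= q" using q LL(2) by linarith
  \<comment> \<open>The cut-off takes one degree, which leaves q - 1 for the interpolant.\<close>
  define n where "n = q - 1"
  have n: "1 <= n" "n + 1 = q" "real n = real q - 1" using q2 by (simp_all add: n_def of_nat_diff)
  obtain v where v: "v \<in> Sq0 sg L q" "enorm s (%x. u x - v x) <= C0 * (sqrt (sg ^ p) + (4 * real n + 13) ^ 5 / (sg ^ p) ^ 7 * ((1/2) ^ (n div 2 ^ m)) powr (1 - s))"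
   using mesh[OF _ pL small n(1)] p1 unfolding n(2) by auto
  have 1: "sqrt (sg ^ p) <= exp (\<omega> / 2) * exp (- b * real L)"
  proof -
   have "sqrt (sg ^ p) = exp (- \<omega> * real p / 2)"
    unfolding sge by (rule real_sqrt_unique) (simp_all add: power2_eq_square flip: exp_add)
   also have "... <= exp (\<omega> / 2 + - b * real L)"
   proof -
    have "\<omega> * (\<tau> * real L - 1) <= \<omega> * real p" using p \<omega> by (intro mult_left_mono) auto
    moreover have "b * real L <= \<omega> * \<tau> / 2 * real L" using b by (intro mult_right_mono) auto
    ultimately show ?thesis by (simp add: algebra_simps)
   qed
   finally show ?thesis by (simp only: exp_add)
  qed
  have 2: "(4 * real n + 13) ^ 5 <= A ^ 5 * exp (\<beta> / 4 * real L)"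
  proof -
   have "1 + \<epsilon> * real L <= exp (\<epsilon> * real L)" by (rule exp_ge_add_one_self)
   moreover have "0 <= \<epsilon> * real L" using \<epsilon> by simp
   ultimately have e1: "\<epsilon> * real L <= exp (\<epsilon> * real L)" "1 <= exp (\<epsilon> * real L)" by linarith+
   have "4 * real n + 13 <= 4 * c2 * real L + 13" using n(3) q(2) by simp
   also have "4 * c2 * real L = 4 * c2 / \<epsilon> * (\<epsilon> * real L)" using \<epsilon> by simp
   also have "... + 13 <= 4 * c2 / \<epsilon> * exp (\<epsilon> * real L) + 13 * exp (\<epsilon> * real L)"
    using e1 c \<epsilon> by (intro add_mono mult_left_mono) auto
   also have "... = A * exp (\<epsilon> * real L)" by (simp add: A_def distrib_right)
   finally have "(4 * real n + 13) ^ 5 <= (A * exp (\<epsilon> * real L)) ^ 5" by (intro power_mono) auto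
   also have "... = A ^ 5 * exp (5 * (\<epsilon> * real L))" by (simp add: power_mult_distrib flip: exp_of_nat_mult)
   also have "5 * (\<epsilon> * real L) = \<beta> / 4 * real L" by (simp add: \<epsilon>_def)
   finally show ?thesis .
  qed
  have 3: "1 / (sg ^ p) ^ 7 <= exp (\<beta> / 4 * real L)"
  proof -
   have "1 / (sg ^ p) ^ 7 = exp (7 * \<omega> * real p)"
    unfolding sge by (simp add: exp_minus power_inverse field_simps flip: exp_of_nat_mult)
   also have "... <= exp (\<beta> / 4 * real L)"
   proof -
    have "7 * \<omega> * real p <= 7 * \<omega> * (\<tau> * real L)" using p \<omega> by (intro mult_left_mono) auto
    also have "... = (7 * \<omega> * \<tau>) * real L" by simp
    also have "... <= \<beta> / 4 * real L" using \<tau>(3) by (intro mult_right_mono) auto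
    finally show ?thesis by simp
   qed
   finally show ?thesis .
  qed
  have 4: "((1/2) ^ (n div 2 ^ m)) powr (1 - s) <= exp (2 * \<gamma>) * exp (- \<beta> * real L)"
  proof -
   define d where "d = real (n div 2 ^ m)"
   have nd: "real n < D * (d + 1)"
   proof -
    have "2 ^ m * (n div 2 ^ m) + n mod 2 ^ m = n" by (rule mult_div_mod_eq)
    moreover have "n mod 2 ^ m < 2 ^ m" by simp
    ultimately have "n < 2 ^ m * (n div 2 ^ m) + 2 ^ m" by linarith
    then have "real n < real (2 ^ m * (n div 2 ^ m) + 2 ^ m)" by (simp only: of_nat_less_iff)
    then show ?thesis by (simp add: D_def d_def algebra_simps)
   qed
   have "((1/2::real) ^ (n div 2 ^ m)) = exp (- ln 2 * d)"
    unfolding d_def by (simp add: exp_minus power_inverse power_one_over inverse_eq_divide exp_of_nat2_mult)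
   then have "((1/2) ^ (n div 2 ^ m)) powr (1 - s) = exp (- \<gamma> * d)"
    by (simp add: powr_def \<gamma>_def)
   also have "... <= exp (2 * \<gamma> + - \<beta> * real L)"
   proof -
    have "c1 * real L - 1 <= D * (d + 1)" using nd q(1) n(3) by linarith
    then have "c1 * real L / D - 1 / D <= d + 1" using D by (simp add: diff_divide_distrib[symmetric] pos_divide_le_eq mult.commute)
    moreover have "1 / D <= 1" using D by simp
    \<comment> \<open>One unit is lost to n = q - 1, the other to integer division by 2^m.\<close>
    ultimately have "c1 * real L / D - 2 <= d" by linarith
    then have "\<gamma> * (c1 * real L / D - 2) <= \<gamma> * d" using \<gamma> by (intro mult_left_mono) auto
    then show ?thesis by (simp add: \<beta>_def algebra_simps)
   qed
   finally show ?thesis by (simp only: exp_add)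
  qed
  have "(4 * real n + 13) ^ 5 / (sg ^ p) ^ 7 * ((1/2) ^ (n div 2 ^ m)) powr (1 - s)
    = (4 * real n + 13) ^ 5 * (1 / (sg ^ p) ^ 7) * ((1/2) ^ (n div 2 ^ m)) powr (1 - s)" by simp
  also have "... <= (A ^ 5 * exp (\<beta> / 4 * real L)) * exp (\<beta> / 4 * real L) * (exp (2 * \<gamma>) * exp (- \<beta> * real L))"
   using A sg by (intro mult_mono 2 3 4) auto
  also have "... = A ^ 5 * exp (2 * \<gamma>) * exp (- (\<beta> / 2) * real L)"
  proof -
   have e: "exp (\<beta> / 4 * real L) * exp (\<beta> / 4 * real L) * exp (- \<beta> * real L) = exp (- (\<beta> / 2) * real L)"
    unfolding exp_add[symmetric] by (simp add: algebra_simps)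
   have "(a * y) * y * (r * z) = a * r * (y * y * z)" for a y r z :: real by (simp only: mult_ac)
   then show ?thesis by (simp only: e)
  qed
  also have "... <= A ^ 5 * exp (2 * \<gamma>) * exp (- b * real L)"
  proof -
   have "- (\<beta> / 2) * real L <= - b * real L" using b by (intro mult_right_mono) auto
   then show ?thesis using A by (intro mult_left_mono) auto
  qed
  finally have 5: "(4 * real n + 13) ^ 5 / (sg ^ p) ^ 7 * ((1/2) ^ (n div 2 ^ m)) powr (1 - s) <= A ^ 5 * exp (2 * \<gamma>) * exp (- b * real L)" .
  have "enorm s (%x. u x - v x) <= C0 * (exp (\<omega> / 2) * exp (- b * real L) + A ^ 5 * exp (2 * \<gamma>) * exp (- b * real L))"
   using C0 by (intro order_trans[OF v(2)] mult_left_mono add_mono 1 5) auto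
  also have "... = C' * exp (- b * real L)" by (simp add: C'_def algebra_simps)
  also have "... <= C * exp (- b * real L)" using C by (intro mult_right_mono) auto
  finally show ?thesis using v(1) by blast
 qed
 then show ?thesis using b(1) C(1) by blast
qed

end

section \<open>From decay in L to decay in the dimension\<close>

text \<open>Each coordinate contributes about L cells times q + 1 degrees, two powers of L; the
  three coordinates give the sixth power.\<close>

lemma root_fun_dim_Sq0:
 assumes sg: "0 < sg" "sg < 1" and L: "1 <= L" and q: "real q <= c2 * real L" and c2: "0 < c2"
 shows "root 6 (real (fun_dim (Sq0 sg L q))) <= 3 * (c2 + 1) * real L"
proof -
 have "real (fun_dim (Sq0 sg L q)) <= real (((2 * L + 1) * (q + 1)) ^ 3)" using fun_dim_Sq0[OF sg L] by (simp only: of_nat_le_iff)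
 also have "... = ((2 * real L + 1) * (real q + 1)) ^ 3"
  by (simp only: of_nat_mult of_nat_add of_nat_power of_nat_1 of_nat_numeral)
 also have "... <= ((3 * real L) * ((c2 + 1) * real L)) ^ 3"
  using L q by (intro power_mono mult_mono) (auto simp: distrib_right)
 also have "... <= ((3 * (c2 + 1) * real L)\<^sup>2) ^ 3"
 proof (rule power_mono)
  have "1 * (c2 + 1) <= 3 * (c2 + 1) * (c2 + 1)" using c2 by (intro mult_right_mono) auto
  then have "(3 * (real L * real L)) * (c2 + 1) <= (3 * (real L * real L)) * (3 * (c2 + 1) * (c2 + 1))" by (intro mult_left_mono) auto
  then show "(3 * real L) * ((c2 + 1) * real L) <= (3 * (c2 + 1) * real L)\<^sup>2" by (simp only: power2_eq_square mult_ac)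
 qed (use c2 in auto)
 also have "... = (3 * (c2 + 1) * real L) ^ 6" by (simp flip: power_mult)
 finally have "root 6 (real (fun_dim (Sq0 sg L q))) <= root 6 ((3 * (c2 + 1) * real L) ^ 6)" by (intro real_root_le_mono) auto
 also have "... = 3 * (c2 + 1) * real L" using c2 by (intro real_root_power_cancel) auto
 finally show ?thesis .
qed

theorem theorem1p1:
  fixes s \<sigma> c1 c2 :: real and f u :: "R3 \<Rightarrow> real"
  assumes s: "0 < s" "s < 1"
    and \<sigma>: "0 < \<sigma>" "\<sigma> < 1"
    and c: "0 < c1" "c1 \<le> c2"
    and f: "analytic_on_closure f Omega"
    and u: "u \<in> Htilde s Omega"
    and weak: "\<forall>v \<in> Htilde s Omega. bform s u v = L2_inner Omega f v"
  shows "\<exists>b C. b > 0 \<and> C > 0 \<and>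
    (\<forall>(L::nat) (q::nat) uN.
       L \<ge> 1 \<longrightarrow> c1 * real L \<le> real q \<longrightarrow> real q \<le> c2 * real L \<longrightarrow>
       uN \<in> Sq0 \<sigma> L q \<longrightarrow>
       (\<forall>v \<in> Sq0 \<sigma> L q. bform s uN v = L2_inner Omega f v) \<longrightarrow>
       Htilde_norm_sq s Omega (\<lambda>x. u x - uN x)
         \<le> ennreal ((C * exp (- b * root 6 (real (fun_dim (Sq0 \<sigma> L q)))))\<^sup>2))"
proof -
 interpret fractional_solution s f u using s f u weak by unfold_locales auto
 obtain b C where bC: "0 < b" "0 < C" and ap: "\<forall>L q. 1 <= L --> c1 * real L <= real q --> real q <= c2 * real L -->
   (\<exists>v\<in>Sq0 \<sigma> L q. enorm s (%x. u x - v x) <= C * exp (- b * real L))"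
  using mesh_exponential[OF \<sigma> c] by (elim exE conjE)
 have c2: "0 < c2" using c by simp
 define K where "K = 3 * (c2 + 1)"
 have K: "0 < K" using c2 by (simp add: K_def)
 define H where "H = sqrt (1 + 2 / hardy_const s)"
 have h1: "0 < 1 + 2 / hardy_const s" using hardy_const_pos[of s] s by (simp add: add_pos_nonneg)
 have H: "0 < H" using h1 by (simp add: H_def)
 show ?thesis
 \<comment> \<open>The rate is divided by K, the ratio of the sixth root of N to L; H is the square
   root of the constant comparing the norm with the seminorm.\<close>
 proof (rule exI[of _ "b / K"], rule exI[of _ "H * C"], intro conjI allI impI)
  show "0 < b / K" "0 < H * C" using bC K H by simp_all
  fix L q uN
  assume L: "1 <= L" and q: "c1 * real L <= real q" "real q <= c2 * real L" and uN: "uN \<in> Sq0 \<sigma> L q"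
   and gal: "\<forall>v \<in> Sq0 \<sigma> L q. bform s uN v = L2_inner Omega f v"
  obtain v where v: "v \<in> Sq0 \<sigma> L q" "enorm s (%x. u x - v x) <= C * exp (- b * real L)" using ap L q by blast
  have uNH: "uN \<in> Htilde s Omega" and vH: "v \<in> Htilde s Omega" using Sq0_Htilde[OF s \<sigma> L] uN v by blast+
  have dS: "(%x. v x - uN x) \<in> Sq0 \<sigma> L q" by (rule Sq0_diff[OF v(1) uN])
  have dH: "(%x. v x - uN x) \<in> Htilde s Omega" by (rule Sq0_Htilde[OF s \<sigma> L dS])
  \<comment> \<open>Galerkin orthogonality: v - uN is a discrete function and, by conformity, an
    admissible test function for the continuous problem.\<close>
  have "bform s u (%x. v x - uN x) = bform s uN (%x. v x - uN x)" using weak gal dS dH by simp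
  then have orth: "kform (kern2 s) u (%x. v x - uN x) = kform (kern2 s) uN (%x. v x - uN x)"
   unfolding bform_eq_kform[OF u dH] bform_eq_kform[OF uNH dH] using Cconst_pos[OF s] by simp
  define w where "w x = u x - uN x" for x
  have wH: "w \<in> Htilde s Omega" unfolding w_def by (rule Htilde_diff[OF s(1) u uNH])
  have root: "root 6 (real (fun_dim (Sq0 \<sigma> L q))) <= K * real L" unfolding K_def by (rule root_fun_dim_Sq0[OF \<sigma> L q(2) c2])
  have "enorm s w <= C * exp (- b * real L)"
   unfolding w_def using cea[OF s(1) u uNH vH orth] v(2) by linarith
  also have "... <= C * exp (- (b / K) * root 6 (real (fun_dim (Sq0 \<sigma> L q))))"
  proof -
   have "(b / K) * root 6 (real (fun_dim (Sq0 \<sigma> L q))) <= (b / K) * (K * real L)" using root bC K by (intro mult_left_mono) auto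
   also have "... = b * real L" using K by simp
   finally show ?thesis using bC by simp
  qed
  finally have en: "enorm s w <= C * exp (- (b / K) * root 6 (real (fun_dim (Sq0 \<sigma> L q))))" .
  have "Htilde_norm_sq s Omega w <= ennreal (1 + 2 / hardy_const s) * gagliardo_sq s UNIV w"
   using HtildeD[OF wH] s(1) by (intro Htilde_norm_le) auto
  also have "... = ennreal ((H * enorm s w)\<^sup>2)"
   unfolding gagliardo_eq_enorm[OF wH] using h1 by (simp add: H_def power_mult_distrib ennreal_mult'')
  also have "... <= ennreal ((H * C * exp (- (b / K) * root 6 (real (fun_dim (Sq0 \<sigma> L q)))))\<^sup>2)"
   unfolding mult.assoc[of H C] using H enorm_nonneg[of s w] by (intro ennreal_leI power_mono mult_left_mono en) auto
  finally show "Htilde_norm_sq s Omega (%x. u x - uN x) <= ennreal ((H * C * exp (- (b / K) * root 6 (real (fun_dim (Sq0 \<sigma> L q)))))\<^sup>2)"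
   unfolding w_def .
 qed
qed

end
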